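(* Let $k$ be a field of characteristic $0$, let $f\in k[X]\setminus k$ be a polynomial of odd degree with $\mathrm{Mon}_k(f)$ solvable, and let $g\in k(Y)\setminus k$ be a Siegel function of degree at least $2$. Then the curve $f(X)=g(Y)$ is reducible over $k$ if and only if $f=h\circ f_1$ and $g=h\circ g_1$ for some $h,f_1\in k[X]$ and $g_1\in k(X)$ with $\deg(h)>1$.
   Context: Let $t$ be transcendental over $k$. For $\varphi=\varphi_1/\varphi_2\in k(X)\setminus k$ with coprime $\varphi_1,\varphi_2\in k[X]$, $\mathrm{Mon}_k(\varphi)$ is the Galois group of $\varphi_1(X)-t\varphi_2(X)$ over $k(t)$ acting on its roots, and $\deg\varphi=\max(\deg\varphi_1,\deg\varphi_2)$. A Siegel function is a rational function $g\in k(X)\setminus k$ with $|g^{-1}(\infty)|\le 2$, the preimages being counted as distinct points of $\mathbb{P}^1(\bar k)$. The curve $f(X)=g(Y)$ is called reducible over $k$ if, for roots $x$ of $f(X)-t$ and $y$ of $g(Y)-t$ (i.e. of the numerator of $g(Y)-t$) in an algebraic closure of $k(t)$, the fields $k(x)$ and $k(y)$ are not linearly disjoint over $k(t)$ (equivalently, the fiber product of $f,g:\mathbb{P}^1_k\to\mathbb{P}^1_k$ is reducible). *)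

theory Defs
  imports "HOL-Algebra.Algebra" "HOL-Algebra.Algebraic_Closure_Type"
begin

section \<open>Rational functions in one variable\<close>

text \<open>
  For a field \<open>k\<close>, given as a type \<open>'a\<close>, the rational function field over \<open>k\<close> is
  \<open>'a poly fract\<close>.  It plays two roles: its elements are the rational functions
  in \<open>k(X)\<close> whose fibres are studied, and it is the base field \<open>k(t)\<close>.
\<close>

definition rf_const :: "'a :: field \<Rightarrow> 'a poly fract" where
  "rf_const c = to_fract [:c:]"

definition rf_quot :: "'a :: field poly fract \<Rightarrow> 'a poly \<times> 'a poly" where
  "rf_quot \<phi> = (THE pq. \<phi> = Fract (fst pq) (snd pq) \<and> coprime (fst pq) (snd pq) \<and>
                        Polynomial.lead_coeff (snd pq) = 1)"

definition rf_num :: "'a :: field poly fract \<Rightarrow> 'a poly" where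
  "rf_num \<phi> = fst (rf_quot \<phi>)"

definition rf_den :: "'a :: field poly fract \<Rightarrow> 'a poly" where
  "rf_den \<phi> = snd (rf_quot \<phi>)"

text \<open>The monic denominator makes the description in \<open>rf_quot\<close> definite:\<close>

lemma coprime_poly_bezout:
  fixes p q :: "'a :: field poly"
  assumes "coprime p q"
  shows "\<exists>a b. a * p + b * q = 1"
proof -
  have ne: "p \<noteq> 0 \<or> q \<noteq> 0" using assms by auto
  define P where "P d \<longleftrightarrow> d \<noteq> 0 \<and> (\<exists>a b. d = a * p + b * q)" for d
  have "p = 1 * p + 0 * q" "q = 0 * p + 1 * q" by simp_all
  hence "P p \<or> P q" unfolding P_def using ne by blast
  then obtain d0 where "P d0" by blast
  then obtain d where d: "P d" and min: "\<And>e. P e \<Longrightarrow> Polynomial.degree d \<le> Polynomial.degree e"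
    using ex_has_least_nat[of P d0 Polynomial.degree] by blast
  from d obtain a b where ab: "d = a * p + b * q" and d0: "d \<noteq> 0"
    unfolding P_def by blast
  have dvd: "d dvd r" if r: "r = u * p + v * q" for r u v
  proof (rule ccontr)
    assume "\<not> d dvd r"
    hence nz: "r mod d \<noteq> 0" by (simp add: mod_eq_0_iff_dvd)
    have "r mod d = r - (r div d) * d" by (simp add: minus_div_mult_eq_mod)
    also have "\<dots> = (u - (r div d) * a) * p + (v - (r div d) * b) * q"
      unfolding r by (subst (2) ab) (simp add: algebra_simps)
    finally have "P (r mod d)" using nz unfolding P_def by blast
    with min have "Polynomial.degree d \<le> Polynomial.degree (r mod d)" by blast
    moreover have "Polynomial.degree (r mod d) < Polynomial.degree d"
      using degree_mod_less[OF d0, of r] nz by auto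
    ultimately show False by simp
  qed
  have "d dvd p" by (rule dvd[of p 1 0]) simp
  moreover have "d dvd q" by (rule dvd[of q 0 1]) simp
  ultimately have "is_unit d" by (rule coprime_common_divisor[OF assms])
  then obtain c where c: "1 = d * c" by (elim dvdE)
  have "(c * a) * p + (c * b) * q = d * c" by (subst ab) (simp add: algebra_simps)
  hence "(c * a) * p + (c * b) * q = 1" by (rule trans) (rule c[symmetric])
  thus ?thesis by blast
qed

lemma rf_quot_unique:
  fixes p q p' q' :: "'a :: field poly"
  assumes "Fract p q = Fract p' q'" "coprime p q" "coprime p' q'"
    and "Polynomial.lead_coeff q = 1" "Polynomial.lead_coeff q' = 1"
  shows "p = p'" "q = q'"
proof -
  have nz: "q \<noteq> 0" "q' \<noteq> 0" using assms(4,5) by auto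
  have eq: "p * q' = p' * q" using assms(1) nz by (simp add: eq_fract)
  have aux: "s dvd s'"
    if cop: "coprime r s" and e: "r * s' = r' * s" for r s r' s' :: "'a poly"
  proof -
    obtain a b where "a * r + b * s = 1" using coprime_poly_bezout[OF cop] by blast
    hence "s' = s' * (a * r + b * s)" by simp
    also have "\<dots> = a * (r * s') + b * s' * s" by (simp add: algebra_simps)
    also have "\<dots> = (a * r' + b * s') * s" unfolding e by (simp add: algebra_simps)
    finally show ?thesis by (rule dvdI[OF trans[OF _ mult.commute]])
  qed
  have "q dvd q'" by (rule aux[OF assms(2) eq])
  moreover have "q' dvd q" by (rule aux[OF assms(3) eq[symmetric]])
  ultimately obtain c d where c: "q' = q * c" and d: "q = q' * d" by (elim dvdE)
  have "q * (c * d) = q * 1" unfolding mult.assoc[symmetric] c[symmetric] d[symmetric] by simp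
  hence "c * d = 1" using nz by (simp only: mult_cancel_left) simp
  hence "is_unit c" by (metis dvd_triv_left)
  then obtain e where e: "c = [:e:]" by (auto simp: is_unit_poly_iff)
  have "Polynomial.lead_coeff q' = Polynomial.lead_coeff q * e"
    unfolding c e by (simp add: lead_coeff_mult)
  hence "c = 1" using assms(4,5) e by simp
  thus "q = q'" using c by simp
  with eq nz show "p = p'" by simp
qed

lemma rf_quot_exists:
  fixes \<phi> :: "'a :: field poly fract"
  shows "\<exists>p q. \<phi> = Fract p q \<and> coprime p q \<and> Polynomial.lead_coeff q = 1"
proof -
  define P where "P q \<longleftrightarrow> q \<noteq> 0 \<and> (\<exists>p. \<phi> = Fract p q)" for q
  obtain p0 q0 where "\<phi> = Fract p0 q0" "q0 \<noteq> 0" by (cases \<phi>)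
  hence "P q0" unfolding P_def by blast
  then obtain q where q: "P q"
    and min: "\<And>e. P e \<Longrightarrow> Polynomial.degree q \<le> Polynomial.degree e"
    using ex_has_least_nat[of P q0 Polynomial.degree] by blast
  from q obtain p where p: "\<phi> = Fract p q" and q0: "q \<noteq> 0" unfolding P_def by blast
  have cop: "coprime p q"
  proof (rule coprimeI)
    fix d assume "d dvd p" "d dvd q"
    then obtain p' q' where pq: "p = d * p'" "q = d * q'" by (elim dvdE)
    have nz: "d \<noteq> 0" "q' \<noteq> 0" using pq q0 by auto
    have "\<phi> = Fract p' q'" unfolding p using nz pq by (simp add: eq_fract)
    hence "P q'" using nz unfolding P_def by blast
    hence "Polynomial.degree q \<le> Polynomial.degree q'" by (rule min)
    hence "Polynomial.degree d = 0" using pq nz by (simp add: degree_mult_eq)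
    thus "is_unit d" using nz by (simp add: is_unit_iff_degree)
  qed
  define c where "c = inverse (Polynomial.lead_coeff q)"
  have c: "c \<noteq> 0" using q0 by (simp add: c_def)
  have "\<phi> = Fract (Polynomial.smult c p) (Polynomial.smult c q)"
    unfolding p using c q0 by (simp add: eq_fract)
  moreover have "coprime (Polynomial.smult c p) (Polynomial.smult c q)"
  proof (rule coprimeI)
    fix d assume "d dvd Polynomial.smult c p" "d dvd Polynomial.smult c q"
    hence "d dvd p" "d dvd q" using c by (simp_all add: dvd_smult_iff)
    thus "is_unit d" by (rule coprime_common_divisor[OF cop])
  qed
  moreover have "Polynomial.lead_coeff (Polynomial.smult c q) = 1"
    using q0 by (simp add: c_def)
  ultimately show ?thesis by blast
qed

lemma rf_quot_eqI:
  fixes p q :: "'a :: field poly"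
  assumes "\<phi> = Fract p q" "coprime p q" "Polynomial.lead_coeff q = 1"
  shows "rf_quot \<phi> = (p, q)"
  unfolding rf_quot_def
proof (rule the_equality)
  fix pq assume pq: "\<phi> = Fract (fst pq) (snd pq) \<and> coprime (fst pq) (snd pq) \<and>
                     Polynomial.lead_coeff (snd pq) = 1"
  hence "Fract (fst pq) (snd pq) = Fract p q" using assms(1) by (metis (no_types))
  from rf_quot_unique[OF this _ assms(2) _ assms(3)] pq
  show "pq = (p, q)" by (intro prod_eqI) simp_all
qed (use assms in simp)

lemma rf_num_den:
  fixes \<phi> :: "'a :: field poly fract"
  shows "\<phi> = Fract (rf_num \<phi>) (rf_den \<phi>)" "coprime (rf_num \<phi>) (rf_den \<phi>)"
    "Polynomial.lead_coeff (rf_den \<phi>) = 1"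
proof -
  obtain p q where pq: "\<phi> = Fract p q" "coprime p q" "Polynomial.lead_coeff q = 1"
    using rf_quot_exists by blast
  have eq: "rf_num \<phi> = p" "rf_den \<phi> = q"
    using rf_quot_eqI[OF pq] by (simp_all add: rf_num_def rf_den_def)
  show "\<phi> = Fract (rf_num \<phi>) (rf_den \<phi>)" "coprime (rf_num \<phi>) (rf_den \<phi>)"
    "Polynomial.lead_coeff (rf_den \<phi>) = 1"
    unfolding eq by (fact pq)+
qed

definition rf_degree :: "'a :: field poly fract \<Rightarrow> nat" where
  "rf_degree \<phi> = max (Polynomial.degree (rf_num \<phi>)) (Polynomial.degree (rf_den \<phi>))"

definition rf_comp :: "'a :: field poly \<Rightarrow> 'a poly fract \<Rightarrow> 'a poly fract" where
  "rf_comp h \<phi> = poly (map_poly rf_const h) \<phi>"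

section \<open>Siegel functions\<close>

text \<open>
  Points of the projective line over the algebraic closure of \<open>k\<close> are modelled by the
  option type, with \<open>None\<close> as the point at infinity.
\<close>

fun rf_map :: "'a :: field poly fract \<Rightarrow> 'a alg_closure option \<Rightarrow> 'a alg_closure option" where
  "rf_map \<phi> (Some a) =
     (let p = poly (map_poly to_ac (rf_num \<phi>)) a; q = poly (map_poly to_ac (rf_den \<phi>)) a
      in if q = 0 then None else Some (p / q))"
| "rf_map \<phi> None =
     (let m = Polynomial.degree (rf_num \<phi>); n = Polynomial.degree (rf_den \<phi>)
      in if m > n then None
         else Some (to_ac (Polynomial.coeff (rf_num \<phi>) n / Polynomial.coeff (rf_den \<phi>) n)))"

definition siegel_function :: "'a :: field poly fract \<Rightarrow> bool" where
  "siegel_function \<phi> \<longleftrightarrow>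
     \<phi> \<notin> range rf_const \<and> finite (rf_map \<phi> -` {None}) \<and> card (rf_map \<phi> -` {None}) \<le> 2"

section \<open>Monodromy groups and reducible fibre products\<close>

text \<open>The polynomial \<open>\<phi>\<^sub>1(X) - t \<phi>\<^sub>2(X)\<close> over \<open>k(t)\<close>.\<close>

definition fibre_poly :: "'a :: field poly fract \<Rightarrow> 'a poly fract poly" where
  "fibre_poly \<phi> = map_poly rf_const (rf_num \<phi>) -
     Polynomial.smult (to_fract [:0, 1:]) (map_poly rf_const (rf_den \<phi>))"

definition fibre :: "'a :: field poly fract \<Rightarrow> 'a poly fract alg_closure set" where
  "fibre \<phi> = {x. poly (map_poly to_ac (fibre_poly \<phi>)) x = 0}"

abbreviation Omega :: "'a :: field poly fract alg_closure ring" where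
  "Omega \<equiv> ring_of_type_algebra"

definition base_field :: "'a :: field poly fract alg_closure set" where
  "base_field = range to_ac"

definition point_field ::
    "'a :: field poly fract alg_closure \<Rightarrow> 'a poly fract alg_closure set" where
  "point_field x = generate_field Omega (insert x (range (\<lambda>c. to_ac (rf_const c))))"

definition splitting_field :: "'a :: field poly fract \<Rightarrow> 'a poly fract alg_closure set" where
  "splitting_field \<phi> = generate_field Omega (base_field \<union> fibre \<phi>)"

definition field_auts :: "('a, 'm) ring_scheme \<Rightarrow> 'a set \<Rightarrow> 'a set \<Rightarrow> ('a \<Rightarrow> 'a) set" where
  "field_auts R F L =
     {\<sigma> \<in> ring_iso (R\<lparr>carrier := L\<rparr>) (R\<lparr>carrier := L\<rparr>). \<forall>a\<in>F. \<sigma> a = a}"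

definition Mon ::
    "'a :: field poly fract \<Rightarrow> ('a poly fract alg_closure \<Rightarrow> 'a poly fract alg_closure) monoid" where
  "Mon \<phi> = (BijGroup (fibre \<phi>))
     \<lparr>carrier := (\<lambda>\<sigma>. restrict \<sigma> (fibre \<phi>)) ` field_auts Omega base_field (splitting_field \<phi>)\<rparr>"

definition linearly_disjoint :: "('a, 'm) ring_scheme \<Rightarrow> 'a set \<Rightarrow> 'a set \<Rightarrow> 'a set \<Rightarrow> bool" where
  "linearly_disjoint R F A B \<longleftrightarrow>
     (\<forall>us. set us \<subseteq> A \<longrightarrow> ring.independent R F us \<longrightarrow> ring.independent R B us)"

text \<open>
  The fibre polynomial of a nonconstant function is irreducible over \<open>k(t)\<close>, so the choice of the roots \<open>x\<close> and \<open>y\<close>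
  is immaterial.
\<close>

definition reducible_curve :: "'a :: field poly fract \<Rightarrow> 'a poly fract \<Rightarrow> bool" where
  "reducible_curve \<phi> \<psi> \<longleftrightarrow>
     (\<exists>x\<in>fibre \<phi>. \<exists>y\<in>fibre \<psi>.
        \<not> linearly_disjoint Omega base_field (point_field x) (point_field y))"

end

theory Submission
  imports Defs "HOL-Computational_Algebra.Formal_Laurent_Series" "HOL-Computational_Algebra.Polynomial_FPS"
begin

text \<open>
  Let \<open>G\<close> be the monodromy group of \<open>f\<close>, \<open>x\<close> and \<open>y\<close> roots of \<open>f - t\<close> and \<open>g - t\<close>, \<open>L\<close> the stabiliser of \<open>x\<close> in \<open>G\<close>
  and \<open>R\<close> the image in \<open>G\<close> of the stabiliser of \<open>y\<close>.  By Galois descent \<open>k(x)\<close> and \<open>k(y)\<close> are linearly disjoint as soon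
  as \<open>G = L R\<close>.  A generator \<open>s\<close> of inertia at infinity is read off from Laurent expansions in \<open>t\<^sup>-\<^sup>1\<^sup>/\<^sup>N\<close>: its cycles
  on the roots correspond to the poles, so \<open>s\<close> is transitive on the roots of \<open>f - t\<close>, of odd order \<open>deg f\<close> there,
  and has at most two orbits on the roots of \<open>g - t\<close>.

  The group theoretic heart is that then \<open>L R \<noteq> G\<close> forces \<open>L\<close> and a conjugate of \<open>R\<close> into a common proper subgroup.
  Enlarging \<open>L\<close> and dividing by its core, one may take \<open>L\<close> core-free and maximal with \<open>L R \<noteq> G\<close>.  As \<open>s\<close> has odd order
  and at most two orbits on \<open>G / R\<close>, minimal normal subgroups are cyclic and meet \<open>L\<close> and \<open>R\<close> trivially; growing a normal
  subgroup inside \<open>I\<close>, the group generated by \<open>s\<close>, up to its centraliser shows that \<open>I\<close> is normal and self-centralising,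
  after which the overgroup is found by hand.

  Finally let \<open>M\<close> be this overgroup.  The product of the \<open>M\<close>-conjugates of \<open>x\<close> is \<open>\<plusminus>u(x)\<close> for a polynomial \<open>u\<close>
  by Gauss' lemma, the degree of \<open>u\<close> is seen from the pole order at infinity, and the expansion of \<open>f\<close> in base \<open>u\<close>
  has constant digits, so \<open>f = h \<circ> u\<close>; since \<open>M\<close> contains the stabiliser of a conjugate of \<open>y\<close>, also \<open>g = h \<circ> g\<^sub>1\<close>.
\<close>

section \<open>Solvable groups with a cyclic transitive subgroup\<close>

hide_const (open) Divisibility.prime

text \<open>Parity enters three times. It merges the two orbits on \<open>G / R\<close> into one on
  the sections that matter. It gives a transitive affine map over the prime \<open>p\<close> a
  trivial linear part, since an odd \<open>p\<close> divides \<open>p choose 2\<close>. And it makes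
  the index of \<open>L\<close> odd, which keeps the prime 2 away. Solvability enters through the
  supply of elementary abelian sections.

  The obstacle is that \<open>R\<close> is known only through the two orbits: neither core-freeness
  nor an odd index is assumed. What helps is \<open>L R \<noteq> G\<close> itself. For a nontrivial
  normal \<open>V\<close>, maximality of \<open>L\<close> gives \<open>G = L V R\<close>, so
  \<open>V\<close> cannot be the product of its intersections with \<open>L\<close> and
  \<open>R\<close>. For elementary abelian \<open>V\<close> of exponent \<open>p\<close> both
  intersections have index at most \<open>p\<close>; hence they coincide, are normal in
  \<open>G\<close> and vanish.

  In the expansions at infinity \<open>N\<close> is a factorial, so that every ramification index
  divides it and all roots are Laurent series in one parameter.\<close>

lemma (in group) inv_cancel_left [simp]:
  "a \<in> carrier G \<Longrightarrow> b \<in> carrier G \<Longrightarrow> inv a \<otimes> (a \<otimes> b) = b"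
  "a \<in> carrier G \<Longrightarrow> b \<in> carrier G \<Longrightarrow> a \<otimes> (inv a \<otimes> b) = b"
  by (simp_all flip: m_assoc)

lemma (in group) nat_pow_dvd:
  assumes "x \<in> carrier G" "x [^] (p::nat) = \<one>" "p dvd i" shows "x [^] i = \<one>"
proof -
  obtain k where "i = p * k" using assms(3) by blast
  with assms(1,2) show ?thesis by (simp flip: nat_pow_pow)
qed

lemma (in group) nat_pow_coprime_mem:
  assumes H: "subgroup H G" and x: "x \<in> carrier G" and xp: "x [^] (p::nat) \<in> H"
    and xi: "x [^] (i::nat) \<in> H" and cop: "coprime i p"
  shows "x \<in> H"
proof -
  obtain a b where ab: "a * int i + b * int p = 1"
    using cop bezout_int[of "int i" "int p"] by (metis coprime_iff_gcd_eq_1 gcd_int_int_eq of_nat_1)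
  have "x = x [^] (int i * a + int p * b)" using x ab by (simp add: mult.commute)
  also have "\<dots> = (x [^] i) [^] a \<otimes> (x [^] p) [^] b"
    using x by (simp add: int_pow_mult int_pow_pow flip: int_pow_int)
  also have "\<dots> \<in> H"
    using subgroup_int_pow_closed[OF H] xi xp subgroup.m_closed[OF H] by blast
  finally show ?thesis .
qed

text \<open>
  The affine map \<open>u \<mapsto> T u c\<close> can only be transitive if \<open>T\<close> is trivial: with \<open>\<nu> = T - 1\<close>, the orbit
  modulo the image of \<open>\<nu>\<^sup>2\<close> is parametrised by \<open>i c + (i choose 2) \<nu> c\<close>, and \<open>p\<close> is odd.
\<close>

lemma (in comm_group) affine_orbit_cyclic:
  fixes p :: nat
  assumes fin: "finite (carrier G)" and p: "prime p" "odd p"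
    and exp: "\<And>x. x \<in> carrier G \<Longrightarrow> x [^] p = \<one>"
    and T: "T \<in> hom G G" "inj_on T (carrier G)" and c: "c \<in> carrier G"
    and u0: "u 0 = \<one>" and uS: "\<And>i. u (Suc i) = T (u i) \<otimes> c"
    and cov: "\<And>x. x \<in> carrier G \<Longrightarrow> \<exists>i::nat. x = u i"
  shows "\<exists>e\<in>carrier G. T e = e \<and> (\<forall>x\<in>carrier G. \<exists>i::nat. x = e [^] i)"
proof -
  interpret T: group_hom G G T by unfold_locales (rule T(1))
  define \<nu> where "\<nu> x = T x \<otimes> inv x" for x
  have \<nu>hom: "\<nu> \<in> hom G G"
    unfolding \<nu>_def by (rule homI) (simp_all add: inv_mult m_ac)
  interpret \<nu>: group_hom G G \<nu> by unfold_locales (rule \<nu>hom)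
  have T\<nu>: "T x = \<nu> x \<otimes> x" if "x \<in> carrier G" for x
    using that by (simp add: \<nu>_def m_assoc)
  have uc: "u i \<in> carrier G" for i by (induction i) (simp_all add: u0 uS c)
  have surj: "(\<lambda>x. T x \<otimes> c) ` carrier G = carrier G"
  proof (rule endo_inj_surj[OF fin])
    show "inj_on (\<lambda>x. T x \<otimes> c) (carrier G)" using T(2) c by (auto simp: inj_on_def)
  qed (use c in auto)
  \<comment> \<open>The affine map is a bijection of a finite set, so every point is hit again after
    any given index \<open>k\<close>. This lets the orbit be restarted at a chosen point
    below.\<close>
  have late: "\<exists>i\<ge>k. x = u i" if "x \<in> carrier G" for k x
    using that
  proof (induction k arbitrary: x)
    case 0 thus ?case using cov by blast
  next
    case (Suc k)
    then obtain z where z: "z \<in> carrier G" "x = T z \<otimes> c" using surj by blast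
    with Suc.IH[of z] obtain i where "i \<ge> k" "z = u i" by auto
    hence "Suc i \<ge> Suc k" "x = u (Suc i)" using z by (auto simp: uS)
    thus ?case by blast
  qed
  define M1 where "M1 = \<nu> ` carrier G"
  define M2 where "M2 = \<nu> ` M1"
  have sM1: "subgroup M1 G" unfolding M1_def by (rule \<nu>.img_is_subgroup)
  have sM2: "subgroup M2 G" unfolding M2_def by (rule \<nu>.subgroup_img_is_subgroup[OF sM1])
  have M1c: "M1 \<subseteq> carrier G" using subgroup.subset[OF sM1] .
  have M21: "M2 \<subseteq> M1" unfolding M2_def using M1c M1_def by blast
  have \<nu>M2: "\<nu> m \<in> M2" if "m \<in> M1" for m using that unfolding M2_def by blast
  show ?thesis
  \<comment> \<open>If \<open>\<nu>\<close> is onto, the affine map has a fixed point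
    \<open>w\<close>, and the orbit never leaves it; since the orbit is everything, the group is
    trivial.\<close>
  proof (cases "M1 = carrier G")
    case True
    then obtain w where w: "w \<in> carrier G" "\<nu> w = inv c"
      using c M1_def by (metis (no_types, lifting) imageE inv_closed)
    hence Tw: "T w \<otimes> c = w" using c by (simp add: T\<nu> m_assoc m_comm[of w c])
    obtain k where k: "w = u k" using cov w by blast
    have "u (k + i) = w" for i by (induction i) (simp_all add: k[symmetric] uS Tw)
    hence all: "x = w" if "x \<in> carrier G" for x
      using late[OF that, of k] by (metis le_Suc_ex)
    show ?thesis
    proof (rule bexI[of _ \<one>], intro conjI ballI exI)
      fix x assume "x \<in> carrier G"
      thus "x = \<one> [^] (0::nat)" using all[of x] all[of \<one>] by simp
    qed simp_all
  next
    case False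
    have ui: "\<exists>m\<in>M1. u i = c [^] i \<otimes> m" for i
    proof (induction i)
      case 0 show ?case using subgroup.one_closed[OF sM1] by (auto simp: u0 intro!: bexI[of _ "\<one>"])
    next
      case (Suc i)
      then obtain m where m: "m \<in> M1" "u i = c [^] i \<otimes> m" by blast
      have "\<nu> (u i) \<otimes> m \<in> M1" using m(1) uc subgroup.m_closed[OF sM1] M1_def by auto
      moreover have "u (Suc i) = c [^] Suc i \<otimes> (\<nu> (u i) \<otimes> m)"
        using uS[of i] T\<nu>[OF uc, of i] m M1c c uc[of i] by (simp add: m_ac subset_iff)
      ultimately show ?case by blast
    qed
    \<comment> \<open>Modulo \<open>M1\<close> the orbit consists of the powers of \<open>c\<close>.
      They fill a nontrivial quotient, so \<open>c\<close> has order exactly \<open>p\<close>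
      there.\<close>
    have ci: "p dvd i" if "c [^] i \<in> M1" for i
    proof (rule ccontr)
      assume "\<not> p dvd i"
      hence "coprime i p" using p(1) by (metis coprime_commute prime_imp_coprime)
      hence cM: "c \<in> M1"
        using nat_pow_coprime_mem[OF sM1 c, of p i] that exp[OF c] subgroup.one_closed[OF sM1] by simp
      have "c [^] j \<in> M1" for j :: nat
        using subgroup_int_pow_closed[OF sM1 cM, of "int j"] by (simp add: int_pow_int)
      hence "u j \<in> M1" for j using ui[of j] subgroup.m_closed[OF sM1] by auto
      hence "carrier G \<subseteq> M1" using cov by blast
      thus False using False M1c by blast
    qed
    define d where "d = \<nu> c"
    have d: "d \<in> M1" "d \<in> carrier G" using c by (auto simp: d_def M1_def)
    have u2: "\<exists>m\<in>M2. u i = c [^] i \<otimes> d [^] (i choose 2) \<otimes> m" for i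
    proof (induction i)
      case 0 show ?case using subgroup.one_closed[OF sM2] by (auto simp: u0 numeral_2_eq_2 intro!: bexI[of _ "\<one>"])
    next
      case (Suc i)
      then obtain m where m: "m \<in> M2" "u i = c [^] i \<otimes> d [^] (i choose 2) \<otimes> m" by blast
      have mc: "m \<in> carrier G" "m \<in> M1" using m M21 M1c by auto
      define m' where "m' = \<nu> (d [^] (i choose 2)) \<otimes> \<nu> m \<otimes> m"
      have dk: "d [^] k \<in> M1" for k :: nat
        using subgroup_int_pow_closed[OF sM1 d(1), of "int k"] by (simp add: int_pow_int)
      have m': "m' \<in> M2" unfolding m'_def
        using \<nu>M2[OF dk] \<nu>M2[OF mc(2)] m(1) subgroup.m_closed[OF sM2] by auto
      have "\<nu> (u i) = d [^] i \<otimes> \<nu> (d [^] (i choose 2)) \<otimes> \<nu> m"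
        using m(2) c d mc by (simp add: \<nu>.hom_nat_pow d_def)
      hence "u (Suc i) = (d [^] i \<otimes> \<nu> (d [^] (i choose 2)) \<otimes> \<nu> m) \<otimes>
               (c [^] i \<otimes> d [^] (i choose 2) \<otimes> m) \<otimes> c"
        using uS[of i] T\<nu>[OF uc, of i] m(2) by simp
      also have "\<dots> = (c [^] i \<otimes> c) \<otimes> (d [^] i \<otimes> d [^] (i choose 2)) \<otimes> m'"
        unfolding m'_def using c d mc by (simp add: m_ac)
      also have "d [^] i \<otimes> d [^] (i choose 2) = d [^] (Suc i choose 2)"
        using d by (simp add: nat_pow_mult numeral_2_eq_2)
      finally show ?case using m' by auto
    qed
    \<comment> \<open>A point of \<open>M1\<close> is reached at an index \<open>i\<close> divisible
      by \<open>p\<close>. Then \<open>c [^] i\<close> and \<open>d [^] (i choose 2)\<close> are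
      both trivial, the latter because \<open>p\<close> is odd, and what remains lies in
      \<open>M2\<close>.\<close>
    have M12: "M1 = M2"
    proof (rule antisym[OF _ M21], rule)
      fix x assume x: "x \<in> M1"
      then obtain i where i: "x = u i" using cov M1c by blast
      obtain m where m: "m \<in> M1" "u i = c [^] i \<otimes> m" using ui by blast
      have "c [^] i = x \<otimes> inv m" using m i c M1c by (simp add: m_assoc subset_iff)
      also have "\<dots> \<in> M1" using x m subgroup.m_closed[OF sM1] subgroup.m_inv_closed[OF sM1] by blast
      finally have pi: "p dvd i" by (rule ci)
      have "2 * (i choose 2) = i * (i - 1)" by (cases i) (simp_all add: choose_two)
      hence "p dvd 2 * (i choose 2)" using pi by simp
      hence "p dvd (i choose 2)" using p by (metis odd_two_times_div_two_nat coprime_dvd_mult_right_iff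
            coprime_right_2_iff_odd)
      hence 1: "d [^] (i choose 2) = \<one>" using nat_pow_dvd[OF d(2) exp[OF d(2)]] by blast
      have 2: "c [^] i = \<one>" using nat_pow_dvd[OF c exp[OF c] pi] .
      obtain m' where "m' \<in> M2" "u i = c [^] i \<otimes> d [^] (i choose 2) \<otimes> m'" using u2 by blast
      thus "x \<in> M2" using i 1 2 M21 M1c by (simp add: subset_iff)
    qed
    \<comment> \<open>Since \<open>\<nu>\<close> maps \<open>M1\<close> onto itself,
      \<open>c\<close> can be corrected by \<open>w\<close> in \<open>M1\<close> to an element
      \<open>e\<close> fixed by \<open>T\<close>, and \<open>b\<close> can be chosen so that
      translation by \<open>b\<close> turns the affine map into multiplication by \<open>e\<close>.
      The orbit through \<open>b\<close> is then a coset of the powers of \<open>e\<close>; it is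
      everything, so it contains the identity.\<close>
    have "d \<in> \<nu> ` M1" using d(1) M12 unfolding M2_def by simp
    then obtain w where w: "w \<in> M1" "d = \<nu> w" by blast
    have wc: "w \<in> carrier G" using w M1c by blast
    have "inv w \<in> \<nu> ` M1" using subgroup.m_inv_closed[OF sM1 w(1)] M12 unfolding M2_def by simp
    then obtain b where b: "b \<in> M1" "inv w = \<nu> b" by blast
    have bc: "b \<in> carrier G" using b M1c by blast
    define e where "e = c \<otimes> inv w"
    have e: "e \<in> carrier G" using c wc by (simp add: e_def)
    have "\<nu> e = \<one>" using c wc w d by (simp add: e_def d_def)
    hence Te: "T e = e" using T\<nu>[OF e] e by simp
    have step: "T (b \<otimes> e [^] i) \<otimes> c = b \<otimes> e [^] Suc i" for i :: nat
    proof -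
      have "T (b \<otimes> e [^] i) = (inv w \<otimes> b) \<otimes> e [^] i"
        using bc e Te T\<nu>[OF bc] b(2) by (simp add: T.hom_nat_pow)
      thus ?thesis using bc e c wc by (simp add: e_def m_ac)
    qed
    obtain k where k: "b = u k" using cov bc by blast
    have orb: "u (k + i) = b \<otimes> e [^] i" for i
      by (induction i) (simp_all add: k[symmetric] bc uS step del: nat_pow_Suc)
    have all: "\<exists>i::nat. x = b \<otimes> e [^] i" if "x \<in> carrier G" for x
      using late[OF that, of k] orb by (metis le_Suc_ex)
    obtain j :: nat where j: "\<one> = b \<otimes> e [^] j" using all[of \<one>] by auto
    have "e [^] (j * p) = \<one>" using nat_pow_dvd[OF e exp[OF e]] by simp
    hence "e [^] (j * (p - 1)) \<otimes> e [^] j = \<one>"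
    proof -
      have "j * (p - 1) + j = j * p" using prime_gt_0_nat[OF p(1)] by (cases p) simp_all
      thus ?thesis using \<open>e [^] (j * p) = \<one>\<close> e by (simp add: nat_pow_mult)
    qed
    hence "b \<otimes> e [^] j = e [^] (j * (p - 1)) \<otimes> e [^] j" using j by simp
    hence "b = e [^] (j * (p - 1))" using bc e by simp
    hence "\<exists>i::nat. x = e [^] i" if "x \<in> carrier G" for x
      using all[OF that] e by (metis nat_pow_mult)
    thus ?thesis using e Te by blast
  qed
qed

lemma card_orbit_dvd:
  assumes n: "(\<phi> ^^ n) x = x" "n > 0"
  shows "card (range (\<lambda>i. (\<phi> ^^ i) x)) dvd n" "finite (range (\<lambda>i. (\<phi> ^^ i) x))"
proof -
  define d where "d = (LEAST d. d > 0 \<and> (\<phi> ^^ d) x = x)"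
  have d: "d > 0" "(\<phi> ^^ d) x = x"
    using LeastI[of "\<lambda>d. d > 0 \<and> (\<phi> ^^ d) x = x" n] n unfolding d_def by auto
  have dmin: "\<not> (0 < e \<and> (\<phi> ^^ e) x = x)" if "e < d" for e
    using not_less_Least[of e] that unfolding d_def by blast
  have mult: "(\<phi> ^^ (d * k)) x = x" for k
    by (induction k) (simp_all add: funpow_add d(2))
  have md: "(\<phi> ^^ i) x = (\<phi> ^^ (i mod d)) x" for i
  proof -
    have "(\<phi> ^^ i) x = (\<phi> ^^ (i mod d + d * (i div d))) x" by simp
    also have "\<dots> = (\<phi> ^^ (i mod d)) x" unfolding funpow_add by (simp add: mult)
    finally show ?thesis .
  qed
  have eq: "range (\<lambda>i. (\<phi> ^^ i) x) = (\<lambda>i. (\<phi> ^^ i) x) ` {..<d}"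
    using md d(1) by (auto intro!: image_eqI[of _ _ "_ mod d"])
  have "inj_on (\<lambda>i. (\<phi> ^^ i) x) {..<d}"
  proof (rule linorder_inj_onI)
    fix a b assume ab: "a < b" "a \<in> {..<d}" "b \<in> {..<d}"
    show "(\<phi> ^^ a) x \<noteq> (\<phi> ^^ b) x"
    proof
      assume e: "(\<phi> ^^ a) x = (\<phi> ^^ b) x"
      have "(\<phi> ^^ (d - b + a)) x = (\<phi> ^^ (d - b + b)) x" unfolding funpow_add by (simp add: e)
      also have "\<dots> = x" using ab d(2) by simp
      finally show False using dmin[of "d - b + a"] ab by auto
    qed
  qed auto
  hence "card (range (\<lambda>i. (\<phi> ^^ i) x)) = d" unfolding eq by (simp add: card_image)
  moreover have "d dvd n" using md[of n] n dmin[of "n mod d"] d(1) by (auto simp: dvd_eq_mod_eq_0)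
  ultimately show "card (range (\<lambda>i. (\<phi> ^^ i) x)) dvd n" by simp
  show "finite (range (\<lambda>i. (\<phi> ^^ i) x))" unfolding eq by simp
qed

text \<open>Parity: two distinct orbits of odd length cannot fill a set of odd size.\<close>

lemma two_odd_orbits_transitive:
  assumes per: "\<And>x. x \<in> M \<Longrightarrow> (\<phi> ^^ n) x = x" and n: "odd n" and odd: "odd (card M)"
    and cl: "\<And>x. x \<in> M \<Longrightarrow> \<phi> x \<in> M" and xy: "x \<in> M" "y \<in> M"
    and cov: "\<And>z. z \<in> M \<Longrightarrow> \<exists>i. z = (\<phi> ^^ i) x \<or> z = (\<phi> ^^ i) y"
    and zw: "z \<in> M" "w \<in> M"
  shows "\<exists>i. w = (\<phi> ^^ i) z"
proof -
  have n0: "n > 0" using n by (cases n) auto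
  define O' where "O' x = range (\<lambda>i. (\<phi> ^^ i) x)" for x
  have cli: "(\<phi> ^^ i) x \<in> M" if "x \<in> M" for i x using that by (induction i) (auto intro: cl)
  have bk: "\<exists>i. x = (\<phi> ^^ i) z" if "x \<in> M" "z = (\<phi> ^^ j) x" for x z j
  proof -
    have "(\<phi> ^^ (n * j)) x = x" by (induction j) (simp_all add: funpow_add per that(1))
    moreover have "n * j = (n * j - j) + j" using n0 by (cases n) auto
    ultimately have "(\<phi> ^^ (n * j - j)) z = x" unfolding that(2) by (metis comp_apply funpow_add)
    thus ?thesis by blast
  qed
  have O: "odd (card (O' x))" "finite (O' x)" if "x \<in> M" for x
    using card_orbit_dvd[OF per[OF that] n0] n dvd_trans unfolding O'_def by blast+
  have M: "M = O' x \<union> O' y" using cov cli xy unfolding O'_def by blast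
  have "O' x \<inter> O' y \<noteq> {}"
  proof
    assume "O' x \<inter> O' y = {}"
    hence "card M = card (O' x) + card (O' y)" unfolding M by (intro card_Un_disjoint O xy)
    thus False using odd O xy by simp
  qed
  then obtain i j where ij: "(\<phi> ^^ i) x = (\<phi> ^^ j) y" unfolding O'_def by auto
  obtain k where k: "y = (\<phi> ^^ k) ((\<phi> ^^ i) x)" using bk[OF xy(2) ij] by blast
  have all: "\<exists>i. z = (\<phi> ^^ i) x" if "z \<in> M" for z
    using cov[OF that] k by (metis comp_apply funpow_add)
  obtain a b where ab: "z = (\<phi> ^^ a) x" "w = (\<phi> ^^ b) x" using all zw by metis
  obtain c where "x = (\<phi> ^^ c) z" using bk[OF xy(1) ab(1)] by blast
  hence "w = (\<phi> ^^ (b + c)) z" using ab(2) by (simp add: funpow_add)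
  thus ?thesis by blast
qed

section \<open>Sections of odd prime exponent under a cyclic group with two orbits\<close>

lemma (in group) odd_order_of_odd_exponent:
  assumes fin: "finite (carrier G)" and "odd (p::nat)" and exp: "\<And>x. x \<in> carrier G \<Longrightarrow> x [^] p = \<one>"
  shows "odd (card (carrier G))"
proof
  assume "even (card (carrier G))"
  \<comment> \<open>Sylow's theorem holds for any prime power dividing the order; exponent 1 makes
    it Cauchy's theorem.\<close>
  then obtain m where "Coset.order G = 2 ^ 1 * m" unfolding Coset.order_def by auto
  from sylow_thm[OF two_is_prime_nat group_axioms this fin]
  obtain H where H: "subgroup H G" "card H = 2" by auto
  have "H \<noteq> {\<one>}" using H(2) by auto
  then obtain h where h: "h \<in> H" "h \<noteq> \<one>" using subgroup.one_closed[OF H(1)] by blast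
  interpret H: group "G\<lparr>carrier := H\<rparr>" using subgroup_imp_group[OF H(1)] .
  have "h [^] (2::nat) = \<one>"
    using H.pow_order_eq_1[of h] h H(2) by (simp add: Coset.order_def nat_pow_consistent[symmetric])
  moreover have "h [^] p = \<one>" using exp h subgroup.mem_carrier[OF H(1)] by blast
  ultimately have "h \<in> {\<one>}"
    using nat_pow_coprime_mem[OF triv_subgroup, of h 2 p] h subgroup.mem_carrier[OF H(1)] assms(2) by auto
  thus False using h by simp
qed

lemma (in group) normal_conj_closed:
  assumes "N \<lhd> G" "x \<in> N" "g \<in> carrier G" shows "g \<otimes> x \<otimes> inv g \<in> N" "inv g \<otimes> x \<otimes> g \<in> N"
  using normal.inv_op_closed2[OF assms(1,3,2)] normal.inv_op_closed1[OF assms(1,3,2)] by auto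

lemma (in group) normal_times_subgroup_mem:
  assumes V: "V \<lhd> G" and H: "subgroup H G"
  shows "\<lbrakk>x \<in> V <#> H; y \<in> V <#> H\<rbrakk> \<Longrightarrow> x \<otimes> y \<in> V <#> H"
    and "x \<in> V <#> H \<Longrightarrow> inv x \<in> V <#> H" and "subgroup (V <#> H) G"
    and "V <#> H = H <#> V"
proof -
  show c: "V <#> H = H <#> V" by (rule commut_normal[OF H V, symmetric])
  show s: "subgroup (V <#> H) G"
    by (rule mult_norm_subgroup[OF V H])
  show "\<lbrakk>x \<in> V <#> H; y \<in> V <#> H\<rbrakk> \<Longrightarrow> x \<otimes> y \<in> V <#> H"
    using subgroup.m_closed[OF s] by blast
  show "x \<in> V <#> H \<Longrightarrow> inv x \<in> V <#> H" using subgroup.m_inv_closed[OF s] by blast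
qed

lemma (in group) inv_mem_cancel_right:
  "\<lbrakk>a \<in> carrier G; b \<in> carrier G\<rbrakk> \<Longrightarrow> a \<otimes> b \<otimes> inv b = a"
  "\<lbrakk>a \<in> carrier G; b \<in> carrier G\<rbrakk> \<Longrightarrow> a \<otimes> inv b \<otimes> b = a"
  by (simp_all add: m_assoc)

lemma (in group) subgroup_nat_pow_closed:
  "subgroup H G \<Longrightarrow> x \<in> H \<Longrightarrow> x [^] (n::nat) \<in> H"
  using subgroup_int_pow_closed[of H x "int n"] by (simp add: int_pow_int)

text \<open>The quotient \<open>V / (V \<inter> H)\<close> is the orbit of the base point of
  \<open>G / H\<close> under \<open>V\<close>. Let \<open>j\<close> be the least positive power of
  \<open>s\<close> in \<open>V H\<close>, that is, preserving this orbit, and write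
  \<open>j = c h0\<close> with \<open>c\<close> in \<open>V\<close> and \<open>h0\<close> in
  \<open>H\<close>. On the quotient \<open>j\<close> acts by
  \<open>v \<mapsto> (j v inv j) c\<close>, an affine map whose orbits come from those of
  \<open>s\<close>; there are at most two, of odd length. The quotient has odd order, so there is
  one orbit, and the affine lemma applies. The conclusions are cyclicity of the quotient,
  transitivity of \<open>s\<close> on it, and triviality of conjugation by those powers of
  \<open>s\<close> that preserve it.\<close>

lemma (in group) two_orbit_section_cyclic:
  fixes p :: nat
  assumes fin: "finite (carrier G)" and V: "V \<lhd> G" and H: "subgroup H G"
    and s: "s \<in> carrier G" and odd_s: "odd (ord s)"
    and ab: "a \<in> carrier G" "b \<in> carrier G"
    and two: "\<And>g. g \<in> carrier G \<Longrightarrow> \<exists>i::nat. \<exists>h\<in>H. g = s [^] i \<otimes> a \<otimes> h \<or> g = s [^] i \<otimes> b \<otimes> h"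
    and comm: "\<And>v w. v \<in> V \<Longrightarrow> w \<in> V \<Longrightarrow> v \<otimes> w \<otimes> inv v \<otimes> inv w \<in> H"
    and pow: "\<And>v. v \<in> V \<Longrightarrow> v [^] p \<in> H" and p: "prime p" "odd p"
  shows "\<exists>e\<in>V. \<forall>v\<in>V. \<exists>i::nat. \<exists>h\<in>V \<inter> H. v = e [^] i \<otimes> h" (is ?A)
    and "\<forall>v\<in>V. \<exists>i::nat. \<exists>h\<in>H. v = s [^] i \<otimes> h" (is ?B)
    and "\<And>i v. s [^] (i::nat) \<in> V <#> H \<Longrightarrow> v \<in> V \<Longrightarrow> s [^] i \<otimes> v \<otimes> inv (s [^] i) \<otimes> inv v \<in> H"
proof -
  note sV = normal_imp_subgroup[OF V]
  note Vc = subgroup.mem_carrier[OF sV] and Hc = subgroup.mem_carrier[OF H]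
  note Vm = subgroup.m_closed[OF sV] and Vi = subgroup.m_inv_closed[OF sV]
  note Hm = subgroup.m_closed[OF H] and Hi = subgroup.m_inv_closed[OF H]
  note VH = normal_times_subgroup_mem[OF V H]
  define N where "N = ord s"
  have N: "odd N" "N > 0" "s [^] N = \<one>" using odd_s s by (auto simp: N_def odd_pos)
  define U where "U = V \<inter> H"
  define GV where "GV = G\<lparr>carrier := V\<rparr>"
  have Uc: "x \<in> U \<Longrightarrow> x \<in> carrier G" for x using Vc U_def by auto
  have sU: "subgroup U G" unfolding U_def by (rule subgroups_Inter_pair[OF sV H])
  interpret GV: group GV unfolding GV_def by (rule subgroup_imp_group[OF sV])
  have invGV: "inv\<^bsub>GV\<^esub> x = inv x" if "x \<in> V" for x
    unfolding GV_def by (rule m_inv_consistent[OF sV that])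
  have UVconj: "x \<otimes> u \<otimes> inv x \<in> U" if "x \<in> V" "u \<in> U" for x u
  proof -
    have xu: "x \<in> carrier G" "u \<in> carrier G" "u \<in> V" "u \<in> H" using that Vc U_def by auto
    have "x \<otimes> u \<otimes> inv x = (x \<otimes> u \<otimes> inv x \<otimes> inv u) \<otimes> u" using xu by (simp add: m_assoc)
    hence "x \<otimes> u \<otimes> inv x \<in> H" using Hm[OF comm[OF that(1) xu(3)] xu(4)] by simp
    thus ?thesis using xu that unfolding U_def by (auto intro: Vm Vi)
  qed
  have "U \<lhd> GV"
    unfolding GV.normal_inv_iff
  proof (intro conjI ballI)
    show "subgroup U GV" unfolding GV_def by (rule subgroup_incl[OF sU sV]) (auto simp: U_def)
    fix x u assume "x \<in> carrier GV" "u \<in> U"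
    thus "x \<otimes>\<^bsub>GV\<^esub> u \<otimes>\<^bsub>GV\<^esub> inv\<^bsub>GV\<^esub> x \<in> U" using UVconj[of x u] invGV[of x] by (simp add: GV_def)
  qed
  then interpret U: normal U GV .
  define Q where "Q = GV Mod U"
  define \<pi> where "\<pi> v = U #> v" for v
  interpret Q: group Q unfolding Q_def by (rule U.factorgroup_is_group)
  have Qc: "carrier Q = \<pi> ` V"
    unfolding Q_def carrier_FactGroup \<pi>_def by (simp add: GV_def)
  have Qm: "\<pi> v \<otimes>\<^bsub>Q\<^esub> \<pi> w = \<pi> (v \<otimes> w)" if "v \<in> V" "w \<in> V" for v w
    using U.rcos_sum[of v w] that unfolding Q_def \<pi>_def by (simp add: GV_def)
  have Q1: "\<one>\<^bsub>Q\<^esub> = \<pi> \<one>"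
    unfolding Q_def \<pi>_def using sU by (simp add: subgroup.subset)
  have Qp: "\<pi> v [^]\<^bsub>Q\<^esub> (n::nat) = \<pi> (v [^] n)" if "v \<in> V" for v n
    by (induction n) (simp_all add: Q1 Qm that subgroup_nat_pow_closed[OF sV])
  \<comment> \<open>Equality in the quotient is expressed as equality of the left cosets
    \<open>v H\<close> and \<open>w H\<close>, the form in which the action of \<open>s\<close> is
    known; normality of \<open>U\<close> in \<open>V\<close> reconciles the two sides.\<close>
  have Qeq: "\<pi> v = \<pi> w \<longleftrightarrow> inv w \<otimes> v \<in> H" if "v \<in> V" "w \<in> V" for v w
  proof -
    have "\<pi> v = \<pi> w \<longleftrightarrow> v \<otimes> inv w \<in> U"
    proof
      assume "\<pi> v = \<pi> w"
      hence "v \<in> U #> w" using rcos_self[OF _ sU, of v] that Vc \<pi>_def by auto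
      thus "v \<otimes> inv w \<in> U" using subgroup.rcos_module_imp[OF sU] that Vc by (metis is_group)
    next
      assume "v \<otimes> inv w \<in> U"
      hence "v \<in> U #> w" using subgroup.rcos_module_rev[OF sU] that Vc by (metis is_group)
      thus "\<pi> v = \<pi> w" using repr_independence[OF _ _ sU, of v w] that Vc \<pi>_def by auto
    qed
    also have "\<dots> \<longleftrightarrow> inv w \<otimes> v \<in> U"
    proof
      assume "v \<otimes> inv w \<in> U"
      from UVconj[OF Vi[OF that(2)] this] show "inv w \<otimes> v \<in> U"
        using that Vc by (simp add: m_assoc)
    next
      assume "inv w \<otimes> v \<in> U"
      from UVconj[OF that(2) this] show "v \<otimes> inv w \<in> U"
        using that Vc by (simp add: m_assoc)
    qed
    also have "\<dots> \<longleftrightarrow> inv w \<otimes> v \<in> H" using that by (auto simp: U_def intro: Vm Vi)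
    finally show ?thesis .
  qed
  have finV: "finite V" using fin subgroup.subset[OF sV] finite_subset by blast
  interpret Q: comm_group Q
  proof (rule Q.group_comm_groupI)
    fix x y assume "x \<in> carrier Q" "y \<in> carrier Q"
    then obtain v w where vw: "v \<in> V" "w \<in> V" "x = \<pi> v" "y = \<pi> w" using Qc by auto
    have "\<pi> (v \<otimes> w) = \<pi> (w \<otimes> v)"
    proof (subst Qeq)
      have "inv (w \<otimes> v) \<otimes> (v \<otimes> w) = inv v \<otimes> inv w \<otimes> inv (inv v) \<otimes> inv (inv w)"
        using vw Vc by (simp add: inv_mult_group m_assoc)
      thus "inv (w \<otimes> v) \<otimes> (v \<otimes> w) \<in> H" using comm[OF Vi Vi] vw by simp
    qed (use vw Vm in auto)
    thus "x \<otimes>\<^bsub>Q\<^esub> y = y \<otimes>\<^bsub>Q\<^esub> x" using vw by (simp add: Qm)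
  qed
  have Vsub: "x \<in> V <#> H" if "x \<in> V" for x
    using that subgroup.one_closed[OF H] Vc unfolding set_mult_def by force
  have Hsub: "x \<in> V <#> H" if "x \<in> H" for x
    using that subgroup.one_closed[OF sV] Hc unfolding set_mult_def by force

  define k where "k = (LEAST k::nat. k > 0 \<and> s [^] k \<in> V <#> H)"
  have "N > 0 \<and> s [^] N \<in> V <#> H" using N Vsub subgroup.one_closed[OF sV] by simp
  hence k: "k > 0" "s [^] k \<in> V <#> H" unfolding k_def
    using LeastI[of "\<lambda>k::nat. k > 0 \<and> s [^] k \<in> V <#> H" N] by auto
  have kdvd: "k dvd i" if "s [^] i \<in> V <#> H" for i
  proof -
    have "s [^] (k * (i div k)) \<in> V <#> H"
      using subgroup_nat_pow_closed[OF VH(3) k(2)] s by (simp add: nat_pow_pow)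
    moreover have "s [^] i = s [^] (i mod k) \<otimes> s [^] (k * (i div k))" using s by (simp add: nat_pow_mult)
    ultimately have "s [^] (i mod k) = s [^] i \<otimes> inv (s [^] (k * (i div k)))"
      using s by (simp add: m_assoc)
    also have "\<dots> \<in> V <#> H" using VH that \<open>s [^] (k * (i div k)) \<in> V <#> H\<close> by blast
    finally have "\<not> i mod k > 0"
      using not_less_Least[of "i mod k" "\<lambda>k::nat. k > 0 \<and> s [^] k \<in> V <#> H"] k(1)
      unfolding k_def[symmetric] by auto
    thus ?thesis by auto
  qed
  define j where "j = s [^] k"
  have j: "j \<in> carrier G" using s by (simp add: j_def)
  obtain c h0 where ch: "c \<in> V" "h0 \<in> H" "j = c \<otimes> h0"
    using k(2) unfolding j_def set_mult_def by blast
  have chc: "c \<in> carrier G" "h0 \<in> carrier G" using ch Vc Hc by auto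
  have jN: "j [^] N = \<one>" 
  proof -
    have "j [^] N = (s [^] N) [^] k" unfolding j_def using s by (simp add: nat_pow_pow mult.commute)
    thus ?thesis using N by simp
  qed
  define \<tau> where "\<tau> v = j \<otimes> v \<otimes> inv j" for v
  have \<tau>V: "\<tau> v \<in> V" if "v \<in> V" for v
    unfolding \<tau>_def using normal_conj_closed[OF V that j] by simp
  have \<tau>U: "\<tau> u \<in> U" if "u \<in> U" for u
  proof -
    have "h0 \<otimes> u \<otimes> inv h0 \<in> U"
      using that normal_conj_closed(1)[OF V _ chc(2), of u] ch unfolding U_def by (auto intro: Hm Hi)
    from UVconj[OF ch(1) this] show ?thesis
      using ch chc Uc[OF that] by (simp add: \<tau>_def m_assoc inv_mult_group)
  qed
  have \<tau>m: "\<tau> (v \<otimes> w) = \<tau> v \<otimes> \<tau> w" "\<tau> (inv v) = inv (\<tau> v)" if "v \<in> V" "w \<in> V" for v w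
    using that Vc j by (simp_all add: \<tau>_def m_assoc inv_mult_group)
  have \<tau>\<pi>: "\<pi> (\<tau> v) = \<pi> (\<tau> w)" if "\<pi> v = \<pi> w" "v \<in> V" "w \<in> V" for v w
  proof -
    have "inv w \<otimes> v \<in> U" using that Qeq Vm Vi by (auto simp: U_def)
    from \<tau>U[OF this] have "inv (\<tau> w) \<otimes> \<tau> v \<in> H" using that \<tau>m Vi by (auto simp: U_def)
    thus ?thesis using Qeq \<tau>V that by blast
  qed
  \<comment> \<open>Conjugation by \<open>j\<close> on cosets, through an arbitrary representative;
    by \<open>\<tau>\<pi>\<close> the choice does not matter.\<close>
  define T where "T C = \<pi> (\<tau> (SOME v. v \<in> V \<and> C = \<pi> v))" for C
  have T: "T (\<pi> v) = \<pi> (\<tau> v)" if "v \<in> V" for v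
  proof -
    define w where "w = (SOME w. w \<in> V \<and> \<pi> v = \<pi> w)"
    have "w \<in> V \<and> \<pi> v = \<pi> w" unfolding w_def by (rule someI[of _ v]) (use that in auto)
    thus ?thesis unfolding T_def w_def[symmetric] using \<tau>\<pi> that by metis
  qed
  have Thom: "T \<in> hom Q Q"
    by (rule homI) (auto simp: Qc T Qm \<tau>V Vm \<tau>m)
  have TN: "(T ^^ i) (\<pi> v) = \<pi> (j [^] i \<otimes> v \<otimes> inv (j [^] i)) \<and> j [^] i \<otimes> v \<otimes> inv (j [^] i) \<in> V"
    if v: "v \<in> V" for v i
  proof (induction i)
    case (Suc i)
    have jc: "j [^] i \<otimes> j = j \<otimes> j [^] i" using j by (metis nat_pow_Suc nat_pow_Suc2)
    have "\<tau> (j [^] i \<otimes> v \<otimes> inv (j [^] i)) = j [^] Suc i \<otimes> v \<otimes> inv (j [^] Suc i)"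
      using j Vc[OF v] by (simp add: \<tau>_def m_assoc inv_mult_group jc)
    with Suc show ?case using T \<tau>V by (metis funpow.simps(2) comp_apply)
  qed (use v Vc in simp)
  have Tinj: "inj_on T (carrier Q)"
  proof (rule inj_on_inverseI[of _ "T ^^ (N - 1)"])
    fix x assume "x \<in> carrier Q"
    then obtain v where v: "v \<in> V" "x = \<pi> v" using Qc by auto
    have "(T ^^ (N - 1)) (T x) = (T ^^ N) x" using N(2) by (cases N) (simp_all add: funpow_swap1)
    also have "\<dots> = x" using TN[OF v(1), of N] v Vc jN by simp
    finally show "(T ^^ (N - 1)) (T x) = x" .
  qed
  define \<phi> where "\<phi> C = T C \<otimes>\<^bsub>Q\<^esub> \<pi> c" for C
  \<comment> \<open>A representative of the \<open>i\<close>-th iterate of the affine map: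
    \<open>j [^] i \<otimes> v\<close> is brought back into \<open>V\<close> by a factor in
    \<open>H\<close>, which cosets of \<open>H\<close> do not see.\<close>
  define \<psi> where "\<psi> i v = j [^] i \<otimes> v \<otimes> inv (h0 [^] i)" for i :: nat and v
  have \<phi>N: "(\<phi> ^^ i) (\<pi> v) = \<pi> (\<psi> i v) \<and> \<psi> i v \<in> V" if v: "v \<in> V" for v i
  proof (induction i)
    case (Suc i)
    have jc: "j [^] i \<otimes> j = j \<otimes> j [^] i" using j by (metis nat_pow_Suc nat_pow_Suc2)
    have "\<tau> (\<psi> i v) \<otimes> c = \<psi> (Suc i) v"
    proof -
      have "inv j \<otimes> c = inv h0" using ch chc by (simp add: inv_mult_group m_assoc)
      moreover have "inv h0 \<otimes> inv (h0 [^] i) = inv (h0 [^] Suc i)" using chc by (simp add: inv_mult_group)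
      ultimately have "j \<otimes> (j [^] i \<otimes> v \<otimes> inv (h0 [^] i)) \<otimes> inv j \<otimes> c
          = j [^] Suc i \<otimes> v \<otimes> (inv (h0 [^] i) \<otimes> inv h0)"
        using j Vc[OF v] chc by (simp add: m_assoc jc)
      also have "inv (h0 [^] i) \<otimes> inv h0 = inv (h0 [^] Suc i)"
        using chc by (metis inv_mult_group nat_pow_Suc2 nat_pow_closed)
      finally show ?thesis by (simp add: \<tau>_def \<psi>_def)
    qed
    moreover have "\<phi> (\<pi> (\<psi> i v)) = \<pi> (\<tau> (\<psi> i v) \<otimes> c)"
      unfolding \<phi>_def using Suc ch \<tau>V by (simp add: T Qm)
    ultimately show ?case using Suc Vm[OF \<tau>V ch(1)] by (metis funpow.simps(2) comp_apply)
  qed (use v Vc in \<open>simp add: \<psi>_def\<close>)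
  \<comment> \<open>Two elements of \<open>V\<close> in one double coset \<open><s> x H\<close> are
    linked by a power of \<open>s\<close> that lies in \<open>V H\<close>, hence by a power of
    \<open>j\<close>. The exponent \<open>(N - 1) * i'\<close> plays the role of
    \<open>- i'\<close>.\<close>
  have same: "\<exists>l. \<pi> v = (\<phi> ^^ l) (\<pi> w)"
    if v: "v \<in> V" "h \<in> H" "v = s [^] i \<otimes> x \<otimes> h" and w: "w \<in> V" "h' \<in> H" "w = s [^] i' \<otimes> x \<otimes> h'"
      and x: "x \<in> carrier G" for v w h h' x and i i' :: nat
  proof -
    define m where "m = i + (N - 1) * i'"
    note c = Vc[OF v(1)] Vc[OF w(1)] Hc[OF v(2)] Hc[OF w(2)] x s
    have "(N - 1) * i' + i' = N * i'" using N(2) by (cases N) simp_all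
    hence e1: "s [^] ((N - 1) * i') \<otimes> s [^] i' = \<one>"
      using nat_pow_dvd[OF s N(3), of "N * i'"] s by (simp add: nat_pow_mult)
    have "s [^] m \<otimes> w = s [^] i \<otimes> ((s [^] ((N - 1) * i') \<otimes> s [^] i') \<otimes> (x \<otimes> h'))"
      unfolding m_def w(3) nat_pow_mult[OF s, symmetric] using c by (simp add: m_assoc)
    also have "\<dots> = s [^] i \<otimes> (x \<otimes> h')" unfolding e1 using c by simp
    also have "\<dots> = v \<otimes> (inv h \<otimes> h')" unfolding v(3) using c by (simp add: m_assoc)
    finally have e2: "s [^] m \<otimes> w = v \<otimes> (inv h \<otimes> h')" .
    hence "s [^] m = v \<otimes> (inv h \<otimes> h') \<otimes> inv w" using c inv_solve_right[of "s [^] m" "v \<otimes> (inv h \<otimes> h')" w] by simp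
    also have "\<dots> \<in> V <#> H" 
      by (rule VH(1)[OF VH(1)[OF Vsub[OF v(1)] Hsub[OF Hm[OF Hi[OF v(2)] w(2)]]] VH(2)[OF Vsub[OF w(1)]]])
    finally have "k dvd m" by (rule kdvd)
    then obtain l where "m = k * l" by blast
    hence l: "s [^] m = j [^] l" using s by (simp add: j_def nat_pow_pow)
    have "\<psi> l w = v \<otimes> (inv h \<otimes> h' \<otimes> inv (h0 [^] l))"
      unfolding \<psi>_def using e2 l c chc by (simp add: m_assoc)
    hence "inv v \<otimes> \<psi> l w = inv h \<otimes> h' \<otimes> inv (h0 [^] l)" using c chc by simp
    hence "inv v \<otimes> \<psi> l w \<in> H" using v w ch by (auto intro!: Hm Hi subgroup_nat_pow_closed[OF H])
    hence "\<pi> (\<psi> l w) = \<pi> v" using Qeq \<phi>N[OF w(1), of l] v(1) by blast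
    thus ?thesis using \<phi>N[OF w(1), of l] by metis
  qed
  have rep: "\<exists>xa\<in>V. \<forall>v\<in>V. (\<exists>i::nat. \<exists>h\<in>H. v = s [^] i \<otimes> x \<otimes> h) \<longrightarrow> (\<exists>l. \<pi> v = (\<phi> ^^ l) (\<pi> xa))"
    if x: "x \<in> carrier G" for x
  proof (cases "\<exists>w\<in>V. \<exists>i::nat. \<exists>h\<in>H. w = s [^] i \<otimes> x \<otimes> h")
    case True
    then obtain w i h where w: "w \<in> V" "h \<in> H" "w = s [^] (i::nat) \<otimes> x \<otimes> h" by blast
    show ?thesis
    proof (rule bexI[OF _ w(1)], intro ballI impI)
      fix v assume v: "v \<in> V" and "\<exists>i::nat. \<exists>h\<in>H. v = s [^] i \<otimes> x \<otimes> h"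
      then obtain i' h' where "h' \<in> H" "v = s [^] (i'::nat) \<otimes> x \<otimes> h'" by blast
      from same[OF v this w x] show "\<exists>l. \<pi> v = (\<phi> ^^ l) (\<pi> w)" .
    qed
  next
    \<comment> \<open>A double coset that misses \<open>V\<close> imposes no condition, so any
      element of \<open>V\<close> may stand for it.\<close>
    case False
    thus ?thesis using subgroup.one_closed[OF sV] by blast
  qed
  from rep[OF ab(1)] obtain xa where xa: "xa \<in> V"
    "\<forall>v\<in>V. (\<exists>i::nat. \<exists>h\<in>H. v = s [^] i \<otimes> a \<otimes> h) \<longrightarrow> (\<exists>l. \<pi> v = (\<phi> ^^ l) (\<pi> xa))" by (elim bexE)
  from rep[OF ab(2)] obtain xb where xb: "xb \<in> V"
    "\<forall>v\<in>V. (\<exists>i::nat. \<exists>h\<in>H. v = s [^] i \<otimes> b \<otimes> h) \<longrightarrow> (\<exists>l. \<pi> v = (\<phi> ^^ l) (\<pi> xb))" by (elim bexE)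
  have expQ: "x [^]\<^bsub>Q\<^esub> p = \<one>\<^bsub>Q\<^esub>" if x: "x \<in> carrier Q" for x
  proof -
    obtain v where v: "v \<in> V" "x = \<pi> v" using x Qc by auto
    show ?thesis unfolding v(2) Qp[OF v(1)] Q1
      by (subst Qeq) (use v pow subgroup_nat_pow_closed[OF sV] subgroup.one_closed[OF sV] Vc in auto)
  qed
  have finQ: "finite (carrier Q)" using finV Qc by simp
  have trans: "\<exists>i. w = (\<phi> ^^ i) z" if "z \<in> carrier Q" "w \<in> carrier Q" for z w
  proof (rule two_odd_orbits_transitive[where M = "carrier Q" and x = "\<pi> xa" and y = "\<pi> xb" and n = N])
    fix x assume "x \<in> carrier Q"
    then obtain v where v: "v \<in> V" "x = \<pi> v" using Qc by auto
    have "\<psi> N v = v \<otimes> inv (h0 [^] N)" using jN v Vc by (simp add: \<psi>_def)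
    hence "inv v \<otimes> \<psi> N v \<in> H" using v Vc chc ch by (auto intro!: Hi subgroup_nat_pow_closed[OF H])
    thus "(\<phi> ^^ N) x = x" using \<phi>N[OF v(1), of N] v Qeq by auto
    show "\<phi> x \<in> carrier Q" using \<phi>N[OF v(1), of 1] v Qc by auto
    obtain i :: nat and h where "h \<in> H" "v = s [^] i \<otimes> a \<otimes> h \<or> v = s [^] i \<otimes> b \<otimes> h"
      using two[OF Vc[OF v(1)]] by blast
    hence "(\<exists>i::nat. \<exists>h\<in>H. v = s [^] i \<otimes> a \<otimes> h) \<or> (\<exists>i::nat. \<exists>h\<in>H. v = s [^] i \<otimes> b \<otimes> h)"
      by (elim disjE) (rule disjI1 disjI2, rule exI, rule bexI, assumption+)+
    thus "\<exists>i. x = (\<phi> ^^ i) (\<pi> xa) \<or> x = (\<phi> ^^ i) (\<pi> xb)"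
    proof
      assume "\<exists>i::nat. \<exists>h\<in>H. v = s [^] i \<otimes> a \<otimes> h"
      from xa(2)[rule_format, OF v(1) this] show ?thesis unfolding v(2) by (elim exE) (rule exI, rule disjI1)
    next
      assume "\<exists>i::nat. \<exists>h\<in>H. v = s [^] i \<otimes> b \<otimes> h"
      from xb(2)[rule_format, OF v(1) this] show ?thesis unfolding v(2) by (elim exE) (rule exI, rule disjI2)
    qed
  qed (use N Q.odd_order_of_odd_exponent[OF finQ p(2) expQ] xa(1) xb(1) Qc that in auto)
  define u where "u i = (\<phi> ^^ i) (\<pi> \<one>)" for i
  have one: "\<one> \<in> V" using subgroup.one_closed[OF sV] .
  obtain e where e: "e \<in> carrier Q" "T e = e" "\<forall>x\<in>carrier Q. \<exists>i::nat. x = e [^]\<^bsub>Q\<^esub> i"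
    using Q.affine_orbit_cyclic[OF finQ p expQ Thom Tinj, of "\<pi> c" u] trans one ch
    by (auto simp: u_def \<phi>_def Q1 Qc)
  obtain e0 where e0: "e0 \<in> V" "e = \<pi> e0" using e Qc by auto
  show ?A
  proof (rule bexI[OF _ e0(1)], intro ballI)
    fix v assume v: "v \<in> V"
    hence "\<pi> v \<in> carrier Q" using Qc by blast
    from e(3)[rule_format, OF this] obtain i :: nat where "\<pi> v = e [^]\<^bsub>Q\<^esub> i" by (elim exE)
    hence "\<pi> v = \<pi> (e0 [^] i)" using e0 Qp by simp
    moreover have ei: "e0 [^] i \<in> V" using subgroup_nat_pow_closed[OF sV] e0 by blast
    ultimately have "inv (e0 [^] i) \<otimes> v \<in> V \<inter> H" using Qeq[OF v ei] v by (auto intro: Vm Vi)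
    moreover have "v = e0 [^] i \<otimes> (inv (e0 [^] i) \<otimes> v)" using v ei Vc by simp
    ultimately show "\<exists>i::nat. \<exists>h\<in>V \<inter> H. v = e0 [^] i \<otimes> h" by (intro exI bexI)
  qed
  show ?B
  proof
    fix v assume v: "v \<in> V"
    obtain i where "\<pi> v = (\<phi> ^^ i) (\<pi> \<one>)" using trans[of "\<pi> \<one>" "\<pi> v"] v one Qc by auto
    hence "\<pi> v = \<pi> (\<psi> i \<one>)" "\<psi> i \<one> \<in> V" using \<phi>N[OF one, of i] by auto
    hence h: "inv (\<psi> i \<one>) \<otimes> v \<in> H" using Qeq[OF v, of "\<psi> i \<one>"] by simp
    have "v = \<psi> i \<one> \<otimes> (inv (\<psi> i \<one>) \<otimes> v)" using v \<open>\<psi> i \<one> \<in> V\<close> Vc by simp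
    also have "\<dots> = s [^] (k * i) \<otimes> (inv (h0 [^] i) \<otimes> (inv (\<psi> i \<one>) \<otimes> v))"
    proof -
      have "\<psi> i \<one> = s [^] (k * i) \<otimes> inv (h0 [^] i)" using s j by (simp add: \<psi>_def j_def nat_pow_pow)
      thus ?thesis using s chc Hc[OF h] by (metis inv_closed m_assoc nat_pow_closed)
    qed
    finally show "\<exists>i::nat. \<exists>h\<in>H. v = s [^] i \<otimes> h"
      by (intro exI bexI) (assumption, intro Hm Hi subgroup_nat_pow_closed[OF H] ch h)
  qed
  show "s [^] i \<otimes> v \<otimes> inv (s [^] i) \<otimes> inv v \<in> H" if i: "s [^] i \<in> V <#> H" and v: "v \<in> V" for i :: nat and v
  proof -
    interpret T: group_hom Q Q T by unfold_locales (rule Thom)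
    obtain l where l: "i = k * l" using kdvd[OF i] by blast
    hence si: "s [^] i = j [^] l" using s by (simp add: j_def nat_pow_pow)
    \<comment> \<open>\<open>T\<close> fixes the generator \<open>e\<close> and hence the whole
      quotient, so every power of \<open>j\<close> acts trivially by conjugation.\<close>
    have "T x = x" if "x \<in> carrier Q" for x
      using e that by (metis T.hom_nat_pow)
    hence "(T ^^ l) x = x" if "x \<in> carrier Q" for x using that by (induction l) auto
    hence e1: "\<pi> (inv v) = \<pi> (j [^] l \<otimes> inv v \<otimes> inv (j [^] l))" "j [^] l \<otimes> inv v \<otimes> inv (j [^] l) \<in> V"
      using TN[OF Vi[OF v], of l] Qc v Vi by auto
    have "inv (j [^] l \<otimes> inv v \<otimes> inv (j [^] l)) \<otimes> inv v \<in> H"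
      by (rule Qeq[OF Vi[OF v] e1(2), THEN iffD1, OF e1(1)])
    moreover have "inv (j [^] l \<otimes> inv v \<otimes> inv (j [^] l)) \<otimes> inv v
        = j [^] l \<otimes> v \<otimes> inv (j [^] l) \<otimes> inv v"
      using nat_pow_closed[OF j, of l] Vc[OF v] by (simp only: inv_mult_group m_assoc m_closed inv_closed inv_inv)
    ultimately show ?thesis unfolding si by simp
  qed
qed

section \<open>Counting products, cores, and abelian sections of solvable groups\<close>

lemma (in group) card_set_mult:
  assumes fin: "finite (carrier G)" and H: "subgroup H G" and K: "subgroup K G"
  shows "card (H <#> K) * card (H \<inter> K) = card H * card K"
proof -
  note c = subgroup.mem_carrier[OF H] subgroup.mem_carrier[OF K]
  have f: "finite H" "finite K" using fin H K by (meson finite_subset subgroup.subset)+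
  have HK: "H <#> K = (\<lambda>(h, k). h \<otimes> k) ` (H \<times> K)" unfolding set_mult_def by auto
  have "card {z \<in> H \<times> K. (\<lambda>(h, k). h \<otimes> k) z = y} = card (H \<inter> K)" if y: "y \<in> H <#> K" for y
  proof -
    obtain h0 k0 where hk: "h0 \<in> H" "k0 \<in> K" "y = h0 \<otimes> k0" using y unfolding HK by auto
    \<comment> \<open>All factorisations of \<open>h0 \<otimes> k0\<close> arise from this one by
      moving an element of the intersection across the product.\<close>
    have "bij_betw (\<lambda>d. (h0 \<otimes> d, inv d \<otimes> k0)) (H \<inter> K) {z \<in> H \<times> K. (\<lambda>(h, k). h \<otimes> k) z = y}"
    proof (rule bij_betwI[where g = "\<lambda>(h, k). inv h0 \<otimes> h"])
      show "(\<lambda>d. (h0 \<otimes> d, inv d \<otimes> k0)) \<in> H \<inter> K \<rightarrow> {z \<in> H \<times> K. (\<lambda>(h, k). h \<otimes> k) z = y}"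
      proof
        fix d assume d: "d \<in> H \<inter> K"
        have "h0 \<otimes> d \<in> H" "inv d \<otimes> k0 \<in> K"
          using d hk subgroup.m_closed[OF H] subgroup.m_closed[OF K] subgroup.m_inv_closed[OF K] by blast+
        moreover have "h0 \<otimes> d \<otimes> (inv d \<otimes> k0) = y" using d hk c by (simp add: m_assoc)
        ultimately show "(h0 \<otimes> d, inv d \<otimes> k0) \<in> {z \<in> H \<times> K. (\<lambda>(h, k). h \<otimes> k) z = y}" by simp
      qed
      show "(\<lambda>(h, k). inv h0 \<otimes> h) \<in> {z \<in> H \<times> K. (\<lambda>(h, k). h \<otimes> k) z = y} \<rightarrow> H \<inter> K"
      proof
        fix z assume "z \<in> {z \<in> H \<times> K. (\<lambda>(h, k). h \<otimes> k) z = y}"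
        then obtain h k where z: "z = (h, k)" "h \<in> H" "k \<in> K" "h \<otimes> k = h0 \<otimes> k0" using hk by auto
        have "inv h0 \<otimes> h = inv h0 \<otimes> (h \<otimes> k) \<otimes> inv k" using z(2,3) hk(1,2) c by (simp add: m_assoc)
        also have "\<dots> = k0 \<otimes> inv k" unfolding z(4) using z(2,3) hk c by (simp add: m_assoc)
        finally have "inv h0 \<otimes> h \<in> K"
          using hk(2) z(3) subgroup.m_closed[OF K] subgroup.m_inv_closed[OF K] by simp
        thus "(case z of (h, k) \<Rightarrow> inv h0 \<otimes> h) \<in> H \<inter> K"
          using z(1,2) hk(1) subgroup.m_closed[OF H] subgroup.m_inv_closed[OF H] by simp
      qed
      show "(case (h0 \<otimes> d, inv d \<otimes> k0) of (h, k) \<Rightarrow> inv h0 \<otimes> h) = d" if "d \<in> H \<inter> K" for d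
        using that hk c by simp
      show "(h0 \<otimes> (case z of (h, k) \<Rightarrow> inv h0 \<otimes> h), inv (case z of (h, k) \<Rightarrow> inv h0 \<otimes> h) \<otimes> k0) = z"
        if zz: "z \<in> {z \<in> H \<times> K. (\<lambda>(h, k). h \<otimes> k) z = y}" for z
      proof -
        obtain h k where z: "z = (h, k)" "h \<in> H" "k \<in> K" "h \<otimes> k = h0 \<otimes> k0" using hk zz by auto
        have "inv (inv h0 \<otimes> h) \<otimes> k0 = inv h \<otimes> (h0 \<otimes> k0)" using z(2,3) hk(1,2) c by (simp add: inv_mult_group m_assoc)
        also have "\<dots> = k" unfolding z(4)[symmetric] using z(2,3) c by simp
        finally show ?thesis using z hk c by simp
      qed
    qed
    from bij_betw_same_card[OF this] show ?thesis by (rule sym)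
  qed
  hence "(\<Sum>y\<in>H <#> K. card {z \<in> H \<times> K. (\<lambda>(h, k). h \<otimes> k) z = y}) = card (H <#> K) * card (H \<inter> K)"
    by simp
  moreover have "card (H \<times> K) = (\<Sum>y\<in>H <#> K. card {z \<in> H \<times> K. (\<lambda>(h, k). h \<otimes> k) z = y})"
    using sum.image_gen[of "H \<times> K" "\<lambda>_. 1::nat" "\<lambda>(h, k). h \<otimes> k"] f unfolding HK by simp
  ultimately show ?thesis by (simp add: card_cartesian_product)
qed

lemma (in group) card_subgroup_dvd:
  assumes "subgroup H G" "subgroup K G" "H \<subseteq> K" shows "card H dvd card K"
proof -
  interpret K: group "G\<lparr>carrier := K\<rparr>" by (rule subgroup_imp_group[OF assms(2)])
  show ?thesis using K.lagrange[OF subgroup_incl[OF assms]] 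
    by (metis dvd_triv_right Coset.order_def partial_object.select_convs(1) partial_object.surjective partial_object.update_convs(1))
qed

text \<open>For a subgroup \<open>S\<close> this is the largest normal subgroup of the group
  contained in \<open>S\<close>.\<close>

definition (in group) core :: "'a set \<Rightarrow> 'a set" where
  "core S = {y \<in> carrier G. \<forall>g\<in>carrier G. g \<otimes> y \<otimes> inv g \<in> S}"

lemma (in group) core_subset: "core S \<subseteq> S"
  unfolding core_def by (auto dest: bspec[of _ _ \<one>])

lemma (in group) core_normal:
  assumes S: "subgroup S G" shows "core S \<lhd> G"
proof (rule normal_invI)
  show "subgroup (core S) G"
  proof (rule subgroupI)
    show "core S \<noteq> {}" using subgroup.one_closed[OF S] by (auto simp: core_def)
  next
    fix y assume y: "y \<in> core S"
    show "inv y \<in> core S" unfolding core_def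
    proof (safe)
      fix g assume g: "g \<in> carrier G"
      have "inv (g \<otimes> y \<otimes> inv g) \<in> S" using y g subgroup.m_inv_closed[OF S] unfolding core_def by blast
      thus "g \<otimes> inv y \<otimes> inv g \<in> S" using y g by (simp add: core_def inv_mult_group m_assoc)
    qed (use y in \<open>simp add: core_def\<close>)
  next
    fix y z assume y: "y \<in> core S" and z: "z \<in> core S"
    show "y \<otimes> z \<in> core S" unfolding core_def
    proof (safe)
      fix g assume g: "g \<in> carrier G"
      have "(g \<otimes> y \<otimes> inv g) \<otimes> (g \<otimes> z \<otimes> inv g) \<in> S" using y z g subgroup.m_closed[OF S] unfolding core_def by blast
      thus "g \<otimes> (y \<otimes> z) \<otimes> inv g \<in> S" using y z g by (simp add: core_def m_assoc)
    qed (use y z in \<open>simp add: core_def\<close>)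
  qed (auto simp: core_def)
next
  fix x h assume x: "x \<in> carrier G" and h: "h \<in> core S"
  show "x \<otimes> h \<otimes> inv x \<in> core S" unfolding core_def
  proof (safe)
    fix g assume g: "g \<in> carrier G"
    have "(g \<otimes> x) \<otimes> h \<otimes> inv (g \<otimes> x) \<in> S" using h x g unfolding core_def by blast
    thus "g \<otimes> (x \<otimes> h \<otimes> inv x) \<otimes> inv g \<in> S" using h x g by (simp add: core_def m_assoc inv_mult_group)
  qed (use h x in \<open>simp add: core_def\<close>)
qed

lemma (in group) commute_imp_commutator_one:
  "\<lbrakk>x \<in> carrier G; y \<in> carrier G\<rbrakk> \<Longrightarrow> x \<otimes> y \<otimes> inv x \<otimes> inv y = \<one> \<longleftrightarrow> x \<otimes> y = y \<otimes> x"
proof -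
  assume c: "x \<in> carrier G" "y \<in> carrier G"
  have "x \<otimes> y \<otimes> inv x \<otimes> inv y = (x \<otimes> y) \<otimes> inv (y \<otimes> x)" using c by (simp add: inv_mult_group m_assoc)
  moreover have "(x \<otimes> y) \<otimes> inv (y \<otimes> x) = \<one> \<longleftrightarrow> x \<otimes> y = y \<otimes> x"
    using inv_solve_right'[of \<one> "x \<otimes> y" "y \<otimes> x"] c by (simp del: inv_mult_group)
  ultimately show "x \<otimes> y \<otimes> inv x \<otimes> inv y = \<one> \<longleftrightarrow> x \<otimes> y = y \<otimes> x" by simp
qed

lemma (in group) exists_power_of_prime_order:
  assumes x: "x \<in> carrier G" "x \<noteq> \<one>" "finite (carrier G)"
  obtains q k :: nat where "prime q" "x [^] k \<noteq> \<one>" "(x [^] k) [^] q = \<one>"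
proof -
  have o: "ord x > 1" using x ord_ge_1[of x] ord_eq_1[of x] by fastforce
  then obtain q where q: "prime q" "q dvd ord x" using prime_factor_nat[of "ord x"] by auto
  then obtain k where k: "ord x = k * q" by (metis dvd_def mult.commute)
  have k0: "k > 0" using k o by (cases k) auto
  hence "k < ord x" using k prime_gt_1_nat[OF q(1)] by simp
  hence "x [^] k \<noteq> \<one>" using x k0 by (auto simp: pow_eq_id dest: dvd_imp_le)
  moreover have "(x [^] k) [^] q = \<one>" using x k by (simp add: nat_pow_pow flip: k)
  ultimately show ?thesis using that q(1) by blast
qed

text \<open>The last term \<open>E\<close> of the derived series of \<open>C\<close> that is not
  inside \<open>P\<close> has its commutators in \<open>P\<close>, so \<open>E P / P\<close> is
  abelian and nontrivial. \<open>A / P\<close> is its \<open>q\<close>-torsion, where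
  \<open>q\<close> is the order of some element of it; torsion is invariant under conjugation, which
  makes \<open>A\<close> normal.\<close>

lemma (in group) solvable_normal_section:
  assumes fin: "finite (carrier G)" and solv: "solvable G"
    and P: "P \<lhd> G" and C: "C \<lhd> G" and PC: "P \<subset> C"
  obtains A and q :: nat where "A \<lhd> G" "P \<subset> A" "A \<subseteq> C" "prime q" "\<And>a. a \<in> A \<Longrightarrow> a [^] q \<in> P"
    "\<And>a b. a \<in> A \<Longrightarrow> b \<in> A \<Longrightarrow> a \<otimes> b \<otimes> inv a \<otimes> inv b \<in> P"
proof -
  note sP = normal_imp_subgroup[OF P] and sC = normal_imp_subgroup[OF C]
  interpret P: normal P G by (rule P)
  define D where "D n = (derived G ^^ n) C" for n
  have DS: "D (Suc n) = derived G (D n)" for n by (simp add: D_def)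
  have Dn: "D n \<lhd> G" for n
    by (induction n) (simp_all add: DS derived_is_normal, simp add: D_def C)
  have DC: "D n \<subseteq> C" for n
  proof (induction n)
    case (Suc n)
    have "derived G (D n) \<subseteq> D n" by (rule derived_incl[OF order_refl normal_imp_subgroup[OF Dn]])
    thus ?case using Suc DS by blast
  qed (simp add: D_def)
  obtain m where "(derived G ^^ m) (carrier G) = {\<one>}"
    using solv solvable_iff_trivial_derived_seq by blast
  moreover have "D m \<subseteq> (derived G ^^ m) (carrier G)"
    unfolding D_def by (rule mono_exp_of_derived[OF subgroup.subset[OF sC]])
  ultimately have "D m \<subseteq> P" using subgroup.one_closed[OF sP] by auto
  define k where "k = (LEAST k. D k \<subseteq> P)"
  have k: "D k \<subseteq> P" unfolding k_def by (rule LeastI[of _ m]) (rule \<open>D m \<subseteq> P\<close>)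
  have "k \<noteq> 0" using k PC by (auto simp: D_def)
  then obtain l where l: "k = Suc l" by (cases k) auto
  have nl: "\<not> D l \<subseteq> P" using not_less_Least[of l "\<lambda>k. D k \<subseteq> P"] l unfolding k_def by auto
  define E where "E = D l"
  have E: "E \<lhd> G" "E \<subseteq> C" "\<not> E \<subseteq> P" using Dn DC nl by (auto simp: E_def)
  note sE = normal_imp_subgroup[OF E(1)]
  have comE: "x \<otimes> y \<otimes> inv x \<otimes> inv y \<in> P" if "x \<in> E" "y \<in> E" for x y
  proof -
    have "x \<otimes> y \<otimes> inv x \<otimes> inv y \<in> derived_set G E" using that by blast
    hence "x \<otimes> y \<otimes> inv x \<otimes> inv y \<in> derived G E" unfolding derived_def by (rule generate.incl)
    thus ?thesis using k l DS by (auto simp: E_def)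
  qed
  obtain x where x: "x \<in> E" "x \<notin> P" using E by blast
  have xc: "x \<in> carrier G" using subgroup.mem_carrier[OF sE x(1)] .
  interpret Q: group "G Mod P" by (rule P.factorgroup_is_group)
  have fQ: "finite (carrier (G Mod P))" unfolding carrier_FactGroup using fin by simp
  have x1: "P #> x \<noteq> \<one>\<^bsub>G Mod P\<^esub>" using x rcos_self[OF xc sP] by auto
  obtain q r :: nat where q: "prime q" "(P #> x) [^]\<^bsub>G Mod P\<^esub> r \<noteq> \<one>\<^bsub>G Mod P\<^esub>"
    "((P #> x) [^]\<^bsub>G Mod P\<^esub> r) [^]\<^bsub>G Mod P\<^esub> q = \<one>\<^bsub>G Mod P\<^esub>"
  proof (rule Q.exists_power_of_prime_order[OF _ x1 fQ])
    show "P #> x \<in> carrier (G Mod P)" unfolding carrier_FactGroup using xc by blast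
  qed
  define z where "z = x [^] r"
  have zc: "z \<in> carrier G" "z \<in> E" using xc subgroup_nat_pow_closed[OF sE x(1)] by (auto simp: z_def)
  have eqz: "(P #> x) [^]\<^bsub>G Mod P\<^esub> r = P #> z" unfolding z_def using xc by (simp add: P.FactGroup_pow)
  have zP: "z \<notin> P"
    using q(2) zc subgroup.rcos_const[OF sP is_group] unfolding eqz by auto
  have "P #> (z [^] q) = P" using q(3) zc unfolding eqz by (simp add: P.FactGroup_pow)
  hence zq: "z [^] q \<in> P" using rcos_self[OF _ sP, of "z [^] q"] zc by auto
  define A where "A = {a \<in> E <#> P. a [^] q \<in> P}"
  have EP: "E <#> P \<lhd> G" 
  proof (rule normal_invI)
    show "subgroup (E <#> P) G" by (rule mult_norm_subgroup[OF E(1) sP])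
    fix g h assume g: "g \<in> carrier G" and "h \<in> E <#> P"
    then obtain e p where ep: "e \<in> E" "p \<in> P" "h = e \<otimes> p" unfolding set_mult_def by blast
    have c: "e \<in> carrier G" "p \<in> carrier G" using ep subgroup.mem_carrier[OF sE] subgroup.mem_carrier[OF sP] by auto
    have "g \<otimes> h \<otimes> inv g = (g \<otimes> e \<otimes> inv g) \<otimes> (g \<otimes> p \<otimes> inv g)" using g c ep by (simp add: m_assoc)
    thus "g \<otimes> h \<otimes> inv g \<in> E <#> P"
      using normal_conj_closed(1)[OF E(1) ep(1) g] normal_conj_closed(1)[OF P ep(2) g] unfolding set_mult_def by blast
  qed
  note sEP = normal_imp_subgroup[OF EP]
  have cosEP: "\<exists>e\<in>E. P #> a = P #> e" if a: "a \<in> E <#> P" for a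
  proof -
    obtain e p where ep: "e \<in> E" "p \<in> P" "a = e \<otimes> p" using a unfolding set_mult_def by blast
    have c: "e \<in> carrier G" "p \<in> carrier G" using ep subgroup.mem_carrier[OF sE] subgroup.mem_carrier[OF sP] by auto
    have "a = (e \<otimes> p \<otimes> inv e) \<otimes> e" using c ep by (simp add: m_assoc)
    hence "a \<in> P #> e" using normal_conj_closed(1)[OF P ep(2) c(1)] unfolding r_coset_def by blast
    thus ?thesis using repr_independence[OF _ c(1) sP] ep(1) by blast
  qed
  have mem: "(P #> u = P #> v) \<longleftrightarrow> u \<otimes> inv v \<in> P" if "u \<in> carrier G" "v \<in> carrier G" for u v
  proof -
    have "P #> u = P #> v \<longleftrightarrow> u \<in> P #> v"
      using repr_independence[OF _ that(2) sP, of u] rcos_self[OF that(1) sP] by auto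
    thus ?thesis using subgroup.rcos_module[OF sP is_group that(2,1)] by simp
  qed
  have comP: "P #> (a \<otimes> b) = P #> (b \<otimes> a)" if ab: "a \<in> E <#> P" "b \<in> E <#> P" for a b
  proof -
    obtain e f where ef: "e \<in> E" "f \<in> E" "P #> a = P #> e" "P #> b = P #> f" using cosEP[OF ab(1)] cosEP[OF ab(2)] by blast
    have c: "e \<in> carrier G" "f \<in> carrier G" "a \<in> carrier G" "b \<in> carrier G"
      using ef(1,2) ab subgroup.mem_carrier[OF sE] subgroup.mem_carrier[OF sEP] by auto
    have "P #> (e \<otimes> f) = P #> (f \<otimes> e)"
      using comE[OF ef(1,2)] c by (subst mem) (simp_all add: inv_mult_group m_assoc)
    thus ?thesis using c ef(3,4) by (simp add: P.rcos_sum[symmetric])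
  qed
  have com: "a \<otimes> b \<otimes> inv a \<otimes> inv b \<in> P" if "a \<in> E <#> P" "b \<in> E <#> P" for a b
    using comP[OF that] that subgroup.mem_carrier[OF sEP] by (subst (asm) mem) (simp_all add: inv_mult_group m_assoc)
  have powm: "(a \<otimes> b) [^] q \<in> P" if "a \<in> A" "b \<in> A" for a b
  proof -
    have ab: "a \<in> E <#> P" "b \<in> E <#> P" "a [^] q \<in> P" "b [^] q \<in> P" using that by (auto simp: A_def)
    have c: "a \<in> carrier G" "b \<in> carrier G" using ab subgroup.mem_carrier[OF sEP] by auto
    have comm: "(P #> a) \<otimes>\<^bsub>G Mod P\<^esub> (P #> b) = (P #> b) \<otimes>\<^bsub>G Mod P\<^esub> (P #> a)"
      using comP[OF ab(1,2)] c by (simp add: P.rcos_sum)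
    have in': "P #> a \<in> carrier (G Mod P)" "P #> b \<in> carrier (G Mod P)" using c unfolding carrier_FactGroup by auto
    have "P #> ((a \<otimes> b) [^] q) = ((P #> a) \<otimes>\<^bsub>G Mod P\<^esub> (P #> b)) [^]\<^bsub>G Mod P\<^esub> q"
      using c by (simp add: P.FactGroup_pow P.rcos_sum)
    also have "\<dots> = ((P #> a) [^]\<^bsub>G Mod P\<^esub> q) \<otimes>\<^bsub>G Mod P\<^esub> ((P #> b) [^]\<^bsub>G Mod P\<^esub> q)"
      by (rule Q.pow_mult_distrib[OF comm in'])
    also have "\<dots> = P #> (a [^] q \<otimes> b [^] q)" using c by (simp add: P.FactGroup_pow P.rcos_sum)
    also have "\<dots> = P" using subgroup.m_closed[OF sP ab(3,4)] subgroup.rcos_const[OF sP is_group] by blast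
    finally show ?thesis using rcos_self[OF _ sP, of "(a \<otimes> b) [^] q"] c by auto
  qed
  have EEP: "x \<in> E <#> P" if x: "x \<in> E" for x
  proof -
    have "x = x \<otimes> \<one>" using subgroup.mem_carrier[OF sE x] by simp
    thus ?thesis using x subgroup.one_closed[OF sP] unfolding set_mult_def by blast
  qed
  have PEP: "x \<in> E <#> P" if x: "x \<in> P" for x
  proof -
    have "x = \<one> \<otimes> x" using subgroup.mem_carrier[OF sP x] by simp
    thus ?thesis using x subgroup.one_closed[OF sE] unfolding set_mult_def by blast
  qed
  have PA: "P \<subseteq> A" using PEP subgroup_nat_pow_closed[OF sP] by (auto simp: A_def)
  have An: "A \<lhd> G"
  proof (rule normal_invI)
    show "subgroup A G"
    proof (rule subgroupI)
      show "A \<subseteq> carrier G" using subgroup.subset[OF sEP] by (auto simp: A_def)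
      show "A \<noteq> {}" using PA subgroup.one_closed[OF sP] by blast
      show "inv a \<in> A" if "a \<in> A" for a
        using that subgroup.m_inv_closed[OF sEP] subgroup.m_inv_closed[OF sP] subgroup.mem_carrier[OF sEP]
        by (auto simp: A_def nat_pow_inv)
      show "a \<otimes> b \<in> A" if "a \<in> A" "b \<in> A" for a b
        using that powm subgroup.m_closed[OF sEP] by (auto simp: A_def)
    qed
    fix g h assume g: "g \<in> carrier G" and h: "h \<in> A"
    have hc: "h \<in> carrier G" using h subgroup.mem_carrier[OF sEP] by (auto simp: A_def)
    have "(g \<otimes> h \<otimes> inv g) [^] n = g \<otimes> h [^] n \<otimes> inv g" for n :: nat
      using g hc by (induction n) (simp_all add: m_assoc)
    thus "g \<otimes> h \<otimes> inv g \<in> A"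
      using h g normal_conj_closed(1)[OF EP _ g] normal_conj_closed(1)[OF P _ g] by (auto simp: A_def)
  qed
  show ?thesis
  proof (rule that[OF An _ _ q(1)])
    have "z \<in> A" using zq zc EEP unfolding A_def by blast
    thus "P \<subset> A" using PA zP by blast
    show "A \<subseteq> C"
    proof
      fix y assume "y \<in> A"
      then obtain e p where "e \<in> E" "p \<in> P" "y = e \<otimes> p" unfolding A_def set_mult_def by blast
      thus "y \<in> C" using E(2) PC subgroup.m_closed[OF sC, of e p] by blast
    qed
      show "a [^] q \<in> P" if "a \<in> A" for a using that by (simp add: A_def)
    show "a \<otimes> b \<otimes> inv a \<otimes> inv b \<in> P" if "a \<in> A" "b \<in> A" for a b
      using that com unfolding A_def by blast
  qed
qed

text \<open>The situation after the reduction. \<open>L\<close> plays the point stabiliser of the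
  first action and \<open>R\<close> that of the second; \<open>a\<close> and \<open>b\<close>
  represent the orbits of \<open>s\<close> on \<open>G / R\<close> and may represent the same one.
  \<open>maximal\<close> acts through normal subgroups: a nontrivial normal \<open>V\<close> is not
  inside \<open>L\<close>, so \<open>V L R\<close> is everything.\<close>

locale core_free_pair = group G for G (structure) +
  fixes L R and s a b
  assumes fin: "finite (carrier G)" and solv: "solvable G"
    and L: "subgroup L G" and R: "subgroup R G"
    and s: "s \<in> carrier G" and odd_s: "odd (ord s)"
    and transitive: "\<And>g. g \<in> carrier G \<Longrightarrow> \<exists>i::nat. \<exists>x\<in>L. g = s [^] i \<otimes> x"
    and ab: "a \<in> carrier G" "b \<in> carrier G"
    and two_orbits: "\<And>g. g \<in> carrier G \<Longrightarrow> \<exists>i::nat. \<exists>y\<in>R. g = s [^] i \<otimes> a \<otimes> y \<or> g = s [^] i \<otimes> b \<otimes> y"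
    and core_free: "\<And>N. N \<lhd> G \<Longrightarrow> N \<subseteq> L \<Longrightarrow> N = {\<one>}"
    and not_product: "L <#> R \<noteq> carrier G"
    and maximal: "\<And>L'. subgroup L' G \<Longrightarrow> L \<subset> L' \<Longrightarrow> L' <#> R = carrier G"
begin

section \<open>Minimal normal subgroups of a core-free pair\<close>

lemmas L_carrier = subgroup.mem_carrier[OF L] and R_carrier = subgroup.mem_carrier[OF R]
lemmas L_mult = subgroup.m_closed[OF L] and L_inv = subgroup.m_inv_closed[OF L]
lemmas R_mult = subgroup.m_closed[OF R] and R_inv = subgroup.m_inv_closed[OF R]

lemma core_freeD:
  assumes "y \<in> carrier G" "\<And>g. g \<in> carrier G \<Longrightarrow> g \<otimes> y \<otimes> inv g \<in> L" shows "y = \<one>"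
proof -
  have "core L = {\<one>}" using core_free[OF core_normal[OF L] core_subset] .
  moreover have "y \<in> core L" using assms by (simp add: core_def)
  ultimately show ?thesis by simp
qed

lemma transitive': "g \<in> carrier G \<Longrightarrow> \<exists>i::nat. \<exists>x\<in>L. g = x \<otimes> inv (s [^] i)"
proof -
  assume g: "g \<in> carrier G"
  obtain i :: nat and x where x: "x \<in> L" "inv g = s [^] i \<otimes> x" using transitive[of "inv g"] g by blast
  have "g = inv (s [^] i \<otimes> x)" unfolding x(2)[symmetric] using g by simp
  also have "\<dots> = inv x \<otimes> inv (s [^] i)" using x(1) L_carrier s by (simp add: inv_mult_group)
  finally show ?thesis using L_inv[OF x(1)] by blast
qed

text \<open>Powers of \<open>s\<close> commute with each other and \<open>G = L <s>\<close>, so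
  every conjugate of a power of \<open>s\<close> is a conjugate by an element of \<open>L\<close>.
  If the power lies in \<open>L\<close>, so do all its conjugates, and core-freeness applies. Thus
  \<open><s>\<close> acts regularly on \<open>G / L\<close>.\<close>

lemma power_s_in_L: "s [^] (i::nat) \<in> L \<Longrightarrow> s [^] i = \<one>"
proof (rule core_freeD)
  fix g assume i: "s [^] i \<in> L" and "g \<in> carrier G"
  then obtain j :: nat and x where x: "x \<in> L" "g = x \<otimes> inv (s [^] j)" using transitive' by blast
  have "s [^] j \<otimes> s [^] i = s [^] i \<otimes> s [^] j" using s by (simp add: nat_pow_mult add.commute)
  hence "inv (s [^] j) \<otimes> s [^] i \<otimes> s [^] j = s [^] i" using s
    by (metis inv_cancel_left(1) m_assoc nat_pow_closed inv_closed)
  hence "g \<otimes> s [^] i \<otimes> inv g = x \<otimes> (s [^] i) \<otimes> inv x"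
    unfolding x(2) using L_carrier[OF x(1)] s by (simp add: inv_mult_group m_assoc) (metis m_assoc inv_closed m_closed nat_pow_closed)
  thus "g \<otimes> s [^] i \<otimes> inv g \<in> L" using x(1) i L_mult L_inv by simp
qed (use s in simp)

text \<open>Right multiplication by \<open>s\<close> permutes the right cosets of \<open>L\<close>
  in a single cycle, so their number divides the odd order of \<open>s\<close>.\<close>

lemma odd_index: "\<exists>k. odd k \<and> card (carrier G) = k * card L"
proof -
  define \<phi> where "\<phi> C = C #> s" for C
  have \<phi>: "(\<phi> ^^ i) L = L #> s [^] i" for i
    by (induction i) (simp_all add: \<phi>_def coset_mult_assoc subgroup.subset[OF L] s)
  have "rcosets L = range (\<lambda>i. (\<phi> ^^ i) L)"
  proof (intro equalityI subsetI)
    fix C assume "C \<in> rcosets L"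
    then obtain g where g: "g \<in> carrier G" "C = L #> g" unfolding RCOSETS_def by blast
    obtain i :: nat and x where x: "x \<in> L" "g = x \<otimes> inv (s [^] i)" using transitive' g(1) by blast
    have e: "inv (s [^] i) = s [^] ((ord s - 1) * i)"
    proof (rule inv_equality)
      have "(ord s - 1) * i + i = ord s * i" using odd_s by (cases "ord s") simp_all
      thus "s [^] ((ord s - 1) * i) \<otimes> s [^] i = \<one>" using s nat_pow_dvd[of s "ord s" "ord s * i"] by (simp add: nat_pow_mult)
    qed (use s in auto)
    have "C = L #> x #> inv (s [^] i)" unfolding g(2) x(2) using L_carrier[OF x(1)] s subgroup.subset[OF L] by (simp add: coset_mult_assoc)
    also have "L #> x = L" using x(1) subgroup.rcos_const[OF L is_group] by blast
    finally show "C \<in> range (\<lambda>i. (\<phi> ^^ i) L)" unfolding \<phi> e by blast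
  next
    fix C assume "C \<in> range (\<lambda>i. (\<phi> ^^ i) L)"
    thus "C \<in> rcosets L" unfolding \<phi> using s rcosetsI[OF subgroup.subset[OF L]] by auto
  qed
  moreover have "(\<phi> ^^ ord s) L = L" unfolding \<phi> using s subgroup.subset[OF L] by simp
  ultimately have "card (rcosets L) dvd ord s"
    using card_orbit_dvd(1)[of "ord s" \<phi> L] odd_s by (simp add: odd_pos)
  hence "odd (card (rcosets L))" using odd_s dvd_trans by blast
  thus ?thesis using lagrange[OF L] unfolding Coset.order_def by metis
qed

lemma normal_times_L:
  assumes V: "V \<lhd> G" "V \<noteq> {\<one>}"
  shows "subgroup (V <#> L) G" "L \<subset> V <#> L" "\<not> V \<subseteq> L"
    and "g \<in> carrier G \<Longrightarrow> \<exists>x\<in>L. \<exists>v\<in>V. \<exists>y\<in>R. g = x \<otimes> v \<otimes> y"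
proof -
  note sV = normal_imp_subgroup[OF V(1)]
  show s: "subgroup (V <#> L) G" by (rule mult_norm_subgroup[OF V(1) L])
  show n: "\<not> V \<subseteq> L" using core_free V by blast
  have VX: "x \<in> V <#> L" if x: "x \<in> L" for x
  proof -
    have "x = \<one> \<otimes> x" using L_carrier[OF x] by simp
    thus ?thesis using x subgroup.one_closed[OF sV] unfolding set_mult_def by blast
  qed
  have VV: "x \<in> V <#> L" if x: "x \<in> V" for x
  proof -
    have "x = x \<otimes> \<one>" using subgroup.mem_carrier[OF sV x] by simp
    thus ?thesis using x subgroup.one_closed[OF L] unfolding set_mult_def by blast
  qed
  show ps: "L \<subset> V <#> L" using VX VV n by blast
  show "\<exists>x\<in>L. \<exists>v\<in>V. \<exists>y\<in>R. g = x \<otimes> v \<otimes> y" if g: "g \<in> carrier G"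
  proof -
    have "g \<in> (V <#> L) <#> R" using maximal[OF s ps] g by simp
    hence "g \<in> (L <#> V) <#> R" unfolding normal_times_subgroup_mem(4)[OF V(1) L] .
    thus ?thesis unfolding set_mult_def by blast
  qed
qed

text \<open>Such a splitting of \<open>V\<close> would collapse \<open>G = L V R\<close> to
  \<open>L R\<close>. This is the main way in which \<open>not_product\<close> constrains normal
  subgroups.\<close>

lemma not_subset_product:
  assumes V: "V \<lhd> G" "V \<noteq> {\<one>}"
    and c: "\<And>v. v \<in> V \<Longrightarrow> \<exists>x\<in>V \<inter> L. \<exists>y\<in>V \<inter> R. v = x \<otimes> y"
  shows False
proof -
  have "carrier G \<subseteq> L <#> R"
  proof
    fix g assume "g \<in> carrier G"
    then obtain x v y where g: "x \<in> L" "v \<in> V" "y \<in> R" "g = x \<otimes> v \<otimes> y" using normal_times_L(4)[OF V] by blast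
    obtain x' y' where v: "x' \<in> L" "y' \<in> R" "v = x' \<otimes> y'" using c[OF g(2)] by blast
    have "g = (x \<otimes> x') \<otimes> (y' \<otimes> y)"
      unfolding g(4) v(3) using L_carrier[OF g(1)] L_carrier[OF v(1)] R_carrier[OF g(3)] R_carrier[OF v(2)] by (simp add: m_assoc)
    thus "g \<in> L <#> R" using L_mult[OF g(1) v(1)] R_mult[OF v(2) g(3)] unfolding set_mult_def by blast
  qed
  moreover have "L <#> R \<subseteq> carrier G" using L_carrier R_carrier unfolding set_mult_def by auto
  ultimately show False using not_product by blast
qed

text \<open>The hypothesis on \<open>e\<close> says that \<open>V \<inter> B\<close> has index 1 or
  \<open>p\<close> in the elementary abelian group \<open>V\<close>; a single element
  \<open>w\<close> of \<open>A\<close> outside it therefore generates the rest.\<close>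

lemma cyclic_complement_product:
  fixes p :: nat
  assumes V: "subgroup V G" and com: "\<And>v w. v \<in> V \<Longrightarrow> w \<in> V \<Longrightarrow> v \<otimes> w = w \<otimes> v"
    and p: "prime p" and exp: "\<And>v. v \<in> V \<Longrightarrow> v [^] p = \<one>"
    and A: "subgroup A G" and B: "subgroup B G"
    and e: "e \<in> V" "\<forall>v\<in>V. \<exists>i::nat. \<exists>h\<in>V \<inter> B. v = e [^] i \<otimes> h"
    and w: "w \<in> V" "w \<in> A" "w \<notin> B" and v: "v \<in> V"
  shows "\<exists>x\<in>V \<inter> A. \<exists>y\<in>V \<inter> B. v = x \<otimes> y"
proof -
  note Vc = subgroup.mem_carrier[OF V]
  obtain i :: nat and h where i: "h \<in> V" "h \<in> B" "w = e [^] i \<otimes> h" using e w(1) by blast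
  have "\<not> p dvd i"
  proof
    assume "p dvd i"
    hence "e [^] i = \<one>" using nat_pow_dvd exp e(1) Vc by blast
    thus False using i w Vc by simp
  qed
  hence "coprime i p" using p by (metis coprime_commute prime_imp_coprime)
  then obtain r t :: int where rt: "r * int i + t * int p = 1"
    using bezout_int[of "int i" "int p"] by (metis coprime_iff_gcd_eq_1 gcd_int_int_eq of_nat_1)
  obtain j :: nat and h' where j: "h' \<in> V" "h' \<in> B" "v = e [^] j \<otimes> h'" using e v by blast
  have ec: "e \<in> carrier G" "h \<in> carrier G" "w \<in> carrier G" "h' \<in> carrier G" using Vc e i w j by auto
  \<comment> \<open>\<open>r\<close> inverts \<open>i\<close> modulo \<open>p\<close>, so the power
    \<open>m\<close> of \<open>w\<close> agrees with \<open>e [^] j\<close> up to an element of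
    \<open>V \<inter> B\<close>.\<close>
  define m where "m = r * int j"
  have "e [^] j = e [^] (int i * m + int p * (t * int j))"
  proof -
    have "int i * m + int p * (t * int j) = (r * int i + t * int p) * int j" unfolding m_def by (simp add: algebra_simps)
    thus ?thesis by (simp only: rt int_pow_int mult_1)
  qed
  also have "\<dots> = (e [^] i) [^] m \<otimes> (e [^] p) [^] (t * int j)"
    using ec by (simp add: int_pow_mult int_pow_pow flip: int_pow_int)
  also have "\<dots> = (e [^] i) [^] m" using exp[OF e(1)] ec by simp
  also have "e [^] i = w \<otimes> inv h" unfolding i(3) using ec by (simp add: m_assoc)
  also have "(w \<otimes> inv h) [^] m = w [^] m \<otimes> inv h [^] m"
    using com[OF w(1) subgroup.m_inv_closed[OF V i(1)]] ec by (intro int_pow_mult_distrib) auto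
  finally have ej: "e [^] j = w [^] m \<otimes> inv h [^] m" .
  have "v = w [^] m \<otimes> (inv h [^] m \<otimes> h')" unfolding j(3) ej using ec by (simp add: m_assoc)
  moreover have "w [^] m \<in> V \<inter> A"
    using subgroup_int_pow_closed[OF V w(1)] subgroup_int_pow_closed[OF A w(2)] by simp
  moreover have "inv h [^] m \<otimes> h' \<in> V \<inter> B"
    using subgroup.m_closed[OF V subgroup_int_pow_closed[OF V subgroup.m_inv_closed[OF V i(1)]] j(1)]
      subgroup.m_closed[OF B subgroup_int_pow_closed[OF B subgroup.m_inv_closed[OF B i(2)]] j(2)] by simp
  ultimately show ?thesis by (intro bexI)
qed

text \<open>For \<open>p = 2\<close> the index of \<open>V \<inter> H\<close> in \<open>V\<close>
  would be even. It equals the index of \<open>H\<close> in \<open>V H\<close>, which divides the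
  odd index of \<open>L\<close> in \<open>G\<close>.\<close>

lemma prime_odd:
  fixes p :: nat
  assumes V: "V \<lhd> G" and com: "\<And>v w. v \<in> V \<Longrightarrow> w \<in> V \<Longrightarrow> v \<otimes> w \<otimes> inv v \<otimes> inv w \<in> H"
    and H: "subgroup H G" "L \<subseteq> H"
    and p: "prime p" and exp: "\<And>v. v \<in> V \<Longrightarrow> v [^] p \<in> H" and VH: "\<not> V \<subseteq> H"
  shows "odd p"
proof (rule ccontr)
  assume "\<not> odd p"
  hence p2: "p = 2" using p prime_odd_nat[of p] prime_ge_2_nat[OF p] by force
  note sV = normal_imp_subgroup[OF V]
  note Vc = subgroup.mem_carrier[OF sV] and Hc = subgroup.mem_carrier[OF H(1)]
  obtain v where v: "v \<in> V" "v \<notin> H" using VH by blast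
  define U where "U = V \<inter> H"
  have sU: "subgroup U G" unfolding U_def by (rule subgroups_Inter_pair[OF sV H(1)])
  have Uc: "\<And>x. x \<in> U \<Longrightarrow> x \<in> carrier G" using subgroup.mem_carrier[OF sU] .
  have fU: "finite U" using fin subgroup.subset[OF sU] finite_subset by blast
  have vc: "v \<in> carrier G" using Vc v by blast
  have cj: "inv v \<otimes> u \<otimes> v \<in> U" "v \<otimes> u \<otimes> inv v \<in> U" if u: "u \<in> U" for u
  proof -
    have uc: "u \<in> carrier G" "u \<in> V" "u \<in> H" using u Uc U_def by auto
    have "inv v \<otimes> u \<otimes> inv (inv v) \<otimes> inv u \<otimes> u \<in> H"
      using com[OF subgroup.m_inv_closed[OF sV v(1)] uc(2)] uc subgroup.m_closed[OF H(1)] by blast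
    hence "inv v \<otimes> u \<otimes> v \<in> H" using uc vc by (simp add: m_assoc)
    thus "inv v \<otimes> u \<otimes> v \<in> U" using uc v subgroup.m_closed[OF sV] subgroup.m_inv_closed[OF sV] by (simp add: U_def)
    have "v \<otimes> u \<otimes> inv v \<otimes> inv u \<otimes> u \<in> H"
      using com[OF v(1) uc(2)] uc subgroup.m_closed[OF H(1)] by blast
    hence "v \<otimes> u \<otimes> inv v \<in> H" using uc vc by (simp add: m_assoc)
    thus "v \<otimes> u \<otimes> inv v \<in> U" using uc v subgroup.m_closed[OF sV] subgroup.m_inv_closed[OF sV] by (simp add: U_def)
  qed
  have vv: "v \<otimes> v \<in> U"
  proof -
    have "v [^] (2::nat) \<in> H" using exp[OF v(1)] p2 by simp
    moreover have "v [^] (2::nat) = v \<otimes> v" using vc by (simp add: numeral_2_eq_2)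
    ultimately show ?thesis using v subgroup.m_closed[OF sV] by (simp add: U_def)
  qed
  \<comment> \<open>A subgroup containing \<open>U\<close> with index 2, written out explicitly:
    \<open>v\<close> normalises \<open>U\<close> and has its square in \<open>U\<close>.\<close>
  define E where "E = U \<union> (\<lambda>u. v \<otimes> u) ` U"
  have "subgroup E G"
  proof (rule subgroupI)
    show "E \<subseteq> carrier G" using Uc vc by (auto simp: E_def)
    show "E \<noteq> {}" using subgroup.one_closed[OF sU] by (auto simp: E_def)
    show mm: "x \<otimes> y \<in> E" if x: "x \<in> E" and y: "y \<in> E" for x y
    proof -
      have 1: "v \<otimes> u \<otimes> w \<in> E" if "u \<in> U" "w \<in> U" for u w
      proof -
        have "v \<otimes> u \<otimes> w = v \<otimes> (u \<otimes> w)" using that Uc vc by (simp add: m_assoc)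
        thus ?thesis using that subgroup.m_closed[OF sU] unfolding E_def by blast
      qed
      have 2: "u \<otimes> (v \<otimes> w) \<in> E" if "u \<in> U" "w \<in> U" for u w
      proof -
        have "u \<otimes> (v \<otimes> w) = v \<otimes> ((inv v \<otimes> u \<otimes> v) \<otimes> w)" using that Uc vc by (simp add: m_assoc)
        thus ?thesis using that cj subgroup.m_closed[OF sU] unfolding E_def by blast
      qed
      have 3: "v \<otimes> u \<otimes> (v \<otimes> w) \<in> E" if "u \<in> U" "w \<in> U" for u w
      proof -
        have "v \<otimes> u \<otimes> (v \<otimes> w) = (v \<otimes> v) \<otimes> ((inv v \<otimes> u \<otimes> v) \<otimes> w)" using that Uc vc by (simp add: m_assoc)
        thus ?thesis using that cj vv subgroup.m_closed[OF sU] unfolding E_def by simp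
      qed
      consider "x \<in> U" | u where "u \<in> U" "x = v \<otimes> u" using x by (auto simp: E_def)
      note cx = this
      consider "y \<in> U" | u where "u \<in> U" "y = v \<otimes> u" using y by (auto simp: E_def)
      note cy = this
      show ?thesis
      proof (cases rule: cx)
        case 1
        show ?thesis
        proof (cases rule: cy)
          case 1 thus ?thesis using \<open>x \<in> U\<close> subgroup.m_closed[OF sU] unfolding E_def by blast
        next
          case (2 u) thus ?thesis using \<open>x \<in> U\<close> \<open>\<And>u w. u \<in> U \<Longrightarrow> w \<in> U \<Longrightarrow> u \<otimes> (v \<otimes> w) \<in> E\<close> by simp
        qed
      next
        case (2 u)
        note u = this
        show ?thesis
        proof (cases rule: cy)
          case 1 thus ?thesis using u \<open>\<And>u w. u \<in> U \<Longrightarrow> w \<in> U \<Longrightarrow> v \<otimes> u \<otimes> w \<in> E\<close> by simp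
        next
          case (2 w) thus ?thesis using u 3 by simp
        qed
      qed
    qed
    show "inv x \<in> E" if x: "x \<in> E" for x
    proof (cases "x \<in> U")
      case True thus ?thesis using subgroup.m_inv_closed[OF sU] by (auto simp: E_def)
    next
      case False
      then obtain u where u: "u \<in> U" "x = v \<otimes> u" using x by (auto simp: E_def)
      have "inv (v \<otimes> u) = v \<otimes> (inv (v \<otimes> v) \<otimes> (v \<otimes> inv u \<otimes> inv v))"
        using u Uc vc by (simp add: inv_mult_group m_assoc)
      moreover have "inv (v \<otimes> v) \<otimes> (v \<otimes> inv u \<otimes> inv v) \<in> U"
        using vv cj(2) u subgroup.m_inv_closed[OF sU] subgroup.m_closed[OF sU] by blast
      ultimately show ?thesis using u unfolding E_def by blast
    qed
  qed
  moreover have "E \<subseteq> V" using v subgroup.m_closed[OF sV] by (auto simp: E_def U_def)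
  ultimately have "card E dvd card V" using card_subgroup_dvd sV by blast
  moreover have "card E = 2 * card U"
  proof -
    have "U \<inter> (\<lambda>u. v \<otimes> u) ` U = {}"
    proof (rule ccontr)
      assume "U \<inter> (\<lambda>u. v \<otimes> u) ` U \<noteq> {}"
      then obtain u where u: "u \<in> U" "v \<otimes> u \<in> U" by blast
      have "v \<otimes> u \<otimes> inv u \<in> U" using u subgroup.m_closed[OF sU] subgroup.m_inv_closed[OF sU] by blast
      hence "v \<in> U" using u Uc vc by (simp add: m_assoc)
      thus False using v by (simp add: U_def)
    qed
    moreover have "card ((\<lambda>u. v \<otimes> u) ` U) = card U"
      by (rule card_image) (use Uc vc in \<open>auto simp: inj_on_def\<close>)
    ultimately show ?thesis unfolding E_def using fU by (simp add: card_Un_disjoint)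
  qed
  ultimately obtain m where m: "card V = 2 * card U * m" by (metis dvdE)
  have U0: "card U > 0" using fU subgroup.one_closed[OF sU] by (auto simp: card_gt_0_iff)
  have "card (V <#> H) * card U = card V * card H" unfolding U_def by (rule card_set_mult[OF fin sV H(1)])
  hence "card (V <#> H) = 2 * m * card H" using m U0 by simp
  moreover have "card (V <#> H) dvd card (carrier G)"
    using card_subgroup_dvd[OF mult_norm_subgroup[OF V H(1)] subgroup_self] subgroup.subset[OF mult_norm_subgroup[OF V H(1)]] by blast
  moreover have "card L dvd card H" by (rule card_subgroup_dvd[OF L H])
  ultimately have "2 * card L dvd card (carrier G)" by (metis dvd_mult_right dvd_trans mult.assoc mult_dvd_mono dvd_refl dvd_triv_left)
  then obtain k r where k: "odd k" "card (carrier G) = k * card L" "card (carrier G) = 2 * card L * r"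
    using odd_index by (metis dvdE)
  have "card L > 0" using subgroup.one_closed[OF L] finite_subset[OF subgroup.subset[OF L] fin] by (auto simp: card_gt_0_iff)
  hence "k = 2 * r" using k by simp
  thus False using k by simp
qed

end

context core_free_pair begin

text \<open>The section lemma, applied to \<open>L\<close> and to \<open>R\<close>, bounds the
  indices of \<open>V \<inter> L\<close> and \<open>V \<inter> R\<close> in \<open>V\<close> by
  \<open>p\<close>. If one were not contained in the other, their product would be \<open>V\<close>,
  which \<open>not_subset_product\<close> forbids; so they coincide. The common intersection is
  normalised by \<open>L\<close>, by \<open>R\<close> and by the abelian group \<open>V\<close>,
  hence by \<open>G = L V R\<close>, and core-freeness makes it trivial.\<close>

lemma elementary_abelian_normal:
  fixes p :: nat
  assumes V: "V \<lhd> G" "V \<noteq> {\<one>}" and com: "\<And>v w. v \<in> V \<Longrightarrow> w \<in> V \<Longrightarrow> v \<otimes> w = w \<otimes> v"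
    and p: "prime p" and exp: "\<And>v. v \<in> V \<Longrightarrow> v [^] p = \<one>"
  shows "\<exists>e\<in>V. \<forall>v\<in>V. \<exists>i::nat. v = e [^] i" and "V \<inter> L = {\<one>}" and "V \<inter> R = {\<one>}"
proof -
  note sV = normal_imp_subgroup[OF V(1)]
  note Vc = subgroup.mem_carrier[OF sV]
  have cm: "v \<otimes> w \<otimes> inv v \<otimes> inv w = \<one>" if "v \<in> V" "w \<in> V" for v w
    using com[OF that] commute_imp_commutator_one[of v w] Vc that by blast
  have pw: "v [^] p \<in> H" if "v \<in> V" "subgroup H G" for v H
    using exp[OF that(1)] subgroup.one_closed[OF that(2)] by simp
  have ex: "v \<otimes> w \<otimes> inv v \<otimes> inv w \<in> H" if "v \<in> V" "w \<in> V" "subgroup H G" for v w H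
    using cm[OF that(1,2)] subgroup.one_closed[OF that(3)] by simp
  have podd: "odd p"
    by (rule prime_odd[OF V(1) _ L order_refl p _ normal_times_L(3)[OF V]]) (use ex[OF _ _ L] pw[OF _ L] in blast)+
  \<comment> \<open>\<open>s\<close> is transitive on \<open>G / L\<close>, so both orbit
    representatives are taken to be the identity.\<close>
  have twoL: "\<exists>i::nat. \<exists>h\<in>L. g = s [^] i \<otimes> \<one> \<otimes> h \<or> g = s [^] i \<otimes> \<one> \<otimes> h" if g: "g \<in> carrier G" for g
  proof -
    obtain i :: nat and x where "x \<in> L" "g = s [^] i \<otimes> x" using transitive[OF g] by blast
    hence "g = s [^] i \<otimes> \<one> \<otimes> x" using s by simp
    thus ?thesis using \<open>x \<in> L\<close> by blast
  qed
  have "\<exists>e\<in>V. \<forall>v\<in>V. \<exists>i::nat. \<exists>h\<in>V \<inter> L. v = e [^] i \<otimes> h"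
    by (rule two_orbit_section_cyclic(1)[OF fin V(1) L s odd_s one_closed one_closed twoL ex[OF _ _ L] pw[OF _ L] p podd]) assumption+
  then obtain e where e: "e \<in> V" "\<forall>v\<in>V. \<exists>i::nat. \<exists>h\<in>V \<inter> L. v = e [^] i \<otimes> h" by (elim bexE)
  have "\<exists>e\<in>V. \<forall>v\<in>V. \<exists>i::nat. \<exists>h\<in>V \<inter> R. v = e [^] i \<otimes> h"
    by (rule two_orbit_section_cyclic(1)[OF fin V(1) R s odd_s ab two_orbits ex[OF _ _ R] pw[OF _ R] p podd]) assumption+
  then obtain e' where e': "e' \<in> V" "\<forall>v\<in>V. \<exists>i::nat. \<exists>h\<in>V \<inter> R. v = e' [^] i \<otimes> h" by (elim bexE)
  have RL: "w \<in> L" if w: "w \<in> V" "w \<in> R" for w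
  proof (rule ccontr)
    assume n: "w \<notin> L"
    show False
    proof (rule not_subset_product[OF V])
      fix v assume v: "v \<in> V"
      obtain x y where xy: "x \<in> V \<inter> R" "y \<in> V \<inter> L" "v = x \<otimes> y"
        using cyclic_complement_product[OF sV com p exp R L e w n v] by blast
      hence "v = y \<otimes> x" using com[of x y] by simp
      thus "\<exists>x\<in>V \<inter> L. \<exists>y\<in>V \<inter> R. v = x \<otimes> y" using xy by blast
    qed
  qed
  have LR: "w \<in> R" if w: "w \<in> V" "w \<in> L" for w
  proof (rule ccontr)
    assume n: "w \<notin> R"
    show False
      by (rule not_subset_product[OF V cyclic_complement_product[OF sV com p exp L R e' w n]])
  qed
  have "V \<inter> L \<lhd> G"
  proof (rule normal_invI)
    show "subgroup (V \<inter> L) G" by (rule subgroups_Inter_pair[OF sV L])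
    fix g u assume g: "g \<in> carrier G" and u: "u \<in> V \<inter> L"
    obtain x v y where g: "x \<in> L" "v \<in> V" "y \<in> R" "g = x \<otimes> v \<otimes> y" using normal_times_L(4)[OF V g] by blast
    have c: "x \<in> carrier G" "v \<in> carrier G" "y \<in> carrier G" "u \<in> carrier G" using g u Vc L_carrier R_carrier by auto
    define u' where "u' = y \<otimes> u \<otimes> inv y"
    have u': "u' \<in> V" "u' \<in> R" "u' \<in> carrier G" unfolding u'_def
      using normal_conj_closed(1)[OF V(1) _ c(3)] u LR R_mult R_inv g(3) c by auto
    have "v \<otimes> u' \<otimes> inv v = u'" using com[OF g(2) u'(1)] c u' by (simp add: m_assoc)
    hence e: "g \<otimes> u \<otimes> inv g = x \<otimes> u' \<otimes> inv x"
    proof -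
      have "g \<otimes> u \<otimes> inv g = x \<otimes> (v \<otimes> u' \<otimes> inv v) \<otimes> inv x"
        unfolding g(4) u'_def using c by (simp add: m_assoc inv_mult_group)
      thus ?thesis using \<open>v \<otimes> u' \<otimes> inv v = u'\<close> by simp
    qed
    show "g \<otimes> u \<otimes> inv g \<in> V \<inter> L" unfolding e
      using normal_conj_closed(1)[OF V(1) u'(1) c(1)] RL[OF u'(1,2)] L_mult L_inv g(1) by blast
  qed
  hence one: "V \<inter> L = {\<one>}" using core_free by blast
  thus "V \<inter> L = {\<one>}" .
  show "V \<inter> R = {\<one>}" using one RL subgroup.one_closed[OF sV] subgroup.one_closed[OF R] by blast
  show "\<exists>e\<in>V. \<forall>v\<in>V. \<exists>i::nat. v = e [^] i"
  proof (rule bexI[OF _ e(1)], rule ballI)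
    fix v assume "v \<in> V"
    then obtain i :: nat and h where "h \<in> V \<inter> L" "v = e [^] i \<otimes> h" using e(2) by blast
    hence "v = e [^] i" using one Vc[OF e(1)] by simp
    thus "\<exists>i::nat. v = e [^] i" by (rule exI)
  qed
qed

lemma card_elementary_abelian_normal:
  fixes p :: nat
  assumes V: "V \<lhd> G" "V \<noteq> {\<one>}" and com: "\<And>v w. v \<in> V \<Longrightarrow> w \<in> V \<Longrightarrow> v \<otimes> w = w \<otimes> v"
    and p: "prime p" and exp: "\<And>v. v \<in> V \<Longrightarrow> v [^] p = \<one>"
  shows "card V = p"
proof -
  note sV = normal_imp_subgroup[OF V(1)]
  note Vc = subgroup.mem_carrier[OF sV]
  obtain e where e: "e \<in> V" "\<forall>v\<in>V. \<exists>i::nat. v = e [^] i" using elementary_abelian_normal(1)[OF assms] by blast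
  have "ord e dvd p" using exp[OF e(1)] pow_eq_id[OF Vc[OF e(1)], of p] by blast
  moreover have "e \<noteq> \<one>"
  proof
    assume "e = \<one>"
    hence "V \<subseteq> {\<one>}" using e(2) by auto
    thus False using V subgroup.one_closed[OF sV] by blast
  qed
  hence "ord e \<noteq> 1" using ord_eq_1[OF Vc[OF e(1)]] by simp
  ultimately have oe: "ord e = p" using p by (metis prime_nat_iff)
  have "V = generate G {e}"
  proof
    show "generate G {e} \<subseteq> V" using generate_subgroup_incl[OF _ sV] e(1) by simp
    show "V \<subseteq> generate G {e}"
    proof
      fix v assume "v \<in> V"
      then obtain i :: nat where "v = e [^] i" using e(2) by blast
      thus "v \<in> generate G {e}"
        using subgroup_nat_pow_closed[OF generate_is_subgroup generate.incl, of "{e}" e] Vc e(1) by simp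
    qed
  qed
  thus ?thesis using generate_pow_card[OF Vc[OF e(1)]] oe by simp
qed

text \<open>Counting \<open>G = (V L) R\<close> gives \<open>|G| k = p |L R|\<close> for some
  \<open>k\<close>, and likewise with \<open>q\<close> for \<open>W\<close>. If the primes were
  different, \<open>p\<close> would divide \<open>k\<close> and \<open>|G|\<close> would divide
  \<open>|L R|\<close>, although \<open>L R\<close> is a proper subset of \<open>G\<close>.\<close>

lemma prime_unique:
  fixes p q :: nat
  assumes V: "V \<lhd> G" "V \<noteq> {\<one>}" "\<And>v w. v \<in> V \<Longrightarrow> w \<in> V \<Longrightarrow> v \<otimes> w = w \<otimes> v" "prime p" "\<And>v. v \<in> V \<Longrightarrow> v [^] p = \<one>"
    and W: "W \<lhd> G" "W \<noteq> {\<one>}" "\<And>v w. v \<in> W \<Longrightarrow> w \<in> W \<Longrightarrow> v \<otimes> w = w \<otimes> v" "prime q" "\<And>v. v \<in> W \<Longrightarrow> v [^] q = \<one>"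
  shows "p = q"
proof (rule ccontr)
  assume ne: "p \<noteq> q"
  have key: "\<exists>k. card (carrier G) * k = p * card (L <#> R)"
    if V: "V \<lhd> G" "V \<noteq> {\<one>}" "\<And>v w. v \<in> V \<Longrightarrow> w \<in> V \<Longrightarrow> v \<otimes> w = w \<otimes> v" "prime p" "\<And>v. v \<in> V \<Longrightarrow> v [^] p = \<one>"
    for V and p :: nat
  proof -
    note sV = normal_imp_subgroup[OF V(1)] and sVL = normal_times_L(1)[OF V(1,2)]
    have 1: "card (V <#> L) = p * card L"
      using card_set_mult[OF fin sV L] elementary_abelian_normal(2)[OF V] card_elementary_abelian_normal[OF V] by simp
    have "card (carrier G) * card ((V <#> L) \<inter> R) = card (V <#> L) * card R"
      using card_set_mult[OF fin sVL R] maximal[OF sVL normal_times_L(2)[OF V(1,2)]] by simp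
    moreover have "card (L \<inter> R) dvd card ((V <#> L) \<inter> R)"
      using card_subgroup_dvd[OF subgroups_Inter_pair[OF L R] subgroups_Inter_pair[OF sVL R]]
        normal_times_L(2)[OF V(1,2)] by blast
    then obtain k where k: "card ((V <#> L) \<inter> R) = card (L \<inter> R) * k" by blast
    moreover have "card (L <#> R) * card (L \<inter> R) = card L * card R" by (rule card_set_mult[OF fin L R])
    ultimately have "(card (carrier G) * k) * card (L \<inter> R) = (p * card (L <#> R)) * card (L \<inter> R)"
      using 1 by (simp add: mult.assoc mult.left_commute mult.commute)
    moreover have "card (L \<inter> R) > 0"
      using subgroup.one_closed[OF L] subgroup.one_closed[OF R] finite_subset[OF subgroup.subset[OF L] fin]
      by (auto simp: card_gt_0_iff)
    ultimately show ?thesis by auto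
  qed
  obtain k where k: "card (carrier G) * k = p * card (L <#> R)" using key[OF V] by blast
  obtain l where l: "card (carrier G) * l = q * card (L <#> R)" using key[OF W] by blast
  have G0: "card (carrier G) > 0" using fin by (auto simp: card_gt_0_iff)
  have sub: "L <#> R \<subseteq> carrier G" using L_carrier R_carrier unfolding set_mult_def by auto
  have "card (carrier G) * (k * q) = card (carrier G) * (l * p)" using k l by (metis mult.assoc mult.commute)
  hence "k * q = l * p" using G0 by simp
  hence "p dvd k" using ne V(4) W(4) by (metis dvd_triv_right prime_dvd_mult_iff primes_dvd_imp_eq)
  then obtain r where r: "k = p * r" by blast
  have e: "card (carrier G) * r = card (L <#> R)" using k r prime_gt_0_nat[OF V(4)] by simp
  have "L <#> R \<noteq> {}" using subgroup.one_closed[OF L] subgroup.one_closed[OF R] unfolding set_mult_def by blast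
  hence "card (L <#> R) > 0" using finite_subset[OF sub fin] by (simp add: card_gt_0_iff)
  hence "r > 0" using e by (cases r) auto
  hence "card (carrier G) \<le> card (L <#> R)" using e by (metis mult.right_neutral mult_le_mono2 Suc_leI One_nat_def)
  hence "L <#> R = carrier G" using card_seteq[OF fin sub] by blast
  thus False using not_product by blast
qed

lemma torsion_normal:
  assumes M: "M \<lhd> G" and com: "\<And>v w. v \<in> M \<Longrightarrow> w \<in> M \<Longrightarrow> v \<otimes> w = w \<otimes> v"
  shows "{m \<in> M. m [^] (q::nat) = \<one>} \<lhd> G"
proof (rule normal_invI)
  note sM = normal_imp_subgroup[OF M]
  note Mc = subgroup.mem_carrier[OF sM]
  show "subgroup {m \<in> M. m [^] q = \<one>} G"
  proof (rule subgroupI)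
    show "{m \<in> M. m [^] q = \<one>} \<noteq> {}" using subgroup.one_closed[OF sM] by auto
    show "inv m \<in> {m \<in> M. m [^] q = \<one>}" if "m \<in> {m \<in> M. m [^] q = \<one>}" for m
      using that Mc subgroup.m_inv_closed[OF sM] by (auto simp: nat_pow_inv)
    show "m \<otimes> n \<in> {m \<in> M. m [^] q = \<one>}" if "m \<in> {m \<in> M. m [^] q = \<one>}" "n \<in> {m \<in> M. m [^] q = \<one>}" for m n
      using that Mc subgroup.m_closed[OF sM] com pow_mult_distrib[of m n q] by auto
  qed (use Mc in auto)
  fix g h assume g: "g \<in> carrier G" and h: "h \<in> {m \<in> M. m [^] q = \<one>}"
  have hc: "h \<in> carrier G" using h Mc by auto
  have "(g \<otimes> h \<otimes> inv g) [^] n = g \<otimes> h [^] n \<otimes> inv g" for n :: nat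
    using g hc by (induction n) (simp_all add: m_assoc)
  thus "g \<otimes> h \<otimes> inv g \<in> {m \<in> M. m [^] q = \<one>}"
    using h g normal_conj_closed(1)[OF M _ g] by auto
qed

text \<open>A nontrivial element of the intersection has a power of some prime order
  \<open>q\<close>, and that power lies in the \<open>q\<close>-torsion of \<open>M\<close>, an
  elementary abelian normal subgroup.\<close>

lemma normal_abelian_inter_L:
  assumes M: "M \<lhd> G" and com: "\<And>v w. v \<in> M \<Longrightarrow> w \<in> M \<Longrightarrow> v \<otimes> w = w \<otimes> v"
  shows "M \<inter> L = {\<one>}"
proof (rule ccontr)
  note sM = normal_imp_subgroup[OF M]
  assume "M \<inter> L \<noteq> {\<one>}"
  then obtain x where x: "x \<in> M" "x \<in> L" "x \<noteq> \<one>"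
    using subgroup.one_closed[OF sM] subgroup.one_closed[OF L] by blast
  obtain q k :: nat where q: "prime q" "x [^] k \<noteq> \<one>" "(x [^] k) [^] q = \<one>"
    using exists_power_of_prime_order[OF L_carrier[OF x(2)] x(3) fin] by blast
  have z: "x [^] k \<in> M" "x [^] k \<in> L" using subgroup_nat_pow_closed[OF sM x(1)] subgroup_nat_pow_closed[OF L x(2)] by auto
  define V where "V = {m \<in> M. m [^] q = \<one>}"
  have V: "V \<lhd> G" unfolding V_def by (rule torsion_normal[OF M com])
  have zV: "x [^] k \<in> V" using z q by (simp add: V_def)
  have "V \<inter> L = {\<one>}"
    by (rule elementary_abelian_normal(2)[OF V _ _ q(1)]) (use zV q com in \<open>auto simp: V_def\<close>)
  thus False using zV z q(2) by blast
qed

text \<open>Put \<open>M = N P\<close>. An element of \<open>M\<close> is \<open>c x\<close> with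
  \<open>c\<close> in \<open>P\<close> and \<open>x\<close> in \<open>M \<inter> L\<close>, and
  \<open>x\<close> commutes with \<open>P\<close>; so a commutator in \<open>M\<close> is the
  commutator of the \<open>L\<close>-parts and lies in \<open>L\<close>. The same holds for its
  conjugates, hence core-freeness makes \<open>M\<close> abelian. Then \<open>M \<inter> L\<close>
  is trivial and every \<open>x\<close> is the identity.\<close>

lemma normal_in_product_centralizing:
  assumes P: "P \<lhd> G" and Pcom: "\<And>c d. c \<in> P \<Longrightarrow> d \<in> P \<Longrightarrow> c \<otimes> d = d \<otimes> c"
    and N: "N \<lhd> G" and NP: "N \<subseteq> P <#> L" and cent: "\<And>n c. n \<in> N \<Longrightarrow> c \<in> P \<Longrightarrow> n \<otimes> c = c \<otimes> n"
  shows "N \<subseteq> P"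
proof -
  note sP = normal_imp_subgroup[OF P] and sN = normal_imp_subgroup[OF N]
  note Pc = subgroup.mem_carrier[OF sP] and Nc = subgroup.mem_carrier[OF sN]
  define M where "M = N <#> P"
  have sM: "subgroup M G" unfolding M_def by (rule mult_norm_subgroup[OF N sP])
  note Mc = subgroup.mem_carrier[OF sM]
  have M: "M \<lhd> G"
  proof (rule normal_invI[OF sM])
    fix g h assume g: "g \<in> carrier G" and "h \<in> M"
    then obtain e p where ep: "e \<in> N" "p \<in> P" "h = e \<otimes> p" unfolding M_def set_mult_def by blast
    have "g \<otimes> h \<otimes> inv g = (g \<otimes> e \<otimes> inv g) \<otimes> (g \<otimes> p \<otimes> inv g)" using g Nc[OF ep(1)] Pc[OF ep(2)] ep(3) by (simp add: m_assoc)
    thus "g \<otimes> h \<otimes> inv g \<in> M"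
      using normal_conj_closed(1)[OF N ep(1) g] normal_conj_closed(1)[OF P ep(2) g] unfolding M_def set_mult_def by blast
  qed
  have PM: "c \<in> M" if c: "c \<in> P" for c
  proof -
    have "c = \<one> \<otimes> c" using Pc[OF c] by simp
    thus ?thesis using c subgroup.one_closed[OF sN] unfolding M_def set_mult_def by blast
  qed
  have NM: "n \<in> M" if n: "n \<in> N" for n
  proof -
    have "n = n \<otimes> \<one>" using Nc[OF n] by simp
    thus ?thesis using n subgroup.one_closed[OF sP] unfolding M_def set_mult_def by blast
  qed
  have Mcent: "m \<otimes> c = c \<otimes> m" if m: "m \<in> M" and c: "c \<in> P" for m c
  proof -
    obtain e p where ep: "e \<in> N" "p \<in> P" "m = e \<otimes> p" using m unfolding M_def set_mult_def by blast
    have "m \<otimes> c = e \<otimes> (c \<otimes> p)" unfolding ep(3) using Pcom[OF ep(2) c] Nc[OF ep(1)] Pc[OF ep(2)] Pc[OF c] by (simp add: m_assoc)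
    also have "\<dots> = (e \<otimes> c) \<otimes> p" using Nc[OF ep(1)] Pc[OF ep(2)] Pc[OF c] by (simp add: m_assoc)
    also have "\<dots> = c \<otimes> m" unfolding ep(3) cent[OF ep(1) c] using Nc[OF ep(1)] Pc[OF ep(2)] Pc[OF c] by (simp add: m_assoc)
    finally show ?thesis .
  qed
  have dec: "\<exists>x\<in>L. \<exists>c\<in>P. x \<in> M \<and> m = c \<otimes> x" if m: "m \<in> M" for m
  proof -
    obtain e p where ep: "e \<in> N" "p \<in> P" "m = e \<otimes> p" using m unfolding M_def set_mult_def by blast
    obtain c x where cx: "c \<in> P" "x \<in> L" "e = c \<otimes> x" using NP ep(1) unfolding set_mult_def by blast
    have c: "e \<in> carrier G" "p \<in> carrier G" "c \<in> carrier G" "x \<in> carrier G" using Nc ep Pc cx L_carrier by auto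
    have xM: "x \<in> M"
    proof -
      have "x = inv c \<otimes> e" using cx(3) c by simp
      thus ?thesis using subgroup.m_closed[OF sM subgroup.m_inv_closed[OF sM PM[OF cx(1)]] NM[OF ep(1)]] by simp
    qed
    have "m = (c \<otimes> p) \<otimes> x"
      unfolding ep(3) cx(3) using Mcent[OF xM ep(2)] c by (simp add: m_assoc)
    thus ?thesis using xM cx(2) subgroup.m_closed[OF sP cx(1) ep(2)] by blast
  qed
  have comL: "m \<otimes> n \<otimes> inv m \<otimes> inv n \<in> L" if m: "m \<in> M" and n: "n \<in> M" for m n
  proof -
    obtain x c where x: "x \<in> L" "c \<in> P" "x \<in> M" "m = c \<otimes> x" using dec[OF m] by blast
    obtain y d where y: "y \<in> L" "d \<in> P" "y \<in> M" "n = d \<otimes> y" using dec[OF n] by blast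
    have c: "x \<in> carrier G" "c \<in> carrier G" "y \<in> carrier G" "d \<in> carrier G" using x y L_carrier Pc by auto
    have 1: "m \<otimes> n = (c \<otimes> d) \<otimes> (x \<otimes> y)"
    proof -
      have "m \<otimes> n = c \<otimes> (x \<otimes> d) \<otimes> y" unfolding x(4) y(4) using c by (simp add: m_assoc)
      thus ?thesis unfolding Mcent[OF x(3) y(2)] using c by (simp add: m_assoc)
    qed
    have 2: "n \<otimes> m = (c \<otimes> d) \<otimes> (y \<otimes> x)"
    proof -
      have "n \<otimes> m = d \<otimes> (y \<otimes> c) \<otimes> x" unfolding x(4) y(4) using c by (simp add: m_assoc)
      also have "\<dots> = (d \<otimes> c) \<otimes> (y \<otimes> x)" unfolding Mcent[OF y(3) x(2)] using c by (simp add: m_assoc)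
      finally show ?thesis unfolding Pcom[OF y(2) x(2)] .
    qed
    have mn: "m \<in> carrier G" "n \<in> carrier G" using Mc m n by auto
    have "m \<otimes> n \<otimes> inv m \<otimes> inv n = (m \<otimes> n) \<otimes> inv (n \<otimes> m)" using mn by (simp add: inv_mult_group m_assoc)
    also have "\<dots> = (c \<otimes> d) \<otimes> (x \<otimes> y) \<otimes> inv (y \<otimes> x) \<otimes> inv (c \<otimes> d)" unfolding 1 2 using c by (simp add: inv_mult_group m_assoc)
    also have "\<dots> = (x \<otimes> y) \<otimes> inv (y \<otimes> x)"
    proof -
      have z: "(x \<otimes> y) \<otimes> inv (y \<otimes> x) \<in> M"
        using x(3) y(3) subgroup.m_closed[OF sM] subgroup.m_inv_closed[OF sM] by blast
      have cd: "c \<otimes> d \<in> P" using subgroup.m_closed[OF sP x(2) y(2)] .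
      have zc: "(x \<otimes> y) \<otimes> inv (y \<otimes> x) \<in> carrier G" "c \<otimes> d \<in> carrier G" using Mc[OF z] Pc[OF cd] by auto
      have "(c \<otimes> d) \<otimes> ((x \<otimes> y) \<otimes> inv (y \<otimes> x)) \<otimes> inv (c \<otimes> d) = (x \<otimes> y) \<otimes> inv (y \<otimes> x)"
        unfolding Mcent[OF z cd, symmetric] using zc by (rule inv_mem_cancel_right(1))
      moreover have "(c \<otimes> d) \<otimes> (x \<otimes> y) \<otimes> inv (y \<otimes> x) = (c \<otimes> d) \<otimes> ((x \<otimes> y) \<otimes> inv (y \<otimes> x))"
        using c by (intro m_assoc) auto
      ultimately show ?thesis by simp
    qed
    also have "\<dots> \<in> L" using x(1) y(1) L_mult L_inv by blast
    finally show ?thesis .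
  qed
  have com: "m \<otimes> n = n \<otimes> m" if m: "m \<in> M" and n: "n \<in> M" for m n
  proof -
    have mn: "m \<in> carrier G" "n \<in> carrier G" using Mc m n by auto
    have "m \<otimes> n \<otimes> inv m \<otimes> inv n = \<one>"
    proof (rule core_freeD)
      fix g assume g: "g \<in> carrier G"
      have "g \<otimes> (m \<otimes> n \<otimes> inv m \<otimes> inv n) \<otimes> inv g =
        (g \<otimes> m \<otimes> inv g) \<otimes> (g \<otimes> n \<otimes> inv g) \<otimes> inv (g \<otimes> m \<otimes> inv g) \<otimes> inv (g \<otimes> n \<otimes> inv g)"
        using g mn by (simp add: inv_mult_group m_assoc)
      thus "g \<otimes> (m \<otimes> n \<otimes> inv m \<otimes> inv n) \<otimes> inv g \<in> L"
        using comL normal_conj_closed(1)[OF M _ g] m n by simp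
    qed (use mn in simp)
    thus ?thesis using commute_imp_commutator_one mn by blast
  qed
  have one: "M \<inter> L = {\<one>}" by (rule normal_abelian_inter_L[OF M com])
  show "N \<subseteq> P"
  proof
    fix n assume n: "n \<in> N"
    obtain x c where x: "x \<in> L" "c \<in> P" "x \<in> M" "n = c \<otimes> x" using dec[OF NM[OF n]] by blast
    hence "x = \<one>" using one by blast
    thus "n \<in> P" using x(2,4) Pc[OF x(2)] by simp
  qed
qed

end

section \<open>Growing a normal subgroup of powers of \<open>s\<close>\<close>

lemma (in group) centralizer_normal:
  assumes P: "P \<lhd> G"
  shows "{g \<in> carrier G. \<forall>c\<in>P. g \<otimes> c = c \<otimes> g} \<lhd> G"
proof (rule normal_invI)
  note sP = normal_imp_subgroup[OF P]
  note Pc = subgroup.mem_carrier[OF sP]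
  let ?C = "{g \<in> carrier G. \<forall>c\<in>P. g \<otimes> c = c \<otimes> g}"
  show "subgroup ?C G"
  proof (rule subgroupI)
    show "?C \<noteq> {}" using Pc by (auto intro!: exI[of _ \<one>])
    show "inv g \<in> ?C" if g: "g \<in> ?C" for g
    proof (safe)
      fix c assume c: "c \<in> P"
      have "g \<otimes> c = c \<otimes> g" "g \<in> carrier G" using g c by auto
      hence "inv g \<otimes> (g \<otimes> c) \<otimes> inv g = inv g \<otimes> (c \<otimes> g) \<otimes> inv g" by simp
      thus "inv g \<otimes> c = c \<otimes> inv g" using \<open>g \<in> carrier G\<close> Pc[OF c] by (simp add: m_assoc)
    qed (use g in auto)
    show "g \<otimes> h \<in> ?C" if g: "g \<in> ?C" and h: "h \<in> ?C" for g h
    proof (safe)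
      fix c assume c: "c \<in> P"
      have gh: "g \<in> carrier G" "h \<in> carrier G" "g \<otimes> c = c \<otimes> g" "h \<otimes> c = c \<otimes> h" using g h c by auto
      have "g \<otimes> h \<otimes> c = g \<otimes> c \<otimes> h" using gh(1,2,4) Pc[OF c] by (simp add: m_assoc)
      thus "g \<otimes> h \<otimes> c = c \<otimes> (g \<otimes> h)" using gh(1,2,3) Pc[OF c] by (simp add: m_assoc)
    qed (use g h in auto)
  qed auto
  fix g h assume g: "g \<in> carrier G" and h: "h \<in> ?C"
  hence hc: "h \<in> carrier G" by auto
  show "g \<otimes> h \<otimes> inv g \<in> ?C"
  proof (safe)
    fix c assume c: "c \<in> P"
    define c' where "c' = inv g \<otimes> c \<otimes> g"
    have c': "c' \<in> P" unfolding c'_def by (rule normal_conj_closed(2)[OF P c g])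
    have ce: "c = g \<otimes> c' \<otimes> inv g" unfolding c'_def using g Pc[OF c] by (simp add: m_assoc)
    have "g \<otimes> h \<otimes> inv g \<otimes> c = g \<otimes> (h \<otimes> c') \<otimes> inv g" unfolding ce using g hc Pc[OF c'] by (simp add: m_assoc)
    also have "h \<otimes> c' = c' \<otimes> h" using h c' by blast
    also have "g \<otimes> (c' \<otimes> h) \<otimes> inv g = c \<otimes> (g \<otimes> h \<otimes> inv g)" unfolding ce using g hc Pc[OF c'] by (simp add: m_assoc)
    finally show "g \<otimes> h \<otimes> inv g \<otimes> c = c \<otimes> (g \<otimes> h \<otimes> inv g)" .
  qed (use g hc in auto)
qed

text \<open>Commutator calculus in class two: the commutator \<open>z\<close> is central in the
  group generated by \<open>x\<close> and \<open>y\<close>, so it collects with exponent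
  \<open>n\<close> here and with exponent \<open>n choose 2\<close> in the product formula that
  follows.\<close>

lemma (in group) class_two_pow_commute:
  fixes n :: nat
  assumes "x \<in> carrier G" "y \<in> carrier G" "z \<in> carrier G"
    and "x \<otimes> y = z \<otimes> (y \<otimes> x)" "z \<otimes> x = x \<otimes> z" "z \<otimes> y = y \<otimes> z"
  shows "x [^] n \<otimes> y = z [^] n \<otimes> (y \<otimes> x [^] n)"
proof (induction n)
  case (Suc n)
  have zx: "z \<otimes> x [^] n = x [^] n \<otimes> z" using assms(1,3,5)
    by (induction n) (simp_all add: m_assoc, metis m_assoc nat_pow_closed)
  have "x [^] Suc n \<otimes> y = x [^] n \<otimes> (x \<otimes> y)" using assms(1,2) by (simp add: m_assoc)
  also have "\<dots> = (x [^] n \<otimes> z) \<otimes> (y \<otimes> x)" unfolding assms(4) using assms(1,2,3) by (simp add: m_assoc)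
  also have "\<dots> = z \<otimes> ((x [^] n \<otimes> y) \<otimes> x)" unfolding zx[symmetric] using assms(1,2,3) by (simp add: m_assoc)
  also have "\<dots> = (z \<otimes> z [^] n) \<otimes> (y \<otimes> (x [^] n \<otimes> x))" unfolding Suc using assms(1,2,3) by (simp add: m_assoc)
  also have "z \<otimes> z [^] n = z [^] Suc n" using assms(3) by (metis nat_pow_Suc2)
  finally show ?case using assms by simp
qed (use assms in simp)

lemma (in group) class_two_pow_mult:
  fixes n :: nat
  assumes xyz: "x \<in> carrier G" "y \<in> carrier G" "z \<in> carrier G"
    and "y \<otimes> x = z \<otimes> (x \<otimes> y)" and zx: "z \<otimes> x = x \<otimes> z" and zy: "z \<otimes> y = y \<otimes> z"
  shows "(x \<otimes> y) [^] n = z [^] (n choose 2) \<otimes> (x [^] n \<otimes> y [^] n)"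
proof (induction n)
  case (Suc n)
  have zx': "x [^] n \<otimes> z [^] n = z [^] n \<otimes> x [^] n"
    using zx xyz by (intro group_commutes_pow[symmetric]; simp add: pow_mult_distrib)
  have "(x \<otimes> y) [^] Suc n = z [^] (n choose 2) \<otimes> (x [^] n \<otimes> (y [^] n \<otimes> x) \<otimes> y)"
    using Suc xyz by (simp add: m_assoc)
  also have "y [^] n \<otimes> x = z [^] n \<otimes> (x \<otimes> y [^] n)"
    by (rule class_two_pow_commute[OF xyz(2,1,3) assms(4) zy zx])
  also have "x [^] n \<otimes> (z [^] n \<otimes> (x \<otimes> y [^] n)) \<otimes> y = z [^] n \<otimes> (x [^] Suc n \<otimes> y [^] Suc n)"
    using xyz by (simp add: m_assoc[symmetric] zx')
  also have "z [^] (n choose 2) \<otimes> (z [^] n \<otimes> (x [^] Suc n \<otimes> y [^] Suc n)) =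
      z [^] (Suc n choose 2) \<otimes> (x [^] Suc n \<otimes> y [^] Suc n)"
    using xyz by (simp add: m_assoc[symmetric] nat_pow_mult numeral_2_eq_2 add.commute del: nat_pow_Suc)
  finally show ?case .
qed (use assms in \<open>simp add: numeral_2_eq_2\<close>)

text \<open>In a finite cyclic group the elements killed by the prime \<open>q\<close> form a group
  of order 1 or \<open>q\<close>, so a nontrivial one in \<open>P\<close> generates all of them.
  Concretely, all are powers of \<open>s [^] d\<close> with \<open>ord s = d * q\<close>.\<close>

lemma (in group) cyclic_torsion_mem:
  fixes i j q :: nat
  assumes s: "s \<in> carrier G" "ord s > 0" and q: "prime q" and P: "subgroup P G"
    and j: "s [^] j \<in> P" "s [^] j \<noteq> \<one>" "(s [^] j) [^] q = \<one>" and i: "(s [^] i) [^] q = \<one>"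
  shows "s [^] i \<in> P"
proof -
  have dj: "ord s dvd j * q" "\<not> ord s dvd j" "ord s dvd i * q"
    using s j i by (auto simp: nat_pow_pow pow_eq_id)
  have "q dvd ord s"
  proof (rule ccontr)
    assume "\<not> q dvd ord s"
    hence "coprime (ord s) q" using q by (metis coprime_commute prime_imp_coprime)
    thus False using dj by (simp add: coprime_dvd_mult_left_iff)
  qed
  then obtain d where d: "ord s = d * q" by (metis dvd_def mult.commute)
  have q0: "q > 0" using prime_gt_0_nat[OF q] .
  have "d dvd j" "d dvd i" using dj(1,3) d q0 by auto
  then obtain j' i' where ji: "j = d * j'" "i = d * i'" by (elim dvdE)
  have "\<not> q dvd j'" using dj(2) d ji by (metis mult.commute mult_dvd_mono dvd_refl)
  hence cop: "coprime j' q" using q by (metis coprime_commute prime_imp_coprime)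
  have "s [^] d \<in> P"
  proof (rule nat_pow_coprime_mem[OF P _ _ _ cop])
    have "(s [^] d) [^] q = \<one>" using s d by (simp add: nat_pow_pow pow_eq_id)
    thus "(s [^] d) [^] q \<in> P" using subgroup.one_closed[OF P] by simp
    show "(s [^] d) [^] j' \<in> P" using j(1) ji s by (simp add: nat_pow_pow)
  qed (use s in simp)
  thus ?thesis using subgroup_nat_pow_closed[OF P, of "s [^] d" i'] ji s by (simp add: nat_pow_pow)
qed

context core_free_pair begin

text \<open>The subgroup generated by \<open>s\<close>; natural exponents suffice because the order
  is finite.\<close>

definition I where "I = range (\<lambda>i::nat. s [^] i)"

lemma I_subgroup: "subgroup I G"
proof (rule subgroupI)
  show "I \<subseteq> carrier G" "I \<noteq> {}" using s by (auto simp: I_def)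
  show "x \<otimes> y \<in> I" if "x \<in> I" "y \<in> I" for x y using that s by (auto simp: I_def nat_pow_mult)
  show "inv x \<in> I" if "x \<in> I" for x
  proof -
    obtain i :: nat where i: "x = s [^] i" using \<open>x \<in> I\<close> by (auto simp: I_def)
    have "inv x = s [^] ((ord s - 1) * i)"
    proof (rule inv_equality)
      have "(ord s - 1) * i + i = ord s * i" using odd_s by (cases "ord s") simp_all
      thus "s [^] ((ord s - 1) * i) \<otimes> x = \<one>"
        using s nat_pow_dvd[of s "ord s" "ord s * i"] i by (simp add: nat_pow_mult)
    qed (use s i in auto)
    thus ?thesis by (auto simp: I_def)
  qed
qed

lemma I_commute: "x \<in> I \<Longrightarrow> y \<in> I \<Longrightarrow> x \<otimes> y = y \<otimes> x"
  using s by (auto simp: I_def nat_pow_mult add.commute)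

lemma I_inter_L: "x \<in> I \<Longrightarrow> x \<in> L \<Longrightarrow> x = \<one>"
  using power_s_in_L by (auto simp: I_def)

text \<open>Let \<open>H = P L\<close>. The section lemma places \<open>A\<close> inside
  \<open><s> H\<close>; the point is that the powers of \<open>s\<close> that occur lie in
  \<open>A\<close> themselves. They act trivially on \<open>A\<close> modulo \<open>H\<close>, and
  they belong to a normal subgroup \<open>D\<close> built from the elements with this property,
  which maximality of \<open>A\<close> identifies with \<open>A\<close>.\<close>

lemma section_contains_powers:
  assumes P: "P \<lhd> G" "P \<subseteq> I" and C: "C = {g \<in> carrier G. \<forall>c\<in>P. g \<otimes> c = c \<otimes> g}"
    and A: "A \<lhd> G" "P \<subset> A" "A \<subseteq> C" and q: "prime q"
    and pw: "\<And>a. a \<in> A \<Longrightarrow> a [^] (q::nat) \<in> P"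
    and cm: "\<And>a b. a \<in> A \<Longrightarrow> b \<in> A \<Longrightarrow> a \<otimes> b \<otimes> inv a \<otimes> inv b \<in> P"
    and Amax: "\<And>D. D \<lhd> G \<Longrightarrow> A \<subseteq> D \<Longrightarrow> D \<subseteq> C \<Longrightarrow> (\<And>a. a \<in> D \<Longrightarrow> a [^] q \<in> P) \<Longrightarrow>
      (\<And>a b. a \<in> D \<Longrightarrow> b \<in> D \<Longrightarrow> a \<otimes> b \<otimes> inv a \<otimes> inv b \<in> P) \<Longrightarrow> D = A"
  shows "odd q" and "\<forall>v\<in>A. \<exists>i::nat. \<exists>h\<in>A \<inter> (P <#> L). s [^] i \<in> A \<and> v = s [^] i \<otimes> h"
proof -
  note sP = normal_imp_subgroup[OF P(1)] and sA = normal_imp_subgroup[OF A(1)]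
  note Pc = subgroup.mem_carrier[OF sP] and Ac = subgroup.mem_carrier[OF sA]
  note Am = subgroup.m_closed[OF sA] and Ai = subgroup.m_inv_closed[OF sA]
  have Cn: "C \<lhd> G" unfolding C by (rule centralizer_normal[OF P(1)])
  have Pcom: "\<And>c d. c \<in> P \<Longrightarrow> d \<in> P \<Longrightarrow> c \<otimes> d = d \<otimes> c" using P(2) I_commute by blast
  define H where "H = P <#> L"
  have sH: "subgroup H G" unfolding H_def by (rule mult_norm_subgroup[OF P(1) L])
  note Hc = subgroup.mem_carrier[OF sH] and Hm = subgroup.m_closed[OF sH] and Hi = subgroup.m_inv_closed[OF sH]
  have LH: "x \<in> H" if x: "x \<in> L" for x
  proof -
    have "x = \<one> \<otimes> x" using L_carrier[OF x] by simp
    thus ?thesis using x subgroup.one_closed[OF sP] unfolding H_def set_mult_def by blast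
  qed
  have PH: "c \<in> H" if c: "c \<in> P" for c
  proof -
    have "c = c \<otimes> \<one>" using Pc[OF c] by simp
    thus ?thesis using c subgroup.one_closed[OF L] unfolding H_def set_mult_def by blast
  qed
  \<comment> \<open>Elements of \<open>C\<close> all of whose conjugates stay in \<open>H\<close>
    already lie in \<open>P\<close>. For normal subgroups inside \<open>C\<close> this turns
    statements modulo \<open>H\<close> into statements modulo \<open>P\<close>.\<close>
  have coreH: "y \<in> P" if y: "y \<in> C" "\<And>g. g \<in> carrier G \<Longrightarrow> g \<otimes> y \<otimes> inv g \<in> H" for y
  proof -
    have "core H \<inter> C \<subseteq> P"
    proof (rule normal_in_product_centralizing[OF P(1) Pcom])
      show "core H \<inter> C \<lhd> G" by (rule normal_subgroup_intersect[OF core_normal[OF sH] Cn])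
      show "core H \<inter> C \<subseteq> P <#> L" using core_subset[of H] H_def by blast
      show "n \<otimes> c = c \<otimes> n" if "n \<in> core H \<inter> C" "c \<in> P" for n c using that C by blast
    qed
    moreover have "y \<in> core H \<inter> C" using y C unfolding core_def by blast
    ultimately show ?thesis by blast
  qed
  have AH: "\<not> A \<subseteq> H"
  proof
    assume "A \<subseteq> H"
    hence "A \<subseteq> P" using normal_in_product_centralizing[OF P(1) Pcom A(1)] A(3) unfolding H_def C by blast
    thus False using A(2) by blast
  qed
  have cmH: "a \<otimes> b \<otimes> inv a \<otimes> inv b \<in> H" if "a \<in> A" "b \<in> A" for a b using cm[OF that] PH by blast
  have pwH: "a [^] q \<in> H" if "a \<in> A" for a using pw[OF that] PH by blast
  show qodd: "odd q"
    by (rule prime_odd[OF A(1) cmH sH _ q pwH AH]) (use LH in blast)+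
  have twoH: "\<exists>i::nat. \<exists>h\<in>H. g = s [^] i \<otimes> \<one> \<otimes> h \<or> g = s [^] i \<otimes> \<one> \<otimes> h" if g: "g \<in> carrier G" for g
  proof -
    obtain i :: nat and x where "x \<in> L" "g = s [^] i \<otimes> x" using transitive[OF g] by blast
    hence "g = s [^] i \<otimes> \<one> \<otimes> x" using s by simp
    thus ?thesis using LH[OF \<open>x \<in> L\<close>] by blast
  qed
  have TB: "\<forall>v\<in>A. \<exists>i::nat. \<exists>h\<in>H. v = s [^] i \<otimes> h"
    by (rule two_orbit_section_cyclic(2)[OF fin A(1) sH s odd_s one_closed one_closed twoH cmH pwH q qodd]) assumption+
  have TT: "s [^] i \<otimes> v \<otimes> inv (s [^] i) \<otimes> inv v \<in> H" if "s [^] i \<in> A <#> H" "v \<in> A" for i :: nat and v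
    by (rule two_orbit_section_cyclic(3)[OF fin A(1) sH s odd_s one_closed one_closed twoH cmH pwH q qodd that]) assumption+
  have sAH: "subgroup (A <#> H) G" by (rule mult_norm_subgroup[OF A(1) sH])
  note AHc = subgroup.mem_carrier[OF sAH] and AHm = subgroup.m_closed[OF sAH] and AHi = subgroup.m_inv_closed[OF sAH]
  have A_AH: "a \<in> A <#> H" if a: "a \<in> A" for a
  proof -
    have "a = a \<otimes> \<one>" using Ac[OF a] by simp
    thus ?thesis using a subgroup.one_closed[OF sH] unfolding set_mult_def by blast
  qed
  have H_AH: "h \<in> A <#> H" if h: "h \<in> H" for h
  proof -
    have "h = \<one> \<otimes> h" using Hc[OF h] by simp
    thus ?thesis using h subgroup.one_closed[OF sA] unfolding set_mult_def by blast
  qed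
  \<comment> \<open>The elements of \<open>A H\<close> that act trivially on \<open>A\<close> modulo
    \<open>H\<close>. They satisfy the power and commutator conditions of \<open>A\<close> with
    \<open>H\<close> in place of \<open>P\<close>.\<close>
  define D1 where "D1 = {g \<in> A <#> H. \<forall>v\<in>A. g \<otimes> v \<otimes> inv g \<otimes> inv v \<in> H}"
  have D1c: "g \<in> carrier G" if "g \<in> D1" for g using that AHc by (simp add: D1_def)
  have conjA: "g \<otimes> v \<otimes> inv g \<in> A" "inv g \<otimes> v \<otimes> g \<in> A" if "g \<in> carrier G" "v \<in> A" for g v
    using normal_conj_closed[OF A(1) that(2,1)] by auto
  have sD1: "subgroup D1 G"
  proof (rule subgroupI)
    show "D1 \<subseteq> carrier G" using D1c by blast
    show "D1 \<noteq> {}" using subgroup.one_closed[OF sAH] subgroup.one_closed[OF sH] Ac by (auto simp: D1_def intro!: exI[of _ \<one>])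
    show "inv g \<in> D1" if g: "g \<in> D1" for g unfolding D1_def
    proof (intro CollectI conjI ballI)
      show "inv g \<in> A <#> H" using g AHi by (simp add: D1_def)
      fix v assume v: "v \<in> A"
      have gc: "g \<in> carrier G" "v \<in> carrier G" using D1c[OF g] Ac[OF v] by auto
      define w where "w = inv g \<otimes> v \<otimes> g"
      have w: "w \<in> A" "w \<in> carrier G" using conjA[OF gc(1) v] Ac by (auto simp: w_def)
      have "g \<otimes> w \<otimes> inv g \<otimes> inv w \<in> H" using g w by (simp add: D1_def)
      moreover have "g \<otimes> w \<otimes> inv g = v" unfolding w_def using gc by (simp add: m_assoc)
      ultimately have "inv (v \<otimes> inv w) \<in> H" using Hi by simp
      hence "w \<otimes> inv v \<in> H" using w gc by (simp add: inv_mult_group)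
      thus "inv g \<otimes> v \<otimes> inv (inv g) \<otimes> inv v \<in> H" using gc by (simp add: w_def)
    qed
    show "g \<otimes> h \<in> D1" if g: "g \<in> D1" and h: "h \<in> D1" for g h unfolding D1_def
    proof (intro CollectI conjI ballI)
      show "g \<otimes> h \<in> A <#> H" using g h AHm by (simp add: D1_def)
      fix v assume v: "v \<in> A"
      have gc: "g \<in> carrier G" "h \<in> carrier G" "v \<in> carrier G" using D1c[OF g] D1c[OF h] Ac[OF v] by auto
      define u where "u = h \<otimes> v \<otimes> inv h \<otimes> inv v"
      have uH: "u \<in> H" using h v by (simp add: D1_def u_def)
      have uA: "u \<in> A" unfolding u_def by (intro Am Ai conjA gc v)
      have uc: "u \<in> carrier G" using Ac[OF uA] .
      have "g \<otimes> u \<otimes> inv g \<otimes> inv u \<in> H" "g \<otimes> v \<otimes> inv g \<otimes> inv v \<in> H" using g uA v by (auto simp: D1_def)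
      hence "(g \<otimes> u \<otimes> inv g \<otimes> inv u) \<otimes> u \<otimes> (g \<otimes> v \<otimes> inv g \<otimes> inv v) \<in> H" using Hm uH by blast
      moreover have "(g \<otimes> u \<otimes> inv g \<otimes> inv u) \<otimes> u \<otimes> (g \<otimes> v \<otimes> inv g \<otimes> inv v) = g \<otimes> u \<otimes> v \<otimes> inv g \<otimes> inv v"
        using gc uc by (simp add: m_assoc)
      moreover have "u \<otimes> v = h \<otimes> v \<otimes> inv h" unfolding u_def using gc by (simp add: m_assoc)
      hence "g \<otimes> u \<otimes> v \<otimes> inv g \<otimes> inv v = g \<otimes> (h \<otimes> v \<otimes> inv h) \<otimes> inv g \<otimes> inv v" using gc uc by (simp add: m_assoc)
      moreover have "g \<otimes> (h \<otimes> v \<otimes> inv h) \<otimes> inv g \<otimes> inv v = g \<otimes> h \<otimes> v \<otimes> inv (g \<otimes> h) \<otimes> inv v"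
        using gc by (simp add: m_assoc inv_mult_group)
      ultimately show "g \<otimes> h \<otimes> v \<otimes> inv (g \<otimes> h) \<otimes> inv v \<in> H" by simp
    qed
  qed
  note D1m = subgroup.m_closed[OF sD1] and D1i = subgroup.m_inv_closed[OF sD1]
  have AD1: "a \<in> D1" if a: "a \<in> A" for a unfolding D1_def using a A_AH cmH by blast
  have normK: "a \<otimes> k \<otimes> inv a \<in> H" if a: "a \<in> A" and k: "k \<in> D1" "k \<in> H" for a k
  proof -
    have c: "a \<in> carrier G" "k \<in> carrier G" using Ac a D1c k by auto
    have "k \<otimes> a \<otimes> inv k \<otimes> inv a \<in> H" using k a by (simp add: D1_def)
    hence "inv (k \<otimes> a \<otimes> inv k \<otimes> inv a) \<otimes> k \<in> H" using Hm Hi k by blast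
    thus ?thesis using c by (simp add: inv_mult_group m_assoc)
  qed
  have decD1: "\<exists>a\<in>A. \<exists>h\<in>H. h \<in> D1 \<and> d = a \<otimes> h" if d: "d \<in> D1" for d
  proof -
    obtain a h where ah: "a \<in> A" "h \<in> H" "d = a \<otimes> h" using d unfolding D1_def set_mult_def by blast
    have "h = inv a \<otimes> d" using ah Ac Hc by simp
    hence "h \<in> D1" using D1m[OF D1i[OF AD1[OF ah(1)]] d] by simp
    thus ?thesis using ah by blast
  qed
  have normK': "inv a \<otimes> k \<otimes> a \<in> H \<and> inv a \<otimes> k \<otimes> a \<in> D1" if a: "a \<in> A" and k: "k \<in> D1" "k \<in> H" for a k
  proof -
    have "inv a \<otimes> k \<otimes> inv (inv a) \<in> H" by (rule normK[OF Ai[OF a] k])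
    thus ?thesis using Ac[OF a] D1m D1i AD1[OF a] k by simp
  qed
  have powD1: "d [^] q \<in> H" if d: "d \<in> D1" for d
  proof -
    obtain a h where ah: "a \<in> A" "h \<in> H" "h \<in> D1" "d = a \<otimes> h" using decD1[OF d] by blast
    have c: "a \<in> carrier G" "h \<in> carrier G" using Ac ah Hc by auto
    have "\<exists>k\<in>H. k \<in> D1 \<and> d [^] n = a [^] n \<otimes> k" for n :: nat
    proof (induction n)
      case 0 show ?case using subgroup.one_closed[OF sH] subgroup.one_closed[OF sD1] by (auto intro!: bexI[of _ \<one>])
    next
      case (Suc n)
      then obtain k where k: "k \<in> H" "k \<in> D1" "d [^] n = a [^] n \<otimes> k" by blast
      have "d [^] Suc n = a [^] Suc n \<otimes> ((inv a \<otimes> k \<otimes> a) \<otimes> h)"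
        using k(3) ah(4) c Hc[OF k(1)] by (simp add: m_assoc)
      moreover have "(inv a \<otimes> k \<otimes> a) \<otimes> h \<in> H" "(inv a \<otimes> k \<otimes> a) \<otimes> h \<in> D1"
        using normK'[OF ah(1) k(2,1)] ah Hm D1m by auto
      ultimately show ?case by (intro bexI conjI)
    qed
    then obtain k where k: "k \<in> H" "d [^] q = a [^] q \<otimes> k" by blast
    show ?thesis unfolding k(2) using Hm[OF pwH[OF ah(1)] k(1)] .
  qed
  have comD1: "d \<otimes> e \<otimes> inv d \<otimes> inv e \<in> H" if d: "d \<in> D1" and e: "e \<in> D1" for d e
  proof -
    obtain a h where ah: "a \<in> A" "h \<in> H" "h \<in> D1" "d = a \<otimes> h" using decD1[OF d] by blast
    obtain b k where bk: "b \<in> A" "k \<in> H" "k \<in> D1" "e = b \<otimes> k" using decD1[OF e] by blast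
    have c: "a \<in> carrier G" "h \<in> carrier G" "b \<in> carrier G" "k \<in> carrier G" using Ac ah bk Hc by auto
    define k1 where "k1 = (inv b \<otimes> h \<otimes> b) \<otimes> k"
    define k2 where "k2 = (inv a \<otimes> k \<otimes> a) \<otimes> h"
    have k12: "k1 \<in> H" "k1 \<in> D1" "k2 \<in> H" "k2 \<in> D1" unfolding k1_def k2_def
      using normK'[OF bk(1) ah(3,2)] normK'[OF ah(1) bk(3,2)] ah bk Hm D1m by auto
    have k12c: "k1 \<in> carrier G" "k2 \<in> carrier G" using Hc k12 by auto
    have 1: "d \<otimes> e = (a \<otimes> b) \<otimes> k1" unfolding ah(4) bk(4) k1_def using c by (simp add: m_assoc)
    have 2: "e \<otimes> d = (b \<otimes> a) \<otimes> k2" unfolding ah(4) bk(4) k2_def using c by (simp add: m_assoc)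
    have dec: "d \<in> carrier G" "e \<in> carrier G" using D1c d e by auto
    have "d \<otimes> e \<otimes> inv d \<otimes> inv e = (d \<otimes> e) \<otimes> inv (e \<otimes> d)" using dec by (simp add: inv_mult_group m_assoc)
    also have "\<dots> = ((a \<otimes> b) \<otimes> (k1 \<otimes> inv k2) \<otimes> inv (a \<otimes> b)) \<otimes> (a \<otimes> b \<otimes> inv a \<otimes> inv b)"
      unfolding 1 2 using c k12c by (simp add: inv_mult_group m_assoc)
    also have "\<dots> \<in> H"
      by (rule Hm[OF normK[OF Am[OF ah(1) bk(1)] D1m[OF k12(2) D1i[OF k12(4)]] Hm[OF k12(1) Hi[OF k12(3)]]] cmH[OF ah(1) bk(1)]])
    finally show ?thesis .
  qed
  \<comment> \<open>Taking the core produces a normal subgroup, and \<open>coreH\<close> then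
    improves \<open>H\<close> to \<open>P\<close>, so that \<open>Amax\<close> applies.\<close>
  define D where "D = core D1 \<inter> C"
  have Dn: "D \<lhd> G" unfolding D_def by (rule normal_subgroup_intersect[OF core_normal[OF sD1] Cn])
  note sD = normal_imp_subgroup[OF Dn]
  have DD1: "d \<in> D1" if "d \<in> D" for d using that core_subset[of D1] by (auto simp: D_def)
  have Dc: "d \<in> carrier G" if "d \<in> D" for d using DD1[OF that] D1c by blast
  have DC: "D \<subseteq> C" by (auto simp: D_def)
  note sC = normal_imp_subgroup[OF Cn]
  have "D = A"
  proof (rule Amax[OF Dn _ DC])
    show "A \<subseteq> D"
    proof
      fix a assume a: "a \<in> A"
      hence "a \<in> core D1" unfolding core_def using Ac[OF a] AD1 conjA by blast
      thus "a \<in> D" using a A(3) by (auto simp: D_def)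
    qed
    show "d [^] q \<in> P" if d: "d \<in> D" for d
    proof (rule coreH)
      show "d [^] q \<in> C" using subgroup_nat_pow_closed[OF sC] d DC by blast
      fix g assume g: "g \<in> carrier G"
      have "(g \<otimes> d \<otimes> inv g) [^] n = g \<otimes> d [^] n \<otimes> inv g" for n :: nat
        using g Dc[OF d] by (induction n) (simp_all add: m_assoc)
      thus "g \<otimes> d [^] q \<otimes> inv g \<in> H"
        using powD1[OF DD1[OF normal_conj_closed(1)[OF Dn d g]]] by simp
    qed
    show "d \<otimes> e \<otimes> inv d \<otimes> inv e \<in> P" if d: "d \<in> D" and e: "e \<in> D" for d e
    proof (rule coreH)
      have "d \<otimes> e \<otimes> inv d \<otimes> inv e \<in> D"
        using d e subgroup.m_closed[OF sD] subgroup.m_inv_closed[OF sD] by blast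
      thus "d \<otimes> e \<otimes> inv d \<otimes> inv e \<in> C" using DC by blast
      fix g assume g: "g \<in> carrier G"
      have "g \<otimes> (d \<otimes> e \<otimes> inv d \<otimes> inv e) \<otimes> inv g =
        (g \<otimes> d \<otimes> inv g) \<otimes> (g \<otimes> e \<otimes> inv g) \<otimes> inv (g \<otimes> d \<otimes> inv g) \<otimes> inv (g \<otimes> e \<otimes> inv g)"
        using g Dc[OF d] Dc[OF e] by (simp add: inv_mult_group m_assoc)
      thus "g \<otimes> (d \<otimes> e \<otimes> inv d \<otimes> inv e) \<otimes> inv g \<in> H"
        using comD1[OF DD1[OF normal_conj_closed(1)[OF Dn d g]] DD1[OF normal_conj_closed(1)[OF Dn e g]]] by simp
    qed
  qed
  \<comment> \<open>By \<open>transitive'\<close> every conjugate of \<open>s [^] i\<close> is a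
    conjugate by some \<open>x\<close> in \<open>L\<close>, and conjugation by \<open>x\<close>
    preserves \<open>A\<close>, \<open>H\<close> and hence the conditions defining
    \<open>D1\<close>. So \<open>s [^] i\<close> lies in the core.\<close>
  have powA: "s [^] i \<in> A" if i: "s [^] i \<in> A <#> H" for i :: nat
  proof -
    have d: "s [^] i \<in> D1" unfolding D1_def using i TT by blast
    have "s [^] i \<in> core D1" unfolding core_def
    proof (intro CollectI conjI ballI)
      fix g assume "g \<in> carrier G"
      then obtain j :: nat and x where x: "x \<in> L" "g = x \<otimes> inv (s [^] j)" using transitive' by blast
      have xc: "x \<in> carrier G" using L_carrier x(1) by blast
      have "inv (s [^] j) \<otimes> s [^] i \<otimes> s [^] j = s [^] i"
      proof -
        have "s [^] i \<otimes> s [^] j = s [^] j \<otimes> s [^] i" using s by (simp add: nat_pow_mult add.commute)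
        thus ?thesis using s by (simp add: m_assoc)
      qed
      moreover have "g \<otimes> s [^] i \<otimes> inv g = x \<otimes> (inv (s [^] j) \<otimes> s [^] i \<otimes> s [^] j) \<otimes> inv x"
        unfolding x(2) using xc s by (simp add: inv_mult_group m_assoc)
      ultimately have e: "g \<otimes> s [^] i \<otimes> inv g = x \<otimes> s [^] i \<otimes> inv x" by simp
      show "g \<otimes> s [^] i \<otimes> inv g \<in> D1" unfolding e D1_def
      proof (intro CollectI conjI ballI)
        have xAH: "x \<in> A <#> H" using H_AH LH x(1) by blast
        show "x \<otimes> s [^] i \<otimes> inv x \<in> A <#> H" using xAH i AHm AHi by blast
        fix v assume v: "v \<in> A"
        define w where "w = inv x \<otimes> v \<otimes> x"
        have w: "w \<in> A" "w \<in> carrier G" "v = x \<otimes> w \<otimes> inv x"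
          using conjA[OF xc v] Ac Ac[OF v] xc by (auto simp: w_def m_assoc)
        have "x \<otimes> (s [^] i \<otimes> w \<otimes> inv (s [^] i) \<otimes> inv w) \<otimes> inv x \<in> H"
          using TT[OF i w(1)] LH[OF x(1)] Hm Hi by blast
        moreover have "x \<otimes> s [^] i \<otimes> inv x \<otimes> v \<otimes> inv (x \<otimes> s [^] i \<otimes> inv x) \<otimes> inv v
          = x \<otimes> (s [^] i \<otimes> w \<otimes> inv (s [^] i) \<otimes> inv w) \<otimes> inv x"
          unfolding w(3) using w(2) xc s by (simp add: inv_mult_group m_assoc)
        ultimately show "x \<otimes> s [^] i \<otimes> inv x \<otimes> v \<otimes> inv (x \<otimes> s [^] i \<otimes> inv x) \<otimes> inv v \<in> H" by simp
      qed
    qed (use s in simp)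
    moreover have "s [^] i \<in> C" unfolding C using s P(2) I_commute[of "s [^] i"] by (auto simp: I_def)
    ultimately show ?thesis using \<open>D = A\<close> by (auto simp: D_def)
  qed
  show "\<forall>v\<in>A. \<exists>i::nat. \<exists>h\<in>A \<inter> (P <#> L). s [^] i \<in> A \<and> v = s [^] i \<otimes> h"
  proof
    fix v assume v: "v \<in> A"
    obtain i :: nat and h where h: "h \<in> H" "v = s [^] i \<otimes> h" using TB v by blast
    have "s [^] i = v \<otimes> inv h" unfolding h(2) using s Hc[OF h(1)] by (simp add: m_assoc)
    hence "s [^] i \<in> A <#> H" using AHm[OF A_AH[OF v] H_AH[OF Hi[OF h(1)]]] by simp
    hence si: "s [^] i \<in> A" by (rule powA)
    have "h = inv (s [^] i) \<otimes> v" unfolding h(2) using s Hc[OF h(1)] by simp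
    hence "h \<in> A" using Am[OF Ai[OF si] v] by simp
    thus "\<exists>i::nat. \<exists>h\<in>A \<inter> (P <#> L). s [^] i \<in> A \<and> v = s [^] i \<otimes> h" using si h unfolding H_def by blast
  qed
qed

end

context core_free_pair begin

lemma torsion_prime_unique:
  fixes p q :: nat
  assumes M: "M \<lhd> G" "\<And>v w. v \<in> M \<Longrightarrow> w \<in> M \<Longrightarrow> v \<otimes> w = w \<otimes> v"
    and N: "N \<lhd> G" "\<And>v w. v \<in> N \<Longrightarrow> w \<in> N \<Longrightarrow> v \<otimes> w = w \<otimes> v"
    and p: "prime p" "x \<in> M" "x \<noteq> \<one>" "x [^] p = \<one>"
    and q: "prime q" "y \<in> N" "y \<noteq> \<one>" "y [^] q = \<one>"
  shows "p = q"
proof (rule prime_unique[OF torsion_normal[OF M, of p] _ _ p(1) _ torsion_normal[OF N, of q] _ _ q(1)])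
  show "{m \<in> M. m [^] p = \<one>} \<noteq> {\<one>}" using p by blast
  show "{m \<in> N. m [^] q = \<one>} \<noteq> {\<one>}" using q by blast
qed (use M(2) N(2) in auto)

text \<open>For a maximal section \<open>A / P\<close> it suffices to show that
  \<open>A \<inter> P L\<close> lies in \<open>P\<close>, for then \<open>A\<close> consists of
  powers of \<open>s\<close>. That would follow from \<open>normal_in_product_centralizing\<close>
  if the intersection were normal in \<open>G\<close>. For nontrivial \<open>P\<close> the proof
  therefore describes it in an invariant way: its elements are those whose \<open>q\<close>-th power
  is the \<open>q\<close>-th power of an element of \<open>P\<close>.\<close>

lemma normal_power_subgroup_grows:
  assumes P: "P \<lhd> G" "P \<subseteq> I" and ne: "{g \<in> carrier G. \<forall>c\<in>P. g \<otimes> c = c \<otimes> g} \<noteq> P"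
  shows "\<exists>A. A \<lhd> G \<and> A \<subseteq> I \<and> P \<subset> A"
proof -
  define C where "C = {g \<in> carrier G. \<forall>c\<in>P. g \<otimes> c = c \<otimes> g}"
  note sP = normal_imp_subgroup[OF P(1)]
  note Pc = subgroup.mem_carrier[OF sP]
  have Pcom: "\<And>c d. c \<in> P \<Longrightarrow> d \<in> P \<Longrightarrow> c \<otimes> d = d \<otimes> c" using P(2) I_commute by blast
  have Cn: "C \<lhd> G" unfolding C_def by (rule centralizer_normal[OF P(1)])
  have PC: "P \<subset> C" using ne Pc Pcom unfolding C_def by blast
  obtain A0 q where A0: "A0 \<lhd> G" "P \<subset> A0" "A0 \<subseteq> C" "prime q" "\<And>a. a \<in> A0 \<Longrightarrow> a [^] (q::nat) \<in> P"
    "\<And>a b. a \<in> A0 \<Longrightarrow> b \<in> A0 \<Longrightarrow> a \<otimes> b \<otimes> inv a \<otimes> inv b \<in> P"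
    by (rule solvable_normal_section[OF fin solv P(1) Cn PC]) blast
  define S where "S A \<longleftrightarrow> A \<lhd> G \<and> P \<subset> A \<and> A \<subseteq> C \<and> (\<forall>a\<in>A. a [^] q \<in> P) \<and>
    (\<forall>a\<in>A. \<forall>b\<in>A. a \<otimes> b \<otimes> inv a \<otimes> inv b \<in> P)" for A
  have "S A0" unfolding S_def using A0 by blast
  moreover have "\<forall>A. S A \<longrightarrow> card A < Suc (card (carrier G))"
    using card_mono[OF fin] subgroup.subset normal_imp_subgroup unfolding S_def by (metis less_Suc_eq_le)
  ultimately obtain A where A: "S A" and mx: "\<And>D. S D \<Longrightarrow> card D \<le> card A"
    using ex_has_greatest_nat[of S A0 card "Suc (card (carrier G))"] by blast
  have An: "A \<lhd> G" "P \<subset> A" "A \<subseteq> C" and pw: "\<And>a. a \<in> A \<Longrightarrow> a [^] q \<in> P"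
    and cm: "\<And>a b. a \<in> A \<Longrightarrow> b \<in> A \<Longrightarrow> a \<otimes> b \<otimes> inv a \<otimes> inv b \<in> P"
    using A unfolding S_def by blast+
  note sA = normal_imp_subgroup[OF An(1)]
  note Ac = subgroup.mem_carrier[OF sA] and Am = subgroup.m_closed[OF sA] and Ai = subgroup.m_inv_closed[OF sA]
  have Amax: "D = A" if D: "D \<lhd> G" "A \<subseteq> D" "D \<subseteq> C" "\<And>a. a \<in> D \<Longrightarrow> a [^] q \<in> P"
      "\<And>a b. a \<in> D \<Longrightarrow> b \<in> D \<Longrightarrow> a \<otimes> b \<otimes> inv a \<otimes> inv b \<in> P" for D
  proof -
    have "S D" unfolding S_def using D An(2) by blast
    moreover have "finite D" using finite_subset[OF subgroup.subset[OF normal_imp_subgroup[OF D(1)]] fin] .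
    ultimately show ?thesis using card_seteq[of D A] mx D(2) by blast
  qed
  have qodd: "odd q"
    by (rule section_contains_powers(1)[OF P C_def An A0(4) pw cm Amax])
  have dec: "\<forall>v\<in>A. \<exists>i::nat. \<exists>h\<in>A \<inter> (P <#> L). s [^] i \<in> A \<and> v = s [^] i \<otimes> h"
    by (rule section_contains_powers(2)[OF P C_def An A0(4) pw cm Amax])
  have AP: "a \<otimes> c = c \<otimes> a" if "a \<in> A" "c \<in> P" for a c using that An(3) C_def by blast
  have key: "A \<inter> (P <#> L) \<subseteq> P"
  proof (cases "P = {\<one>}")
    case True
    have com: "v \<otimes> w = w \<otimes> v" if "v \<in> A" "w \<in> A" for v w
      using cm[OF that] True commute_imp_commutator_one[of v w] Ac that by blast
    have "A \<inter> L = {\<one>}" by (rule normal_abelian_inter_L[OF An(1) com])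
    moreover have "P <#> L = L" unfolding True set_mult_def using L_carrier by auto
    ultimately show ?thesis using True by blast
  next
    case False
    \<comment> \<open>Without \<open>q\<close>-torsion in \<open>P\<close> the commutators of
      \<open>A\<close>, which are killed by \<open>q\<close>, would vanish, and an element of
      \<open>A\<close> outside \<open>P\<close> could be divided by a \<open>q\<close>-th root taken
      in \<open>P\<close> to give an element of order \<open>q\<close>. But \<open>P\<close>
      contains elements of some prime order, and uniqueness of the prime makes it
      \<open>q\<close>.\<close>
    have tors: "\<exists>y\<in>P. y \<noteq> \<one> \<and> y [^] q = \<one>"
    proof (rule ccontr)
      assume nt: "\<not> (\<exists>y\<in>P. y \<noteq> \<one> \<and> y [^] q = \<one>)"
      have com: "v \<otimes> w = w \<otimes> v" if v: "v \<in> A" and w: "w \<in> A" for v w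
      proof -
        define z where "z = v \<otimes> w \<otimes> inv v \<otimes> inv w"
        have c: "v \<in> carrier G" "w \<in> carrier G" using Ac v w by auto
        have z: "z \<in> P" unfolding z_def by (rule cm[OF v w])
        have "v \<otimes> w = z \<otimes> (w \<otimes> v)" unfolding z_def using c by (simp add: m_assoc)
        from class_two_pow_commute[OF c Pc[OF z] this AP[OF v z, symmetric] AP[OF w z, symmetric], of q]
        have "v [^] q \<otimes> w = z [^] q \<otimes> (w \<otimes> v [^] q)" .
        also have "w \<otimes> v [^] q = v [^] q \<otimes> w" by (rule AP[OF w pw[OF v]])
        finally have "z [^] q = \<one>" using c Pc[OF z] by simp
        hence "z = \<one>" using nt z by blast
        thus ?thesis using commute_imp_commutator_one[OF c] unfolding z_def by simp
      qed
      have "inj_on (\<lambda>c. c [^] q) P"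
      proof (rule inj_onI)
        fix c d assume cd: "c \<in> P" "d \<in> P" "c [^] q = d [^] q"
        have "(c \<otimes> inv d) [^] q = c [^] q \<otimes> inv d [^] q"
          using Pcom[OF cd(1) subgroup.m_inv_closed[OF sP cd(2)]] Pc cd by (intro pow_mult_distrib) auto
        also have "\<dots> = \<one>" using cd(3) Pc[OF cd(2)] by (simp add: nat_pow_inv)
        finally have "c \<otimes> inv d = \<one>"
          using nt subgroup.m_closed[OF sP cd(1) subgroup.m_inv_closed[OF sP cd(2)]] by blast
        thus "c = d" using Pc[OF cd(1)] Pc[OF cd(2)] inv_equality[of c "inv d"] by simp
      qed
      hence surj: "(\<lambda>c. c [^] q) ` P = P"
        using endo_inj_surj[of P "\<lambda>c. c [^] q"] finite_subset[OF subgroup.subset[OF sP] fin]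
          subgroup_nat_pow_closed[OF sP] by blast
      obtain x where x: "x \<in> A" "x \<notin> P" using An(2) by blast
      have "x [^] q \<in> (\<lambda>c. c [^] q) ` P" unfolding surj by (rule pw[OF x(1)])
      then obtain c where c: "c \<in> P" "x [^] q = c [^] q" by blast
      have cA: "c \<in> A" using An(2) c by blast
      define z where "z = x \<otimes> inv c"
      have zA: "z \<in> A" unfolding z_def using Am Ai x cA by blast
      have zn: "z \<noteq> \<one>"
      proof
        assume "z = \<one>"
        hence "x = c" unfolding z_def using Ac[OF x(1)] Pc[OF c(1)] inv_equality[of x "inv c"] by simp
        thus False using x c by simp
      qed
      have "z [^] q = x [^] q \<otimes> inv c [^] q" unfolding z_def
        using com[OF x(1) Ai[OF cA]] Ac[OF x(1)] Pc[OF c(1)] by (intro pow_mult_distrib) auto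
      hence zq: "z [^] q = \<one>" using c(2) Pc[OF c(1)] by (simp add: nat_pow_inv)
      obtain u where u: "u \<in> P" "u \<noteq> \<one>" using False subgroup.one_closed[OF sP] by blast
      obtain p k :: nat where p: "prime p" "u [^] k \<noteq> \<one>" "(u [^] k) [^] p = \<one>"
        using exists_power_of_prime_order[OF Pc[OF u(1)] u(2) fin] by blast
      have uk: "u [^] k \<in> P" by (rule subgroup_nat_pow_closed[OF sP u(1)])
      have "p = q" by (rule torsion_prime_unique[OF P(1) Pcom An(1) com p(1) uk p(2,3) A0(4) zA zn zq])
      thus False using nt uk p by blast
    qed
    then obtain y where y: "y \<in> P" "y \<noteq> \<one>" "y [^] q = \<one>" by blast
    \<comment> \<open>The commutators of \<open>A\<close> are central in \<open>A\<close> and killed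
      by \<open>q\<close>; an odd \<open>q\<close> divides \<open>q choose 2\<close>, so the
      \<open>q\<close>-th power map is multiplicative.\<close>
    have qpow: "(v \<otimes> w) [^] q = v [^] q \<otimes> w [^] q" if v: "v \<in> A" and w: "w \<in> A" for v w
    proof -
      define z where "z = w \<otimes> v \<otimes> inv w \<otimes> inv v"
      have c: "v \<in> carrier G" "w \<in> carrier G" using Ac v w by auto
      have z: "z \<in> P" unfolding z_def by (rule cm[OF w v])
      have zw: "w \<otimes> v = z \<otimes> (v \<otimes> w)" unfolding z_def using c by (simp add: m_assoc)
      from class_two_pow_commute[OF c(2,1) Pc[OF z] this AP[OF w z, symmetric] AP[OF v z, symmetric], of q]
      have "w [^] q \<otimes> v = z [^] q \<otimes> (v \<otimes> w [^] q)" .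
      also have "v \<otimes> w [^] q = w [^] q \<otimes> v" by (rule AP[OF v pw[OF w]])
      finally have zq: "z [^] q = \<one>" using c Pc[OF z] by simp
      have "2 * (q choose 2) = q * (q - 1)" by (cases q) (simp_all add: choose_two)
      hence "q dvd 2 * (q choose 2)" by simp
      hence "q dvd (q choose 2)" using qodd by (metis coprime_dvd_mult_right_iff coprime_right_2_iff_odd)
      hence "z [^] (q choose 2) = \<one>" using nat_pow_dvd[OF Pc[OF z] zq] by blast
      thus ?thesis using class_two_pow_mult[OF c Pc[OF z] zw AP[OF v z, symmetric] AP[OF w z, symmetric], of q] c by simp
    qed
    have PL1: "P \<inter> L = {\<one>}" by (rule normal_abelian_inter_L[OF P(1) Pcom])
    have B1: "\<exists>c\<in>P. h [^] q = c [^] q" if h: "h \<in> A" "h \<in> P <#> L" for h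
    proof -
      obtain c x where cx: "c \<in> P" "x \<in> L" "h = c \<otimes> x" using h(2) unfolding set_mult_def by blast
      have cA: "c \<in> A" using An(2) cx(1) by blast
      have "x = inv c \<otimes> h" unfolding cx(3) using Pc[OF cx(1)] L_carrier[OF cx(2)] by simp
      hence xA: "x \<in> A" using Am[OF Ai[OF cA] h(1)] by simp
      have "x [^] q \<in> P \<inter> L" using pw[OF xA] subgroup_nat_pow_closed[OF L cx(2)] by blast
      hence "x [^] q = \<one>" using PL1 by blast
      hence "h [^] q = c [^] q" unfolding cx(3) qpow[OF cA xA] using Pc[OF cx(1)] by simp
      thus ?thesis using cx(1) by blast
    qed
    define B where "B = {x \<in> A. \<exists>c\<in>P. x [^] q = c [^] q}"
    \<comment> \<open>The element \<open>z\<close> of \<open>I\<close> differs from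
      \<open>s [^] i\<close> by elements of \<open>P\<close> and is killed by \<open>q\<close>. A
      cyclic group has only one subgroup of order \<open>q\<close>, and \<open>P\<close> contains
      it; so \<open>z\<close>, and with it \<open>s [^] i\<close>, lies in \<open>P\<close>.\<close>
    have B2: "x \<in> P <#> L" if x: "x \<in> B" for x
    proof -
      have xA: "x \<in> A" using x by (simp add: B_def)
      obtain c where c: "c \<in> P" "x [^] q = c [^] q" using x unfolding B_def by blast
      obtain i :: nat and h where ih: "h \<in> A" "h \<in> P <#> L" "s [^] i \<in> A" "x = s [^] i \<otimes> h" using dec xA by blast
      obtain d where d: "d \<in> P" "h [^] q = d [^] q" using B1[OF ih(1,2)] by blast
      have dc: "d \<in> carrier G" "c \<in> carrier G" "d \<in> A" "c \<in> A" using Pc c d An(2) by auto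
      define z where "z = s [^] i \<otimes> (d \<otimes> inv c)"
      have "(s [^] i) [^] q \<otimes> d [^] q = c [^] q" using qpow[OF ih(3,1)] ih(4) d(2) c(2) by simp
      moreover have "z [^] q = (s [^] i) [^] q \<otimes> (d [^] q \<otimes> inv (c [^] q))"
        unfolding z_def using qpow ih(3) dc Am Ai by (simp add: nat_pow_inv)
      ultimately have zq: "z [^] q = \<one>" using s dc by (simp add: m_assoc[symmetric])
      have "s [^] i \<in> I" "d \<in> I" "c \<in> I" using P(2) c d by (auto simp: I_def)
      hence "z \<in> I" unfolding z_def
        using subgroup.m_closed[OF I_subgroup] subgroup.m_inv_closed[OF I_subgroup] by simp
      then obtain m :: nat where m: "z = s [^] m" by (auto simp: I_def)
      have "y \<in> I" using y P(2) by blast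
      then obtain j :: nat where j: "y = s [^] j" by (auto simp: I_def)
      have "z \<in> P" unfolding m
        by (rule cyclic_torsion_mem[OF s _ A0(4) sP, of j]) (use y j zq m odd_s odd_pos in auto)
      moreover have "s [^] i = z \<otimes> inv (d \<otimes> inv c)" unfolding z_def using s dc by (simp add: m_assoc)
      ultimately have "s [^] i \<in> P" using subgroup.m_closed[OF sP] subgroup.m_inv_closed[OF sP] c d by simp
      moreover have sPL: "subgroup (P <#> L) G" by (rule mult_norm_subgroup[OF P(1) L])
      moreover have "s [^] i = s [^] i \<otimes> \<one>" using s by simp
      ultimately have "s [^] i \<in> P <#> L" using subgroup.one_closed[OF L] unfolding set_mult_def by blast
      thus ?thesis using subgroup.m_closed[OF sPL _ ih(2)] ih(4) by simp
    qed
    have Beq: "A \<inter> (P <#> L) = B" using B1 B2 unfolding B_def by blast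
    have sB: "subgroup B G" unfolding Beq[symmetric]
      by (rule subgroups_Inter_pair[OF sA mult_norm_subgroup[OF P(1) L]])
    have Bn: "B \<lhd> G"
    proof (rule normal_invI[OF sB])
      fix g h assume g: "g \<in> carrier G" and h: "h \<in> B"
      obtain c where c: "c \<in> P" "h [^] q = c [^] q" using h unfolding B_def by blast
      have hA: "h \<in> A" using h by (simp add: B_def)
      have cj: "(g \<otimes> x \<otimes> inv g) [^] n = g \<otimes> x [^] n \<otimes> inv g" if "x \<in> carrier G" for x and n :: nat
        using g that by (induction n) (simp_all add: m_assoc)
      have "(g \<otimes> h \<otimes> inv g) [^] q = (g \<otimes> c \<otimes> inv g) [^] q" using cj[OF Ac[OF hA]] cj[OF Pc[OF c(1)]] c(2) by simp
      thus "g \<otimes> h \<otimes> inv g \<in> B"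
        unfolding B_def using normal_conj_closed(1)[OF An(1) hA g] normal_conj_closed(1)[OF P(1) c(1) g] by blast
    qed
    show ?thesis unfolding Beq
      by (rule normal_in_product_centralizing[OF P(1) Pcom Bn]) (use B2 AP in \<open>auto simp: B_def\<close>)
  qed
  have "A \<subseteq> I"
  proof
    fix v assume "v \<in> A"
    then obtain i :: nat and h where "h \<in> A \<inter> (P <#> L)" "v = s [^] i \<otimes> h" using dec by blast
    thus "v \<in> I" using key P(2) subgroup.m_closed[OF I_subgroup, of "s [^] i" h] by (auto simp: I_def)
  qed
  thus ?thesis using An by blast
qed

text \<open>A largest normal subgroup \<open>P\<close> of \<open>G\<close> inside \<open>I\<close>
  is its own centraliser, as it would grow otherwise; but the abelian group \<open>I\<close>
  centralises \<open>P\<close>.\<close>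

lemma I_normal_self_centralizing:
  "I \<lhd> G" "{g \<in> carrier G. \<forall>c\<in>I. g \<otimes> c = c \<otimes> g} = I"
proof -
  define S where "S P \<longleftrightarrow> P \<lhd> G \<and> P \<subseteq> I" for P
  have "S {\<one>}" unfolding S_def using one_is_normal subgroup.one_closed[OF I_subgroup] by blast
  moreover have "\<forall>A. S A \<longrightarrow> card A < Suc (card (carrier G))"
    using card_mono[OF fin] subgroup.subset normal_imp_subgroup unfolding S_def by (metis less_Suc_eq_le)
  ultimately obtain P where P: "S P" and mx: "\<And>D. S D \<Longrightarrow> card D \<le> card P"
    using ex_has_greatest_nat[of S "{\<one>}" card "Suc (card (carrier G))"] by blast
  have Pn: "P \<lhd> G" "P \<subseteq> I" using P by (auto simp: S_def)
  have C: "{g \<in> carrier G. \<forall>c\<in>P. g \<otimes> c = c \<otimes> g} = P"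
  proof (rule ccontr)
    assume "{g \<in> carrier G. \<forall>c\<in>P. g \<otimes> c = c \<otimes> g} \<noteq> P"
    then obtain A where A: "A \<lhd> G" "A \<subseteq> I" "P \<subset> A" using normal_power_subgroup_grows[OF Pn] by blast
    have "finite A" using finite_subset[OF subgroup.subset[OF normal_imp_subgroup[OF A(1)]] fin] .
    hence "card P < card A" using A(3) by (rule psubset_card_mono)
    moreover have "card A \<le> card P" by (rule mx) (use A in \<open>simp add: S_def\<close>)
    ultimately show False by simp
  qed
  have "I \<subseteq> {g \<in> carrier G. \<forall>c\<in>P. g \<otimes> c = c \<otimes> g}"
    using I_commute Pn(2) subgroup.mem_carrier[OF I_subgroup] by blast
  hence "I = P" using C Pn(2) by blast
  thus "I \<lhd> G" "{g \<in> carrier G. \<forall>c\<in>I. g \<otimes> c = c \<otimes> g} = I" using Pn C by auto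
qed

end

section \<open>Geometric sums modulo powers of an odd prime\<close>

lemma geometric_sum_prime_one_mod:
  fixes p :: nat and \<nu> :: int
  assumes p: "prime p" "odd p" and \<nu>: "int p dvd \<nu> - 1"
  shows "\<exists>w. (\<Sum>j<p. \<nu> ^ j) = int p * w \<and> \<not> int p dvd w"
proof -
  obtain t where t: "\<nu> = 1 + int p * t" using \<nu> by (metis dvd_def add.commute diff_add_cancel)
  \<comment> \<open>Modulo \<open>p ^ 2\<close> the powers of \<open>1 + p t\<close> are linear in
    the exponent, and an odd \<open>p\<close> divides \<open>0 + ... + (p - 1)\<close>; so the sum
    is congruent to \<open>p\<close> modulo \<open>p ^ 2\<close>.\<close>
  have pw: "\<exists>z. \<nu> ^ j = 1 + int j * int p * t + int p ^ 2 * z" for j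
  proof (induction j)
    case (Suc j)
    then obtain z where "\<nu> ^ j = 1 + int j * int p * t + int p ^ 2 * z" by blast
    hence "\<nu> ^ Suc j = 1 + int (Suc j) * int p * t + int p ^ 2 * (z + z * int p * t + int j * t ^ 2)"
      unfolding power_Suc t by (simp add: algebra_simps power2_eq_square)
    thus ?case by blast
  qed (auto intro: exI[of _ 0])
  then obtain z where z: "\<And>j. \<nu> ^ j = 1 + int j * int p * t + int p ^ 2 * z j" by metis
  have "(\<Sum>j<p. \<nu> ^ j) = int p + int p * t * (\<Sum>j<p. int j) + int p ^ 2 * (\<Sum>j<p. z j)"
    unfolding z by (simp add: sum.distrib sum_distrib_left sum_distrib_right mult_ac)
  moreover have "int p dvd (\<Sum>j<p. int j)"
  proof -
    have "2 * (\<Sum>j<p. int j) = int p * (int p - 1)"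
      by (induction p) (simp_all add: algebra_simps)
    hence "int p dvd 2 * (\<Sum>j<p. int j)" by simp
    moreover have "coprime (int p) 2" using p(2) by simp
    ultimately show ?thesis using coprime_dvd_mult_right_iff by blast
  qed
  then obtain r where "(\<Sum>j<p. int j) = int p * r" by blast
  ultimately have "(\<Sum>j<p. \<nu> ^ j) = int p * (1 + int p * (t * r + (\<Sum>j<p. z j)))"
    by (simp add: algebra_simps power2_eq_square)
  moreover have "\<not> int p dvd 1 + int p * (t * r + (\<Sum>j<p. z j))"
  proof
    assume "int p dvd 1 + int p * (t * r + (\<Sum>j<p. z j))"
    hence "int p dvd 1" by (simp add: dvd_add_left_iff)
    thus False using prime_gt_1_nat[OF p(1)] by simp
  qed
  ultimately show ?thesis by blast
qed

text \<open>Cutting the range into blocks of length \<open>p ^ r\<close> factors the sum for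
  \<open>p ^ Suc r\<close> into the one for \<open>p ^ r\<close> and a sum of \<open>p\<close>
  powers of \<open>\<mu> ^ p ^ r\<close>, which contains \<open>p\<close> exactly once. Such a sum
  is the exponent of \<open>s\<close> that appears in powers of
  \<open>s [^] c \<otimes> x\<close>.\<close>

lemma geometric_sum_prime_power:
  fixes p :: nat and \<mu> :: int
  assumes p: "prime p" "odd p" and \<mu>: "int p dvd \<mu> - 1"
  shows "\<exists>w. (\<Sum>j<p ^ r. \<mu> ^ j) = int p ^ r * w \<and> \<not> int p dvd w"
proof (induction r)
  case 0
  show ?case using prime_gt_1_nat[OF p(1)] by (auto intro!: exI[of _ 1])
next
  case (Suc r)
  then obtain w where w: "(\<Sum>j<p ^ r. \<mu> ^ j) = int p ^ r * w" "\<not> int p dvd w" by blast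
  have "\<mu> - 1 dvd \<mu> ^ p ^ r - 1" by (metis dvd_triv_left power_diff_1_eq)
  hence "int p dvd \<mu> ^ p ^ r - 1" using \<mu> dvd_trans by blast
  then obtain w' where w': "(\<Sum>j<p. (\<mu> ^ p ^ r) ^ j) = int p * w'" "\<not> int p dvd w'"
    using geometric_sum_prime_one_mod[OF p] by blast
  have split: "(\<Sum>j<m * k. \<mu> ^ j) = (\<Sum>j<k. \<mu> ^ j) * (\<Sum>j<m. (\<mu> ^ k) ^ j)" for k m
  proof -
    have "(\<Sum>j\<in>{i * k..<i * k + k}. \<mu> ^ j) = (\<mu> ^ k) ^ i * (\<Sum>j<k. \<mu> ^ j)" for i
    proof -
      have "(\<Sum>j\<in>{i * k..<i * k + k}. \<mu> ^ j) = (\<Sum>j<k. \<mu> ^ (i * k + j))"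
        by (rule sum.reindex_bij_witness[of _ "\<lambda>j. i * k + j" "\<lambda>j. j - i * k"]) auto
      thus ?thesis by (simp add: power_add sum_distrib_left power_mult mult.commute[of i])
    qed
    hence "(\<Sum>j<m * k. \<mu> ^ j) = (\<Sum>i<m. (\<mu> ^ k) ^ i * (\<Sum>j<k. \<mu> ^ j))"
      by (simp flip: sum.nat_group)
    thus ?thesis unfolding sum_distrib_right[symmetric] by (rule trans[OF _ mult.commute])
  qed
  have "(\<Sum>j<p ^ Suc r. \<mu> ^ j) = int p ^ Suc r * (w * w')"
    using split[where m = p and k = "p ^ r"] w(1) w'(1) by simp
  moreover have "\<not> int p dvd w * w'" using w(2) w'(2) p(1) by (simp add: prime_dvd_mult_iff)
  ultimately show ?case by blast
qed

lemma prime_power_of_unique_prime_divisor: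
  fixes n p :: nat
  assumes "n > 0" "\<And>q. prime q \<Longrightarrow> q dvd n \<Longrightarrow> q = p"
  shows "\<exists>a. n = p ^ a"
  using assms
proof (induction n rule: less_induct)
  case (less n)
  show ?case
  proof (cases "n = 1")
    case False
    then obtain q where q: "prime q" "q dvd n" using prime_factor_nat by blast
    hence "q = p" using less.prems by blast
    then obtain m where m: "n = p * m" using q by blast
    have "p > 1" using q \<open>q = p\<close> prime_gt_1_nat by blast
    hence "m < n" "m > 0" using m less.prems(1) by auto
    then obtain a where "m = p ^ a" using less.IH[of m] less.prems(2) m by (metis dvd_mult)
    thus ?thesis using m by (metis power_Suc)
  qed (auto intro: exI[of _ 0])
qed

section \<open>The common overgroup of \<open>L\<close> and a conjugate of \<open>R\<close>\<close>

context core_free_pair begin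

lemma conjugate_power:
  assumes g: "g \<in> carrier G"
  obtains m :: nat where "\<And>i::nat. g \<otimes> s [^] i \<otimes> inv g = s [^] (m * i)"
proof -
  have "s \<in> I" using s unfolding I_def by (metis nat_pow_eone rangeI)
  hence "g \<otimes> s \<otimes> inv g \<in> I" by (rule normal_conj_closed(1)[OF I_normal_self_centralizing(1) _ g])
  then obtain m :: nat where m: "g \<otimes> s \<otimes> inv g = s [^] m" by (auto simp: I_def)
  have "(g \<otimes> s \<otimes> inv g) [^] i = g \<otimes> s [^] i \<otimes> inv g" for i :: nat
    using g s by (induction i) (simp_all add: m_assoc)
  hence "g \<otimes> s [^] i \<otimes> inv g = s [^] (m * i)" for i :: nat using m s by (metis nat_pow_pow)
  thus thesis by (rule that)
qed

text \<open>Automorphisms of the cyclic group \<open>I\<close> commute, so commutators centralise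
  \<open>I\<close>, which is its own centraliser.\<close>

lemma commutator_in_I:
  assumes g: "g \<in> carrier G" and h: "h \<in> carrier G"
  shows "g \<otimes> h \<otimes> inv g \<otimes> inv h \<in> I"
proof -
  obtain m :: nat where m: "\<And>i::nat. g \<otimes> s [^] i \<otimes> inv g = s [^] (m * i)" using conjugate_power[OF g] by blast
  obtain n :: nat where n: "\<And>i::nat. h \<otimes> s [^] i \<otimes> inv h = s [^] (n * i)" using conjugate_power[OF h] by blast
  have "g \<otimes> h \<otimes> inv g \<otimes> inv h \<otimes> c = c \<otimes> (g \<otimes> h \<otimes> inv g \<otimes> inv h)" if c: "c \<in> I" for c
  proof -
    have cc: "c \<in> carrier G" using subgroup.mem_carrier[OF I_subgroup c] .
    have "inv h \<otimes> c \<otimes> inv (inv h) \<in> I" by (rule normal_conj_closed(1)[OF I_normal_self_centralizing(1) c]) (use h in simp)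
    hence "inv g \<otimes> (inv h \<otimes> c \<otimes> inv (inv h)) \<otimes> inv (inv g) \<in> I"
      by (rule normal_conj_closed(1)[OF I_normal_self_centralizing(1)]) (use g in simp)
    then obtain j :: nat where j: "inv g \<otimes> (inv h \<otimes> c \<otimes> h) \<otimes> g = s [^] j" using g h by (auto simp: I_def)
    have ce: "c = h \<otimes> (g \<otimes> s [^] j \<otimes> inv g) \<otimes> inv h" unfolding j[symmetric] using g h cc by (simp add: m_assoc)
    also have "\<dots> = s [^] (n * (m * j))" unfolding m n ..
    finally have c1: "c = s [^] (n * (m * j))" .
    have "g \<otimes> (h \<otimes> s [^] j \<otimes> inv h) \<otimes> inv g = s [^] (m * (n * j))" unfolding n m ..
    hence c2: "g \<otimes> (h \<otimes> s [^] j \<otimes> inv h) \<otimes> inv g = c" unfolding c1 by (simp add: mult.left_commute)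
    have "g \<otimes> h \<otimes> inv g \<otimes> inv h \<otimes> c = g \<otimes> (h \<otimes> s [^] j \<otimes> inv h) \<otimes> inv g \<otimes> (g \<otimes> h \<otimes> inv g \<otimes> inv h)"
      unfolding ce using g h s by (simp add: m_assoc)
    thus ?thesis unfolding c2 .
  qed
  thus ?thesis using I_normal_self_centralizing(2) g h by blast
qed

lemma R_inter_I: "x \<in> R \<Longrightarrow> x \<in> I \<Longrightarrow> x = \<one>"
proof (rule ccontr)
  assume x: "x \<in> R" "x \<in> I" "x \<noteq> \<one>"
  obtain q k :: nat where q: "prime q" "x [^] k \<noteq> \<one>" "(x [^] k) [^] q = \<one>"
    using exists_power_of_prime_order[OF R_carrier[OF x(1)] x(3) fin] by blast
  have z: "x [^] k \<in> I" "x [^] k \<in> R"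
    using subgroup_nat_pow_closed[OF I_subgroup x(2)] subgroup_nat_pow_closed[OF R x(1)] by auto
  define V where "V = {m \<in> I. m [^] q = \<one>}"
  have V: "V \<lhd> G" unfolding V_def by (rule torsion_normal[OF I_normal_self_centralizing(1) I_commute])
  have zV: "x [^] k \<in> V" using z q by (simp add: V_def)
  have "V \<inter> R = {\<one>}"
    by (rule elementary_abelian_normal(3)[OF V _ _ q(1)]) (use zV q I_commute in \<open>auto simp: V_def\<close>)
  thus False using zV z q(2) by blast
qed

text \<open>By uniqueness of the prime, \<open>I\<close> is a \<open>p\<close>-group;
  \<open>W\<close> is its subgroup of order \<open>p\<close>. If \<open>R\<close> centralises
  \<open>W\<close>, the overgroup is \<open><s^p> L\<close> and contains \<open>R\<close> itself.
  Otherwise some \<open>z\<close> in \<open>R\<close> acts on \<open>I\<close> without nontrivial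
  fixed points, and this provides an element of \<open>I\<close> that conjugates \<open>R\<close>
  into \<open>L\<close>.\<close>

lemma exists_common_overgroup:
  "\<exists>M g. subgroup M G \<and> M \<noteq> carrier G \<and> L \<subseteq> M \<and> g \<in> carrier G \<and> (\<forall>y\<in>R. g \<otimes> y \<otimes> inv g \<in> M)"
proof -
  note In = I_normal_self_centralizing(1)
  note Ic = subgroup.mem_carrier[OF I_subgroup]
  have Lne: "L \<noteq> carrier G"
  proof
    assume e: "L = carrier G"
    have "L <#> R = carrier G"
    proof
      show "L <#> R \<subseteq> carrier G" using L_carrier R_carrier unfolding set_mult_def by auto
      show "carrier G \<subseteq> L <#> R"
      proof
        fix g assume g: "g \<in> carrier G"
        hence "g = g \<otimes> \<one>" by simp
        thus "g \<in> L <#> R" using g e subgroup.one_closed[OF R] unfolding set_mult_def by blast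
      qed
    qed
    thus False using not_product by blast
  qed
  have "I \<noteq> {\<one>}"
  proof
    assume I1: "I = {\<one>}"
    have "x \<in> I" if x: "x \<in> carrier G" for x
    proof -
      have "\<forall>c\<in>I. x \<otimes> c = c \<otimes> x" unfolding I1 using x by simp
      thus ?thesis using I_normal_self_centralizing(2) x by blast
    qed
    hence "carrier G \<subseteq> L" unfolding I1 using subgroup.one_closed[OF L] by blast
    thus False using Lne subgroup.subset[OF L] by blast
  qed
  then obtain u where u: "u \<in> I" "u \<noteq> \<one>" using subgroup.one_closed[OF I_subgroup] by blast
  obtain p k :: nat where p: "prime p" "u [^] k \<noteq> \<one>" "(u [^] k) [^] p = \<one>"
    by (rule exists_power_of_prime_order[OF Ic[OF u(1)] u(2) fin])
  define w where "w = u [^] k"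
  have w: "w \<in> I" "w \<noteq> \<one>" "w [^] p = \<one>" using p subgroup_nat_pow_closed[OF I_subgroup u(1)] by (auto simp: w_def)
  have uniq: "q = p" if "prime q" "x \<in> I" "x \<noteq> \<one>" "x [^] q = \<one>" for q :: nat and x
    by (rule torsion_prime_unique[OF In I_commute In I_commute that p(1) w])
  define W where "W = {m \<in> I. m [^] p = \<one>}"
  have Wn: "W \<lhd> G" unfolding W_def by (rule torsion_normal[OF In I_commute])
  have wW: "w \<in> W" using w by (simp add: W_def)
  have W1: "W \<noteq> {\<one>}" using wW w by blast
  have Wcom: "\<And>v w. v \<in> W \<Longrightarrow> w \<in> W \<Longrightarrow> v \<otimes> w = w \<otimes> v" using I_commute by (auto simp: W_def)
  have Wexp: "\<And>v. v \<in> W \<Longrightarrow> v [^] p = \<one>" by (simp add: W_def)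
  have podd: "odd p"
  proof (rule prime_odd[OF Wn _ L order_refl p(1)])
    show "\<not> W \<subseteq> L" using wW w I_inter_L by blast
    show "v [^] p \<in> L" if "v \<in> W" for v using Wexp[OF that] subgroup.one_closed[OF L] by simp
    show "v \<otimes> w \<otimes> inv v \<otimes> inv w \<in> L" if "v \<in> W" "w \<in> W" for v w
      using Wcom[OF that] commute_imp_commutator_one[of v w] that Ic subgroup.one_closed[OF L] by (simp add: W_def)
  qed
  obtain e where e: "e \<in> W" "\<forall>v\<in>W. \<exists>i::nat. v = e [^] i"
    using elementary_abelian_normal(1)[OF Wn W1 Wcom p(1) Wexp] by blast
  show ?thesis
  proof (cases "\<forall>y\<in>R. \<forall>v\<in>W. y \<otimes> v = v \<otimes> y")
    case True
    \<comment> \<open>The subgroup of index \<open>p\<close> in \<open>I\<close>. The product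
      \<open>N L\<close> is proper because \<open>I\<close> meets \<open>L\<close>
      trivially.\<close>
    define N where "N = range (\<lambda>i::nat. s [^] (p * i))"
    define n where "n = ord s"
    have n0: "n > 0" using odd_s odd_pos by (simp add: n_def)
    obtain a where a: "n = p ^ a"
    proof -
      have "q = p" if q: "prime q" "q dvd n" for q
      proof -
        obtain d where d: "n = d * q" using q(2) by (metis dvd_def mult.commute)
        have "0 < d" using d n0 by (cases d) auto
        hence "d < n" using d prime_gt_1_nat[OF q(1)] by simp
        hence "s [^] d \<noteq> \<one>" using \<open>0 < d\<close> s unfolding n_def by (auto simp: pow_eq_id dest: dvd_imp_le)
        moreover have "(s [^] d) [^] q = \<one>" using s d unfolding n_def by (simp add: nat_pow_pow pow_eq_id)
        ultimately show ?thesis using uniq[OF q(1), of "s [^] d"] by (simp add: I_def)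
      qed
      thus thesis using prime_power_of_unique_prime_divisor[OF n0] that by blast
    qed
    obtain iw :: nat where iw: "w = s [^] iw" using w(1) by (auto simp: I_def)
    have "a \<noteq> 0"
    proof
      assume "a = 0"
      hence "n = 1" using a by simp
      hence "s = \<one>" using ord_eq_1[OF s] n_def by simp
      thus False using w(2) iw by simp
    qed
    then obtain r where r: "a = Suc r" by (cases a) auto
    have sN: "subgroup N G"
    proof (rule subgroupI)
      show "N \<subseteq> carrier G" "N \<noteq> {}" using s by (auto simp: N_def)
      show "x \<otimes> y \<in> N" if "x \<in> N" "y \<in> N" for x y
        using that s by (auto simp: N_def nat_pow_mult simp flip: distrib_left)
      show "inv x \<in> N" if "x \<in> N" for x
      proof -
        obtain i :: nat where i: "x = s [^] (p * i)" using \<open>x \<in> N\<close> by (auto simp: N_def)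
        have "inv x = s [^] (p * ((n - 1) * i))"
        proof (rule inv_equality)
          have "p * ((n - 1) * i) + p * i = n * (p * i)" using n0 by (cases n) (simp_all add: algebra_simps)
          thus "s [^] (p * ((n - 1) * i)) \<otimes> x = \<one>"
            using s nat_pow_dvd[of s n "n * (p * i)"] i by (simp add: nat_pow_mult n_def)
        qed (use s i in auto)
        thus ?thesis by (auto simp: N_def)
      qed
    qed
    have Nn: "N \<lhd> G"
    proof (rule normal_invI[OF sN])
      fix g h assume g: "g \<in> carrier G" and "h \<in> N"
      then obtain i :: nat where i: "h = s [^] (p * i)" by (auto simp: N_def)
      obtain m :: nat where m: "\<And>i::nat. g \<otimes> s [^] i \<otimes> inv g = s [^] (m * i)" using conjugate_power[OF g] by blast
      have "g \<otimes> h \<otimes> inv g = s [^] (p * (m * i))" unfolding i m by (simp add: mult.left_commute)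
      thus "g \<otimes> h \<otimes> inv g \<in> N" by (auto simp: N_def)
    qed
    define M where "M = N <#> L"
    have sM: "subgroup M G" unfolding M_def by (rule mult_norm_subgroup[OF Nn L])
    have "M \<noteq> carrier G"
    proof
      assume "M = carrier G"
      then obtain c x where cx: "c \<in> N" "x \<in> L" "s = c \<otimes> x" using s unfolding M_def set_mult_def by blast
      obtain i :: nat where i: "c = s [^] (p * i)" using cx(1) by (auto simp: N_def)
      have "x = inv c \<otimes> s" using cx(2,3) L_carrier subgroup.mem_carrier[OF sN cx(1)] by (metis inv_cancel_left(1))
      moreover have "c \<in> I" unfolding i by (simp add: I_def)
      moreover have "s \<in> I" using s unfolding I_def by (metis nat_pow_eone rangeI)
      ultimately have "x \<in> I" using subgroup.m_closed[OF I_subgroup] subgroup.m_inv_closed[OF I_subgroup] by simp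
      hence "x = \<one>" using I_inter_L cx(2) by blast
      hence si: "s = s [^] (p * i)" using cx(3) i s by simp
      have "w = (s [^] (p * i)) [^] iw" using iw si by simp
      also have "\<dots> = (w [^] p) [^] i" unfolding iw using s by (simp add: nat_pow_pow mult_ac)
      also have "\<dots> = \<one>" using w(3) by simp
      finally show False using w(2) by blast
    qed
    moreover have "L \<subseteq> M"
    proof
      fix x assume x: "x \<in> L"
      hence "x = \<one> \<otimes> x" using L_carrier by simp
      thus "x \<in> M" using x subgroup.one_closed[OF sN] unfolding M_def set_mult_def by blast
    qed
    \<comment> \<open>With \<open>y = s [^] c \<otimes> x\<close> the claim is that \<open>p\<close>
      divides \<open>c\<close>. Conjugation by \<open>y\<close> and by \<open>x\<close> is the same
      power map \<open>\<mu>\<close> on \<open>I\<close>, and \<open>\<mu>\<close> is 1 modulo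
      \<open>p\<close> since \<open>y\<close> fixes \<open>W\<close>. Hence
      \<open>x [^] (p ^ r)\<close> centralises \<open>I\<close> and is trivial; then
      \<open>y [^] (p ^ r)\<close> is a power of \<open>s\<close> in \<open>R\<close>, so trivial
      too. Its exponent \<open>c * \<Sigma> (p ^ r)\<close> is thus divisible by
      \<open>p ^ Suc r\<close>, while the sum contains \<open>p\<close> only \<open>r\<close>
      times.\<close>
    moreover have "y \<in> M" if y: "y \<in> R" for y
    proof -
      obtain c :: nat and x where cx: "x \<in> L" "y = s [^] c \<otimes> x" using transitive[OF R_carrier[OF y]] by blast
      have xc: "x \<in> carrier G" using L_carrier cx by blast
      obtain \<mu> :: nat where \<mu>: "\<And>i::nat. x \<otimes> s [^] i \<otimes> inv x = s [^] (\<mu> * i)" using conjugate_power[OF xc] by blast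
      have ys: "y \<otimes> s [^] i \<otimes> inv y = s [^] (\<mu> * i)" for i :: nat
      proof -
        have "y \<otimes> s [^] i \<otimes> inv y = s [^] c \<otimes> (x \<otimes> s [^] i \<otimes> inv x) \<otimes> inv (s [^] c)"
          unfolding cx(2) using xc s by (simp add: inv_mult_group m_assoc)
        also have "\<dots> = (s [^] c \<otimes> s [^] (\<mu> * i)) \<otimes> inv (s [^] c)" unfolding \<mu> ..
        also have "s [^] c \<otimes> s [^] (\<mu> * i) = s [^] (\<mu> * i) \<otimes> s [^] c" using s by (simp add: nat_pow_mult add.commute)
        finally show ?thesis using s by (simp add: m_assoc)
      qed
      have \<mu>1: "int p dvd int \<mu> - 1"
      proof -
        define d where "d = p ^ r"
        have nd: "n = p * d" using a r by (simp add: d_def)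
        have "(s [^] d) [^] p = \<one>" using s nd unfolding n_def by (simp add: nat_pow_pow pow_eq_id mult.commute)
        hence "s [^] d \<in> W" by (simp add: W_def I_def)
        hence "y \<otimes> s [^] d = s [^] d \<otimes> y" using True y by blast
        hence "y \<otimes> s [^] d \<otimes> inv y = s [^] d" using s R_carrier[OF y] by (simp add: m_assoc)
        hence "s [^] (\<mu> * d) = s [^] d" unfolding ys .
        hence "s [^] int (\<mu> * d) = s [^] int d" unfolding int_pow_int .
        hence "int n dvd int (\<mu> * d) - int d" unfolding n_def using int_pow_eq[OF s] by (metis dvd_minus_iff minus_diff_eq)
        hence "int p * int d dvd (int \<mu> - 1) * int d" unfolding nd by (simp add: algebra_simps)
        moreover have "int d \<noteq> 0" using prime_gt_0_nat[OF p(1)] by (simp add: d_def)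
        ultimately show ?thesis by simp
      qed
      define \<Sigma> where "\<Sigma> k = (\<Sum>j<k. \<mu> ^ j)" for k :: nat
      have \<Sigma>S: "\<Sigma> (Suc k) = 1 + \<mu> * \<Sigma> k" for k
        unfolding \<Sigma>_def by (simp add: sum.lessThan_Suc_shift sum_distrib_left del: sum.lessThan_Suc)
      have yk: "y [^] k = s [^] (c * \<Sigma> k) \<otimes> x [^] k" for k :: nat
      proof (induction k)
        case 0 show ?case by (simp add: \<Sigma>_def)
      next
        case (Suc k)
        have "y [^] Suc k = y \<otimes> y [^] k" using R_carrier[OF y] by (metis nat_pow_Suc2)
        also have "\<dots> = s [^] c \<otimes> (x \<otimes> s [^] (c * \<Sigma> k) \<otimes> inv x) \<otimes> (x \<otimes> x [^] k)"
          unfolding Suc unfolding cx(2) using xc s by (simp add: m_assoc)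
        also have "x \<otimes> x [^] k = x [^] Suc k" using xc by (metis nat_pow_Suc2)
        also have "s [^] c \<otimes> (x \<otimes> s [^] (c * \<Sigma> k) \<otimes> inv x) = s [^] (c * \<Sigma> (Suc k))"
          unfolding \<mu> using s by (simp add: nat_pow_mult \<Sigma>S algebra_simps)
        finally show ?case .
      qed
      obtain v where v: "(\<Sum>j<p ^ r. int \<mu> ^ j) = int p ^ r * v" "\<not> int p dvd v"
        using geometric_sum_prime_power[OF p(1) podd \<mu>1] by blast
      have \<Sigma>i: "int (\<Sigma> (p ^ r)) = int p ^ r * v" unfolding \<Sigma>_def v(1)[symmetric] by simp
      have "int \<mu> ^ p ^ r - 1 = (int \<mu> - 1) * (\<Sum>j<p ^ r. int \<mu> ^ j)" by (rule power_diff_1_eq)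
      hence "int p * int p ^ r dvd int \<mu> ^ p ^ r - 1" unfolding v(1) using \<mu>1 by (simp add: mult_dvd_mono)
      hence nd: "int n dvd int \<mu> ^ p ^ r - 1" using a r by simp
      have xk: "x [^] (k::nat) \<otimes> s \<otimes> inv (x [^] k) = s [^] (\<mu> ^ k)" for k
      proof (induction k)
        case (Suc k)
        have "x [^] Suc k = x \<otimes> x [^] k" using xc by (metis nat_pow_Suc2)
        hence "x [^] Suc k \<otimes> s \<otimes> inv (x [^] Suc k) = x \<otimes> (x [^] k \<otimes> s \<otimes> inv (x [^] k)) \<otimes> inv x"
          using xc s by (simp add: inv_mult_group m_assoc del: nat_pow_Suc)
        thus ?case unfolding Suc \<mu> by simp
      qed (use s in simp)
      have "s [^] (\<mu> ^ p ^ r) = s"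
      proof -
        have "s [^] int (\<mu> ^ p ^ r) = s [^] (1::int)"
          using nd int_pow_eq[OF s, of "int (\<mu> ^ p ^ r)" 1] unfolding n_def
          by (metis dvd_minus_iff minus_diff_eq of_nat_power)
        thus ?thesis using s unfolding int_pow_int by simp
      qed
      hence xs: "x [^] (p ^ r) \<otimes> s \<otimes> inv (x [^] (p ^ r)) = s" using xk[of "p ^ r"] by simp
      have "x [^] (p ^ r) \<otimes> c = c \<otimes> x [^] (p ^ r)" if c: "c \<in> I" for c
      proof -
        obtain i :: nat where i: "c = s [^] i" using c by (auto simp: I_def)
        have "x [^] (p ^ r) \<otimes> s = s \<otimes> x [^] (p ^ r)"
          using xs xc s inv_solve_right'[of s "x [^] (p ^ r) \<otimes> s" "x [^] (p ^ r)"] by simp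
        hence "s \<otimes> x [^] (p ^ r) = x [^] (p ^ r) \<otimes> s" by simp
        thus ?thesis unfolding i using group_commutes_pow[of s "x [^] (p ^ r)" i] xc s by simp
      qed
      hence "x [^] (p ^ r) \<in> I" using I_normal_self_centralizing(2) xc by blast
      hence "x [^] (p ^ r) = \<one>" using I_inter_L subgroup_nat_pow_closed[OF L cx(1)] by blast
      hence ye: "y [^] (p ^ r) = s [^] (c * \<Sigma> (p ^ r))" using yk[of "p ^ r"] s by simp
      hence "y [^] (p ^ r) \<in> I" by (simp add: I_def)
      hence "y [^] (p ^ r) = \<one>" using R_inter_I subgroup_nat_pow_closed[OF R y] by blast
      hence "n dvd c * \<Sigma> (p ^ r)" using ye s pow_eq_id unfolding n_def by metis
      hence "int n dvd int c * int (\<Sigma> (p ^ r))" by (metis int_dvd_int_iff of_nat_mult)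
      hence "int p ^ r * int p dvd int p ^ r * (int c * v)" unfolding \<Sigma>i using a r by (simp add: mult_ac)
      hence "int p dvd int c * v" using prime_gt_0_nat[OF p(1)] by simp
      hence "p dvd c" using v(2) p(1) by (simp add: prime_dvd_mult_iff)
      hence "s [^] c \<in> N" unfolding N_def by (auto elim: dvdE)
      thus ?thesis unfolding cx(2) M_def set_mult_def using cx(1) by blast
    qed
    hence "\<forall>y\<in>R. \<one> \<otimes> y \<otimes> inv \<one> \<in> M" using R_carrier by simp
    ultimately show ?thesis using sM one_closed by blast
  next
    case False
    then obtain z v where z: "z \<in> R" "v \<in> W" "z \<otimes> v \<noteq> v \<otimes> z" by blast
    have zc: "z \<in> carrier G" using R_carrier z by blast
    define Z where "Z = {h \<in> carrier G. z \<otimes> h = h \<otimes> z}"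
    have sZ: "subgroup Z G"
    proof (rule subgroupI)
      show "Z \<noteq> {}" using zc by (auto simp: Z_def intro!: exI[of _ \<one>])
      show "inv h \<in> Z" if h: "h \<in> Z" for h
      proof -
        have hz: "h \<in> carrier G" "z \<otimes> h = h \<otimes> z" using h by (auto simp: Z_def)
        hence "inv h \<otimes> (z \<otimes> h) \<otimes> inv h = inv h \<otimes> (h \<otimes> z) \<otimes> inv h" by simp
        thus ?thesis using hz(1) zc by (simp add: m_assoc Z_def)
      qed
      show "h \<otimes> k \<in> Z" if h: "h \<in> Z" and k: "k \<in> Z" for h k
      proof -
        have hk: "h \<in> carrier G" "k \<in> carrier G" "z \<otimes> h = h \<otimes> z" "z \<otimes> k = k \<otimes> z" using h k by (auto simp: Z_def)
        have "z \<otimes> (h \<otimes> k) = (h \<otimes> z) \<otimes> k" unfolding hk(3)[symmetric] using hk(1,2) zc by (simp add: m_assoc)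
        also have "\<dots> = h \<otimes> k \<otimes> z" using hk(1,2,4) zc by (simp add: m_assoc)
        finally show ?thesis using hk by (simp add: Z_def)
      qed
    qed (auto simp: Z_def)
    \<comment> \<open>A nontrivial fixed point of \<open>z\<close> in \<open>I\<close> would have a
      power of order \<open>p\<close>, and that power would generate \<open>W\<close>, which
      \<open>z\<close> does not centralise.\<close>
    have free: "c = \<one>" if c: "c \<in> I" "z \<otimes> c = c \<otimes> z" for c
    proof (rule ccontr)
      assume "c \<noteq> \<one>"
      then obtain q l :: nat where q: "prime q" "c [^] l \<noteq> \<one>" "(c [^] l) [^] q = \<one>"
        using exists_power_of_prime_order[OF Ic[OF c(1)] _ fin] by blast
      have cl: "c [^] l \<in> I" by (rule subgroup_nat_pow_closed[OF I_subgroup c(1)])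
      have "q = p" by (rule uniq[OF q(1) cl q(2,3)])
      hence clW: "c [^] l \<in> W" using cl q by (simp add: W_def)
      have "c \<in> Z" using c Ic by (simp add: Z_def)
      hence clZ: "c [^] l \<in> Z" by (rule subgroup_nat_pow_closed[OF sZ])
      obtain j :: nat where j: "c [^] l = e [^] j" using e clW by blast
      have ec: "e \<in> carrier G" "e [^] p = \<one>" using e(1) Ic by (auto simp: W_def)
      have "\<not> p dvd j" using q(2) j nat_pow_dvd[OF ec] by auto
      hence "coprime j p" using p(1) by (metis coprime_commute prime_imp_coprime)
      hence "e \<in> Z" using nat_pow_coprime_mem[OF sZ ec(1), of p j] clZ j ec(2) subgroup.one_closed[OF sZ] by simp
      moreover obtain m :: nat where "v = e [^] m" using e z(2) by blast
      ultimately have "v \<in> Z" using subgroup_nat_pow_closed[OF sZ] by simp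
      thus False using z(3) by (simp add: Z_def)
    qed
    \<comment> \<open>Absence of fixed points makes \<open>\<phi>\<close> injective on the finite
      group \<open>I\<close>, hence onto. With \<open>z = s [^] c \<otimes> x\<close>, solving
      \<open>\<phi> g = s [^] c\<close> amounts to \<open>g z inv g = x\<close>.\<close>
    define \<phi> where "\<phi> c = z \<otimes> c \<otimes> inv z \<otimes> inv c" for c
    have \<phi>I: "\<phi> c \<in> I" if c: "c \<in> I" for c
      unfolding \<phi>_def using normal_conj_closed(1)[OF In c zc] subgroup.m_closed[OF I_subgroup] subgroup.m_inv_closed[OF I_subgroup] c by blast
    have "inj_on \<phi> I"
    proof (rule inj_onI)
      fix c d assume cd: "c \<in> I" "d \<in> I" "\<phi> c = \<phi> d"
      have cc: "c \<in> carrier G" "d \<in> carrier G" using Ic cd by auto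
      define c' where "c' = z \<otimes> c \<otimes> inv z"
      define d' where "d' = z \<otimes> d \<otimes> inv z"
      have c'd': "c' \<in> I" "d' \<in> I" unfolding c'_def d'_def using normal_conj_closed(1)[OF In _ zc] cd by auto
      have cc': "c' \<in> carrier G" "d' \<in> carrier G" using Ic c'd' by auto
      have "c' \<otimes> inv c = d' \<otimes> inv d" using cd(3) unfolding \<phi>_def c'_def d'_def .
      hence "inv d' \<otimes> (c' \<otimes> inv c) \<otimes> c = inv d' \<otimes> (d' \<otimes> inv d) \<otimes> c" by simp
      hence e1: "inv d' \<otimes> c' = inv d \<otimes> c" using cc cc' by (simp add: m_assoc)
      have "inv d' \<otimes> c' = z \<otimes> (inv d \<otimes> c) \<otimes> inv z" unfolding c'_def d'_def using cc zc by (simp add: m_assoc inv_mult_group)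
      hence "z \<otimes> (inv d \<otimes> c) \<otimes> inv z = inv d \<otimes> c" using e1 by simp
      hence "z \<otimes> (inv d \<otimes> c) = (inv d \<otimes> c) \<otimes> z" using inv_solve_right'[of "inv d \<otimes> c" "z \<otimes> (inv d \<otimes> c)" z] cc zc by simp
      hence "inv d \<otimes> c = \<one>" using free subgroup.m_closed[OF I_subgroup subgroup.m_inv_closed[OF I_subgroup cd(2)] cd(1)] by blast
      hence "d \<otimes> (inv d \<otimes> c) = d \<otimes> \<one>" by simp
      thus "c = d" using cc by simp
    qed
    hence surj: "\<phi> ` I = I"
      using endo_inj_surj[of I \<phi>] finite_subset[OF subgroup.subset[OF I_subgroup] fin] \<phi>I by blast
    obtain c :: nat and x where cx: "x \<in> L" "z = s [^] c \<otimes> x" using transitive[OF zc] by blast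
    have xc: "x \<in> carrier G" using L_carrier cx by blast
    have "s [^] c \<in> \<phi> ` I" unfolding surj by (simp add: I_def)
    then obtain g where g: "g \<in> I" "s [^] c = \<phi> g" by blast
    have gc: "g \<in> carrier G" using Ic g by blast
    have gz: "g \<otimes> z \<otimes> inv g = x"
    proof -
      have "inv (\<phi> g) \<otimes> z = g \<otimes> z \<otimes> inv g" unfolding \<phi>_def using gc zc by (simp add: inv_mult_group m_assoc)
      moreover have "inv (s [^] c) \<otimes> z = x" unfolding cx(2) using xc s by simp
      ultimately show ?thesis using g(2) by simp
    qed
    have freex: "d = \<one>" if d: "d \<in> I" "x \<otimes> d = d \<otimes> x" for d
    proof (rule free[OF d(1)])
      have dc: "d \<in> carrier G" using Ic d by blast
      have gd: "inv g \<otimes> d \<otimes> g = d" using I_commute[OF d(1) g(1)] dc gc by (simp add: m_assoc)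
      have ze: "z = inv g \<otimes> x \<otimes> g" unfolding gz[symmetric] using gc zc by (simp add: m_assoc)
      have "z \<otimes> (inv g \<otimes> d \<otimes> g) = inv g \<otimes> (x \<otimes> d) \<otimes> g" unfolding ze using dc gc xc by (simp add: m_assoc)
      also have "\<dots> = (inv g \<otimes> d \<otimes> g) \<otimes> z" unfolding d(2) ze using dc gc xc by (simp add: m_assoc)
      finally show "z \<otimes> d = d \<otimes> z" unfolding gd .
    qed
    have Label: "x \<otimes> x' = x' \<otimes> x" if x': "x' \<in> L" for x'
    proof -
      have "x \<otimes> x' \<otimes> inv x \<otimes> inv x' \<in> L" using cx(1) x' L_mult L_inv by blast
      hence "x \<otimes> x' \<otimes> inv x \<otimes> inv x' = \<one>" using I_inter_L commutator_in_I[OF xc L_carrier[OF x']] by blast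
      thus ?thesis using commute_imp_commutator_one[OF xc L_carrier[OF x']] by simp
    qed
    \<comment> \<open>Commutators lie in \<open>I\<close>, which meets \<open>L\<close> and
      \<open>R\<close> trivially; so \<open>x\<close> is central in \<open>L\<close> and
      \<open>z\<close> is central in \<open>R\<close>. Hence \<open>y'\<close> commutes with
      \<open>x\<close>, and so does the power of \<open>s\<close> in
      \<open>y' = s [^] d \<otimes> x'\<close>. This power is a fixed point of \<open>x\<close> in
      \<open>I\<close>, therefore trivial, and \<open>y'\<close> is in \<open>L\<close>.\<close>
    have "g \<otimes> y \<otimes> inv g \<in> L" if y: "y \<in> R" for y
    proof -
      have yc: "y \<in> carrier G" using R_carrier y by blast
      have "z \<otimes> y \<otimes> inv z \<otimes> inv y \<in> R" using z(1) y R_mult R_inv by blast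
      hence "z \<otimes> y \<otimes> inv z \<otimes> inv y = \<one>" using R_inter_I commutator_in_I[OF zc yc] by blast
      hence zy: "z \<otimes> y = y \<otimes> z" using commute_imp_commutator_one[OF zc yc] by simp
      define y' where "y' = g \<otimes> y \<otimes> inv g"
      have y'c: "y' \<in> carrier G" using gc yc by (simp add: y'_def)
      have xy': "x \<otimes> y' = y' \<otimes> x"
      proof -
        have "x \<otimes> y' = g \<otimes> (z \<otimes> y) \<otimes> inv g" unfolding gz[symmetric] y'_def using gc zc yc by (simp add: m_assoc)
        also have "\<dots> = y' \<otimes> x" unfolding zy gz[symmetric] y'_def using gc zc yc by (simp add: m_assoc)
        finally show ?thesis .
      qed
      obtain d :: nat and x' where dx: "x' \<in> L" "y' = s [^] d \<otimes> x'" using transitive[OF y'c] by blast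
      have x'c: "x' \<in> carrier G" using L_carrier dx by blast
      have sd: "s [^] d = y' \<otimes> inv x'" unfolding dx(2) using s x'c by (simp add: m_assoc)
      have "x \<otimes> inv x' = inv x' \<otimes> x" by (rule Label[OF L_inv[OF dx(1)]])
      hence "x \<otimes> s [^] d = s [^] d \<otimes> x"
      proof -
        have "x \<otimes> s [^] d = (x \<otimes> y') \<otimes> inv x'" unfolding sd using xc y'c x'c by (simp add: m_assoc)
        also have "\<dots> = y' \<otimes> (x \<otimes> inv x')" unfolding xy' using xc y'c x'c by (simp add: m_assoc)
        also have "\<dots> = s [^] d \<otimes> x" unfolding sd \<open>x \<otimes> inv x' = inv x' \<otimes> x\<close> using xc y'c x'c by (simp add: m_assoc)
        finally show ?thesis .
      qed
      hence "s [^] d = \<one>" using freex by (simp add: I_def)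
      thus ?thesis using dx x'c unfolding y'_def[symmetric] by simp
    qed
    thus ?thesis using L Lne gc by blast
  qed
qed

end

text \<open>The enlarged \<open>L\<close> is one of maximal cardinality, and its core
  \<open>N\<close> lies in \<open>L\<close>. Therefore membership in \<open>L\<close> and in
  \<open>L R\<close> can be tested modulo \<open>N\<close>, and all conditions of the reduced
  situation pass to the quotient; the overgroup found there is pulled back.\<close>

theorem (in group) solvable_factorization:
  assumes fin: "finite (carrier G)" and solv: "solvable G"
    and L0: "subgroup L0 G" and R: "subgroup R G" and s: "s \<in> carrier G" and odd_s: "odd (ord s)"
    and trans: "\<And>g. g \<in> carrier G \<Longrightarrow> \<exists>i::nat. \<exists>x\<in>L0. g = s [^] i \<otimes> x"
    and ab: "a \<in> carrier G" "b \<in> carrier G"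
    and two: "\<And>g. g \<in> carrier G \<Longrightarrow> \<exists>i::nat. \<exists>y\<in>R. g = s [^] i \<otimes> a \<otimes> y \<or> g = s [^] i \<otimes> b \<otimes> y"
    and np: "L0 <#> R \<noteq> carrier G"
  shows "\<exists>M g. subgroup M G \<and> M \<noteq> carrier G \<and> L0 \<subseteq> M \<and> g \<in> carrier G \<and> (\<forall>y\<in>R. g \<otimes> y \<otimes> inv g \<in> M)"
proof -
  define S where "S L \<longleftrightarrow> subgroup L G \<and> L0 \<subseteq> L \<and> L <#> R \<noteq> carrier G" for L
  have "S L0" using L0 np by (simp add: S_def)
  moreover have "\<forall>L. S L \<longrightarrow> card L < Suc (card (carrier G))"
    using card_mono[OF fin] subgroup.subset unfolding S_def by (metis less_Suc_eq_le)
  ultimately obtain L where SL: "S L" and mx: "\<And>D. S D \<Longrightarrow> card D \<le> card L"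
    using ex_has_greatest_nat[of S L0 card "Suc (card (carrier G))"] by blast
  have L: "subgroup L G" "L0 \<subseteq> L" "L <#> R \<noteq> carrier G" using SL by (auto simp: S_def)
  have Lmax: "L' <#> R = carrier G" if L': "subgroup L' G" "L \<subset> L'" for L'
  proof (rule ccontr)
    assume "L' <#> R \<noteq> carrier G"
    hence "S L'" unfolding S_def using L' L by blast
    moreover have "card L < card L'"
      by (rule psubset_card_mono[OF finite_subset[OF subgroup.subset[OF L'(1)] fin] L'(2)])
    ultimately show False using mx[of L'] by simp
  qed
  note Lc = subgroup.mem_carrier[OF L(1)] and Rc = subgroup.mem_carrier[OF R]
  define N where "N = core L"
  have Nn: "N \<lhd> G" unfolding N_def by (rule core_normal[OF L(1)])
  have NL: "N \<subseteq> L" unfolding N_def by (rule core_subset)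
  interpret N: normal N G by (rule Nn)
  define Q where "Q = G Mod N"
  define \<pi> where "\<pi> x = N #> x" for x
  interpret Q: group Q unfolding Q_def by (rule N.factorgroup_is_group)
  have hom: "\<pi> \<in> hom G Q" unfolding \<pi>_def Q_def by (rule N.r_coset_hom_Mod)
  interpret \<pi>: group_hom G Q \<pi> by unfold_locales (rule hom)
  have Qc: "carrier Q = \<pi> ` carrier G" unfolding Q_def \<pi>_def carrier_FactGroup ..
  have \<pi>eq: "\<exists>n\<in>N. x = n \<otimes> y" if "\<pi> x = \<pi> y" "x \<in> carrier G" "y \<in> carrier G" for x y
  proof -
    have "x \<in> N #> y" using rcos_self[OF that(2) N.subgroup_axioms] that(1) unfolding \<pi>_def by simp
    thus ?thesis unfolding r_coset_def by blast
  qed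
  have memL: "x \<in> L" if x: "\<pi> x \<in> \<pi> ` L" "x \<in> carrier G" for x
  proof -
    obtain l where l: "l \<in> L" "\<pi> x = \<pi> l" using x(1) by blast
    obtain n where "n \<in> N" "x = n \<otimes> l" using \<pi>eq[OF l(2) x(2) Lc[OF l(1)]] by blast
    thus ?thesis using NL subgroup.m_closed[OF L(1) _ l(1)] by blast
  qed
  have pre: "subgroup {x \<in> carrier G. \<pi> x \<in> H} G" if H: "subgroup H Q" for H
  proof (rule subgroupI)
    show "{x \<in> carrier G. \<pi> x \<in> H} \<noteq> {}"
      using subgroup.one_closed[OF H] by (auto intro!: exI[of _ \<one>])
    show "inv x \<in> {x \<in> carrier G. \<pi> x \<in> H}" if "x \<in> {x \<in> carrier G. \<pi> x \<in> H}" for x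
      using that subgroup.m_inv_closed[OF H] by simp
    show "x \<otimes> y \<in> {x \<in> carrier G. \<pi> x \<in> H}"
      if "x \<in> {x \<in> carrier G. \<pi> x \<in> H}" "y \<in> {x \<in> carrier G. \<pi> x \<in> H}" for x y
      using that subgroup.m_closed[OF H] by simp
  qed auto
  have finQ: "finite (carrier Q)" unfolding Qc using fin by simp
  interpret cf: core_free_pair Q "\<pi> ` L" "\<pi> ` R" "\<pi> s" "\<pi> a" "\<pi> b"
  proof (rule core_free_pair.intro[OF Q.group_axioms], rule core_free_pair_axioms.intro)
    show "finite (carrier Q)" by (rule finQ)
    show "solvable Q" by (rule \<pi>.surj_hom_imp_solvable[OF Qc[symmetric] solv])
    show "subgroup (\<pi> ` L) Q" "subgroup (\<pi> ` R) Q" using \<pi>.subgroup_img_is_subgroup L(1) R by auto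
    show "\<pi> s \<in> carrier Q" "\<pi> a \<in> carrier Q" "\<pi> b \<in> carrier Q" using s ab by auto
    have "\<pi> s [^]\<^bsub>Q\<^esub> ord s = \<one>\<^bsub>Q\<^esub>" using \<pi>.hom_nat_pow[OF s, of "ord s"] s by simp
    hence "Q.ord (\<pi> s) dvd ord s" using Q.pow_eq_id[of "\<pi> s" "ord s"] s by simp
    thus "odd (Q.ord (\<pi> s))" using odd_s dvd_trans by blast
    show "\<exists>i::nat. \<exists>x\<in>\<pi> ` L. g = \<pi> s [^]\<^bsub>Q\<^esub> i \<otimes>\<^bsub>Q\<^esub> x" if g: "g \<in> carrier Q" for g
    proof -
      obtain g' where g': "g' \<in> carrier G" "g = \<pi> g'" using g Qc by blast
      obtain i :: nat and x where x: "x \<in> L0" "g' = s [^] i \<otimes> x" using trans[OF g'(1)] by blast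
      have xL: "x \<in> L" using x(1) L(2) by blast
      have "g = \<pi> s [^]\<^bsub>Q\<^esub> i \<otimes>\<^bsub>Q\<^esub> \<pi> x" using g'(2) x(2) s Lc[OF xL] by (simp add: \<pi>.hom_nat_pow)
      thus ?thesis using xL by blast
    qed
    show "\<exists>i::nat. \<exists>y\<in>\<pi> ` R. g = \<pi> s [^]\<^bsub>Q\<^esub> i \<otimes>\<^bsub>Q\<^esub> \<pi> a \<otimes>\<^bsub>Q\<^esub> y \<or> g = \<pi> s [^]\<^bsub>Q\<^esub> i \<otimes>\<^bsub>Q\<^esub> \<pi> b \<otimes>\<^bsub>Q\<^esub> y"
      if g: "g \<in> carrier Q" for g
    proof -
      obtain g' where g': "g' \<in> carrier G" "g = \<pi> g'" using g Qc by blast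
      obtain i :: nat and y where y: "y \<in> R" "g' = s [^] i \<otimes> a \<otimes> y \<or> g' = s [^] i \<otimes> b \<otimes> y" using two[OF g'(1)] by blast
      have "g = \<pi> s [^]\<^bsub>Q\<^esub> i \<otimes>\<^bsub>Q\<^esub> \<pi> a \<otimes>\<^bsub>Q\<^esub> \<pi> y \<or> g = \<pi> s [^]\<^bsub>Q\<^esub> i \<otimes>\<^bsub>Q\<^esub> \<pi> b \<otimes>\<^bsub>Q\<^esub> \<pi> y"
        using g'(2) y(2) s ab Rc[OF y(1)] by (auto simp: \<pi>.hom_nat_pow)
      thus ?thesis using y(1) by blast
    qed
    show "K = {\<one>\<^bsub>Q\<^esub>}" if K: "K \<lhd> Q" "K \<subseteq> \<pi> ` L" for K
    proof -
      note sK = normal_imp_subgroup[OF K(1)]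
      have "K \<subseteq> {\<one>\<^bsub>Q\<^esub>}"
      proof
        fix k assume k: "k \<in> K"
        then obtain x where x: "x \<in> L" "k = \<pi> x" using K(2) by blast
        have "x \<in> N" unfolding N_def core_def
        proof (intro CollectI conjI ballI)
          fix g assume g: "g \<in> carrier G"
          have "\<pi> g \<otimes>\<^bsub>Q\<^esub> k \<otimes>\<^bsub>Q\<^esub> inv\<^bsub>Q\<^esub> \<pi> g \<in> K" by (rule Q.normal_conj_closed(1)[OF K(1) k]) (use g in simp)
          hence "\<pi> (g \<otimes> x \<otimes> inv g) \<in> \<pi> ` L" using x K(2) g Lc by auto
          thus "g \<otimes> x \<otimes> inv g \<in> L" by (rule memL) (use g x Lc in simp)
        qed (use x Lc in simp)
        hence "N #> x = N" using N.rcos_const[OF is_group] by blast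
        thus "k \<in> {\<one>\<^bsub>Q\<^esub>}" using x unfolding \<pi>_def Q_def by simp
      qed
      thus ?thesis using subgroup.one_closed[OF sK] by blast
    qed
    show "\<pi> ` L <#>\<^bsub>Q\<^esub> \<pi> ` R \<noteq> carrier Q"
    proof
      assume e: "\<pi> ` L <#>\<^bsub>Q\<^esub> \<pi> ` R = carrier Q"
      have "carrier G \<subseteq> L <#> R"
      proof
        fix g assume g: "g \<in> carrier G"
        hence "\<pi> g \<in> \<pi> ` L <#>\<^bsub>Q\<^esub> \<pi> ` R" using e by auto
        then obtain l r where lr: "l \<in> L" "r \<in> R" "\<pi> g = \<pi> l \<otimes>\<^bsub>Q\<^esub> \<pi> r" unfolding set_mult_def by blast
        have c: "l \<in> carrier G" "r \<in> carrier G" using lr Lc Rc by auto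
        have "\<pi> g = \<pi> (l \<otimes> r)" using lr(3) c by simp
        then obtain n where n: "n \<in> N" "g = n \<otimes> (l \<otimes> r)" using \<pi>eq[OF _ g] c by blast
        hence "g = (n \<otimes> l) \<otimes> r" using c N.mem_carrier[OF n(1)] by (simp add: m_assoc)
        moreover have "n \<otimes> l \<in> L" using n(1) NL lr(1) subgroup.m_closed[OF L(1)] by blast
        ultimately show "g \<in> L <#> R" using lr(2) unfolding set_mult_def by blast
      qed
      moreover have "L <#> R \<subseteq> carrier G" using Lc Rc unfolding set_mult_def by auto
      ultimately show False using L(3) by blast
    qed
    show "K <#>\<^bsub>Q\<^esub> \<pi> ` R = carrier Q" if K: "subgroup K Q" "\<pi> ` L \<subset> K" for K
    proof -
      define L' where "L' = {x \<in> carrier G. \<pi> x \<in> K}"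
      have "L \<subseteq> L'" using K(2) Lc unfolding L'_def by blast
      moreover have "L \<noteq> L'"
      proof
        assume e: "L = L'"
        obtain k where k: "k \<in> K" "k \<notin> \<pi> ` L" using K(2) by blast
        obtain x where "x \<in> carrier G" "k = \<pi> x" using k(1) subgroup.mem_carrier[OF K(1)] Qc by blast
        thus False using k e unfolding L'_def by blast
      qed
      ultimately have e: "L' <#> R = carrier G" using Lmax[OF pre[OF K(1)]] unfolding L'_def by blast
      have "carrier Q \<subseteq> K <#>\<^bsub>Q\<^esub> \<pi> ` R"
      proof
        fix q assume "q \<in> carrier Q"
        then obtain g where g: "g \<in> carrier G" "q = \<pi> g" using Qc by blast
        obtain l r where lr: "l \<in> L'" "r \<in> R" "g = l \<otimes> r" using g(1) e unfolding set_mult_def by blast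
        have "q = \<pi> l \<otimes>\<^bsub>Q\<^esub> \<pi> r" using g(2) lr Rc by (simp add: L'_def)
        thus "q \<in> K <#>\<^bsub>Q\<^esub> \<pi> ` R" using lr unfolding L'_def set_mult_def by blast
      qed
      moreover have "K <#>\<^bsub>Q\<^esub> \<pi> ` R \<subseteq> carrier Q" using subgroup.mem_carrier[OF K(1)] Rc unfolding set_mult_def by auto
      ultimately show ?thesis by blast
    qed
  qed
  obtain M h where M: "subgroup M Q" "M \<noteq> carrier Q" "\<pi> ` L \<subseteq> M" "h \<in> carrier Q"
    "\<forall>y\<in>\<pi> ` R. h \<otimes>\<^bsub>Q\<^esub> y \<otimes>\<^bsub>Q\<^esub> inv\<^bsub>Q\<^esub> h \<in> M" using cf.exists_common_overgroup by blast
  obtain g where g: "g \<in> carrier G" "h = \<pi> g" using M(4) Qc by blast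
  define M' where "M' = {x \<in> carrier G. \<pi> x \<in> M}"
  have "subgroup M' G" unfolding M'_def by (rule pre[OF M(1)])
  moreover have "M' \<noteq> carrier G"
  proof
    assume "M' = carrier G"
    hence "carrier Q \<subseteq> M" unfolding Qc M'_def by blast
    thus False using M(2) subgroup.subset[OF M(1)] by blast
  qed
  moreover have "L0 \<subseteq> M'" using L(2) M(3) Lc unfolding M'_def by blast
  moreover have "g \<otimes> y \<otimes> inv g \<in> M'" if y: "y \<in> R" for y
    using M(5) y g Rc[OF y] unfolding M'_def by auto
  ultimately show ?thesis using g(1) by blast
qed

section \<open>Extension of field homomorphisms\<close>

hide_const (open) Module.smult Coset.order Divisibility.irreducible

locale fhom =
  fixes h :: "'b :: field \<Rightarrow> 'c :: field"
  assumes hom_add: "h (x + y) = h x + h y" and hom_mult: "h (x * y) = h x * h y" and hom_one: "h 1 = 1"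
begin

lemma hom_zero: "h 0 = 0" by (metis add.right_neutral add_cancel_right_right hom_add)
lemma hom_uminus: "h (- x) = - h x" using hom_add[of x "- x"] by (simp add: hom_zero eq_neg_iff_add_eq_0 add.commute)
lemma hom_diff: "h (x - y) = h x - h y" using hom_add[of x "- y"] by (simp add: hom_uminus)
lemma hom_eq_0: "h x = 0 \<longleftrightarrow> x = 0"
proof
  assume "h x = 0"
  show "x = 0"
  proof (rule ccontr)
    assume "x \<noteq> 0"
    hence "h (x * inverse x) = 1" by (simp add: hom_one)
    thus False using \<open>h x = 0\<close> by (simp add: hom_mult)
  qed
qed (simp add: hom_zero)
lemma hom_eq: "h x = h y \<longleftrightarrow> x = y" using hom_eq_0[of "x - y"] by (simp add: hom_diff)
lemma hom_inverse: "h (inverse x) = inverse (h x)"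
proof (cases "x = 0")
  case False
  hence "h x * h (inverse x) = 1" by (simp add: hom_one flip: hom_mult)
  thus ?thesis by (simp add: inverse_unique)
qed (simp add: hom_zero)
lemma hom_divide: "h (x / y) = h x / h y" by (simp add: field_class.field_divide_inverse hom_mult hom_inverse)
lemma hom_power: "h (x ^ n) = h x ^ n" by (induction n) (simp_all add: hom_one hom_mult)
lemma hom_of_nat: "h (of_nat n) = of_nat n" by (induction n) (simp_all add: hom_zero hom_one hom_add)
lemma hom_sum: "h (sum f A) = (\<Sum>x\<in>A. h (f x))"
  by (induction A rule: infinite_finite_induct) (simp_all add: hom_zero hom_add)
lemma hom_prod: "h (prod f A) = (\<Prod>x\<in>A. h (f x))"
  by (induction A rule: infinite_finite_induct) (simp_all add: hom_one hom_mult)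
lemma inj: "inj h" by (auto simp: inj_def hom_eq)

lemma coeff_map: "coeff (map_poly h p) i = h (coeff p i)" by (simp add: coeff_map_poly hom_zero)
lemma map_poly_hom_add: "map_poly h (p + q) = map_poly h p + map_poly h q"
  by (simp add: poly_eq_iff coeff_map hom_add)
lemma map_poly_hom_diff: "map_poly h (p - q) = map_poly h p - map_poly h q"
  by (simp add: poly_eq_iff coeff_map hom_diff)
lemma map_poly_hom_smult: "map_poly h (smult c p) = smult (h c) (map_poly h p)"
  by (simp add: poly_eq_iff coeff_map hom_mult)
lemma map_poly_hom_mult: "map_poly h (p * q) = map_poly h p * map_poly h q"
  by (simp add: poly_eq_iff coeff_map coeff_mult hom_sum hom_mult)
lemma map_poly_hom_pCons: "map_poly h (pCons c p) = pCons (h c) (map_poly h p)"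
  by (simp add: map_poly_pCons hom_zero)
lemma map_poly_hom_one: "map_poly h 1 = 1" by (simp add: one_pCons map_poly_hom_pCons hom_one)
lemma map_poly_hom_eq_0: "map_poly h p = 0 \<longleftrightarrow> p = 0"
  by (simp add: poly_eq_iff coeff_map hom_eq_0)
lemma map_poly_hom_eq: "map_poly h p = map_poly h q \<longleftrightarrow> p = q"
  by (simp add: poly_eq_iff coeff_map hom_eq)
lemma degree_map_hom: "degree (map_poly h p) = degree p"
  by (rule degree_map_poly) (simp add: hom_eq_0)
lemma poly_map_hom: "poly (map_poly h p) (h x) = h (poly p x)"
  by (induction p) (simp_all add: map_poly_hom_pCons hom_zero hom_add hom_mult)
lemma map_poly_hom_pcompose: "map_poly h (pcompose p q) = pcompose (map_poly h p) (map_poly h q)"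
  by (induction p) (simp_all add: map_poly_hom_pCons hom_zero pcompose_pCons map_poly_hom_add map_poly_hom_mult)

end

lemma fhom_compose: "fhom g \<Longrightarrow> fhom h \<Longrightarrow> fhom (g \<circ> h)"
  unfolding fhom_def by auto

lemma fhom_to_ac: "fhom to_ac" by unfold_locales simp_all

text \<open>Partial homomorphisms are represented by their graphs, so that Zorn's lemma applies to inclusion.\<close>

definition hom_graph :: "('b :: field \<times> 'c :: field) set \<Rightarrow> bool" where
  "hom_graph G \<longleftrightarrow> (1, 1) \<in> G \<and> (\<forall>a b c d. (a, b) \<in> G \<longrightarrow> (c, d) \<in> G \<longrightarrow> (a - c, b - d) \<in> G \<and> (a * c, b * d) \<in> G) \<and>
     (\<forall>a b. (a, b) \<in> G \<longrightarrow> (inverse a, inverse b) \<in> G) \<and> (\<forall>b. (0, b) \<in> G \<longrightarrow> b = 0)"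

text \<open>A polynomial over the domain of a partial homomorphism together with its image. Working
  with such pairs replaces polynomial rings over subfields.\<close>

definition poly_pairs :: "('b :: field \<times> 'c :: field) set \<Rightarrow> ('b poly \<times> 'c poly) set" where
  "poly_pairs G = {(p, q). \<forall>i. (coeff p i, coeff q i) \<in> G}"

context
  fixes G :: "('b :: field \<times> 'c :: field) set"
  assumes G: "hom_graph G"
begin

lemma graph_1: "(1, 1) \<in> G" and graph_diff: "\<And>a b c d. (a, b) \<in> G \<Longrightarrow> (c, d) \<in> G \<Longrightarrow> (a - c, b - d) \<in> G"
  and graph_mult: "\<And>a b c d. (a, b) \<in> G \<Longrightarrow> (c, d) \<in> G \<Longrightarrow> (a * c, b * d) \<in> G"
  and graph_inverse: "\<And>a b. (a, b) \<in> G \<Longrightarrow> (inverse a, inverse b) \<in> G"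
  and graph_0D: "\<And>b. (0, b) \<in> G \<Longrightarrow> b = 0"
  using G unfolding hom_graph_def by blast+

lemma graph_0: "(0, 0) \<in> G" using graph_diff[OF graph_1 graph_1] by simp

lemma graph_add: "(a, b) \<in> G \<Longrightarrow> (c, d) \<in> G \<Longrightarrow> (a + c, b + d) \<in> G"
  using graph_diff[OF _ graph_diff[OF graph_0], of a b c d] by simp

lemma graph_sum: "(\<And>i. i \<in> A \<Longrightarrow> (f i, g i) \<in> G) \<Longrightarrow> (sum f A, sum g A) \<in> G"
  by (induction A rule: infinite_finite_induct) (simp_all add: graph_0 graph_add)

lemma graph_eq_0: "(a, b) \<in> G \<Longrightarrow> a = 0 \<longleftrightarrow> b = 0"
proof
  assume ab: "(a, b) \<in> G" and "b = 0"
  show "a = 0"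
  proof (rule ccontr)
    assume "a \<noteq> 0"
    hence "(1, 0) \<in> G" using graph_mult[OF ab graph_inverse[OF ab]] \<open>b = 0\<close> by simp
    from graph_0D[of 1] graph_diff[OF graph_1 this] show False by simp
  qed
qed (use graph_0D in auto)

lemma graph_fun: "(a, b) \<in> G \<Longrightarrow> (a, b') \<in> G \<Longrightarrow> b = b'"
  using graph_0D[of "b - b'"] graph_diff[of a b a b'] by simp

lemma pairs_add: "(p, q) \<in> poly_pairs G \<Longrightarrow> (r, s) \<in> poly_pairs G \<Longrightarrow> (p + r, q + s) \<in> poly_pairs G"
  and pairs_diff: "(p, q) \<in> poly_pairs G \<Longrightarrow> (r, s) \<in> poly_pairs G \<Longrightarrow> (p - r, q - s) \<in> poly_pairs G"
  and pairs_mult: "(p, q) \<in> poly_pairs G \<Longrightarrow> (r, s) \<in> poly_pairs G \<Longrightarrow> (p * r, q * s) \<in> poly_pairs G"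
  and pairs_monom: "(a, b) \<in> G \<Longrightarrow> (monom a n, monom b n) \<in> poly_pairs G"
  and pairs_0: "(0, 0) \<in> poly_pairs G"
  unfolding poly_pairs_def by (auto simp: graph_add graph_diff coeff_mult graph_0 intro!: graph_sum graph_mult)

lemma pairs_eq_0: "(p, q) \<in> poly_pairs G \<Longrightarrow> p = 0 \<longleftrightarrow> q = 0"
  unfolding poly_pairs_def poly_eq_iff using graph_eq_0 by auto

lemma pairs_degree: "(p, q) \<in> poly_pairs G \<Longrightarrow> degree p = degree q"
proof -
  assume "(p, q) \<in> poly_pairs G"
  hence "coeff p i = 0 \<longleftrightarrow> coeff q i = 0" for i unfolding poly_pairs_def using graph_eq_0 by blast
  thus ?thesis unfolding degree_def by simp
qed

lemma pairs_division:
  assumes m: "(m, m') \<in> poly_pairs G" "m \<noteq> 0" and p: "(p, q) \<in> poly_pairs G"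
  shows "\<exists>s s' r r'. (s, s') \<in> poly_pairs G \<and> (r, r') \<in> poly_pairs G \<and> p = s * m + r \<and> q = s' * m' + r' \<and>
    (r = 0 \<or> degree r < degree m)"
  using p
proof (induction "degree p" arbitrary: p q rule: less_induct)
  case less
  show ?case
  proof (cases "p = 0 \<or> degree p < degree m")
    case True
    show ?thesis
      by (rule exI[of _ 0], rule exI[of _ 0], rule exI[of _ p], rule exI[of _ q]) (use True less.prems pairs_0 in auto)
  next
    case False
    hence p0: "p \<noteq> 0" and dg: "degree m \<le> degree p" by auto
    note dm = pairs_degree[OF m(1)] and dp = pairs_degree[OF less.prems]
    define k where "k = degree p - degree m"
    define c where "c = lead_coeff p * inverse (lead_coeff m)"
    define c' where "c' = lead_coeff q * inverse (lead_coeff m')"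
    have "(lead_coeff p, lead_coeff q) \<in> G" "(lead_coeff m, lead_coeff m') \<in> G"
      using less.prems m(1) dm dp unfolding poly_pairs_def by auto
    hence cG: "(c, c') \<in> G" unfolding c_def c'_def by (intro graph_mult graph_inverse)
    define p1 where "p1 = p - monom c k * m"
    define q1 where "q1 = q - monom c' k * m'"
    have pq1: "(p1, q1) \<in> poly_pairs G" unfolding p1_def q1_def
      by (intro pairs_diff less.prems pairs_mult pairs_monom cG m(1))
    have c0: "c \<noteq> 0" using p0 m(2) by (simp add: c_def)
    have dk: "degree (monom c k) = k" by (rule Polynomial.degree_monom_eq[OF c0])
    have "monom c k \<noteq> 0" using c0 by (simp add: monom_eq_0_iff)
    from degree_mult_eq[OF this m(2)] have "degree (monom c k * m) = k + degree m" unfolding dk .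
    hence dmm: "degree (monom c k * m) = degree p" unfolding k_def using dg by simp
    have "coeff (monom c k * m) (degree p) = lead_coeff p"
    proof -
      have "coeff (monom c k * m) (degree p) = lead_coeff (monom c k * m)" using dmm by simp
      also have "\<dots> = c * lead_coeff m" by (simp add: lead_coeff_mult dk)
      finally show ?thesis using m(2) by (simp add: c_def)
    qed
    hence cf: "coeff p1 (degree p) = 0" by (simp add: p1_def)
    have dle: "degree p1 \<le> degree p" unfolding p1_def by (intro degree_diff_le) (auto simp: dmm)
    have "\<exists>s s' r r'. (s, s') \<in> poly_pairs G \<and> (r, r') \<in> poly_pairs G \<and> p1 = s * m + r \<and> q1 = s' * m' + r' \<and>
      (r = 0 \<or> degree r < degree m)"
    proof (cases "degree p1 < degree p")
      case True
      thus ?thesis using less.hyps[OF _ pq1] by simp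
    next
      case False
      hence "lead_coeff p1 = 0" using dle cf by (metis le_antisym not_less)
      hence "p1 = 0" by simp
      moreover hence "q1 = 0" using pairs_eq_0[OF pq1] by simp
      ultimately show ?thesis using pairs_0 by (intro exI[of _ 0]) auto
    qed
    then obtain s s' r r' where s: "(s, s') \<in> poly_pairs G" "(r, r') \<in> poly_pairs G" "p1 = s * m + r" "q1 = s' * m' + r'"
      "r = 0 \<or> degree r < degree m" by blast
    have "p = (s + monom c k) * m + r" "q = (s' + monom c' k) * m' + r'"
      using s(3,4) unfolding p1_def q1_def by (simp_all add: algebra_simps)
    thus ?thesis using s pairs_add[OF s(1) pairs_monom[OF cG]] by blast
  qed
qed

lemma graph_extend:
  assumes eq: "\<And>p q. (p, q) \<in> poly_pairs G \<Longrightarrow> poly p z = 0 \<longleftrightarrow> poly q \<zeta> = 0"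
  shows "\<exists>G'. hom_graph G' \<and> G \<subseteq> G' \<and> (z, \<zeta>) \<in> G'"
proof -
  \<comment> \<open>The elements of the extension are quotients of polynomials in \<open>z\<close>.
    By \<open>eq\<close> the denominators vanish at \<open>z\<close> and at \<open>\<zeta>\<close>
    simultaneously, and an element that is 0 on one side is 0 on the other.\<close>
  define G' where "G' = {(poly p z / poly p' z, poly q \<zeta> / poly q' \<zeta>) | p q p' q'.
    (p, q) \<in> poly_pairs G \<and> (p', q') \<in> poly_pairs G \<and> poly p' z \<noteq> 0}"
  have I: "(poly p z / poly p' z, poly q \<zeta> / poly q' \<zeta>) \<in> G'"
    if "(p, q) \<in> poly_pairs G" "(p', q') \<in> poly_pairs G" "poly p' z \<noteq> 0" for p q p' q'
    unfolding G'_def using that by blast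
  have c: "([:a:], [:b:]) \<in> poly_pairs G" if "(a, b) \<in> G" for a b
    using pairs_monom[OF that, of 0] by (simp add: monom_0)
  have xx: "([:0, 1:], [:0, 1:]) \<in> poly_pairs G" using pairs_monom[OF graph_1, of 1] by (simp add: monom_altdef)
  have "hom_graph G'" unfolding hom_graph_def
  proof (intro conjI allI impI)
    show "(1, 1) \<in> G'" using I[OF c[OF graph_1] c[OF graph_1]] by simp
  next
    fix a b a1 b1 assume "(a, b) \<in> G'" "(a1, b1) \<in> G'"
    then obtain p q p' q' r s r' s' where
      p: "(p, q) \<in> poly_pairs G" "(p', q') \<in> poly_pairs G" "poly p' z \<noteq> 0" "a = poly p z / poly p' z" "b = poly q \<zeta> / poly q' \<zeta>"
      and r: "(r, s) \<in> poly_pairs G" "(r', s') \<in> poly_pairs G" "poly r' z \<noteq> 0" "a1 = poly r z / poly r' z" "b1 = poly s \<zeta> / poly s' \<zeta>"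
      unfolding G'_def by blast
    have nz: "poly q' \<zeta> \<noteq> 0" "poly s' \<zeta> \<noteq> 0" using eq p r by blast+
    have "(poly (p * r' - r * p') z / poly (p' * r') z, poly (q * s' - s * q') \<zeta> / poly (q' * s') \<zeta>) \<in> G'"
      using p r by (intro I pairs_diff pairs_mult) auto
    thus "(a - a1, b - b1) \<in> G'" using p r nz by (simp add: diff_frac_eq)
    have "(poly (p * r) z / poly (p' * r') z, poly (q * s) \<zeta> / poly (q' * s') \<zeta>) \<in> G'"
      using p r by (intro I pairs_mult) auto
    thus "(a * a1, b * b1) \<in> G'" using p r by simp
  next
    fix a b assume "(a, b) \<in> G'"
    then obtain p q p' q' where p: "(p, q) \<in> poly_pairs G" "(p', q') \<in> poly_pairs G" "poly p' z \<noteq> 0"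
      "a = poly p z / poly p' z" "b = poly q \<zeta> / poly q' \<zeta>" unfolding G'_def by blast
    show "(inverse a, inverse b) \<in> G'"
    proof (cases "poly p z = 0")
      case True
      thus ?thesis using p eq[OF p(1)] I[OF pairs_0 c[OF graph_1]] by simp
    next
      case False
      thus ?thesis using p I[OF p(2,1) False] by simp
    qed
  next
    fix b assume "(0, b) \<in> G'"
    then obtain p q p' q' where p: "(p, q) \<in> poly_pairs G" "(p', q') \<in> poly_pairs G" "poly p' z \<noteq> 0"
      "0 = poly p z / poly p' z" "b = poly q \<zeta> / poly q' \<zeta>" unfolding G'_def by blast
    thus "b = 0" using eq[OF p(1)] by simp
  qed
  moreover have "G \<subseteq> G'"
  proof
    fix x assume "x \<in> G"
    moreover obtain a b where "x = (a, b)" by (cases x)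
    ultimately show "x \<in> G'" using I[OF c c[OF graph_1], of a b] by simp
  qed
  moreover have "(z, \<zeta>) \<in> G'" using I[OF xx c[OF graph_1]] by simp
  ultimately show ?thesis by blast
qed

text \<open>\<open>m\<close> is the minimal polynomial of \<open>z\<close> over the domain of the
  graph and \<open>m'\<close> its image; the last conclusion is the extension of a homomorphism to a
  simple algebraic extension.\<close>

lemma graph_minimal_poly:
  assumes alg: "\<exists>p q. (p, q) \<in> poly_pairs G \<and> p \<noteq> 0 \<and> poly p z = 0"
  obtains m m' where "(m, m') \<in> poly_pairs G" "poly m z = 0" "degree m > 0"
    "\<And>p q. (p, q) \<in> poly_pairs G \<Longrightarrow> p \<noteq> 0 \<Longrightarrow> poly p z = 0 \<Longrightarrow> degree m \<le> degree p"
    "\<And>\<zeta>. poly m' \<zeta> = 0 \<Longrightarrow> \<exists>G'. hom_graph G' \<and> G \<subseteq> G' \<and> (z, \<zeta>) \<in> G'"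
proof -
  define S where "S x \<longleftrightarrow> x \<in> poly_pairs G \<and> fst x \<noteq> 0 \<and> poly (fst x) z = 0" for x
  obtain x0 where "S x0" using alg by (auto simp: S_def)
  then obtain x where x: "S x" "\<And>y. S y \<Longrightarrow> degree (fst x) \<le> degree (fst y)"
    using ex_has_least_nat[of S x0 "\<lambda>x. degree (fst x)"] by blast
  obtain m m' where xm: "x = (m, m')" by (cases x)
  have m: "(m, m') \<in> poly_pairs G" "m \<noteq> 0" "poly m z = 0" using x(1) by (auto simp: S_def xm)
  have min: "degree m \<le> degree p" if "(p, q) \<in> poly_pairs G" "p \<noteq> 0" "poly p z = 0" for p q
    using x(2)[of "(p, q)"] that by (simp add: S_def xm)
  have deg: "degree m > 0"
  proof (rule ccontr)
    assume "\<not> degree m > 0"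
    then obtain c where "m = [:c:]" using degree_eq_zeroE by blast
    thus False using m by simp
  qed
  have ext: "\<exists>G'. hom_graph G' \<and> G \<subseteq> G' \<and> (z, \<zeta>) \<in> G'" if \<zeta>: "poly m' \<zeta> = 0" for \<zeta>
  proof (rule graph_extend, rule iffI)
    fix p q assume pq: "(p, q) \<in> poly_pairs G" and "poly p z = 0"
    obtain s s' r r' where s: "(r, r') \<in> poly_pairs G" "p = s * m + r" "q = s' * m' + r'" "r = 0 \<or> degree r < degree m"
      using pairs_division[OF m(1,2) pq] by blast
    have "poly r z = 0" using \<open>poly p z = 0\<close> s(2) m(3) by simp
    hence "r = 0" using min[OF s(1)] s(4) by force
    hence "r' = 0" using pairs_eq_0[OF s(1)] by simp
    thus "poly q \<zeta> = 0" using s(3) \<zeta> by simp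
  next
    fix p q assume pq: "(p, q) \<in> poly_pairs G" and q0: "poly q \<zeta> = 0"
    show "poly p z = 0"
    proof (rule ccontr)
      assume pz: "poly p z \<noteq> 0"
      \<comment> \<open>A generator \<open>d\<close> of the ideal of polynomials whose images vanish
        at \<open>\<zeta>\<close>. It divides both \<open>m\<close> and \<open>p\<close>. Since
        \<open>p\<close> does not vanish at \<open>z\<close>, neither does \<open>d\<close>, so the
        cofactor of \<open>d\<close> in \<open>m\<close> does; minimality of \<open>m\<close> makes
        \<open>d\<close> constant, which is absurd.\<close>
      define D where "D x \<longleftrightarrow> x \<in> poly_pairs G \<and> fst x \<noteq> 0 \<and> poly (snd x) \<zeta> = 0" for x
      have "D (p, q)" using pq q0 pz by (auto simp: D_def)
      then obtain y where y: "D y" "\<And>w. D w \<Longrightarrow> degree (fst y) \<le> degree (fst w)"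
        using ex_has_least_nat[of D "(p, q)" "\<lambda>x. degree (fst x)"] by blast
      obtain d d' where yd: "y = (d, d')" by (cases y)
      have d: "(d, d') \<in> poly_pairs G" "d \<noteq> 0" "poly d' \<zeta> = 0" using y(1) by (auto simp: D_def yd)
      have dvd: "\<exists>s s'. (s, s') \<in> poly_pairs G \<and> u = s * d" if u: "(u, u') \<in> poly_pairs G" "poly u' \<zeta> = 0" for u u'
      proof -
        obtain s s' r r' where s: "(s, s') \<in> poly_pairs G" "(r, r') \<in> poly_pairs G" "u = s * d + r" "u' = s' * d' + r'"
          "r = 0 \<or> degree r < degree d" using pairs_division[OF d(1,2) u(1)] by blast
        have "poly r' \<zeta> = 0" using u(2) s(4) d(3) by simp
        hence "r = 0" using y(2)[of "(r, r')"] s(2,5) by (force simp: D_def yd)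
        thus ?thesis using s by auto
      qed
      obtain s s' where s: "(s, s') \<in> poly_pairs G" "m = s * d" using dvd[OF m(1) \<zeta>] by blast
      obtain w where "p = w * d" using dvd[OF pq q0] by blast
      hence "poly d z \<noteq> 0" using pz by auto
      hence "poly s z = 0" using m(3) s(2) by simp
      moreover have "s \<noteq> 0" using m(2) s(2) by auto
      ultimately have "degree m \<le> degree s" using min[OF s(1)] by simp
      hence "degree d = 0" using s(2) d(2) \<open>s \<noteq> 0\<close> by (simp add: degree_mult_eq)
      hence "degree d' = 0" using pairs_degree[OF d(1)] by simp
      then obtain c where "d' = [:c:]" using degree_eq_zeroE by blast
      thus False using d pairs_eq_0[OF d(1)] by simp
    qed
  qed
  show thesis by (rule that[OF m(1,3) deg min ext])
qed

end

text \<open>A maximal graph is total: any \<open>z\<close> is algebraic over its domain, and the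
  image of the minimal polynomial has a root in the algebraically closed target, to which
  \<open>z\<close> can be sent.\<close>

lemma hom_graph_extension:
  fixes G :: "('b :: field \<times> 'c :: alg_closed_field) set"
  assumes G: "hom_graph G" and alg: "\<And>z. \<exists>p q. (p, q) \<in> poly_pairs G \<and> p \<noteq> 0 \<and> poly p z = 0"
  shows "\<exists>h. fhom h \<and> (\<forall>a b. (a, b) \<in> G \<longrightarrow> h a = b)"
proof -
  define A where "A = {G'. hom_graph G' \<and> G \<subseteq> G'}"
  have "\<exists>M\<in>A. \<forall>Z1\<in>A. M \<subseteq> Z1 \<longrightarrow> Z1 = M"
  proof (rule subset_Zorn_nonempty)
    show "A \<noteq> {}" using G by (auto simp: A_def)
    fix C assume C: "C \<noteq> {}" "subset.chain A C"
    have hg: "hom_graph Z1" "G \<subseteq> Z1" if "Z1 \<in> C" for Z1 using C(2) that by (auto simp: subset.chain_def A_def)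
    have two: "\<exists>Z1\<in>C. x \<in> Z1 \<and> y \<in> Z1" if "x \<in> \<Union> C" "y \<in> \<Union> C" for x y
    proof -
      obtain Z1 Z2 where Z12: "Z1 \<in> C" "Z2 \<in> C" "x \<in> Z1" "y \<in> Z2" using \<open>x \<in> \<Union> C\<close> \<open>y \<in> \<Union> C\<close> by blast
      have "Z1 \<subseteq> Z2 \<or> Z2 \<subseteq> Z1" using C(2) Z12 by (auto simp: subset_chain_def)
      thus ?thesis using Z12 by blast
    qed
    have "hom_graph (\<Union> C)" unfolding hom_graph_def
    proof (intro conjI allI impI)
      show "(1, 1) \<in> \<Union> C" using C(1) graph_1 hg by blast
    next
      fix a b c d assume "(a, b) \<in> \<Union> C" "(c, d) \<in> \<Union> C"
      then obtain Z1 where Z1: "Z1 \<in> C" "(a, b) \<in> Z1" "(c, d) \<in> Z1" using two by blast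
      show "(a - c, b - d) \<in> \<Union> C" using graph_diff[OF hg(1)[OF Z1(1)] Z1(2,3)] Z1(1) by blast
      show "(a * c, b * d) \<in> \<Union> C" using graph_mult[OF hg(1)[OF Z1(1)] Z1(2,3)] Z1(1) by blast
    next
      fix a b assume "(a, b) \<in> \<Union> C"
      then obtain Z1 where Z1: "Z1 \<in> C" "(a, b) \<in> Z1" by blast
      show "(inverse a, inverse b) \<in> \<Union> C" using graph_inverse[OF hg(1)[OF Z1(1)] Z1(2)] Z1(1) by blast
    next
      fix b assume "(0, b) \<in> \<Union> C"
      then obtain Z1 where Z1: "Z1 \<in> C" "(0, b) \<in> Z1" by blast
      show "b = 0" by (rule graph_0D[OF hg(1)[OF Z1(1)] Z1(2)])
    qed
    moreover have "G \<subseteq> \<Union> C" using C(1) hg(2) by blast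
    ultimately show "\<Union> C \<in> A" by (simp add: A_def)
  qed
  then obtain M where M: "hom_graph M" "G \<subseteq> M" and mx: "\<And>Z1. hom_graph Z1 \<Longrightarrow> M \<subseteq> Z1 \<Longrightarrow> Z1 = M" by (auto simp: A_def)
  have tot: "\<exists>b. (z, b) \<in> M" for z
  proof -
    have "poly_pairs G \<subseteq> poly_pairs M" using M(2) by (auto simp: poly_pairs_def)
    hence "\<exists>p q. (p, q) \<in> poly_pairs M \<and> p \<noteq> 0 \<and> poly p z = 0" using alg[of z] by blast
    thus ?thesis
    proof (rule graph_minimal_poly[OF M(1)])
      fix m m' assume m: "(m, m') \<in> poly_pairs M" "degree m > 0"
        "\<And>\<zeta>. poly m' \<zeta> = 0 \<Longrightarrow> \<exists>G'. hom_graph G' \<and> M \<subseteq> G' \<and> (z, \<zeta>) \<in> G'"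
      have "degree m' > 0" using m(2) pairs_degree[OF M(1) m(1)] by simp
      then obtain \<zeta> where "poly m' \<zeta> = 0" using alg_closed_imp_poly_has_root by blast
      then obtain G' where "hom_graph G'" "M \<subseteq> G'" "(z, \<zeta>) \<in> G'" using m(3) by blast
      thus ?thesis using mx by blast
    qed
  qed
  define h where "h z = (SOME b. (z, b) \<in> M)" for z
  have h: "(z, h z) \<in> M" for z unfolding h_def using someI_ex[OF tot[of z]] .
  note fn = graph_fun[OF M(1)]
  have "fhom h"
    by unfold_locales (rule fn[OF h graph_add[OF M(1) h h]] fn[OF h graph_mult[OF M(1) h h]] fn[OF h graph_1[OF M(1)]])+
  moreover have "h a = b" if "(a, b) \<in> G" for a b using fn[OF h] M(2) that by blast
  ultimately show ?thesis by blast
qed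

lemma (in fhom) hom_graph_range:
  assumes "fhom g" shows "hom_graph (range (\<lambda>a. (h a, g a)))"
  unfolding hom_graph_def
proof (intro conjI allI impI)
  interpret g: fhom g by (rule assms)
  show "(1, 1) \<in> range (\<lambda>a. (h a, g a))" by (rule range_eqI[of _ _ 1]) (simp add: hom_one g.hom_one)
  fix a b c d assume "(a, b) \<in> range (\<lambda>a. (h a, g a))" "(c, d) \<in> range (\<lambda>a. (h a, g a))"
  then obtain x y where xy: "a = h x" "b = g x" "c = h y" "d = g y" by blast
  show "(a - c, b - d) \<in> range (\<lambda>a. (h a, g a))"
    by (rule range_eqI[of _ _ "x - y"]) (simp add: xy hom_diff g.hom_diff)
  show "(a * c, b * d) \<in> range (\<lambda>a. (h a, g a))"
    by (rule range_eqI[of _ _ "x * y"]) (simp add: xy hom_mult g.hom_mult)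
next
  interpret g: fhom g by (rule assms)
  fix a b assume "(a, b) \<in> range (\<lambda>a. (h a, g a))"
  then obtain x where "a = h x" "b = g x" by blast
  thus "(inverse a, inverse b) \<in> range (\<lambda>a. (h a, g a))"
    by (intro range_eqI[of _ _ "inverse x"]) (simp add: hom_inverse g.hom_inverse)
next
  interpret g: fhom g by (rule assms)
  fix b assume "(0, b) \<in> range (\<lambda>a. (h a, g a))"
  then obtain x where "0 = h x" "b = g x" by blast
  thus "b = 0" using hom_eq_0[of x] g.hom_zero by simp
qed

lemma (in fhom) poly_pairs_range:
  assumes "fhom g" shows "(map_poly h p, map_poly g p) \<in> poly_pairs (range (\<lambda>a. (h a, g a)))"
  unfolding poly_pairs_def using fhom.coeff_map[OF assms] by (auto simp: coeff_map)

lemma fhom_extension: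
  fixes e :: "'b :: field \<Rightarrow> 'o :: field" and g :: "'b \<Rightarrow> 'c :: alg_closed_field"
  assumes e: "fhom e" and g: "fhom g" and alg: "\<And>z. \<exists>p. p \<noteq> 0 \<and> poly (map_poly e p) z = 0"
  shows "\<exists>h. fhom h \<and> (\<forall>a. h (e a) = g a)"
proof -
  interpret e: fhom e by (rule e)
  have "\<exists>h. fhom h \<and> (\<forall>a b. (a, b) \<in> range (\<lambda>a. (e a, g a)) \<longrightarrow> h a = b)"
  proof (rule hom_graph_extension[OF e.hom_graph_range[OF g]])
    fix z
    obtain p where "p \<noteq> 0" "poly (map_poly e p) z = 0" using alg by blast
    thus "\<exists>p q. (p, q) \<in> poly_pairs (range (\<lambda>a. (e a, g a))) \<and> p \<noteq> 0 \<and> poly p z = 0"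
      using e.poly_pairs_range[OF g, of p] e.map_poly_hom_eq_0 by blast
  qed
  thus ?thesis by blast
qed

text \<open>If \<open>z\<close> were the only root of its minimal polynomial, which is not linear,
  the derivative would vanish at \<open>z\<close> as well; in characteristic 0 it is a nonzero
  polynomial of smaller degree, against minimality. Sending \<open>z\<close> to a second root moves
  it.\<close>

lemma fhom_moving:
  fixes e :: "'b :: field \<Rightarrow> 'o :: alg_closed_field"
  assumes e: "fhom e" and char0: "\<And>n. n > 0 \<Longrightarrow> (of_nat n :: 'o) \<noteq> 0"
    and alg: "\<And>z. \<exists>p. p \<noteq> 0 \<and> poly (map_poly e p) z = 0" and z: "z \<notin> range e"
  shows "\<exists>h. fhom h \<and> (\<forall>a. h (e a) = e a) \<and> h z \<noteq> z"
proof -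
  interpret e: fhom e by (rule e)
  define G where "G = range (\<lambda>a. (e a, e a))"
  have G: "hom_graph G" unfolding G_def by (rule e.hom_graph_range[OF e])
  have algG: "\<exists>p q. (p, q) \<in> poly_pairs G \<and> p \<noteq> 0 \<and> poly p z = 0" for z
    using alg[of z] e.poly_pairs_range[OF e] e.map_poly_hom_eq_0 unfolding G_def by blast
  obtain m m' where m: "(m, m') \<in> poly_pairs G" "poly m z = 0" "degree m > 0"
    "\<And>p q. (p, q) \<in> poly_pairs G \<Longrightarrow> p \<noteq> 0 \<Longrightarrow> poly p z = 0 \<Longrightarrow> degree m \<le> degree p"
    "\<And>\<zeta>. poly m' \<zeta> = 0 \<Longrightarrow> \<exists>G'. hom_graph G' \<and> G \<subseteq> G' \<and> (z, \<zeta>) \<in> G'"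
    by (rule graph_minimal_poly[OF G algG[of z]]) blast
  have mG: "(coeff m i, coeff m' i) \<in> range (\<lambda>a. (e a, e a))" for i
    using m(1) by (simp add: poly_pairs_def G_def)
  have mm: "m' = m"
  proof (rule poly_eqI)
    show "coeff m' i = coeff m i" for i using mG[of i] by auto
  qed
  have mr: "coeff m i \<in> range e" for i using m(1) unfolding poly_pairs_def G_def by auto
  have "\<exists>\<zeta>. poly m \<zeta> = 0 \<and> \<zeta> \<noteq> z"
  proof (rule ccontr)
    assume no: "\<not> (\<exists>\<zeta>. poly m \<zeta> = 0 \<and> \<zeta> \<noteq> z)"
    obtain s where s: "m = [:- z, 1:] * s" using m(2) by (metis dvd_def poly_eq_0_iff_dvd)
    have s0: "s \<noteq> 0" using s m(3) by auto
    have dm: "degree m = Suc (degree s)" unfolding s using s0 by (subst degree_mult_eq) auto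
    show False
    proof (cases "degree s = 0")
      case True
      then obtain c where c: "s = [:c:]" using degree_eq_zeroE by blast
      have "coeff m 1 = c" "coeff m 0 = - (z * c)" unfolding s c by auto
      then obtain a b where "c = e a" "- (z * c) = e b" using mr by (metis imageE)
      hence "z * e a = - e b" "e a \<noteq> 0" using s0 c by (auto simp: minus_equation_iff)
      hence "z = e (- (b / a))" by (simp add: e.hom_uminus e.hom_divide field_simps)
      thus False using z by blast
    next
      case False
      then obtain y where y: "poly s y = 0" using alg_closed_imp_poly_has_root by blast
      hence "poly m y = 0" unfolding s by simp
      hence "poly s z = 0" using no y by blast
      hence pd: "poly (pderiv m) z = 0" unfolding s pderiv_mult by (simp add: pderiv_pCons)
      have "(pderiv m, pderiv m) \<in> poly_pairs G"
      proof -
        have "of_nat n * coeff m i \<in> range e" for n i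
        proof -
          obtain a where "coeff m i = e a" using mr by blast
          thus ?thesis by (intro range_eqI[of _ _ "of_nat n * a"]) (simp add: e.hom_mult e.hom_of_nat)
        qed
        hence "coeff (pderiv m) i \<in> range e" for i unfolding coeff_pderiv .
        thus ?thesis unfolding poly_pairs_def G_def by blast
      qed
      moreover have c: "coeff (pderiv m) (degree m - 1) \<noteq> 0"
      proof -
        have "lead_coeff m \<noteq> 0" using m(3) by auto
        thus ?thesis unfolding coeff_pderiv using dm char0[of "degree m"] by (simp del: of_nat_Suc)
      qed
      hence "pderiv m \<noteq> 0" by auto
      ultimately have "degree m \<le> degree (pderiv m)" using m(4) pd by blast
      moreover have "degree (pderiv m) \<le> degree m - 1"
        by (rule degree_le) (auto simp: coeff_pderiv coeff_eq_0)
      ultimately show False using m(3) by simp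
    qed
  qed
  then obtain \<zeta> where \<zeta>: "poly m \<zeta> = 0" "\<zeta> \<noteq> z" by blast
  then obtain G' where G': "hom_graph G'" "G \<subseteq> G'" "(z, \<zeta>) \<in> G'" using m(5) mm by blast
  have "\<exists>h. fhom h \<and> (\<forall>a b. (a, b) \<in> G' \<longrightarrow> h a = b)"
  proof (rule hom_graph_extension[OF G'(1)])
    have "poly_pairs G \<subseteq> poly_pairs G'" using G'(2) by (auto simp: poly_pairs_def)
    thus "\<exists>p q. (p, q) \<in> poly_pairs G' \<and> p \<noteq> 0 \<and> poly p z = 0" for z using algG[of z] by blast
  qed
  then obtain h where h: "fhom h" "\<And>a b. (a, b) \<in> G' \<Longrightarrow> h a = b" by blast
  have "h (e a) = e a" for a using h(2)[of "e a" "e a"] G'(2) by (auto simp: G_def)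
  moreover have "h z \<noteq> z" using h(2)[OF G'(3)] \<zeta>(2) by simp
  ultimately show ?thesis using h(1) by blast
qed

text \<open>An injective map over the base field permutes the finite set of roots of each polynomial
  over that field, so every algebraic element is hit.\<close>

lemma fhom_surj:
  fixes e :: "'b :: field \<Rightarrow> 'o :: field"
  assumes e: "fhom e" and alg: "\<And>z. \<exists>p. p \<noteq> 0 \<and> poly (map_poly e p) z = 0"
    and h: "fhom h" "\<And>a. h (e a) = e a"
  shows "bij h"
proof -
  interpret e: fhom e by (rule e)
  interpret h: fhom h by (rule h(1))
  have "surj h" unfolding surj_def
  proof
    fix z
    obtain p where p: "p \<noteq> 0" "poly (map_poly e p) z = 0" using alg by blast
    define S where "S = {x. poly (map_poly e p) x = 0}"
    have fS: "finite S" unfolding S_def by (rule poly_roots_finite) (simp add: e.map_poly_hom_eq_0 p)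
    have hp: "map_poly h (map_poly e p) = map_poly e p"
      by (simp add: poly_eq_iff h.coeff_map e.coeff_map h(2))
    have "h ` S \<subseteq> S" unfolding S_def using h.poly_map_hom[of "map_poly e p"] by (auto simp: hp h.hom_zero)
    hence "h ` S = S" using fS by (intro endo_inj_surj) (auto intro: inj_on_subset[OF h.inj])
    moreover have "z \<in> S" using p by (simp add: S_def)
    ultimately show "\<exists>x. z = h x" by blast
  qed
  thus ?thesis using h.inj by (simp add: bij_def)
qed

section \<open>Evaluation of rational functions\<close>

text \<open>Evaluation in lowest terms with coefficients sent through \<open>e\<close>. The same
  function serves several purposes: for \<open>e = cst\<close> its range is the field
  \<open>k(x)\<close>, for \<open>e = eL\<close> it expands \<open>k(t)\<close> at infinity, and for
  \<open>e = rf_const\<close> it substitutes one rational function into another.\<close>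

definition rf_eval :: "('a :: field \<Rightarrow> 'c :: field) \<Rightarrow> 'c \<Rightarrow> 'a poly fract \<Rightarrow> 'c" where
  "rf_eval e x \<phi> = poly (map_poly e (rf_num \<phi>)) x / poly (map_poly e (rf_den \<phi>)) x"

text \<open>Transcendence of \<open>x\<close> over the image of \<open>e\<close> keeps denominators
  from vanishing, and evaluation becomes a field homomorphism.\<close>

locale transc = fhom e for e :: "'a :: field \<Rightarrow> 'c :: field" +
  fixes x :: 'c
  assumes transc: "poly (map_poly e p) x = 0 \<Longrightarrow> p = 0"
begin

lemma rf_eval_Fract:
  assumes "q \<noteq> 0" shows "rf_eval e x (Fract p q) = poly (map_poly e p) x / poly (map_poly e q) x"
proof -
  define \<phi> where "\<phi> = Fract p q"
  have d0: "rf_den \<phi> \<noteq> 0" using rf_num_den(3)[of \<phi>] by auto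
  have "Fract p q = Fract (rf_num \<phi>) (rf_den \<phi>)" using rf_num_den(1)[of \<phi>] \<phi>_def by simp
  hence "p * rf_den \<phi> = rf_num \<phi> * q" using assms d0 by (simp add: eq_fract)
  hence "poly (map_poly e p) x * poly (map_poly e (rf_den \<phi>)) x = poly (map_poly e (rf_num \<phi>)) x * poly (map_poly e q) x"
    by (simp flip: map_poly_hom_mult poly_mult)
  moreover have "poly (map_poly e q) x \<noteq> 0" "poly (map_poly e (rf_den \<phi>)) x \<noteq> 0" using transc assms d0 by blast+
  ultimately show ?thesis unfolding rf_eval_def \<phi>_def[symmetric] by (simp add: frac_eq_eq)
qed

lemma rf_eval_to_fract: "rf_eval e x (to_fract p) = poly (map_poly e p) x"
  using rf_eval_Fract[of 1 p] by (simp add: to_fract_def map_poly_hom_one)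

lemma rf_eval_const: "rf_eval e x (rf_const c) = e c"
  by (simp add: rf_const_def rf_eval_to_fract map_poly_hom_pCons)

lemma rf_eval_var: "rf_eval e x (to_fract [:0, 1:]) = x"
  by (simp add: rf_eval_to_fract map_poly_hom_pCons hom_zero hom_one)

sublocale ev: fhom "rf_eval e x"
proof
  fix \<phi> \<psi> :: "'a poly fract"
  obtain a b where ab: "\<phi> = Fract a b" "b \<noteq> 0" by (cases \<phi>)
  obtain c d where cd: "\<psi> = Fract c d" "d \<noteq> 0" by (cases \<psi>)
  have nz: "poly (map_poly e b) x \<noteq> 0" "poly (map_poly e d) x \<noteq> 0" using transc ab cd by blast+
  show "rf_eval e x (\<phi> + \<psi>) = rf_eval e x \<phi> + rf_eval e x \<psi>"
    unfolding ab(1) cd(1) using ab(2) cd(2) nz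
    by (simp add: rf_eval_Fract map_poly_hom_add map_poly_hom_mult add_frac_eq)
  show "rf_eval e x (\<phi> * \<psi>) = rf_eval e x \<phi> * rf_eval e x \<psi>"
    unfolding ab(1) cd(1) using ab(2) cd(2) nz by (simp add: rf_eval_Fract map_poly_hom_mult)
  show "rf_eval e x 1 = 1" by (simp add: One_fract_def rf_eval_Fract map_poly_hom_one)
qed

lemma rf_eval_comp: "rf_eval e x (rf_comp h \<phi>) = poly (map_poly e h) (rf_eval e x \<phi>)"
proof -
  have "rf_eval e x (rf_comp h \<phi>) = poly (map_poly (rf_eval e x) (map_poly rf_const h)) (rf_eval e x \<phi>)"
    unfolding rf_comp_def by (rule ev.poly_map_hom[symmetric])
  also have "map_poly (rf_eval e x) (map_poly rf_const h) = map_poly e h"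
    by (simp add: poly_eq_iff ev.coeff_map coeff_map_poly rf_const_def rf_eval_const[unfolded rf_const_def] hom_zero)
  finally show ?thesis .
qed

end

lemma rf_const_fhom: "fhom rf_const"
  by unfold_locales (simp_all add: rf_const_def flip: one_pCons to_fract_add to_fract_mult)

definition cst :: "'a :: field \<Rightarrow> 'a poly fract alg_closure" where "cst c = to_ac (rf_const c)"

abbreviation tt :: "'a :: field poly fract alg_closure" where "tt \<equiv> to_ac (to_fract [:0, 1:])"

lemma cst_fhom: "fhom cst"
  using fhom_compose[OF fhom_to_ac rf_const_fhom] by (simp add: cst_def[abs_def] comp_def)

interpretation cst: fhom cst by (rule cst_fhom)
interpretation ac: fhom to_ac by (rule fhom_to_ac)
interpretation rfc: fhom rf_const by (rule rf_const_fhom)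

lemma map_cst: "map_poly to_ac (map_poly rf_const p) = map_poly cst p"
  by (simp add: poly_eq_iff coeff_map_poly cst_def rfc.hom_zero)

lemma poly_rf_const: "poly (map_poly rf_const p) (to_fract [:0, 1:]) = to_fract p"
proof (induction p)
  case (pCons a p)
  have "poly (map_poly rf_const (pCons a p)) (to_fract [:0, 1:]) = rf_const a + to_fract [:0, 1:] * to_fract p"
    by (simp add: rfc.map_poly_hom_pCons pCons.IH)
  also have "\<dots> = to_fract ([:a:] + [:0, 1:] * p)" by (simp only: rf_const_def to_fract_add to_fract_mult)
  also have "[:a:] + [:0, 1:] * p = pCons a p" by simp
  finally show ?case .
qed simp

lemma tt_transc: "transc cst tt"
proof
  fix p :: "'a poly" assume "poly (map_poly cst p) tt = 0"
  hence "poly (map_poly rf_const p) (to_fract [:0, 1:]) = 0"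
    unfolding map_cst[symmetric] ac.poly_map_hom by simp
  thus "p = 0" unfolding poly_rf_const by simp
qed

interpretation tt: transc cst tt by (rule tt_transc)

lemma rf_eval_tt: "rf_eval cst tt \<phi> = to_ac \<phi>"
proof -
  have ev: "poly (map_poly cst p) tt = to_ac (to_fract p)" for p :: "'a poly"
    unfolding map_cst[symmetric] ac.poly_map_hom poly_rf_const ..
  have "\<phi> = to_fract (rf_num \<phi>) / to_fract (rf_den \<phi>)"
    using rf_num_den(1)[of \<phi>] by (simp add: to_fract_def)
  thus ?thesis unfolding rf_eval_def ev by (metis to_ac_divide)
qed

lemma rf_num_den_to_fract: "rf_num (to_fract f) = f" "rf_den (to_fract f) = 1"
proof -
  have "rf_quot (to_fract f) = (f, 1)" by (rule rf_quot_eqI) (simp_all add: to_fract_def)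
  thus "rf_num (to_fract f) = f" "rf_den (to_fract f) = 1" by (simp_all add: rf_num_def rf_den_def)
qed

lemma fibre_iff:
  "x \<in> fibre \<phi> \<longleftrightarrow> poly (map_poly cst (rf_num \<phi>)) x = tt * poly (map_poly cst (rf_den \<phi>)) x"
  unfolding fibre_def fibre_poly_def by (simp add: ac.map_poly_hom_diff ac.map_poly_hom_smult map_cst)

lemma fibre_to_fract: "x \<in> fibre (to_fract f) \<longleftrightarrow> poly (map_poly cst f) x = tt"
  unfolding fibre_iff rf_num_den_to_fract by (simp add: cst.map_poly_hom_one)

section \<open>Laurent expansions at infinity\<close>

text \<open>At a pole the leading monomial dominates. This yields the transcendence of the image of
  \<open>t\<close> over the constants and, later, the degree of a polynomial from the pole order of
  its value.\<close>

lemma poly_fls_subdegree: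
  fixes w :: "'k :: field fls"
  assumes w: "fls_subdegree w < 0" and p: "p \<noteq> 0"
  shows "poly (map_poly fls_const p) w \<noteq> 0" "fls_subdegree (poly (map_poly fls_const p) w) = int (degree p) * fls_subdegree w"
proof -
  have w0: "w \<noteq> 0" using w by auto
  have "poly (map_poly fls_const p) w \<noteq> 0 \<and> fls_subdegree (poly (map_poly fls_const p) w) = int (degree p) * fls_subdegree w"
    using p
  proof (induction p)
    case (pCons a p)
    show ?case
    proof (cases "p = 0")
      case True
      thus ?thesis using pCons by (simp add: map_poly_pCons)
    next
      case False
      define q where "q = w * poly (map_poly fls_const p) w"
      have q: "q \<noteq> 0" "fls_subdegree q = int (degree (pCons a p)) * fls_subdegree w"
        using pCons.IH[OF False] w0 False by (auto simp: q_def algebra_simps)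
      hence neg: "fls_subdegree q < 0" using w False by (simp add: mult_less_0_iff)
      have "poly (map_poly fls_const (pCons a p)) w = fls_const a + q" by (simp add: q_def map_poly_pCons)
      moreover have "fls_subdegree (fls_const a + q) = fls_subdegree q"
        by (rule fls_subdegree_add_eq2[OF q(1)]) (use neg in simp)
      moreover have "fls_const a + q \<noteq> 0" using calculation(2) neg by auto
      ultimately show ?thesis using q(2) by simp
    qed
  qed simp
  thus "poly (map_poly fls_const p) w \<noteq> 0" "fls_subdegree (poly (map_poly fls_const p) w) = int (degree p) * fls_subdegree w"
    by auto
qed

lemma fls_const_fhom: "fhom (fls_const :: 'k :: field \<Rightarrow> _)"
  by unfold_locales (simp_all add: fls_plus_const)

text \<open>The substitution \<open>X \<mapsto> \<zeta> X\<close>, that is, the action of inertia.\<close>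

definition scl :: "'k :: field \<Rightarrow> 'k fls \<Rightarrow> 'k fls" where
  "scl \<zeta> F = fls_compose_fps F (fps_const \<zeta> * fps_X)"

lemma scl_fhom:
  fixes \<zeta> :: "'k :: field"
  assumes "\<zeta> \<noteq> 0" shows "fhom (scl \<zeta>)"
proof -
  have H: "fps_const \<zeta> * fps_X \<noteq> 0" "(fps_const \<zeta> * fps_X) $ 0 = 0" using assms by auto
  show ?thesis
    by unfold_locales (simp_all add: scl_def fls_compose_fps_add[OF H] fls_compose_fps_mult[OF H])
qed

lemma scl_const: "scl \<zeta> (fls_const c) = fls_const c"
  unfolding scl_def by simp

text \<open>The image \<open>fls_X_inv ^ N\<close> of \<open>t\<close> is fixed, so inertia acts
  over the base field \<open>k(t)\<close>.\<close>

lemma scl_X_inv_power: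
  fixes \<zeta> :: "'k :: field"
  assumes "\<zeta> \<noteq> 0" "\<zeta> ^ N = 1" shows "scl \<zeta> (fls_X_inv ^ N) = fls_X_inv ^ N"
proof -
  interpret fhom "scl \<zeta>" by (rule scl_fhom[OF assms(1)])
  have "scl \<zeta> fls_X = fls_const \<zeta> * fls_X"
    unfolding scl_def by (simp add: fls_times_fps_to_fls)
  hence "scl \<zeta> (fls_X ^ N) = fls_X ^ N" unfolding hom_power
    using assms(2) by (simp add: power_mult_distrib flip: fls_const_power)
  moreover have "(fls_X_inv :: 'k fls) ^ N = inverse (fls_X ^ N)" by (simp add: power_inverse flip: fls_inverse_X)
  ultimately show ?thesis by (simp add: hom_inverse)
qed

lemma scl_compose_monom:
  fixes v :: "'k :: field fps"
  assumes "\<zeta> \<noteq> 0" "M > 0"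
  shows "scl \<zeta> (fps_to_fls (fps_compose v (fps_const c * fps_X ^ M))) = fps_to_fls (fps_compose v (fps_const (c * \<zeta> ^ M) * fps_X ^ M))"
proof -
  have H: "(fps_const \<zeta> * fps_X) $ 0 = (0 :: 'k)" by simp
  have "fps_compose (fps_compose v (fps_const c * fps_X ^ M)) (fps_const \<zeta> * fps_X) =
    fps_compose v (fps_compose (fps_const c * fps_X ^ M) (fps_const \<zeta> * fps_X))"
    using assms by (intro fps_compose_assoc[symmetric]) auto
  also have "fps_compose (fps_const c * fps_X ^ M) (fps_const \<zeta> * fps_X) = fps_const (c * \<zeta> ^ M) * fps_X ^ M"
  proof -
    have "fps_compose (fps_X ^ M) (fps_const \<zeta> * fps_X) = (fps_const \<zeta> * fps_X) ^ M"
      unfolding fps_compose_power[OF H, symmetric] by simp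
    thus ?thesis by (simp add: fps_compose_mult_distrib[OF H] power_mult_distrib fps_const_power mult.assoc flip: fps_const_mult)
  qed
  finally show ?thesis unfolding scl_def using assms by simp
qed

text \<open>If \<open>p\<close> divides \<open>m\<close>, a \<open>p\<close>-th root of
  \<open>a\<close> has the required order. Otherwise \<open>a\<close> is multiplied by a root
  \<open>c\<close> of \<open>1 + X + ... + X^(p-1)\<close>; it is different from 1 because the
  characteristic is 0, so it has order \<open>p\<close>.\<close>

lemma primitive_root_step:
  fixes a :: "'k :: {alg_closed_field, field_char_0}"
  assumes a: "\<And>i. a ^ i = 1 \<longleftrightarrow> m dvd i" and p: "prime (p::nat)"
  shows "\<exists>b::'k. \<forall>i. b ^ i = 1 \<longleftrightarrow> p * m dvd i"
proof (cases "p dvd m")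
  case True
  obtain b where b: "b ^ p = a" using nth_root_exists[of p a] prime_gt_0_nat[OF p] by blast
  have bp: "b ^ (p * i) = a ^ i" for i unfolding b[symmetric] by (simp add: power_mult)
  have "b ^ i = 1 \<longleftrightarrow> p * m dvd i" for i
  proof
    assume bi: "b ^ i = 1"
    have "a ^ i = (b ^ i) ^ p" unfolding bp[symmetric] by (simp add: power_mult[symmetric] mult.commute)
    hence "m dvd i" using a bi by simp
    then obtain i' where i': "i = p * i'" using True by (metis dvd_trans dvd_def)
    hence "a ^ i' = 1" using bi bp by simp
    thus "p * m dvd i" using a i' by simp
  next
    assume "p * m dvd i"
    then obtain j where "i = p * (m * j)" by (metis dvd_def mult.assoc)
    thus "b ^ i = 1" using bp a by simp
  qed
  thus ?thesis by blast
next
  case False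
  define q where "q = (\<Sum>j<p. monom (1::'k) j)"
  have p2: "p \<ge> 2" using prime_ge_2_nat[OF p] .
  have "coeff q (p - 1) = 1" unfolding q_def using p2 by (simp add: coeff_sum)
  hence "degree q > 0" using p2 le_degree[of q "p - 1"] by simp
  then obtain c where c: "poly q c = 0" using alg_closed_imp_poly_has_root by blast
  have s: "(\<Sum>j<p. c ^ j) = 0" using c by (simp add: q_def poly_sum poly_monom)
  have "c ^ p - 1 = (c - 1) * (\<Sum>j<p. c ^ j)" by (rule power_diff_1_eq)
  hence cp: "c ^ p = 1" using s by simp
  have c1: "c \<noteq> 1" using s p2 by auto
  have ci: "p dvd i" if "c ^ i = 1" for i
  proof (rule ccontr)
    assume "\<not> p dvd i"
    hence "coprime i p" using p by (metis coprime_commute prime_imp_coprime)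
    then obtain x y where "i * x = p * y + 1" using coprime_bezout_strong[of i p] p2 by auto
    hence "c ^ (i * x) = c ^ (p * y) * c" by (simp add: power_add)
    thus False using that cp c1 by (simp add: power_mult)
  qed
  have "(a * c) ^ i = 1 \<longleftrightarrow> p * m dvd i" for i
  proof
    assume e: "(a * c) ^ i = 1"
    have "((a * c) ^ i) ^ p = a ^ (p * i) * (c ^ p) ^ i"
      by (simp add: power_mult_distrib power_mult[symmetric] mult.commute)
    hence "a ^ (p * i) = 1" using e cp by simp
    hence "m dvd p * i" using a by simp
    moreover have "coprime m p" using False p by (metis coprime_commute prime_imp_coprime)
    ultimately have mi: "m dvd i" by (simp add: coprime_dvd_mult_right_iff)
    hence "a ^ i = 1" using a by simp
    hence "c ^ i = 1" using e by (simp add: power_mult_distrib)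
    hence "p dvd i" by (rule ci)
    thus "p * m dvd i" using mi \<open>coprime m p\<close> by (simp add: divides_mult coprime_commute)
  next
    assume "p * m dvd i"
    hence "m dvd i" "p dvd i" by (metis dvd_mult_right, metis dvd_mult_left)
    hence "a ^ i = 1" "c ^ i = 1" using a cp by (auto simp: power_mult elim!: dvdE)
    thus "(a * c) ^ i = 1" by (simp add: power_mult_distrib)
  qed
  thus ?thesis by blast
qed

lemma primitive_root_exists:
  assumes "N > 0"
  shows "\<exists>\<zeta>::'k :: {alg_closed_field, field_char_0}. \<forall>i. \<zeta> ^ i = 1 \<longleftrightarrow> N dvd i"
  using assms
proof (induction N rule: less_induct)
  case (less N)
  show ?case
  proof (cases "N = 1")
    case True
    thus ?thesis by (intro exI[of _ 1]) simp
  next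
    case False
    then obtain p where p: "prime p" "p dvd N" using prime_factor_nat by blast
    then obtain m where m: "N = p * m" by blast
    have "m > 0" "m < N" using m less.prems prime_gt_1_nat[OF p(1)] by auto
    then obtain a :: 'k where "\<And>i. a ^ i = 1 \<longleftrightarrow> m dvd i" using less.IH by blast
    from primitive_root_step[OF this p(1)] show ?thesis unfolding m .
  qed
qed

section \<open>Power series branches over a pole\<close>

lemma poly_fps_compose:
  fixes z :: "'k :: field fps"
  assumes "z $ 0 = 0" shows "poly (map_poly fps_const p) z = fps_compose (fps_of_poly p) z"
proof (induction p)
  case (pCons a p)
  thus ?case using assms
    by (simp add: map_poly_pCons fps_of_poly_pCons fps_compose_add_distrib fps_compose_mult_distrib mult.commute)
qed simp

lemma poly_fps_to_fls:
  fixes z :: "'k :: field fps"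
  shows "poly (map_poly fls_const p) (fps_to_fls z) = fps_to_fls (poly (map_poly fps_const p) z)"
  by (induction p) (simp_all add: map_poly_pCons fls_times_fps_to_fls)

lemma compose_monom_nth:
  fixes v :: "'k :: field fps"
  assumes "M > 0"
  shows "fps_compose v (fps_const c * fps_X ^ M) $ k = (if M dvd k then v $ (k div M) * c ^ (k div M) else 0)"
proof -
  have "fps_compose (fps_const c * fps_X) (fps_X ^ M) = fps_const c * fps_X ^ M"
    using assms by (subst fps_compose_mult_distrib) auto
  hence "fps_compose v (fps_const c * fps_X ^ M) = fps_compose (fps_compose v (fps_const c * fps_X)) (fps_X ^ M)"
    using assms by (subst fps_compose_assoc[symmetric]) auto
  thus ?thesis using assms by (auto simp: fps_nth_compose_X_power fps_compose_linear)
qed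

text \<open>With \<open>r = q / p\<close> the equation reads
  \<open>z ^ e * r(z) = X ^ (e * M)\<close>. The unit \<open>r\<close> has an \<open>e\<close>-th
  root \<open>\<rho>\<close>, and \<open>w = X \<rho>\<close> turns the equation into
  \<open>w(z) ^ e = X ^ (e * M)\<close>, solved by \<open>w(z) = \<theta> X ^ M\<close> with
  \<open>\<theta> ^ e = 1\<close>. The series \<open>v\<close> is the compositional inverse of
  \<open>w\<close>.\<close>

lemma local_branch:
  fixes p q :: "'k :: {alg_closed_field, field_char_0} poly"
  assumes p: "poly p 0 \<noteq> 0" and q: "poly q 0 \<noteq> 0" and e: "e > 0" and M: "M > 0"
  obtains v :: "'k fps" where "v $ 0 = 0" "v $ 1 \<noteq> 0"
    "\<And>\<theta> z. \<theta> ^ e = 1 \<Longrightarrow> z = fps_compose v (fps_const \<theta> * fps_X ^ M) \<Longrightarrow>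
       fps_X ^ (e * M) * poly (map_poly fps_const p) z = z ^ e * poly (map_poly fps_const q) z"
proof -
  define r where "r = fps_of_poly q / fps_of_poly p"
  have p0: "fps_of_poly p $ 0 \<noteq> 0" "fps_of_poly q $ 0 \<noteq> 0" using p q by (simp_all add: poly_0_coeff_0)
  hence rp: "r * fps_of_poly p = fps_of_poly q" unfolding r_def
    by (simp add: fps_divide_unit mult.assoc inverse_mult_eq_1)
  have r0: "r $ 0 \<noteq> 0" using rp p0 by (metis fps_mult_nth_0 mult_eq_0_iff)
  obtain k where k: "e = Suc k" using e by (cases e) auto
  obtain \<kappa> where \<kappa>: "\<kappa> ^ e = r $ 0" using nth_root_exists[OF e] by blast
  define \<rho> where "\<rho> = fps_radical (\<lambda>_ _. \<kappa>) e r"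
  have \<rho>e: "\<rho> ^ e = r"
    using power_radical[of r "\<lambda>_ _. \<kappa>" k] r0 \<kappa> unfolding \<rho>_def k by simp
  have \<rho>0: "\<rho> $ 0 \<noteq> 0"
  proof
    assume "\<rho> $ 0 = 0"
    hence "(\<rho> ^ e) $ 0 = 0" using e by (simp add: fps_power_zeroth)
    thus False using r0 \<rho>e by simp
  qed
  define w where "w = fps_X * \<rho>"
  have w: "w $ 0 = 0" "w $ 1 \<noteq> 0" using \<rho>0 by (simp_all add: w_def)
  define v where "v = fps_inv w"
  have v0: "v $ 0 = 0" by (simp add: v_def fps_inv_def)
  have v1: "v $ 1 \<noteq> 0" using w(2) by (simp add: v_def fps_inv_def)
  have wv: "fps_compose w v = fps_X" unfolding v_def by (rule fps_inv_right[OF w])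
  show thesis
  proof (rule that[OF v0 v1])
    fix \<theta> z assume \<theta>: "\<theta> ^ e = 1" and z: "z = fps_compose v (fps_const \<theta> * fps_X ^ M)"
    have m0: "(fps_const \<theta> * fps_X ^ M) $ 0 = 0" using M by simp
    have z0: "z $ 0 = 0" unfolding z using v0 by simp
    have "fps_compose w z = fps_compose (fps_compose w v) (fps_const \<theta> * fps_X ^ M)"
      unfolding z by (rule fps_compose_assoc[OF m0 v0])
    also have "\<dots> = fps_const \<theta> * fps_X ^ M" unfolding wv using m0 by simp
    finally have wz: "fps_compose w z = fps_const \<theta> * fps_X ^ M" .
    have "fps_compose (w ^ e) z = (fps_const \<theta> * fps_X ^ M) ^ e" unfolding wz[symmetric] by (rule fps_compose_power[OF z0, symmetric])
    also have "\<dots> = fps_X ^ (e * M)" using \<theta> by (simp add: power_mult_distrib fps_const_power mult.commute flip: power_mult)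
    finally have 1: "fps_compose (w ^ e) z = fps_X ^ (e * M)" .
    have "w ^ e = fps_X ^ e * r" by (simp add: w_def power_mult_distrib \<rho>e)
    hence "fps_X ^ (e * M) * fps_compose (fps_of_poly p) z = fps_compose (fps_X ^ e * (r * fps_of_poly p)) z"
      unfolding 1[symmetric] by (simp add: fps_compose_mult_distrib[OF z0] mult.assoc)
    also have "\<dots> = z ^ e * fps_compose (fps_of_poly q) z"
      unfolding rp using z0 by (simp add: fps_compose_mult_distrib[OF z0] fps_compose_power[OF z0, symmetric])
    finally show "fps_X ^ (e * M) * poly (map_poly fps_const p) z = z ^ e * poly (map_poly fps_const q) z"
      by (simp add: poly_fps_compose[OF z0])
  qed
qed

text \<open>The maps \<open>eL\<close> and \<open>tL N\<close> describe the expansion at infinity: the local parameter is an \<open>N\<close>-th root of \<open>1/t\<close>.\<close>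

definition eL :: "'a :: field_char_0 \<Rightarrow> 'a alg_closure fls alg_closure" where
  "eL c = to_ac (fls_const (to_ac c))"

definition tL :: "nat \<Rightarrow> 'a :: field_char_0 alg_closure fls alg_closure" where
  "tL N = to_ac (fls_X_inv ^ N)"

lemma map_eL: "map_poly eL p = map_poly to_ac (map_poly fls_const (map_poly to_ac p))"
  by (simp add: poly_eq_iff coeff_map_poly eL_def)

lemma fls_subdegree_X_inv_power: "fls_subdegree (fls_X_inv ^ N :: 'k :: field fls) = - int N"
  by (induction N) (simp_all add: fls_subdegree_mult)

lemma transc_tL:
  assumes "N > 0" shows "transc eL (tL N :: 'a :: field_char_0 alg_closure fls alg_closure)"
proof -
  have eLc: "(eL :: 'a \<Rightarrow> _) = to_ac \<circ> (fls_const \<circ> to_ac)" by (simp add: eL_def fun_eq_iff)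
  have "fhom (eL :: 'a \<Rightarrow> _)"
    unfolding eLc by (rule fhom_compose[OF fhom_to_ac fhom_compose[OF fls_const_fhom fhom_to_ac]])
  moreover have "transc_axioms eL (tL N :: 'a alg_closure fls alg_closure)"
  proof
    fix p :: "'a poly" assume "poly (map_poly eL p) (tL N) = 0"
    hence "poly (map_poly fls_const (map_poly to_ac p)) (fls_X_inv ^ N) = 0"
      unfolding map_eL tL_def ac.poly_map_hom by simp
    hence "map_poly to_ac p = 0"
      using poly_fls_subdegree(1)[of "fls_X_inv ^ N" "map_poly to_ac p"] assms by (auto simp: fls_subdegree_X_inv_power)
    thus "p = 0" by (simp add: ac.map_poly_hom_eq_0)
  qed
  ultimately show ?thesis by (rule transc.intro)
qed

text \<open>The polynomial splits already over its algebraically closed field of coefficients, so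
  its image acquires no new roots.\<close>

lemma fhom_root_in_range:
  fixes \<iota> :: "'o :: alg_closed_field \<Rightarrow> 'c :: field"
  assumes \<iota>: "fhom \<iota>" and "p \<noteq> 0" "poly (map_poly \<iota> p) w = 0"
  shows "w \<in> range \<iota>"
  using assms(2,3)
proof (induction "degree p" arbitrary: p rule: less_induct)
  case less
  interpret \<iota>: fhom \<iota> by (rule \<iota>)
  show ?case
  proof (cases "degree p = 0")
    case True
    then obtain c where "p = [:c:]" using degree_eq_zeroE by blast
    thus ?thesis using less.prems by (simp add: \<iota>.map_poly_hom_pCons \<iota>.hom_eq_0)
  next
    case False
    then obtain x where "poly p x = 0" using alg_closed_imp_poly_has_root by blast
    then obtain q where q: "p = [:- x, 1:] * q" by (metis dvd_def poly_eq_0_iff_dvd)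
    have q0: "q \<noteq> 0" using q less.prems by auto
    have "degree q < degree p" unfolding q using q0 by (subst degree_mult_eq) auto
    moreover have "poly (map_poly \<iota> p) w = (w - \<iota> x) * poly (map_poly \<iota> q) w"
      unfolding q \<iota>.map_poly_hom_mult by (simp add: \<iota>.map_poly_hom_pCons \<iota>.hom_uminus \<iota>.hom_one algebra_simps)
    ultimately show ?thesis using less.hyps[of q] less.prems q0 by auto
  qed
qed

lemma exists_Laurent_embedding:
  assumes "N > 0"
  shows "\<exists>\<iota> :: 'a :: field_char_0 poly fract alg_closure \<Rightarrow> 'a alg_closure fls alg_closure.
    fhom \<iota> \<and> (\<forall>\<phi>. \<iota> (to_ac \<phi>) = rf_eval eL (tL N) \<phi>)"
proof -
  interpret transc eL "tL N :: 'a alg_closure fls alg_closure" by (rule transc_tL[OF assms])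
  show ?thesis
    by (rule fhom_extension[OF fhom_to_ac ev.fhom_axioms]) (metis alg_closure_algebraic)
qed

text \<open>\<open>\<sigma>\<close> extends the substitution to the algebraic closure of the Laurent
  series field. It fixes the image of \<open>k(t)\<close>, hence maps elements algebraic over it to
  roots of the same polynomials, which lie in the image of \<open>\<iota>\<close>;
  \<open>\<Sigma>\<close> is the map induced on the source of \<open>\<iota>\<close>.\<close>

lemma exists_inertia:
  fixes \<iota> :: "'a :: field_char_0 poly fract alg_closure \<Rightarrow> 'a alg_closure fls alg_closure"
  assumes N: "N > 0" and \<iota>: "fhom \<iota>" "\<And>\<phi>. \<iota> (to_ac \<phi>) = rf_eval eL (tL N) \<phi>"
    and \<zeta>: "\<zeta> \<noteq> 0" "\<zeta> ^ N = 1"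
  shows "\<exists>\<Sigma>. fhom \<Sigma> \<and> (\<forall>\<phi>. \<Sigma> (to_ac \<phi>) = to_ac \<phi>) \<and> (\<forall>x w. \<iota> x = to_ac w \<longrightarrow> \<iota> (\<Sigma> x) = to_ac (scl \<zeta> w))"
proof -
  interpret transc eL "tL N :: 'a alg_closure fls alg_closure" by (rule transc_tL[OF N])
  interpret \<iota>: fhom \<iota> by (rule \<iota>(1))
  have "\<exists>\<sigma>. fhom \<sigma> \<and> (\<forall>w. \<sigma> (to_ac w) = (to_ac \<circ> scl \<zeta>) w)"
    by (rule fhom_extension[OF fhom_to_ac fhom_compose[OF fhom_to_ac scl_fhom[OF \<zeta>(1)]]]) (metis alg_closure_algebraic)
  then obtain \<sigma> :: "'a alg_closure fls alg_closure \<Rightarrow> _" where \<sigma>: "fhom \<sigma>" "\<And>w. \<sigma> (to_ac w) = to_ac (scl \<zeta> w)" by auto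
  interpret \<sigma>: fhom \<sigma> by (rule \<sigma>(1))
  have \<sigma>e: "\<sigma> (eL c) = eL c" for c by (simp add: eL_def \<sigma>(2) scl_const)
  have \<sigma>t: "\<sigma> (tL N) = tL N" unfolding tL_def \<sigma>(2) scl_X_inv_power[OF \<zeta>] ..
  have \<sigma>p: "map_poly \<sigma> (map_poly eL p) = map_poly eL p" for p by (simp add: poly_eq_iff \<sigma>.coeff_map coeff_map \<sigma>e)
  have \<sigma>\<phi>: "\<sigma> (\<iota> (to_ac \<phi>)) = \<iota> (to_ac \<phi>)" for \<phi>
    unfolding \<iota>(2) rf_eval_def \<sigma>.hom_divide \<sigma>.poly_map_hom[symmetric] \<sigma>p \<sigma>t ..
  have rng: "\<sigma> (\<iota> x) \<in> range \<iota>" for x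
  proof -
    obtain p :: "'a poly fract poly" where p: "p \<noteq> 0" "poly (map_poly to_ac p) x = 0" by (rule alg_closure_algebraic)
    define q where "q = map_poly to_ac p"
    have q: "q \<noteq> 0" "poly q x = 0" using p by (auto simp: q_def ac.map_poly_hom_eq_0)
    have e: "map_poly \<sigma> (map_poly \<iota> q) = map_poly \<iota> q"
      by (simp add: poly_eq_iff \<sigma>.coeff_map \<iota>.coeff_map q_def ac.coeff_map \<sigma>\<phi>)
    have "poly (map_poly \<iota> q) (\<sigma> (\<iota> x)) = 0"
      using \<sigma>.poly_map_hom[of "map_poly \<iota> q" "\<iota> x"] unfolding e \<iota>.poly_map_hom q(2) by (simp add: \<iota>.hom_zero \<sigma>.hom_zero)
    thus ?thesis by (rule fhom_root_in_range[OF \<iota>(1) q(1)])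
  qed
  define \<Sigma> where "\<Sigma> x = (SOME y. \<iota> y = \<sigma> (\<iota> x))" for x
  have \<Sigma>: "\<iota> (\<Sigma> x) = \<sigma> (\<iota> x)" for x 
  proof -
    obtain y where "\<sigma> (\<iota> x) = \<iota> y" using rng[of x] by blast
    hence "\<exists>y. \<iota> y = \<sigma> (\<iota> x)" by metis
    thus ?thesis unfolding \<Sigma>_def by (rule someI_ex)
  qed
  have "fhom \<Sigma>"
  proof
    show "\<Sigma> (x + y) = \<Sigma> x + \<Sigma> y" for x y
      using \<iota>.hom_eq[of "\<Sigma> (x + y)" "\<Sigma> x + \<Sigma> y"] by (simp add: \<Sigma> \<iota>.hom_add \<sigma>.hom_add)
    show "\<Sigma> (x * y) = \<Sigma> x * \<Sigma> y" for x y
      using \<iota>.hom_eq[of "\<Sigma> (x * y)" "\<Sigma> x * \<Sigma> y"] by (simp add: \<Sigma> \<iota>.hom_mult \<sigma>.hom_mult)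
    show "\<Sigma> 1 = 1" using \<iota>.hom_eq[of "\<Sigma> 1" 1] by (simp add: \<Sigma> \<iota>.hom_one \<sigma>.hom_one)
  qed
  moreover have "\<Sigma> (to_ac \<phi>) = to_ac \<phi>" for \<phi> using \<iota>.hom_eq[of "\<Sigma> (to_ac \<phi>)" "to_ac \<phi>"] by (simp add: \<Sigma> \<sigma>\<phi>)
  moreover have "\<iota> (\<Sigma> x) = to_ac (scl \<zeta> w)" if "\<iota> x = to_ac w" for x w using that by (simp add: \<Sigma> \<sigma>(2))
  ultimately show ?thesis by blast
qed

text \<open>The \<open>e\<close> solutions belong to the \<open>e\<close>-th roots of unity
  \<open>(\<zeta> ^ M) ^ i\<close> and are told apart by the coefficient of \<open>X ^ M\<close>.
  Replacing \<open>X\<close> by \<open>\<zeta> X\<close> multiplies this root of unity by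
  \<open>\<zeta> ^ M\<close>, which is the step from \<open>i\<close> to
  \<open>Suc i\<close>.\<close>

lemma shifted_branch_family:
  fixes v :: "'k :: {alg_closed_field, field_char_0} fps"
  assumes v: "v $ 0 = 0" "v $ 1 \<noteq> 0" and e: "e > 0" and M: "M > 0"
    and \<zeta>: "\<And>i. \<zeta> ^ i = 1 \<longleftrightarrow> e * M dvd i"
  defines "z \<equiv> \<lambda>i. fps_compose v (fps_const ((\<zeta> ^ M) ^ i) * fps_X ^ M)"
  shows "((\<zeta> ^ M) ^ i) ^ e = 1" "inj_on z {..<e}" "z (i + e) = z i" "subdegree (z i) = M" "z i \<noteq> 0"
    "scl \<zeta> (fps_to_fls (z i)) = fps_to_fls (z (Suc i))"
proof -
  have \<zeta>0: "\<zeta> \<noteq> 0"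
  proof
    assume z: "\<zeta> = 0"
    have "\<zeta> ^ (e * M) = 1" using \<zeta> by simp
    thus False using e M unfolding z by (simp add: power_0_left)
  qed
  have \<omega>: "(\<zeta> ^ M) ^ i = 1 \<longleftrightarrow> e dvd i" for i using \<zeta>[of "M * i"] M by (simp add: power_mult mult.commute)
  show "((\<zeta> ^ M) ^ i) ^ e = 1" using \<omega>[of "i * e"] by (simp add: power_mult)
  have nth: "z i $ k = (if M dvd k then v $ (k div M) * ((\<zeta> ^ M) ^ i) ^ (k div M) else 0)" for i k
    unfolding z_def by (rule compose_monom_nth[OF M])
  have zM: "z i $ M = v $ 1 * (\<zeta> ^ M) ^ i" for i using M by (simp add: nth)
  show "inj_on z {..<e}"
  proof (rule linorder_inj_onI)
    fix a b assume ab: "a < b" "a \<in> {..<e}" "b \<in> {..<e}"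
    show "z a \<noteq> z b"
    proof
      assume "z a = z b"
      hence "z a $ M = z b $ M" by simp
      hence "(\<zeta> ^ M) ^ a = (\<zeta> ^ M) ^ b" using v(2) unfolding zM by simp
      also have "\<dots> = (\<zeta> ^ M) ^ a * (\<zeta> ^ M) ^ (b - a)" using ab by (simp flip: power_add)
      finally have "(\<zeta> ^ M) ^ (b - a) = 1" using \<zeta>0 by simp
      hence "e dvd b - a" using \<omega> by blast
      thus False using ab by (auto dest: dvd_imp_le)
    qed
  qed auto
  show "z (i + e) = z i" unfolding z_def using \<omega>[of e] by (simp add: power_add)
  have "z i $ M \<noteq> 0" unfolding zM using v(2) \<zeta>0 by simp
  moreover have "z i $ k = 0" if "k < M" for k using that v(1) by (auto simp: nth)
  ultimately show "subdegree (z i) = M" by (rule subdegreeI)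
  show "z i \<noteq> 0" using \<open>z i $ M \<noteq> 0\<close> by auto
  show "scl \<zeta> (fps_to_fls (z i)) = fps_to_fls (z (Suc i))"
    unfolding z_def scl_compose_monom[OF \<zeta>0 M] by (simp add: mult.commute)
qed

text \<open>Translation by \<open>\<beta>\<close> moves the pole to 0, where \<open>Q\<close>
  becomes \<open>z ^ e\<close> times a polynomial not vanishing there; this is the local equation
  with ramification index \<open>e = order \<beta> Q\<close> and \<open>M = N / e\<close>. The
  constant term of the branch remembers \<open>\<beta>\<close>.\<close>

lemma finite_pole_branches:
  fixes P Q :: "'k :: {alg_closed_field, field_char_0} poly"
  assumes Q: "Q \<noteq> 0" "poly Q \<beta> = 0" and P: "poly P \<beta> \<noteq> 0" and N: "order \<beta> Q dvd N" "N > 0"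
    and \<zeta>: "\<And>i. \<zeta> ^ i = 1 \<longleftrightarrow> N dvd i"
  shows "\<exists>Y. (\<forall>i. poly (map_poly fls_const P) (Y i) = fls_X_inv ^ N * poly (map_poly fls_const Q) (Y i)) \<and>
    inj_on Y {..<order \<beta> Q} \<and> (\<forall>i. Y (i + order \<beta> Q) = Y i) \<and> (\<forall>i. scl \<zeta> (Y i) = Y (Suc i)) \<and>
    (\<forall>i. fls_nth (Y i) 0 = \<beta> \<and> fls_subdegree (Y i) \<ge> 0)"
proof -
  define e where "e = order \<beta> Q"
  have e: "e > 0" unfolding e_def using Q by (simp add: order_gt_0_iff)
  obtain M where M: "N = e * M" using N(1) e_def by blast
  have M0: "M > 0" using M N by (cases M) auto
  obtain Q1 where Q1: "Q = [:- \<beta>, 1:] ^ e * Q1" "\<not> [:- \<beta>, 1:] dvd Q1"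
    using order_decomp[OF Q(1), of \<beta>] unfolding e_def by blast
  define p where "p = pcompose P [:\<beta>, 1:]"
  define q where "q = pcompose Q1 [:\<beta>, 1:]"
  have pq0: "poly p 0 \<noteq> 0" "poly q 0 \<noteq> 0"
    using P Q1(2) by (simp_all add: p_def q_def poly_pcompose poly_eq_0_iff_dvd)
  obtain v where v: "v $ 0 = 0" "v $ 1 \<noteq> 0"
    "\<And>\<theta> z. \<theta> ^ e = 1 \<Longrightarrow> z = fps_compose v (fps_const \<theta> * fps_X ^ M) \<Longrightarrow>
       fps_X ^ (e * M) * poly (map_poly fps_const p) z = z ^ e * poly (map_poly fps_const q) z"
    using local_branch[OF pq0 e M0] by blast
  define z where "z i = fps_compose v (fps_const ((\<zeta> ^ M) ^ i) * fps_X ^ M)" for i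
  have z: "((\<zeta> ^ M) ^ i) ^ e = 1" "inj_on z {..<e}" "z (i + e) = z i" "subdegree (z i) = M"
    "scl \<zeta> (fps_to_fls (z i)) = fps_to_fls (z (Suc i))" for i
    using shifted_branch_family[OF v(1,2) e M0 \<zeta>[unfolded M]] unfolding z_def by blast+
  define Y where "Y i = fls_const \<beta> + fps_to_fls (z i)" for i
  interpret c: fhom "fls_const :: 'k \<Rightarrow> _" by (rule fls_const_fhom)
  have \<zeta>0: "\<zeta> \<noteq> 0"
  proof
    assume z: "\<zeta> = 0"
    have "\<zeta> ^ (N) = 1" using \<zeta> by simp
    thus False using N unfolding z by (simp add: power_0_left)
  qed
  interpret s: fhom "scl \<zeta>" by (rule scl_fhom[OF \<zeta>0])
  have sub: "poly (map_poly fls_const (pcompose R [:\<beta>, 1:])) (fps_to_fls (z i)) = poly (map_poly fls_const R) (Y i)" for R i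
    unfolding c.map_poly_hom_pcompose poly_pcompose by (simp add: c.map_poly_hom_pCons Y_def)
  have root: "poly (map_poly fls_const P) (Y i) = fls_X_inv ^ N * poly (map_poly fls_const Q) (Y i)" for i
  proof -
    have "fps_to_fls (fps_X ^ N * poly (map_poly fps_const p) (z i)) = fps_to_fls (z i ^ e * poly (map_poly fps_const q) (z i))"
      unfolding M using v(3)[OF z(1), of "z i" i] unfolding z_def by simp
    hence "fls_X ^ N * poly (map_poly fls_const P) (Y i) = fps_to_fls (z i) ^ e * poly (map_poly fls_const Q1) (Y i)"
      by (simp add: fls_times_fps_to_fls fps_to_fls_power flip: poly_fps_to_fls) (simp add: p_def q_def sub)
    moreover have "poly (map_poly fls_const Q) (Y i) = fps_to_fls (z i) ^ e * poly (map_poly fls_const Q1) (Y i)"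
    proof -
      have "map_poly fls_const ([:- \<beta>, 1:] ^ n) = [:- fls_const \<beta>, 1:] ^ n" for n
        by (induction n) (simp_all add: c.map_poly_hom_one c.map_poly_hom_mult c.map_poly_hom_pCons del: mult_pCons_left)
      thus ?thesis unfolding Q1(1) c.map_poly_hom_mult by (simp add: Y_def poly_power)
    qed
    ultimately have "fls_X ^ N * poly (map_poly fls_const P) (Y i) = poly (map_poly fls_const Q) (Y i)" by simp
    hence "fls_X_inv ^ N * poly (map_poly fls_const Q) (Y i) = (fls_X_inv ^ N * fls_X ^ N) * poly (map_poly fls_const P) (Y i)"
      by (simp add: mult.assoc)
    moreover have "(fls_X_inv ^ N * fls_X ^ N :: 'k fls) = 1"
      by (simp flip: power_mult_distrib fls_inverse_X)
    ultimately show ?thesis by simp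
  qed
  have "inj_on Y {..<e}" using z(2) by (auto simp: inj_on_def Y_def)
  moreover have "Y (i + e) = Y i" for i using z(3) by (simp add: Y_def)
  moreover have "scl \<zeta> (Y i) = Y (Suc i)" for i using z(5) by (simp add: Y_def s.hom_add scl_const)
  moreover have "fls_nth (Y i) 0 = \<beta> \<and> fls_subdegree (Y i) \<ge> 0" for i
  proof
    have "z i $ 0 = 0" using z(4)[of i] M0 by (metis nth_less_subdegree_zero)
    thus "fls_nth (Y i) 0 = \<beta>" by (simp add: Y_def)
    show "fls_subdegree (Y i) \<ge> 0" by (rule fls_subdegree_ge0I) (simp add: Y_def)
  qed
  ultimately show ?thesis using root unfolding e_def by blast
qed

text \<open>Reflecting the polynomials exchanges 0 and infinity, and \<open>Y = 1 / z\<close>. The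
  ramification index is \<open>degree P - degree Q\<close>; the pole order of the branches is
  recorded because it later measures degrees of polynomials.\<close>

lemma infinite_pole_branches:
  fixes P Q :: "'k :: {alg_closed_field, field_char_0} poly"
  assumes Q: "Q \<noteq> 0" and PQ: "degree P > degree Q" and N: "degree P - degree Q dvd N" "N > 0"
    and \<zeta>: "\<And>i. \<zeta> ^ i = 1 \<longleftrightarrow> N dvd i"
  shows "\<exists>Y. (\<forall>i. poly (map_poly fls_const P) (Y i) = fls_X_inv ^ N * poly (map_poly fls_const Q) (Y i)) \<and>
    inj_on Y {..<degree P - degree Q} \<and> (\<forall>i. Y (i + (degree P - degree Q)) = Y i) \<and> (\<forall>i. scl \<zeta> (Y i) = Y (Suc i)) \<and>
    (\<forall>i. fls_subdegree (Y i) = - int (N div (degree P - degree Q)))"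
proof -
  define e where "e = degree P - degree Q"
  have e: "e > 0" unfolding e_def using PQ by simp
  obtain M where M: "N = e * M" using N(1) e_def by blast
  have M0: "M > 0" using M N by (cases M) auto
  have P: "P \<noteq> 0" using PQ by auto
  have pq0: "poly (reflect_poly P) 0 \<noteq> 0" "poly (reflect_poly Q) 0 \<noteq> 0" using P Q by simp_all
  obtain v where v: "v $ 0 = 0" "v $ 1 \<noteq> 0"
    "\<And>\<theta> z. \<theta> ^ e = 1 \<Longrightarrow> z = fps_compose v (fps_const \<theta> * fps_X ^ M) \<Longrightarrow>
       fps_X ^ (e * M) * poly (map_poly fps_const (reflect_poly P)) z = z ^ e * poly (map_poly fps_const (reflect_poly Q)) z"
    using local_branch[OF pq0 e M0] by blast
  define z where "z i = fps_compose v (fps_const ((\<zeta> ^ M) ^ i) * fps_X ^ M)" for i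
  have z: "((\<zeta> ^ M) ^ i) ^ e = 1" "inj_on z {..<e}" "z (i + e) = z i" "subdegree (z i) = M" "z i \<noteq> 0"
    "scl \<zeta> (fps_to_fls (z i)) = fps_to_fls (z (Suc i))" for i
    using shifted_branch_family[OF v(1,2) e M0 \<zeta>[unfolded M]] unfolding z_def by blast+
  define Y where "Y i = inverse (fps_to_fls (z i))" for i
  interpret c: fhom "fls_const :: 'k \<Rightarrow> _" by (rule fls_const_fhom)
  have \<zeta>0: "\<zeta> \<noteq> 0"
  proof
    assume z: "\<zeta> = 0"
    have "\<zeta> ^ (N) = 1" using \<zeta> by simp
    thus False using N unfolding z by (simp add: power_0_left)
  qed
  interpret s: fhom "scl \<zeta>" by (rule scl_fhom[OF \<zeta>0])
  have z0: "fps_to_fls (z i) \<noteq> 0" for i using z(5) by simp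
  have refl: "poly (map_poly fls_const (reflect_poly R)) (fps_to_fls (z i)) = fps_to_fls (z i) ^ degree R * poly (map_poly fls_const R) (Y i)" for R i
  proof -
    have "map_poly fls_const (reflect_poly R) = reflect_poly (map_poly fls_const R)"
      by (simp add: poly_eq_iff c.coeff_map coeff_reflect_poly c.degree_map_hom c.hom_zero)
    thus ?thesis using poly_reflect_poly_nz[OF z0, of "map_poly fls_const R" i] by (simp add: Y_def c.degree_map_hom)
  qed
  have root: "poly (map_poly fls_const P) (Y i) = fls_X_inv ^ N * poly (map_poly fls_const Q) (Y i)" for i
  proof -
    have "fps_to_fls (fps_X ^ N * poly (map_poly fps_const (reflect_poly P)) (z i)) = fps_to_fls (z i ^ e * poly (map_poly fps_const (reflect_poly Q)) (z i))"
      unfolding M using v(3)[OF z(1), of "z i" i] unfolding z_def by simp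
    hence "fls_X ^ N * (fps_to_fls (z i) ^ degree P * poly (map_poly fls_const P) (Y i)) = fps_to_fls (z i) ^ e * (fps_to_fls (z i) ^ degree Q * poly (map_poly fls_const Q) (Y i))"
      by (simp add: fls_times_fps_to_fls fps_to_fls_power flip: poly_fps_to_fls) (simp add: refl)
    also have "\<dots> = fps_to_fls (z i) ^ degree P * poly (map_poly fls_const Q) (Y i)"
      using PQ by (simp add: e_def mult.assoc[symmetric] flip: power_add)
    finally have "fps_to_fls (z i) ^ degree P * (fls_X ^ N * poly (map_poly fls_const P) (Y i)) = fps_to_fls (z i) ^ degree P * poly (map_poly fls_const Q) (Y i)"
      by (simp add: mult.left_commute)
    hence "fls_X ^ N * poly (map_poly fls_const P) (Y i) = poly (map_poly fls_const Q) (Y i)" using z0 by simp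
    hence "fls_X_inv ^ N * poly (map_poly fls_const Q) (Y i) = (fls_X_inv ^ N * fls_X ^ N) * poly (map_poly fls_const P) (Y i)"
      by (simp add: mult.assoc)
    moreover have "(fls_X_inv ^ N * fls_X ^ N :: 'k fls) = 1"
      by (simp flip: power_mult_distrib fls_inverse_X)
    ultimately show ?thesis by simp
  qed
  have "inj_on Y {..<e}" using z(2) by (auto simp: inj_on_def Y_def)
  moreover have "Y (i + e) = Y i" for i using z(3) by (simp add: Y_def)
  moreover have "scl \<zeta> (Y i) = Y (Suc i)" for i using z(6) by (simp add: Y_def s.hom_inverse)
  moreover have "fls_subdegree (Y i) = - int (N div e)" for i
    using z(4,5)[of i] e by (simp add: Y_def fls_inverse_subdegree fls_subdegree_fls_to_fps M)
  ultimately show ?thesis using root unfolding e_def by blast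
qed

lemma sum_order_eq_degree:
  fixes Q :: "'k :: alg_closed_field poly"
  assumes "Q \<noteq> 0" shows "(\<Sum>\<beta>\<in>{\<beta>. poly Q \<beta> = 0}. order \<beta> Q) = degree Q"
proof -
  obtain A where A: "size A = degree Q" "Q = smult (lead_coeff Q) (\<Prod>x\<in>#A. [:-x, 1:])"
    using alg_closed_imp_factorization[OF assms] by blast
  have l0: "lead_coeff Q \<noteq> 0" using assms by simp
  have nz: "(\<Prod>x\<in>#B. [:-x, 1:]) \<noteq> (0 :: 'k poly)" for B by (auto simp: prod_mset_zero_iff)
  have "proots (\<Prod>x\<in>#B. [:-x, 1:]) = B" for B :: "'k multiset"
  proof (induction B)
    case (add x B)
    have "proots ([:-x, 1:] * (\<Prod>x\<in>#B. [:-x, 1:])) = proots [:-x, 1:] + proots (\<Prod>x\<in>#B. [:-x, 1:])"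
      by (rule proots_mult) (use nz[of B] in simp_all)
    thus ?case using add by simp
  qed simp
  hence "proots Q = A" by (subst A(2)) (use l0 in simp)
  hence "degree Q = size (proots Q)" using A(1) by simp
  also have "\<dots> = (\<Sum>\<beta>\<in>{\<beta>. poly Q \<beta> = 0}. order \<beta> Q)"
    using assms by (simp add: size_multiset_overloaded_eq)
  finally show ?thesis by simp
qed

text \<open>
  Each pole \<open>pt\<close> of order \<open>e pt\<close> carries the expansions \<open>Y pt 0, \<dots>, Y pt (e pt - 1)\<close>, which inertia permutes cyclically;
  the orders add up to the degree, so these are all roots.
\<close>

lemma fibre_branches:
  fixes \<phi> :: "'a :: field_char_0 poly fract"
    and \<iota> :: "'a poly fract alg_closure \<Rightarrow> 'a alg_closure fls alg_closure"
  assumes N: "N > 0" "\<And>e. 0 < e \<Longrightarrow> e \<le> rf_degree \<phi> \<Longrightarrow> e dvd N"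
    and \<zeta>: "\<And>i. \<zeta> ^ i = 1 \<longleftrightarrow> N dvd i"
    and \<iota>: "fhom \<iota>" "\<And>\<phi>. \<iota> (to_ac \<phi>) = rf_eval eL (tL N) \<phi>"
  shows "\<exists>Y e. (\<forall>pt. rf_map \<phi> pt = None \<longrightarrow> e pt > 0 \<and> (\<forall>i. Y pt (i + e pt) = Y pt i) \<and> (\<forall>i. scl \<zeta> (Y pt i) = Y pt (Suc i))) \<and>
    (\<forall>x\<in>fibre \<phi>. \<exists>pt i. rf_map \<phi> pt = None \<and> \<iota> x = to_ac (Y pt i)) \<and> card (fibre \<phi>) = rf_degree \<phi> \<and>
    (rf_map \<phi> None = None \<longrightarrow> (\<forall>i. fls_subdegree (Y None i) = - int (N div e None)) \<and> e None = degree (rf_num \<phi>) - degree (rf_den \<phi>))"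
proof -
  interpret \<iota>: fhom \<iota> by (rule \<iota>(1))
  interpret L: transc eL "tL N :: 'a alg_closure fls alg_closure" by (rule transc_tL[OF N(1)])
  interpret c: fhom "fls_const :: 'a alg_closure \<Rightarrow> _" by (rule fls_const_fhom)
  define P where "P = map_poly to_ac (rf_num \<phi>)"
  define Q where "Q = map_poly to_ac (rf_den \<phi>)"
  have den0: "rf_den \<phi> \<noteq> 0" using rf_num_den(3)[of \<phi>] by auto
  have Q0: "Q \<noteq> 0" using den0 by (simp add: Q_def ac.map_poly_hom_eq_0)
  have degs: "degree P = degree (rf_num \<phi>)" "degree Q = degree (rf_den \<phi>)" by (simp_all add: P_def Q_def ac.degree_map_hom)
  have cop: "poly P \<beta> \<noteq> 0" if "poly Q \<beta> = 0" for \<beta>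
  proof
    assume "poly P \<beta> = 0"
    obtain a b where "a * rf_num \<phi> + b * rf_den \<phi> = 1" using coprime_poly_bezout[OF rf_num_den(2)[of \<phi>]] by blast
    hence "map_poly to_ac (a * rf_num \<phi> + b * rf_den \<phi>) = 1" by (simp add: ac.map_poly_hom_one)
    hence "map_poly to_ac a * P + map_poly to_ac b * Q = 1" by (simp add: ac.map_poly_hom_add ac.map_poly_hom_mult P_def Q_def)
    hence "poly (map_poly to_ac a * P + map_poly to_ac b * Q) \<beta> = 1" by simp
    thus False using that \<open>poly P \<beta> = 0\<close> by simp
  qed
  have pole: "rf_map \<phi> (Some \<beta>) = None \<longleftrightarrow> poly Q \<beta> = 0" for \<beta> by (simp add: Q_def Let_def)
  have poleN: "rf_map \<phi> None = None \<longleftrightarrow> degree P > degree Q" by (simp add: degs Let_def)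
  have dmax: "rf_degree \<phi> = max (degree P) (degree Q)" by (simp add: rf_degree_def degs)
  define e where "e pt = (case pt of Some \<beta> \<Rightarrow> order \<beta> Q | None \<Rightarrow> degree P - degree Q)" for pt
  define R where "R y \<longleftrightarrow> poly (map_poly fls_const P) y = fls_X_inv ^ N * poly (map_poly fls_const Q) y" for y
  \<comment> \<open>Besides solving the equation, a family of branches must reveal its pole: by the
    constant term at a finite pole, by a negative order at infinity. This is what makes branches at
    different poles distinct.\<close>
  define Bd where "Bd pt Y \<longleftrightarrow> (\<forall>i. R (Y i)) \<and> inj_on Y {..<e pt} \<and> (\<forall>i. Y (i + e pt) = Y i) \<and> (\<forall>i. scl \<zeta> (Y i) = Y (Suc i)) \<and>
      (\<forall>i. case pt of Some \<beta> \<Rightarrow> fls_nth (Y i) 0 = \<beta> \<and> fls_subdegree (Y i) \<ge> 0 | None \<Rightarrow> fls_subdegree (Y i) = - int (N div e None))"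
    for pt and Y :: "nat \<Rightarrow> 'a alg_closure fls"
  have ex: "\<exists>Y. Bd pt Y" if pt: "rf_map \<phi> pt = None" for pt
  proof (cases pt)
    case (Some \<beta>)
    have Qb: "poly Q \<beta> = 0" using pt pole Some by simp
    have "order \<beta> Q > 0" using Qb Q0 by (simp add: order_gt_0_iff)
    moreover have "order \<beta> Q \<le> rf_degree \<phi>" using order_degree[OF Q0, of \<beta>] dmax by simp
    ultimately have "order \<beta> Q dvd N" by (rule N(2))
    from finite_pole_branches[OF Q0 Qb cop[OF Qb] this N(1) \<zeta>]
    show ?thesis unfolding Bd_def Some R_def e_def by simp
  next
    case None
    have d: "degree P > degree Q" using pt poleN None by simp
    have "degree P - degree Q dvd N" by (rule N(2)) (use d dmax in auto)
    from infinite_pole_branches[OF Q0 d this N(1) \<zeta>]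
    show ?thesis unfolding Bd_def None R_def e_def by simp
  qed
  define Y where "Y pt = (SOME Y. Bd pt Y)" for pt
  have "Bd pt (Y pt)" if "rf_map \<phi> pt = None" for pt unfolding Y_def by (rule someI_ex[OF ex[OF that]])
  note Y = this[unfolded Bd_def]
  have ep: "e pt > 0" if "rf_map \<phi> pt = None" for pt
    using that pole poleN Q0 by (cases pt) (auto simp: e_def order_gt_0_iff)
  define S where "S = {pt. rf_map \<phi> pt = None}"
  have Seq: "S = Some ` {\<beta>. poly Q \<beta> = 0} \<union> (if degree P > degree Q then {None} else {})"
  proof (rule Set.set_eqI)
    fix pt show "pt \<in> S \<longleftrightarrow> pt \<in> Some ` {\<beta>. poly Q \<beta> = 0} \<union> (if degree P > degree Q then {None} else {})"
      using pole poleN by (cases pt) (auto simp: S_def)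
  qed
  have fr: "finite {\<beta>. poly Q \<beta> = 0}" by (rule poly_roots_finite[OF Q0])
  have fS: "finite S" unfolding Seq using fr by simp
  have sumS: "(\<Sum>pt\<in>S. e pt) = rf_degree \<phi>"
  proof -
    have "(\<Sum>pt\<in>S. e pt) = (\<Sum>pt\<in>Some ` {\<beta>. poly Q \<beta> = 0}. e pt) + (\<Sum>pt\<in>(if degree P > degree Q then {None} else {}). e pt)"
      unfolding Seq by (rule sum.union_disjoint) (use fr in auto)
    also have "(\<Sum>pt\<in>Some ` {\<beta>. poly Q \<beta> = 0}. e pt) = degree Q"
      by (subst sum.reindex) (simp_all add: e_def sum_order_eq_degree[OF Q0])
    finally show ?thesis by (simp add: dmax e_def)
  qed
  define G where "G = (\<lambda>(pt, i). to_ac (Y pt i))"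
  define Idx where "Idx = Sigma S (\<lambda>pt. {..<e pt})"
  have injG: "inj_on G Idx"
  proof (rule inj_onI, clarsimp simp: G_def Idx_def S_def)
    fix pt i pt' i' assume a: "rf_map \<phi> pt = None" "i < e pt" "rf_map \<phi> pt' = None" "i' < e pt'" "Y pt i = Y pt' i'"
    have NN: "N div e None > 0" if "rf_map \<phi> None = None"
    proof -
      have "e None dvd N" by (rule N(2)[OF ep[OF that]]) (simp add: e_def dmax)
      thus ?thesis using N(1) ep[OF that] by (simp add: div_greater_zero_iff dvd_imp_le)
    qed
    have "pt = pt'"
    proof (cases pt)
      case None
      have 1: "fls_subdegree (Y pt i) < 0" using Y[OF a(1)] NN a(1) None by simp
      show ?thesis
      proof (cases pt')
        case (Some \<beta>)
        hence "fls_subdegree (Y pt' i') \<ge> 0" using Y[OF a(3)] by simp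
        thus ?thesis using 1 a(5) by simp
      qed (use None in simp)
    next
      case (Some \<beta>)
      have 1: "fls_nth (Y pt i) 0 = \<beta>" "fls_subdegree (Y pt i) \<ge> 0" using Y[OF a(1)] Some by auto
      show ?thesis
      proof (cases pt')
        case None
        hence "fls_subdegree (Y pt' i') < 0" using Y[OF a(3)] NN a(3) by simp
        thus ?thesis using 1 a(5) by simp
      next
        case (Some \<gamma>)
        hence "fls_nth (Y pt' i') 0 = \<gamma>" using Y[OF a(3)] by simp
        thus ?thesis using 1 a(5) Some \<open>pt = Some \<beta>\<close> by simp
      qed
    qed
    moreover have "i = i'" using Y[OF a(1)] a \<open>pt = pt'\<close> by (auto dest: inj_onD)
    ultimately show "pt = pt' \<and> i = i'" by simp
  qed
  \<comment> \<open>The fibre polynomial over the Laurent series field. It has at most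
    \<open>rf_degree \<phi>\<close> roots, and the branches already supply that many.\<close>
  define D where "D = map_poly fls_const P - smult (fls_X_inv ^ N) (map_poly fls_const Q)"
  have D0: "D \<noteq> 0"
  proof
    assume "D = 0"
    \<comment> \<open>In the coefficient of \<open>X ^ (- N)\<close> only the summand containing
      \<open>t\<close> contributes, and it contributes the leading coefficient of
      \<open>Q\<close>.\<close>
    hence "fls_nth (coeff D (degree Q)) (- int N) = 0" by simp
    moreover have "fls_X_inv ^ N * fls_const (lead_coeff Q) = fls_const (lead_coeff Q) * fls_X_intpow (- int N)"
      by (simp add: fls_X_inv_power_conv_shift_1 mult.commute)
    ultimately show False using Q0 N(1)
      by (simp add: D_def c.coeff_map fls_X_inv_power_times_conv_shift)
  qed
  have degD: "degree D \<le> rf_degree \<phi>" unfolding D_def dmax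
    by (rule degree_diff_le) (auto simp: c.degree_map_hom intro: order_trans[OF degree_smult_le])
  define roots where "roots = {w. poly (map_poly to_ac D) w = 0}"
  have sub: "G ` Idx \<subseteq> roots"
  proof
    fix w assume "w \<in> G ` Idx"
    then obtain pt i where "rf_map \<phi> pt = None" "w = to_ac (Y pt i)" by (auto simp: G_def Idx_def S_def)
    thus "w \<in> roots" using Y[of pt] unfolding roots_def by (auto simp: ac.poly_map_hom D_def R_def)
  qed
  have D0': "map_poly to_ac D \<noteq> 0" using D0 by (simp add: ac.map_poly_hom_eq_0)
  have fR: "finite roots" unfolding roots_def by (rule poly_roots_finite[OF D0'])
  have cardG: "card (G ` Idx) = rf_degree \<phi>"
  proof -
    have "card Idx = rf_degree \<phi>" unfolding Idx_def using fS sumS by simp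
    thus ?thesis by (simp only: card_image[OF injG])
  qed
  have "card roots \<le> degree (map_poly to_ac D)" unfolding roots_def by (rule card_poly_roots_bound[OF D0'])
  also have "\<dots> \<le> card (G ` Idx)" using degD cardG by (simp add: ac.degree_map_hom)
  finally have eq: "G ` Idx = roots" using card_seteq[OF fR sub] by blast
  have \<iota>e: "map_poly \<iota> (map_poly cst p) = map_poly to_ac (map_poly fls_const (map_poly to_ac p))" for p
  proof -
    have "\<iota> (cst c) = eL c" for c unfolding cst_def \<iota>(2) by (rule L.rf_eval_const)
    thus ?thesis unfolding map_eL[symmetric] by (simp add: poly_eq_iff \<iota>.coeff_map cst.coeff_map L.coeff_map)
  qed
  have "\<iota> tt = tL N" unfolding \<iota>(2) by (rule L.rf_eval_var)
  hence \<iota>t: "\<iota> tt = to_ac (fls_X_inv ^ N)" unfolding tL_def .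
  have fib: "x \<in> fibre \<phi> \<longleftrightarrow> \<iota> x \<in> roots" for x
  proof -
    have "x \<in> fibre \<phi> \<longleftrightarrow> \<iota> (poly (map_poly cst (rf_num \<phi>)) x) = \<iota> (tt * poly (map_poly cst (rf_den \<phi>)) x)"
      unfolding fibre_iff \<iota>.hom_eq ..
    also have "\<dots> \<longleftrightarrow> poly (map_poly to_ac (map_poly fls_const P)) (\<iota> x) = to_ac (fls_X_inv ^ N) * poly (map_poly to_ac (map_poly fls_const Q)) (\<iota> x)"
      unfolding \<iota>.hom_mult \<iota>.poly_map_hom[symmetric] \<iota>e \<iota>t P_def Q_def ..
    also have "\<dots> \<longleftrightarrow> \<iota> x \<in> roots"
      unfolding roots_def D_def by (simp add: ac.map_poly_hom_diff ac.map_poly_hom_smult)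
    finally show ?thesis .
  qed
  have "\<iota> ` fibre \<phi> = roots"
  proof
    show "\<iota> ` fibre \<phi> \<subseteq> roots" using fib by blast
    show "roots \<subseteq> \<iota> ` fibre \<phi>"
    proof
      fix w assume w: "w \<in> roots"
      define q where "q = map_poly cst (rf_num \<phi>) - smult tt (map_poly cst (rf_den \<phi>))"
      have mq: "map_poly \<iota> q = map_poly to_ac D"
        unfolding q_def \<iota>.map_poly_hom_diff \<iota>.map_poly_hom_smult \<iota>e \<iota>t D_def P_def Q_def
        by (simp add: ac.map_poly_hom_diff ac.map_poly_hom_smult)
      have "q \<noteq> 0" using D0' \<iota>.map_poly_hom_eq_0[of q] unfolding mq by blast
      hence "w \<in> range \<iota>" by (rule fhom_root_in_range[OF \<iota>(1)]) (use w in \<open>simp add: mq roots_def\<close>)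
      thus "w \<in> \<iota> ` fibre \<phi>" using w fib by blast
    qed
  qed
  hence "card (fibre \<phi>) = card roots" by (metis card_image inj_on_subset[OF \<iota>.inj subset_UNIV])
  hence cardf: "card (fibre \<phi>) = rf_degree \<phi>" using eq cardG by simp
  have all: "\<exists>pt i. rf_map \<phi> pt = None \<and> \<iota> x = to_ac (Y pt i)" if "x \<in> fibre \<phi>" for x
  proof -
    have "\<iota> x \<in> G ` Idx" using that fib eq by simp
    thus ?thesis by (auto simp: G_def Idx_def S_def)
  qed
  have A: "\<forall>pt. rf_map \<phi> pt = None \<longrightarrow> e pt > 0 \<and> (\<forall>i. Y pt (i + e pt) = Y pt i) \<and> (\<forall>i. scl \<zeta> (Y pt i) = Y pt (Suc i))"
    using Y ep by blast
  have B: "\<forall>i. fls_subdegree (Y None i) = - int (N div e None)" if "rf_map \<phi> None = None" using Y[OF that] by simp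
  have "e None = degree (rf_num \<phi>) - degree (rf_den \<phi>)" by (simp add: e_def degs)
  thus ?thesis using A B all cardf by (intro exI[of _ Y] exI[of _ e] conjI ballI impI) auto
qed

section \<open>The Galois group over the rational function field\<close>

lemma (in fhom) hom_rf_eval:
  assumes "\<And>c. h (e c) = e' c" "e 0 = 0"
  shows "h (rf_eval e x \<phi>) = rf_eval e' (h x) \<phi>"
proof -
  have "h (poly (map_poly e p) x) = poly (map_poly e' p) (h x)" for p
  proof -
    have "map_poly h (map_poly e p) = map_poly e' p"
      using assms hom_zero by (subst map_poly_map_poly) (auto simp: o_def)
    thus ?thesis using poly_map_hom[of "map_poly e p" x] by simp
  qed
  thus ?thesis unfolding rf_eval_def hom_divide by simp
qed

text \<open>Endomorphisms over \<open>k(t)\<close> of its algebraic closure are automatically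
  bijective, so this is the absolute Galois group of \<open>k(t)\<close>.\<close>

definition gal :: "('a :: field_char_0 poly fract alg_closure \<Rightarrow> 'a poly fract alg_closure) set" where
  "gal = {\<gamma>. fhom \<gamma> \<and> (\<forall>\<phi>. \<gamma> (to_ac \<phi>) = to_ac \<phi>)}"

lemma gal_fhom: "\<gamma> \<in> gal \<Longrightarrow> fhom \<gamma>" and gal_to_ac: "\<gamma> \<in> gal \<Longrightarrow> \<gamma> (to_ac \<phi>) = to_ac \<phi>"
  by (auto simp: gal_def)

lemma gal_cst: "\<gamma> \<in> gal \<Longrightarrow> \<gamma> (cst c) = cst c"
  by (simp add: cst_def gal_to_ac)

lemma galI:
  assumes "fhom \<gamma>" "\<And>c. \<gamma> (cst c) = cst c" "\<gamma> tt = tt" shows "\<gamma> \<in> gal"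
proof -
  have "\<gamma> (to_ac \<phi>) = to_ac \<phi>" for \<phi>
    using fhom.hom_rf_eval[OF assms(1), of cst cst tt \<phi>] assms(2,3) by (simp add: rf_eval_tt cst.hom_zero)
  thus ?thesis using assms(1) by (simp add: gal_def)
qed

lemma gal_bij: "\<gamma> \<in> gal \<Longrightarrow> bij \<gamma>"
  by (rule fhom_surj[OF fhom_to_ac]) (metis alg_closure_algebraic gal_fhom gal_to_ac)+

lemma gal_id: "(\<lambda>x. x) \<in> gal"
  unfolding gal_def by (auto intro: fhom.intro)

lemma gal_comp: "\<gamma> \<in> gal \<Longrightarrow> \<delta> \<in> gal \<Longrightarrow> (\<lambda>x. \<gamma> (\<delta> x)) \<in> gal"
  using fhom_compose[of \<gamma> \<delta>] by (auto simp: gal_def comp_def)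

lemma gal_inverse:
  assumes "\<gamma> \<in> gal" shows "\<exists>\<delta>\<in>gal. (\<forall>x. \<delta> (\<gamma> x) = x) \<and> (\<forall>x. \<gamma> (\<delta> x) = x)"
proof -
  interpret fhom \<gamma> by (rule gal_fhom[OF assms])
  define \<delta> where "\<delta> = inv_into UNIV \<gamma>"
  have b: "\<And>x. \<delta> (\<gamma> x) = x" "\<And>x. \<gamma> (\<delta> x) = x"
    using gal_bij[OF assms] by (simp_all add: \<delta>_def bij_is_inj bij_is_surj surj_f_inv_f)
  have "\<delta> (x + y) = \<delta> x + \<delta> y" "\<delta> (x * y) = \<delta> x * \<delta> y" for x y
    using b by (metis hom_add, metis hom_mult)
  moreover have "\<delta> 1 = 1" "\<delta> (to_ac \<phi>) = to_ac \<phi>" for \<phi>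
    using b hom_one gal_to_ac[OF assms] by metis+
  ultimately have "\<delta> \<in> gal" by (auto simp: gal_def intro: fhom.intro)
  thus ?thesis using b by blast
qed

lemma gal_eval: "\<gamma> \<in> gal \<Longrightarrow> \<gamma> (rf_eval cst x \<phi>) = rf_eval cst (\<gamma> x) \<phi>"
  by (rule fhom.hom_rf_eval) (simp_all add: gal_fhom gal_cst cst.hom_zero)

lemma gal_poly:
  assumes "\<gamma> \<in> gal" shows "\<gamma> (poly (map_poly cst p) x) = poly (map_poly cst p) (\<gamma> x)"
proof -
  interpret fhom \<gamma> by (rule gal_fhom[OF assms])
  have "map_poly \<gamma> (map_poly cst p) = map_poly cst p"
    by (simp add: poly_eq_iff coeff_map cst.coeff_map gal_cst[OF assms])
  thus ?thesis using poly_map_hom[of "map_poly cst p" x] by simp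
qed

lemma gal_fibre: "\<gamma> \<in> gal \<Longrightarrow> x \<in> fibre \<phi> \<Longrightarrow> \<gamma> x \<in> fibre \<phi>"
  unfolding fibre_iff gal_poly[symmetric] by (simp add: fhom.hom_mult gal_fhom gal_to_ac)

lemma rf_den_nonzero: "rf_den \<phi> \<noteq> 0"
  using rf_num_den(3)[of \<phi>] by auto

lemma (in fhom) coprime_no_common_root:
  assumes "coprime p q" "poly (map_poly h p) x = 0" "poly (map_poly h q) x = 0" shows False
proof -
  obtain a b where "a * p + b * q = 1" using coprime_poly_bezout[OF assms(1)] by blast
  hence "map_poly h (a * p + b * q) = 1" by (simp add: map_poly_hom_one)
  hence "poly (map_poly h (a * p + b * q)) x = 1" by simp
  thus False using assms(2,3) by (simp add: map_poly_hom_add map_poly_hom_mult)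
qed

text \<open>If \<open>y\<close> were algebraic over \<open>k\<close>, its image among the Laurent
  series would be a constant \<open>\<beta>\<close>. Then \<open>P(\<beta>) = Q(\<beta>) / X\<close>
  forces numerator and denominator to vanish at \<open>\<beta>\<close>, against coprimality. Any
  embedding serves here, so \<open>N = 1\<close> is chosen.\<close>

lemma fibre_transc:
  fixes y :: "'a :: field_char_0 poly fract alg_closure"
  assumes y: "y \<in> fibre \<phi>" shows "transc cst y"
proof
  fix p :: "'a poly" assume p: "poly (map_poly cst p) y = 0"
  show "p = 0"
  proof (rule ccontr)
    assume p0: "p \<noteq> 0"
    obtain \<iota> :: "'a poly fract alg_closure \<Rightarrow> 'a alg_closure fls alg_closure"
      where \<iota>: "fhom \<iota>" "\<And>\<phi>. \<iota> (to_ac \<phi>) = rf_eval eL (tL 1) \<phi>" using exists_Laurent_embedding[of 1] by auto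
    interpret \<iota>: fhom \<iota> by (rule \<iota>(1))
    interpret L: transc eL "tL 1 :: 'a alg_closure fls alg_closure" by (rule transc_tL) simp
    define K where "K = (\<lambda>c :: 'a alg_closure. to_ac (fls_const c))"
    have K: "fhom K" using fhom_compose[OF fhom_to_ac fls_const_fhom] by (simp add: K_def comp_def)
    interpret K: fhom K by (rule K)
    have \<iota>p: "\<iota> (poly (map_poly cst q) y) = poly (map_poly K (map_poly to_ac q)) (\<iota> y)" for q
    proof -
      have "map_poly \<iota> (map_poly cst q) = map_poly K (map_poly to_ac q)"
        using L.rf_eval_const by (simp add: poly_eq_iff \<iota>.coeff_map cst.coeff_map K.coeff_map) (simp add: K_def cst_def \<iota>(2) eL_def ac.coeff_map)
      thus ?thesis using \<iota>.poly_map_hom[of "map_poly cst q" y] by simp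
    qed
    have "\<iota> y \<in> range K"
      by (rule fhom_root_in_range[OF K, of "map_poly to_ac p"]) (use p p0 \<iota>p[of p] in \<open>simp_all add: ac.map_poly_hom_eq_0 \<iota>.hom_zero\<close>)
    then obtain \<beta> where \<beta>: "\<iota> y = K \<beta>" by blast
    define P Q where "P = poly (map_poly to_ac (rf_num \<phi>)) \<beta>" and "Q = poly (map_poly to_ac (rf_den \<phi>)) \<beta>"
    have "\<iota> tt = tL 1" using L.rf_eval_var by (simp add: \<iota>(2))
    hence "K P = tL 1 * K Q"
      using arg_cong[OF y[unfolded fibre_iff], of \<iota>] by (simp add: \<iota>p \<iota>.hom_mult \<beta> K.poly_map_hom P_def Q_def)
    hence "fls_const P = fls_X_inv * fls_const Q" by (simp add: K_def tL_def flip: to_ac_mult)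
    hence "fls_nth (fls_const P) i = fls_nth (fls_X_inv * fls_const Q) i" for i by simp
    from this[of 0] this[of "-1"] have "P = 0" "Q = 0" by (simp_all add: fls_X_inv_times_conv_shift)
    thus False using ac.coprime_no_common_root[OF rf_num_den(2)] unfolding P_def Q_def by blast
  qed
qed

lemma fibre_eval:
  assumes y: "y \<in> fibre (\<phi> :: 'a :: field_char_0 poly fract)" shows "rf_eval cst y \<phi> = tt"
proof -
  interpret transc cst y by (rule fibre_transc[OF y])
  have "poly (map_poly cst (rf_den \<phi>)) y \<noteq> 0" using transc rf_den_nonzero by blast
  thus ?thesis using y unfolding fibre_iff rf_eval_def by simp
qed

text \<open>The inclusion of \<open>k(t)\<close> in \<open>k(y)\<close> given by
  \<open>t = \<phi>(y)\<close>: the inner evaluation is the composite of \<open>\<psi>\<close> after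
  \<open>\<phi>\<close>.\<close>

lemma to_ac_fibre:
  assumes y: "y \<in> fibre (\<phi> :: 'a :: field_char_0 poly fract)"
  shows "to_ac \<psi> = rf_eval cst y (rf_eval rf_const \<phi> \<psi>)"
proof -
  interpret transc cst y by (rule fibre_transc[OF y])
  have "rf_eval cst y (rf_eval rf_const \<phi> \<psi>) = rf_eval cst (rf_eval cst y \<phi>) \<psi>"
    by (rule ev.hom_rf_eval) (simp_all add: rf_eval_const rfc.hom_zero)
  thus ?thesis by (simp add: fibre_eval[OF y] rf_eval_tt)
qed

lemma of_nat_Omega_nonzero:
  "n > 0 \<Longrightarrow> (of_nat n :: 'a :: field_char_0 poly fract alg_closure) \<noteq> 0"
  using cst.hom_eq_0[of "of_nat n :: 'a"] by (simp add: cst.hom_of_nat)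

lemma fixed_in_base_field:
  assumes "\<And>\<gamma>. \<gamma> \<in> gal \<Longrightarrow> \<gamma> z = z" shows "z \<in> range (to_ac :: 'a :: field_char_0 poly fract \<Rightarrow> _)"
proof (rule ccontr)
  assume "z \<notin> range (to_ac :: 'a poly fract \<Rightarrow> _)"
  from fhom_moving[OF fhom_to_ac of_nat_Omega_nonzero _ this]
  obtain h where "fhom h" "\<forall>\<phi> :: 'a poly fract. h (to_ac \<phi>) = to_ac \<phi>" "h z \<noteq> z"
    by (metis alg_closure_algebraic)
  thus False using assms[of h] by (simp add: gal_def)
qed

text \<open>Everything is algebraic over \<open>k(y)\<close> because \<open>k(y)\<close> contains
  \<open>k(t)\<close>, so an element outside \<open>k(y)\<close> is moved by some homomorphism over
  \<open>k(y)\<close>. That homomorphism fixes \<open>t = \<phi>(y)\<close> and hence belongs to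
  \<open>gal\<close>.\<close>

lemma fixed_in_point_field:
  assumes y: "y \<in> fibre (\<phi> :: 'a :: field_char_0 poly fract)"
    and fixed: "\<And>\<gamma>. \<gamma> \<in> gal \<Longrightarrow> \<gamma> y = y \<Longrightarrow> \<gamma> z = z"
  shows "z \<in> range (rf_eval cst y)"
proof (rule ccontr)
  assume z: "z \<notin> range (rf_eval cst y)"
  interpret transc cst y by (rule fibre_transc[OF y])
  have alg: "\<exists>p. p \<noteq> 0 \<and> poly (map_poly (rf_eval cst y) p) z = 0" for z
  proof -
    obtain p :: "'a poly fract poly" where p: "p \<noteq> 0" "poly (map_poly to_ac p) z = 0" by (rule alg_closure_algebraic)
    define q where "q = map_poly (rf_eval rf_const \<phi>) p"
    have z0: "rf_eval rf_const \<phi> 0 = 0"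
      using to_ac_fibre[OF y, of 0] ev.hom_eq_0 by simp
    have "map_poly (rf_eval cst y) q = map_poly to_ac p"
      unfolding q_def poly_eq_iff by (simp add: ev.coeff_map coeff_map_poly z0 flip: to_ac_fibre[OF y])
    moreover have "q \<noteq> 0" using calculation p(1) by (auto simp: ac.map_poly_hom_eq_0)
    ultimately show ?thesis using p by metis
  qed
  obtain h where h: "fhom h" "\<And>a. h (rf_eval cst y a) = rf_eval cst y a" "h z \<noteq> z"
    using fhom_moving[OF ev.fhom_axioms of_nat_Omega_nonzero alg z] by blast
  have "h (cst c) = cst c" for c using h(2)[of "rf_const c"] by (simp add: rf_eval_const)
  moreover have "h tt = tt" using h(2)[of \<phi>] by (simp add: fibre_eval[OF y])
  ultimately have "h \<in> gal" using h(1) by (intro galI)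
  moreover have "h y = y" using h(2)[of "to_fract [:0, 1:]"] by (simp add: rf_eval_var)
  ultimately show False using fixed h(3) by blast
qed

section \<open>Linear disjointness\<close>

interpretation Om: ring "ring_of_type_algebra :: 'a :: field ring"
  by (rule ring_from_type_algebra)

lemma type_algebra_simps [simp]:
  "carrier (ring_of_type_algebra :: 'a :: field ring) = UNIV"
  "x \<oplus>\<^bsub>ring_of_type_algebra\<^esub> (y :: 'a) = x + y" "x \<otimes>\<^bsub>ring_of_type_algebra\<^esub> (y :: 'a) = x * y"
  "\<zero>\<^bsub>ring_of_type_algebra\<^esub> = (0 :: 'a)" "\<one>\<^bsub>ring_of_type_algebra\<^esub> = (1 :: 'a)"
  by (simp_all add: ring_of_type_algebra_def)

lemma type_algebra_uminus [simp]: "\<ominus>\<^bsub>ring_of_type_algebra\<^esub> (x :: 'a :: field) = - x"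
  using Om.r_neg[of x] by (simp add: eq_neg_iff_add_eq_0 add.commute)

lemma type_algebra_inverse [simp]:
  assumes "x \<noteq> 0" shows "inv\<^bsub>ring_of_type_algebra\<^esub> (x :: 'a :: field) = inverse x"
  by (rule comm_monoid.comm_inv_char[OF cring.axioms(2)[OF cring_from_type_algebra]]) (use assms in simp_all)

lemma (in fhom) subfield_range: "subfield (range h) ring_of_type_algebra"
proof (rule field.subfieldI'[OF field_from_type_algebra])
  show "subring (range h) ring_of_type_algebra"
  proof (rule Om.subringI)
    show "\<one>\<^bsub>ring_of_type_algebra\<^esub> \<in> range h" using hom_one by (metis rangeI type_algebra_simps(5))
  qed (auto simp flip: hom_uminus hom_mult hom_add)
  show "inv\<^bsub>ring_of_type_algebra\<^esub> k \<in> range h" if "k \<in> range h - {\<zero>\<^bsub>ring_of_type_algebra\<^esub>}" for k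
    using that by (auto simp flip: hom_inverse)
qed

lemma generate_field_closed:
  fixes H :: "'a :: field set" defines "K \<equiv> generate_field ring_of_type_algebra H"
  shows "1 \<in> K" "H \<subseteq> K" "a \<in> K \<Longrightarrow> b \<in> K \<Longrightarrow> a + b \<in> K" "a \<in> K \<Longrightarrow> b \<in> K \<Longrightarrow> a * b \<in> K"
    "a \<in> K \<Longrightarrow> - a \<in> K" "a \<in> K \<Longrightarrow> b \<in> K \<Longrightarrow> a - b \<in> K" "a \<in> K \<Longrightarrow> inverse a \<in> K" "0 \<in> K"
proof -
  have add: "a + b \<in> K" if "a \<in> K" "b \<in> K" for a b
    using generate_field.eng_add[of a "ring_of_type_algebra" H b] that by (simp add: K_def)
  have um: "- a \<in> K" if "a \<in> K" for a
    using generate_field.a_inv[of a "ring_of_type_algebra" H] that by (simp add: K_def)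
  show one: "1 \<in> K" using generate_field.one[of "ring_of_type_algebra" H] by (simp add: K_def)
  show "H \<subseteq> K" using generate_field.incl[of _ H ring_of_type_algebra] by (auto simp add: K_def)
  show "a \<in> K \<Longrightarrow> b \<in> K \<Longrightarrow> a + b \<in> K" "a \<in> K \<Longrightarrow> - a \<in> K" by (rule add um; assumption)+
  show "a \<in> K \<Longrightarrow> b \<in> K \<Longrightarrow> a * b \<in> K"
    using generate_field.eng_mult[of a "ring_of_type_algebra" H b] by (simp add: K_def)
  show "a \<in> K \<Longrightarrow> b \<in> K \<Longrightarrow> a - b \<in> K" using add[of a "- b"] um[of b] by simp
  show z: "0 \<in> K" using add[OF one um[OF one]] by simp
  show "inverse a \<in> K" if "a \<in> K"
    using generate_field.m_inv[of a "ring_of_type_algebra" H] that z by (cases "a = 0") (simp_all add: K_def)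
qed

lemma point_field_eq:
  assumes "transc cst y" shows "point_field y = range (rf_eval cst y)"
proof -
  interpret transc cst y by (rule assms)
  let ?H = "insert y (range (\<lambda>c. to_ac (rf_const c)))"
  note cl = generate_field_closed[where H = ?H]
  have "point_field y \<subseteq> range (rf_eval cst y)"
    unfolding point_field_def
  proof (rule field.generate_field_min_subfield1[OF field_from_type_algebra _ ev.subfield_range])
    show "?H \<subseteq> range (rf_eval cst y)"
      using rf_eval_var rf_eval_const unfolding cst_def by (metis insert_subset rangeI image_subsetI)
  qed simp
  moreover have "rf_eval cst y \<phi> \<in> point_field y" for \<phi>
  proof -
    have "poly (map_poly cst p) y \<in> generate_field Omega ?H" for p
    proof (induction p)
      case (pCons a p)
      have "y \<in> generate_field Omega ?H" "cst a \<in> generate_field Omega ?H" using cl(2) by (auto simp: cst_def)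
      hence "cst a + y * poly (map_poly cst p) y \<in> generate_field Omega ?H" by (intro cl(3,4) pCons.IH)
      thus ?case unfolding cst.map_poly_hom_pCons by simp
    qed (use cl(8) in simp)
    thus ?thesis unfolding rf_eval_def point_field_def field_class.field_divide_inverse by (intro cl(4,7))
  qed
  ultimately show ?thesis by blast
qed

lemma (in fhom) combine_hom_list:
  "h (Om.combine cs us) = Om.combine (map h cs) (map h us)"
  by (induction cs us rule: Om.combine.induct) (simp_all add: hom_add hom_mult hom_zero)

lemma combine_replicate_zero: "Om.combine (replicate n 0) us = 0"
proof (induction n arbitrary: us)
  case (Suc n)
  thus ?case by (cases us) simp_all
qed simp

lemma combine_scale: "Om.combine (map ((*) a) cs) us = a * Om.combine cs us"
  by (induction cs us rule: Om.combine.induct) (simp_all add: algebra_simps)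

lemma combine_diff:
  "length cs = length us \<Longrightarrow> length ds = length us \<Longrightarrow>
    Om.combine (map2 (-) cs ds) us = Om.combine cs us - Om.combine ds us"
  by (induction us arbitrary: cs ds) (auto simp: length_Suc_conv algebra_simps)

text \<open>Galois descent: the coefficients of a relation whose conjugates are all relations can be normalised into the base field.\<close>

lemma independent_over_conjugate_relations:
  fixes us :: "'a :: field_char_0 poly fract alg_closure list"
  assumes "Om.independent (range to_ac) us" "length cs = length us"
    "\<And>\<delta>. \<delta> \<in> gal \<Longrightarrow> Om.combine (map \<delta> cs) us = 0"
  shows "set cs \<subseteq> {0}"
  using assms
proof (induction us arbitrary: cs rule: list.induct)
  case (Cons u us)
  from Cons.prems(1) have u: "u \<notin> Om.Span (range to_ac) us" and ind: "Om.independent (range to_ac) us"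
    by (auto elim: Om.independent.cases)
  obtain c ds where cs: "cs = c # ds" and l: "length ds = length us" using Cons.prems(2) by (cases cs) auto
  have rel: "\<delta> c * u + Om.combine (map \<delta> ds) us = 0" if "\<delta> \<in> gal" for \<delta>
    using Cons.prems(3)[OF that] by (simp add: cs)
  have "c = 0"
  proof (rule ccontr)
    assume c: "c \<noteq> 0"
    \<comment> \<open>Dividing by the leading coefficient makes it 1, a value that survives every
      conjugation.\<close>
    define es where "es = map ((*) (inverse c)) ds"
    have les: "length es = length us" by (simp add: es_def l)
    have nrel: "u + Om.combine (map \<delta> es) us = 0" if \<delta>: "\<delta> \<in> gal" for \<delta>
    proof -
      interpret fhom \<delta> by (rule gal_fhom[OF \<delta>])
      have "map \<delta> es = map ((*) (inverse (\<delta> c))) (map \<delta> ds)" by (simp add: es_def hom_mult hom_inverse)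
      hence "u + Om.combine (map \<delta> es) us = inverse (\<delta> c) * (\<delta> c * u + Om.combine (map \<delta> ds) us)"
        using c hom_eq_0[of c] by (simp add: combine_scale distrib_left del: map_map)
      thus ?thesis using rel[OF \<delta>] by simp
    qed
    \<comment> \<open>Subtracting a conjugate of the normalised relation cancels \<open>u\<close>.
      What is left relates the shorter list, so it is trivial by induction, and the coefficients are
      invariant.\<close>
    have fixd: "\<delta> e = e" if \<delta>: "\<delta> \<in> gal" and e: "e \<in> set es" for \<delta> e
    proof -
      have "set (map2 (-) (map \<delta> es) es) \<subseteq> {0}"
      proof (rule Cons.IH[OF ind])
        show "length (map2 (-) (map \<delta> es) es) = length us" by (simp add: les)
        fix \<epsilon> :: "'a poly fract alg_closure \<Rightarrow> _" assume \<epsilon>: "\<epsilon> \<in> gal"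
        interpret fhom \<epsilon> by (rule gal_fhom[OF \<epsilon>])
        have "map \<epsilon> (map2 (-) (map \<delta> es) es) = map2 (-) (map (\<lambda>x. \<epsilon> (\<delta> x)) es) (map \<epsilon> es)"
          by (simp add: hom_diff zip_map1 zip_map2 case_prod_beta comp_def zip_same_conv_map)
        thus "Om.combine (map \<epsilon> (map2 (-) (map \<delta> es) es)) us = 0"
          using nrel[OF gal_comp[OF \<epsilon> \<delta>]] nrel[OF \<epsilon>] les by (simp add: combine_diff add_eq_0_iff)
      qed
      thus ?thesis using e by (auto simp: zip_map1 zip_same_conv_map)
    qed
    have "set es \<subseteq> range to_ac" using fixed_in_base_field fixd by blast
    moreover have "u = Om.combine (map uminus es) us"
    proof -
      have "uminus = (*) (- 1 :: 'a poly fract alg_closure)" by (simp add: fun_eq_iff)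
      hence "Om.combine (map uminus es) us = - Om.combine es us" using combine_scale[of "- 1" es us] by simp
      moreover have "u = - Om.combine es us" using nrel[OF gal_id] by (simp add: eq_neg_iff_add_eq_0)
      ultimately show ?thesis by simp
    qed
    moreover have "set (map uminus es) \<subseteq> range to_ac" using calculation(1) by (auto simp flip: ac.hom_uminus)
    ultimately have "u \<in> Om.Span (range to_ac) us"
      unfolding Om.Span_eq_combine_set[OF ac.subfield_range subset_UNIV[of "set us", folded type_algebra_simps(1)]] by blast
    thus False using u by blast
  qed
  moreover have "set ds \<subseteq> {0}"
  proof (rule Cons.IH[OF ind l])
    fix \<delta> :: "'a poly fract alg_closure \<Rightarrow> _" assume \<delta>: "\<delta> \<in> gal"
    thus "Om.combine (map \<delta> ds) us = 0" using rel[OF \<delta>] \<open>c = 0\<close> by (simp add: fhom.hom_zero[OF gal_fhom])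
  qed
  ultimately show ?case by (simp add: cs)
qed simp

text \<open>Take a relation over \<open>k(y)\<close> between elements of \<open>k(x)\<close> and any
  \<open>\<delta>\<close>. An element \<open>\<gamma>\<close> of the stabiliser of \<open>y\<close>
  that agrees with the inverse of \<open>\<delta>\<close> at \<open>x\<close> makes
  \<open>\<delta> \<circ> \<gamma>\<close> fix \<open>k(x)\<close> while acting as
  \<open>\<delta>\<close> on \<open>k(y)\<close>. So conjugating the coefficients by
  \<open>\<delta>\<close> gives a relation again, and descent applies.\<close>

lemma transitive_stabiliser_linearly_disjoint:
  fixes x y :: "'a :: field_char_0 poly fract alg_closure"
  assumes x: "x \<in> fibre \<phi>" and y: "y \<in> fibre \<psi>"
    and trans: "\<And>x'. x' \<in> fibre \<phi> \<Longrightarrow> \<exists>\<gamma>\<in>gal. \<gamma> y = y \<and> \<gamma> x = x'"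
  shows "linearly_disjoint Omega base_field (point_field x) (point_field y)"
  unfolding linearly_disjoint_def base_field_def
proof (intro allI impI)
  interpret x: transc cst x by (rule fibre_transc[OF x])
  interpret y: transc cst y by (rule fibre_transc[OF y])
  fix us assume us: "set us \<subseteq> point_field x" and ind: "Om.independent (range to_ac) us"
  have sub: "subfield (point_field y) Omega"
    unfolding point_field_eq[OF y.transc_axioms] by (rule y.ev.subfield_range)
  show "Om.independent (point_field y) us"
  proof (rule Om.trivial_combine_imp_independent[OF sub])
    fix ks assume ks: "set ks \<subseteq> point_field y" and rel: "Om.combine ks us = \<zero>\<^bsub>ring_of_type_algebra\<^esub>"
    \<comment> \<open>\<open>combine\<close> stops at the end of the shorter list, so the
      coefficients are cut or padded with zeros to the length of \<open>us\<close>.\<close>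
    define cs where "cs = take (length us) ks @ replicate (length us - length ks) 0"
    have 1: "Om.combine ks us = Om.combine cs us"
    proof -
      have "Om.combine ks us = Om.combine (take (length us) ks @ replicate n 0) us" for n
      proof (induction ks us rule: Om.combine.induct)
      qed (simp_all add: combine_replicate_zero)
      thus ?thesis by (simp add: cs_def)
    qed
    have "set cs \<subseteq> {0}"
    proof (rule independent_over_conjugate_relations[OF ind])
      show "length cs = length us" by (simp add: cs_def)
      fix \<delta> :: "'a poly fract alg_closure \<Rightarrow> _" assume \<delta>: "\<delta> \<in> gal"
      obtain \<delta>' where \<delta>': "\<delta>' \<in> gal" "\<And>z. \<delta> (\<delta>' z) = z" using gal_inverse[OF \<delta>] by blast
      obtain \<gamma> where \<gamma>: "\<gamma> \<in> gal" "\<gamma> y = y" "\<gamma> x = \<delta>' x" using trans[OF gal_fibre[OF \<delta>'(1) x]] by blast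
      define \<epsilon> where "\<epsilon> = (\<lambda>z. \<delta> (\<gamma> z))"
      have \<epsilon>: "\<epsilon> \<in> gal" unfolding \<epsilon>_def by (rule gal_comp[OF \<delta> \<gamma>(1)])
      interpret fhom \<epsilon> by (rule gal_fhom[OF \<epsilon>])
      have "\<epsilon> u = u" if "u \<in> set us" for u
        using that us gal_eval[OF \<epsilon>] \<gamma>(3) \<delta>'(2) by (auto simp: point_field_eq[OF x.transc_axioms] \<epsilon>_def)
      hence eu: "map \<epsilon> us = us" by (simp add: map_idI)
      have "\<gamma> c = c" if "c \<in> set ks" for c
        using that ks gal_eval[OF \<gamma>(1)] \<gamma>(2) by (auto simp: point_field_eq[OF y.transc_axioms])
      hence "\<gamma> c = c" if "c \<in> set cs" for c
        using that fhom.hom_zero[OF gal_fhom[OF \<gamma>(1)]] by (auto simp: cs_def dest: in_set_takeD)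
      hence ec: "map \<epsilon> cs = map \<delta> cs" by (simp add: \<epsilon>_def)
      show "Om.combine (map \<delta> cs) us = 0"
        using combine_hom_list[of cs us] rel by (simp add: eu ec 1 hom_zero)
    qed
    thus "set (take (length us) ks) \<subseteq> {\<zero>\<^bsub>ring_of_type_algebra\<^esub>}" by (simp add: cs_def)
  qed simp
qed

section \<open>Monodromy groups\<close>

lemma gal_splitting_field:
  assumes \<gamma>: "\<gamma> \<in> gal" and z: "z \<in> splitting_field \<phi>" shows "\<gamma> z \<in> splitting_field \<phi>"
  using z unfolding splitting_field_def
proof (induction rule: generate_field.induct)
  interpret fhom \<gamma> by (rule gal_fhom[OF \<gamma>])
  note cl = generate_field_closed[where H = "base_field \<union> fibre \<phi>"]
  {
    case one show ?case using cl(1) by (simp add: hom_one)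
  next
    case (incl h)
    hence "\<gamma> h \<in> base_field \<union> fibre \<phi>"
      using gal_fibre[OF \<gamma>] gal_to_ac[OF \<gamma>] by (auto simp: base_field_def)
    thus ?case using cl(2) by blast
  next
    case (a_inv h) thus ?case using cl(5) by (simp add: hom_uminus)
  next
    case (m_inv h) thus ?case using cl(7) by (simp add: hom_inverse)
  next
    case (eng_add h1 h2) thus ?case using cl(3) by (simp add: hom_add)
  next
    case (eng_mult h1 h2) thus ?case using cl(4) by (simp add: hom_mult)
  }
qed

lemma gal_field_auts:
  assumes \<gamma>: "\<gamma> \<in> gal" shows "\<gamma> \<in> field_auts Omega base_field (splitting_field \<phi>)"
proof -
  interpret fhom \<gamma> by (rule gal_fhom[OF \<gamma>])
  obtain \<delta> where \<delta>: "\<delta> \<in> gal" "\<And>x. \<delta> (\<gamma> x) = x" "\<And>x. \<gamma> (\<delta> x) = x" using gal_inverse[OF \<gamma>] by blast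
  have "bij_betw \<gamma> (splitting_field \<phi>) (splitting_field \<phi>)"
    by (rule bij_betwI[where g = \<delta>]) (use \<delta> gal_splitting_field[OF \<gamma>] gal_splitting_field[OF \<delta>(1)] in auto)
  thus ?thesis using gal_splitting_field[OF \<gamma>] gal_to_ac[OF \<gamma>]
    by (auto simp: field_auts_def ring_iso_def ring_hom_def base_field_def hom_add hom_mult hom_one)
qed

text \<open>An automorphism of the splitting field is a partial homomorphism of the algebraic
  closure, over whose domain everything is algebraic; so it extends. Monodromy elements can
  therefore be handled as restrictions of elements of \<open>gal\<close>.\<close>

lemma field_auts_extend:
  assumes \<sigma>: "\<sigma> \<in> field_auts Omega base_field (splitting_field (\<phi> :: 'a :: field_char_0 poly fract))"
  shows "\<exists>\<gamma>\<in>gal. \<forall>x\<in>fibre \<phi>. \<gamma> x = \<sigma> x"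
proof -
  define L where "L = splitting_field \<phi>"
  note cl = generate_field_closed[where H = "base_field \<union> fibre \<phi>", folded splitting_field_def, folded L_def]
  have fixb: "\<sigma> (to_ac c) = to_ac c" and inL: "to_ac c \<in> L" for c :: "'a poly fract"
    using \<sigma> cl(2) by (auto simp: field_auts_def base_field_def)
  have s1: "\<sigma> 1 = 1" and s0: "\<sigma> 0 = 0" using fixb[of 1] fixb[of 0] by simp_all
  have add: "\<sigma> (a + b) = \<sigma> a + \<sigma> b" and mult: "\<sigma> (a * b) = \<sigma> a * \<sigma> b" if "a \<in> L" "b \<in> L" for a b
    using \<sigma> that by (auto simp: field_auts_def ring_iso_def ring_hom_def L_def)
  have diff: "\<sigma> (a - b) = \<sigma> a - \<sigma> b" if "a \<in> L" "b \<in> L" for a b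
    using add[OF cl(6)[OF that] that(2)] by simp
  have inv: "\<sigma> (inverse a) = inverse (\<sigma> a)" if "a \<in> L" for a
  proof (cases "a = 0")
    case False
    hence "\<sigma> a * \<sigma> (inverse a) = 1" using mult[OF that cl(7)[OF that]] s1 by simp
    thus ?thesis by (metis inverse_unique)
  qed (simp add: s0)
  define G where "G = (\<lambda>a. (a, \<sigma> a)) ` L"
  have G: "hom_graph G"
    unfolding hom_graph_def
  proof (intro conjI allI impI)
    show "(1, 1) \<in> G" using cl(1) s1 unfolding G_def by force
    fix a b c d assume "(a, b) \<in> G" "(c, d) \<in> G"
    hence ac: "a \<in> L" "c \<in> L" "b = \<sigma> a" "d = \<sigma> c" by (auto simp: G_def)
    show "(a - c, b - d) \<in> G" using cl(6)[OF ac(1,2)] diff[OF ac(1,2)] ac(3,4) by (auto simp: G_def)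
    show "(a * c, b * d) \<in> G" using cl(4)[OF ac(1,2)] mult[OF ac(1,2)] ac(3,4) by (auto simp: G_def)
  next
    fix a b assume "(a, b) \<in> G"
    hence a: "a \<in> L" "b = \<sigma> a" by (auto simp: G_def)
    show "(inverse a, inverse b) \<in> G" using cl(7)[OF a(1)] inv[OF a(1)] a(2) by (auto simp: G_def)
  qed (auto simp: G_def s0)
  have "\<exists>h. fhom h \<and> (\<forall>a b. (a, b) \<in> G \<longrightarrow> h a = b)"
  proof (rule hom_graph_extension[OF G])
    fix z
    obtain p :: "'a poly fract poly" where p: "p \<noteq> 0" "poly (map_poly to_ac p) z = 0" by (rule alg_closure_algebraic)
    have "(map_poly to_ac p, map_poly to_ac p) \<in> poly_pairs G"
      unfolding poly_pairs_def G_def using inL fixb by (auto simp: ac.coeff_map image_iff intro!: bexI[of _ "to_ac _"])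
    thus "\<exists>p q. (p, q) \<in> poly_pairs G \<and> p \<noteq> 0 \<and> poly p z = 0"
      using p ac.map_poly_hom_eq_0 by blast
  qed
  then obtain h where h: "fhom h" "\<And>a. a \<in> L \<Longrightarrow> h a = \<sigma> a" by (auto simp: G_def)
  hence "h \<in> gal" using fixb inL by (simp add: gal_def)
  moreover have "h x = \<sigma> x" if "x \<in> fibre \<phi>" for x using that cl(2) h(2) by blast
  ultimately show ?thesis by blast
qed

lemma carrier_Mon: "carrier (Mon \<phi>) = (\<lambda>\<gamma>. restrict \<gamma> (fibre \<phi>)) ` gal"
proof (rule equalityI; rule subsetI)
  fix s assume "s \<in> carrier (Mon \<phi>)"
  then obtain \<sigma> where \<sigma>: "\<sigma> \<in> field_auts Omega base_field (splitting_field \<phi>)" "s = restrict \<sigma> (fibre \<phi>)"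
    by (auto simp: Mon_def)
  obtain \<gamma> where "\<gamma> \<in> gal" "\<forall>x\<in>fibre \<phi>. \<gamma> x = \<sigma> x" using field_auts_extend[OF \<sigma>(1)] by blast
  moreover from this have "s = restrict \<gamma> (fibre \<phi>)" unfolding \<sigma>(2) by (intro restrict_ext) simp
  ultimately show "s \<in> (\<lambda>\<gamma>. restrict \<gamma> (fibre \<phi>)) ` gal" by blast
next
  fix s assume "s \<in> (\<lambda>\<gamma>. restrict \<gamma> (fibre \<phi>)) ` gal"
  thus "s \<in> carrier (Mon \<phi>)" using gal_field_auts by (auto simp: Mon_def)
qed

lemma gal_restrict_Bij:
  assumes "\<gamma> \<in> gal" shows "restrict \<gamma> (fibre \<phi>) \<in> Bij (fibre \<phi>)"
proof -
  obtain \<delta> where \<delta>: "\<delta> \<in> gal" "\<And>x. \<delta> (\<gamma> x) = x" "\<And>x. \<gamma> (\<delta> x) = x" using gal_inverse[OF assms] by blast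
  have "bij_betw \<gamma> (fibre \<phi>) (fibre \<phi>)"
    by (rule bij_betwI[where g = \<delta>]) (use \<delta> gal_fibre[OF assms] gal_fibre[OF \<delta>(1)] in auto)
  thus ?thesis by (simp add: Bij_def bij_betw_restrict_eq)
qed

lemma mult_Mon:
  assumes "\<gamma> \<in> gal" "\<delta> \<in> gal"
  shows "restrict \<gamma> (fibre \<phi>) \<otimes>\<^bsub>Mon \<phi>\<^esub> restrict \<delta> (fibre \<phi>) = restrict (\<lambda>x. \<gamma> (\<delta> x)) (fibre \<phi>)"
  using gal_restrict_Bij[OF assms(1), of \<phi>] gal_restrict_Bij[OF assms(2), of \<phi>] gal_fibre[OF assms(2)]
  by (auto simp: Mon_def BijGroup_def compose_def fun_eq_iff)

lemma one_Mon: "\<one>\<^bsub>Mon \<phi>\<^esub> = restrict (\<lambda>x. x) (fibre \<phi>)"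
  by (simp add: Mon_def BijGroup_def)

lemma group_Mon: "group (Mon (\<phi> :: 'a :: field_char_0 poly fract))"
proof (rule groupI)
  note c = carrier_Mon[of \<phi>]
  show "x \<otimes>\<^bsub>Mon \<phi>\<^esub> y \<in> carrier (Mon \<phi>)" if "x \<in> carrier (Mon \<phi>)" "y \<in> carrier (Mon \<phi>)" for x y
    using that unfolding c by (elim imageE) (simp add: mult_Mon, rule imageI, rule gal_comp)
  show "\<one>\<^bsub>Mon \<phi>\<^esub> \<in> carrier (Mon \<phi>)" unfolding c one_Mon using gal_id by blast
  show "x \<otimes>\<^bsub>Mon \<phi>\<^esub> y \<otimes>\<^bsub>Mon \<phi>\<^esub> z = x \<otimes>\<^bsub>Mon \<phi>\<^esub> (y \<otimes>\<^bsub>Mon \<phi>\<^esub> z)"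
    if "x \<in> carrier (Mon \<phi>)" "y \<in> carrier (Mon \<phi>)" "z \<in> carrier (Mon \<phi>)" for x y z
    using that by (auto simp: c mult_Mon gal_comp)
  show "\<one>\<^bsub>Mon \<phi>\<^esub> \<otimes>\<^bsub>Mon \<phi>\<^esub> x = x" if "x \<in> carrier (Mon \<phi>)" for x
    using that by (auto simp: c one_Mon mult_Mon gal_id)
  fix x assume "x \<in> carrier (Mon \<phi>)"
  then obtain \<gamma> where \<gamma>: "\<gamma> \<in> gal" "x = restrict \<gamma> (fibre \<phi>)" by (auto simp: c)
  obtain \<delta> where "\<delta> \<in> gal" "\<And>x. \<delta> (\<gamma> x) = x" using gal_inverse[OF \<gamma>(1)] by blast
  thus "\<exists>y\<in>carrier (Mon \<phi>). y \<otimes>\<^bsub>Mon \<phi>\<^esub> x = \<one>\<^bsub>Mon \<phi>\<^esub>"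
    using \<gamma> by (intro bexI[of _ "restrict \<delta> (fibre \<phi>)"]) (auto simp: c one_Mon mult_Mon)
qed

lemma inv_Mon:
  assumes "\<gamma> \<in> gal" "\<delta> \<in> gal" "\<And>x. \<delta> (\<gamma> x) = x"
  shows "inv\<^bsub>Mon \<phi>\<^esub> (restrict \<gamma> (fibre \<phi>)) = restrict \<delta> (fibre \<phi>)"
  using assms by (intro group.inv_equality[OF group_Mon]) (auto simp: carrier_Mon mult_Mon one_Mon)

lemma gal_funpow: "\<gamma> \<in> gal \<Longrightarrow> \<gamma> ^^ i \<in> gal"
  using gal_id gal_comp by (induction i) (auto simp: id_def comp_def)

lemma pow_Mon:
  assumes "\<gamma> \<in> gal"
  shows "restrict \<gamma> (fibre \<phi>) [^]\<^bsub>Mon \<phi>\<^esub> (i :: nat) = restrict (\<gamma> ^^ i) (fibre \<phi>)"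
proof (induction i)
  case (Suc i)
  have "restrict \<gamma> (fibre \<phi>) [^]\<^bsub>Mon \<phi>\<^esub> Suc i = restrict (\<gamma> ^^ i) (fibre \<phi>) \<otimes>\<^bsub>Mon \<phi>\<^esub> restrict \<gamma> (fibre \<phi>)"
    by (simp only: monoid.nat_pow_Suc[OF group.axioms(1)[OF group_Mon]] Suc.IH)
  also have "\<dots> = restrict (\<gamma> ^^ Suc i) (fibre \<phi>)"
    by (simp only: mult_Mon[OF gal_funpow[OF assms, of i] assms, of \<phi>] funpow_Suc_right comp_def)
  finally show ?case .
qed (simp add: monoid.nat_pow_0[OF group.axioms(1)[OF group_Mon]] one_Mon id_def)

lemma finite_Mon:
  fixes \<phi> :: "'a :: field_char_0 poly fract"
  assumes "finite (fibre \<phi>)" shows "finite (carrier (Mon \<phi>))"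
proof (rule finite_subset)
  show "carrier (Mon \<phi>) \<subseteq> (fibre \<phi>) \<rightarrow>\<^sub>E (fibre \<phi>)"
    unfolding carrier_Mon using gal_fibre by auto
qed (use assms in \<open>auto intro: finite_PiE\<close>)

text \<open>A subgroup of the monodromy group is given by a condition on automorphisms of the whole
  algebraic closure; a permutation belongs to it when some extension satisfies the
  condition.\<close>

lemma subgroup_Mon:
  assumes "\<And>\<gamma>. P \<gamma> \<Longrightarrow> \<gamma> \<in> gal" "P (\<lambda>x. x)" "\<And>\<gamma> \<delta>. P \<gamma> \<Longrightarrow> P \<delta> \<Longrightarrow> P (\<lambda>x. \<gamma> (\<delta> x))"
    and inverse: "\<And>\<gamma> \<delta>. P \<gamma> \<Longrightarrow> \<delta> \<in> gal \<Longrightarrow> (\<And>x. \<delta> (\<gamma> x) = x) \<Longrightarrow> P \<delta>"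
  shows "subgroup ((\<lambda>\<gamma>. restrict \<gamma> (fibre \<phi>)) ` {\<gamma>. P \<gamma>}) (Mon \<phi>)"
proof (rule group.subgroupI[OF group_Mon])
  show "(\<lambda>\<gamma>. restrict \<gamma> (fibre \<phi>)) ` {\<gamma>. P \<gamma>} \<subseteq> carrier (Mon \<phi>)" using assms(1) by (auto simp: carrier_Mon)
  show "(\<lambda>\<gamma>. restrict \<gamma> (fibre \<phi>)) ` {\<gamma>. P \<gamma>} \<noteq> {}" using assms(2) by blast
next
  fix a assume "a \<in> (\<lambda>\<gamma>. restrict \<gamma> (fibre \<phi>)) ` {\<gamma>. P \<gamma>}"
  then obtain \<gamma> where \<gamma>: "P \<gamma>" "a = restrict \<gamma> (fibre \<phi>)" by blast
  obtain \<delta> where \<delta>: "\<delta> \<in> gal" "\<And>x. \<delta> (\<gamma> x) = x" using gal_inverse[OF assms(1)[OF \<gamma>(1)]] by blast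
  show "inv\<^bsub>Mon \<phi>\<^esub> a \<in> (\<lambda>\<gamma>. restrict \<gamma> (fibre \<phi>)) ` {\<gamma>. P \<gamma>}"
    unfolding \<gamma>(2) inv_Mon[OF assms(1)[OF \<gamma>(1)] \<delta>] using inverse[OF \<gamma>(1) \<delta>] by blast
next
  fix a b assume "a \<in> (\<lambda>\<gamma>. restrict \<gamma> (fibre \<phi>)) ` {\<gamma>. P \<gamma>}" "b \<in> (\<lambda>\<gamma>. restrict \<gamma> (fibre \<phi>)) ` {\<gamma>. P \<gamma>}"
  thus "a \<otimes>\<^bsub>Mon \<phi>\<^esub> b \<in> (\<lambda>\<gamma>. restrict \<gamma> (fibre \<phi>)) ` {\<gamma>. P \<gamma>}"
    using assms(1,3) by (auto simp: mult_Mon)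
qed

section \<open>Blocks and decompositions\<close>

lemma exists_irreducible_divisor:
  fixes p :: "'a :: field poly"
  assumes "degree p > 0" shows "\<exists>r. irreducible r \<and> r dvd p"
proof -
  obtain r where r: "degree r > 0 \<and> r dvd p" and min: "\<And>s. degree s > 0 \<and> s dvd p \<Longrightarrow> degree r \<le> degree s"
    using ex_has_least_nat[of "\<lambda>r. degree r > 0 \<and> r dvd p" p degree] assms by auto
  have "irreducible r"
  proof (rule Factorial_Ring.irreducibleI)
    show r0: "r \<noteq> 0" using r by auto
    show "\<not> is_unit r" using r r0 by (simp add: is_unit_iff_degree)
    fix a b assume ab: "r = a * b"
    hence nz: "a \<noteq> 0" "b \<noteq> 0" using r0 by auto
    have "degree r = degree a + degree b" unfolding ab using nz by (rule degree_mult_eq)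
    moreover have "degree r \<le> degree a" if "degree a > 0" using min[of a] that r ab by (auto dest: dvd_mult_left)
    moreover have "degree r \<le> degree b" if "degree b > 0" using min[of b] that r ab by (auto dest: dvd_mult_right)
    ultimately have "degree a = 0 \<or> degree b = 0" by linarith
    thus "is_unit a \<or> is_unit b" using nz by (simp add: is_unit_iff_degree)
  qed
  thus ?thesis using r by blast
qed

lemma clear_denominators:
  fixes P :: "'a :: idom fract poly"
  shows "\<exists>a A. a \<noteq> 0 \<and> smult (to_fract a) P = fract_poly A"
proof (induction P)
  case 0
  show ?case by (rule exI[of _ 1], rule exI[of _ 0]) simp
next
  case (pCons c P)
  then obtain a A where a: "a \<noteq> 0" "smult (to_fract a) P = fract_poly A" by blast
  obtain p q where c: "c = Fract p q" "q \<noteq> 0" by (cases c)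
  have e: "smult (to_fract (a * q)) P = fract_poly (smult q A)"
  proof -
    have "smult (to_fract (a * q)) P = smult (to_fract q) (smult (to_fract a) P)" by (simp add: mult.commute)
    thus ?thesis by (simp add: a(2))
  qed
  have "to_fract (a * q) * c = to_fract (a * p)"
    unfolding c(1) using c(2) by (simp add: to_fract_def eq_fract)
  hence "smult (to_fract (a * q)) (pCons c P) = fract_poly (pCons (a * p) (smult q A))"
    using e by (simp add: map_poly_pCons del: to_fract_mult)
  thus ?case using a(1) c(2) by (intro exI[of _ "a * q"] exI) auto
qed

text \<open>Because \<open>P\<close> is monic, the denominator \<open>a\<close> itself occurs among
  the coefficients of \<open>A\<close>. A factor \<open>r\<close> of \<open>A\<close> thus divides
  \<open>a\<close> and can be cancelled.\<close>

lemma clear_denominators_reduce: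
  fixes P :: "'a :: field poly fract poly"
  assumes "lead_coeff P = 1" "a \<noteq> 0" "smult (to_fract a) P = fract_poly A" "degree r > 0" "[:r:] dvd A"
  shows "\<exists>a' A'. a' \<noteq> 0 \<and> smult (to_fract a') P = fract_poly A' \<and> degree a' < degree a"
proof -
  obtain A' where A': "A = smult r A'" using assms(5) by (auto elim: dvdE)
  have "to_fract (coeff A (degree P)) = to_fract a"
    using arg_cong[OF assms(3), of "\<lambda>p. coeff p (degree P)"] assms(1) by (simp add: coeff_map_poly)
  hence a: "a = r * coeff A' (degree P)" by (simp add: A' del: to_fract_mult)
  define a' where "a' = coeff A' (degree P)"
  have nz: "a' \<noteq> 0" "r \<noteq> 0" using assms(2) a by (auto simp: a'_def)
  have "smult (to_fract r) (smult (to_fract a') P) = smult (to_fract r) (fract_poly A')"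
    using assms(3) by (simp add: A' a a'_def)
  hence "smult (to_fract a') P = fract_poly A'" using nz by (metis smult_eq_iff to_fract_eq_0_iff)
  moreover have "degree a' < degree a" unfolding a a'_def[symmetric] using nz assms(4) by (simp add: degree_mult_eq)
  ultimately show ?thesis using nz by blast
qed

text \<open>Take denominators of \<open>P\<close> and \<open>R\<close> of least degree. An
  irreducible factor \<open>r\<close> of their product divides \<open>A * B\<close>, hence
  \<open>A\<close> or \<open>B\<close> since \<open>[:r:]\<close> is prime, and could be cancelled.
  So both denominators are constants.\<close>

lemma monic_factor_polynomial_coeffs:
  fixes P R :: "'a :: field poly fract poly"
  assumes PR: "P * R = fract_poly q" and monic: "lead_coeff P = 1" "lead_coeff R = 1"
  shows "\<exists>p. P = fract_poly p"
proof -
  define C where "C P a \<longleftrightarrow> a \<noteq> 0 \<and> (\<exists>A. smult (to_fract a) P = fract_poly A)" for P and a :: "'a poly"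
  have "\<exists>a. C P a \<and> (\<forall>b. C P b \<longrightarrow> degree a \<le> degree b)" for P
    using clear_denominators[of P] ex_has_least_nat[of "C P" _ degree] unfolding C_def by blast
  then obtain m where m: "\<And>P. C P (m P)" and min: "\<And>P b. C P b \<Longrightarrow> degree (m P) \<le> degree b" by metis
  obtain A where A: "smult (to_fract (m P)) P = fract_poly A" using m unfolding C_def by blast
  obtain B where B: "smult (to_fract (m R)) R = fract_poly B" using m unfolding C_def by blast
  have nz: "m P \<noteq> 0" "m R \<noteq> 0" using m unfolding C_def by blast+
  have "fract_poly (A * B) = fract_poly (smult (m P * m R) q)"
    by (simp add: A[symmetric] B[symmetric] PR[symmetric] mult_ac)
  hence AB: "A * B = smult (m P * m R) q" by (simp only: fract_poly_eq_iff)
  have "degree (m P * m R) = 0"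
  proof (rule ccontr)
    assume "degree (m P * m R) \<noteq> 0"
    then obtain r where r: "irreducible r" "r dvd m P * m R" using exists_irreducible_divisor by blast
    have dr: "degree r > 0" using r(1) by (auto simp: Factorial_Ring.irreducible_def is_unit_iff_degree)
    have "prime_elem [:r:]" by (rule lift_prime_elem_poly[OF field_poly_irreducible_imp_prime[OF r(1)]])
    moreover have "[:r:] dvd A * B"
    proof -
      obtain s where s: "m P * m R = r * s" using r(2) by (rule dvdE)
      have "A * B = [:r:] * smult s q" unfolding AB s by (simp add: mult.commute)
      thus ?thesis by (rule dvdI)
    qed
    ultimately have "[:r:] dvd A \<or> [:r:] dvd B" by (metis prime_elem_dvd_mult_iff)
    thus False
    proof
      assume "[:r:] dvd A"
      thus False using clear_denominators_reduce[OF monic(1) nz(1) A dr] min[of P] unfolding C_def by fastforce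
    next
      assume "[:r:] dvd B"
      thus False using clear_denominators_reduce[OF monic(2) nz(2) B dr] min[of R] unfolding C_def by fastforce
    qed
  qed
  hence "degree (m P) = 0" using nz by (simp add: degree_mult_eq)
  then obtain c where c: "m P = [:c:]" by (rule degree_eq_zeroE)
  have "P = smult (to_fract [:inverse c:]) (smult (to_fract [:c:]) P)"
    using nz c by (simp flip: to_fract_mult add: one_pCons[symmetric])
  also have "\<dots> = fract_poly (smult [:inverse c:] A)" using A by (simp add: c)
  finally show ?thesis by blast
qed

section \<open>Polynomials attached to blocks\<close>

lemma base_expansion:
  fixes f u :: "'a :: field poly"
  assumes "degree u > 0"
  shows "\<exists>r m. (\<forall>i. degree (r i) < degree u) \<and> f = (\<Sum>i<m. r i * u ^ i)"
proof (induction "degree f" arbitrary: f rule: less_induct)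
  case less
  show ?case
  proof (cases "degree f < degree u")
    case True
    show ?thesis
      by (rule exI[of _ "\<lambda>i. if i = 0 then f else 0"], rule exI[of _ 1]) (use True assms in auto)
  next
    case False
    have u0: "u \<noteq> 0" using assms by auto
    have "degree (f div u) < degree f"
    proof (cases "f div u = 0")
      case nz: False
      have "degree u + degree (f div u) = degree (f - f mod u)"
        using degree_mult_eq[OF u0 nz] by (simp add: minus_mod_eq_mult_div)
      also have "\<dots> \<le> degree f" by (rule degree_diff_le) (auto intro: degree_mod_less' less_imp_le simp: mod_eq_0_iff_dvd, use degree_mod_less[OF u0, of f] False in auto)
      finally show ?thesis using assms by simp
    qed (use False assms in simp)
    then obtain r m where r: "\<And>i. degree (r i) < degree u" "f div u = (\<Sum>i<m. r i * u ^ i)" using less by metis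
    define s where "s = case_nat (f mod u) r"
    have "degree (f mod u) < degree u" using degree_mod_less[OF u0, of f] assms by auto
    hence "degree (s i) < degree u" for i using r(1) by (simp add: s_def split: nat.split)
    moreover have "f = (\<Sum>i<Suc m. s i * u ^ i)"
    proof -
      have "(\<Sum>i<Suc m. s i * u ^ i) = f mod u + u * (\<Sum>i<m. r i * u ^ i)"
        by (simp add: sum.lessThan_Suc_shift s_def sum_distrib_left mult_ac del: sum.lessThan_Suc)
      also have "\<dots> = f" unfolding r(2)[symmetric] by simp
      finally show ?thesis by simp
    qed
    ultimately show ?thesis by blast
  qed
qed

lemma (in fhom) map_poly_lift:
  assumes "\<And>i. coeff p i \<in> range h" shows "\<exists>q. map_poly h q = p"
  using assms
proof (induction p)
  case (pCons c p)
  have "coeff p i \<in> range h" for i using pCons.prems[of "Suc i"] by simp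
  then obtain q where "map_poly h q = p" using pCons.IH by blast
  moreover obtain d where "c = h d" using pCons.prems[of 0] by auto
  ultimately have "map_poly h (pCons d q) = pCons c p" by (simp add: map_poly_hom_pCons)
  thus ?case by blast
qed (auto intro: exI[of _ 0])

lemma (in fhom) map_poly_prod_linear:
  assumes "finite A" shows "map_poly h (\<Prod>a\<in>A. [:- a, 1:]) = (\<Prod>a\<in>h ` A. [:- a, 1:])"
proof -
  have "map_poly h (\<Prod>a\<in>A. [:- a, 1:]) = (\<Prod>a\<in>A. [:- h a, 1:])"
    using assms by (induction A) (simp_all add: map_poly_hom_one map_poly_hom_mult map_poly_hom_pCons hom_uminus hom_one
      del: mult_pCons_left mult_pCons_right)
  also have "\<dots> = (\<Prod>a\<in>h ` A. [:- a, 1:])" by (subst prod.reindex) (auto intro: inj_on_subset[OF inj])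
  finally show ?thesis .
qed

lemma rf_degree_to_fract: "rf_degree (to_fract f) = degree f"
  by (simp add: rf_degree_def rf_num_den_to_fract)

lemma polynomial_branches:
  fixes f :: "'a :: field_char_0 poly"
    and \<iota> :: "'a poly fract alg_closure \<Rightarrow> 'a alg_closure fls alg_closure"
  assumes f: "degree f > 0" and N: "N > 0" "\<And>e. 0 < e \<Longrightarrow> e \<le> degree f \<Longrightarrow> e dvd N"
    and \<zeta>: "\<And>i. \<zeta> ^ i = 1 \<longleftrightarrow> N dvd i"
    and \<iota>: "fhom \<iota>" "\<And>\<phi>. \<iota> (to_ac \<phi>) = rf_eval eL (tL N) \<phi>"
  shows "\<exists>Y. (\<forall>i. Y (i + degree f) = Y i \<and> scl \<zeta> (Y i) = Y (Suc i) \<and> fls_subdegree (Y i) = - int (N div degree f)) \<and>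
    (\<forall>x\<in>fibre (to_fract f). \<exists>i. \<iota> x = to_ac (Y i)) \<and> card (fibre (to_fract f)) = degree f"
proof -
  have pole: "rf_map (to_fract f) pt = None \<longleftrightarrow> pt = None" for pt
    using f by (cases pt) (simp_all add: rf_num_den_to_fract Let_def ac.map_poly_hom_one)
  have dv: "e dvd N" if "0 < e" "e \<le> rf_degree (to_fract f)" for e using N(2) that by (simp add: rf_degree_to_fract)
  show ?thesis
  proof (rule fibre_branches[of N "to_fract f" \<zeta> \<iota>, THEN exE], goal_cases)
    case (6 Y)
    thus ?case
    proof (elim exE, goal_cases)
      case (1 e)
      thus ?case using f unfolding pole rf_degree_to_fract rf_num_den_to_fract by (intro exI[of _ "Y None"]) auto
    qed
  qed (rule N(1) dv \<zeta> \<iota>; assumption?)+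
qed

lemma pcompose_power: "pcompose (p ^ n) q = pcompose p q ^ n"
  by (induction n) (simp_all add: pcompose_1 pcompose_mult)

lemma lead_coeff_prod_linear: "lead_coeff (\<Prod>a\<in>A. [:- a, 1:] :: 'a :: field poly) = 1"
  by (induction A rule: infinite_finite_induct) (simp_all add: lead_coeff_mult del: mult_pCons_left)

lemma degree_prod_linear: "finite A \<Longrightarrow> degree (\<Prod>a\<in>A. [:- a, 1:] :: 'a :: field poly) = card A"
  by (subst degree_prod_eq_sum_degree) auto

lemma (in transc) transc_poly:
  assumes "degree u > 0" "poly (map_poly e p) (poly (map_poly e u) x) = 0" shows "p = 0"
proof -
  have "poly (map_poly e (pcompose p u)) x = 0" using assms(2) by (simp add: map_poly_hom_pcompose poly_pcompose)
  hence "pcompose p u = 0" by (rule transc)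
  thus ?thesis using assms(1) by (rule pcompose_eq_0)
qed

text \<open>The product of \<open>X - a\<close> over \<open>B\<close> has coefficients in
  \<open>k(x)\<close>, because the stabiliser of \<open>x\<close> permutes \<open>B\<close>, and it
  is a factor of \<open>(f(X) - f(x)) / l\<close>, where \<open>l\<close> is the leading coefficient
  of \<open>f\<close>. The latter is monic with coefficients in \<open>k[x]\<close>, so the factor
  has coefficients in \<open>k[x]\<close> as well; \<open>u\<close> is its constant
  coefficient.\<close>

lemma block_polynomial:
  fixes f :: "'a :: field_char_0 poly"
  assumes f: "degree f > 0" and B: "B \<subseteq> fibre (to_fract f)" and x: "x \<in> fibre (to_fract f)"
    and stab: "\<And>\<gamma>. \<gamma> \<in> gal \<Longrightarrow> \<gamma> x = x \<Longrightarrow> \<gamma> ` B = B"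
  shows "\<exists>u. degree u = card B \<and> poly (map_poly cst u) x = (\<Prod>a\<in>B. - a)"
proof -
  define F where "F = fibre (to_fract f)"
  define n where "n = degree f"
  obtain \<zeta> :: "'a alg_closure" where \<zeta>: "\<And>i. \<zeta> ^ i = 1 \<longleftrightarrow> fact n dvd i" using primitive_root_exists[of "fact n"] by auto
  obtain \<iota> :: "'a poly fract alg_closure \<Rightarrow> 'a alg_closure fls alg_closure"
    where \<iota>: "fhom \<iota>" "\<And>\<phi>. \<iota> (to_ac \<phi>) = rf_eval eL (tL (fact n)) \<phi>" using exists_Laurent_embedding[of "fact n"] by auto
  interpret \<iota>: fhom \<iota> by (rule \<iota>(1))
  define m where "m = int (fact n div n)"
  obtain Y :: "nat \<Rightarrow> 'a alg_closure fls"
    where Y: "\<forall>i. fls_subdegree (Y i) = - m" "\<forall>x\<in>F. \<exists>i. \<iota> x = to_ac (Y i)" and cF: "card F = n"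
  proof -
    obtain Y where Y: "\<forall>i. Y (i + degree f) = Y i \<and> scl \<zeta> (Y i) = Y (Suc i) \<and> fls_subdegree (Y i) = - int (fact n div degree f)"
      "\<forall>x\<in>fibre (to_fract f). \<exists>i. \<iota> x = to_ac (Y i)" "card (fibre (to_fract f)) = degree f"
      using polynomial_branches[OF f _ _ \<zeta> \<iota>] by (auto simp: n_def dvd_fact)
    show ?thesis by (rule that[of Y]) (use Y in \<open>auto simp: F_def n_def m_def\<close>)
  qed
  have n0: "n > 0" using f by (simp add: n_def)
  have "n \<le> fact n" by (rule fact_ge_self)
  hence m0: "m > 0" using n0 by (simp add: m_def div_greater_zero_iff)
  have fF: "finite F" using cF n0 by (metis card_ge_0_finite)
  have fO: "finite B" using B fF F_def finite_subset by metis
  have "\<forall>a\<in>F. \<exists>v. \<iota> a = to_ac v \<and> fls_subdegree v = - m" using Y by blast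
  then obtain w where "\<forall>a\<in>F. \<iota> a = to_ac (w a) \<and> fls_subdegree (w a) = - m" by (rule bchoice[THEN exE])
  hence w: "\<And>a. a \<in> F \<Longrightarrow> \<iota> a = to_ac (w a)" "\<And>a. a \<in> F \<Longrightarrow> fls_subdegree (w a) = - m" by blast+
  interpret x: transc cst x by (rule fibre_transc[OF x])
  define P where "P A = (\<Prod>a\<in>A. [:- a, 1:])" for A :: "'a poly fract alg_closure set"
  have lift: "\<exists>p. map_poly (rf_eval cst x) p = P A" if A: "A \<subseteq> F" "\<And>\<gamma>. \<gamma> \<in> gal \<Longrightarrow> \<gamma> x = x \<Longrightarrow> \<gamma> ` A = A" for A
  proof (rule x.ev.map_poly_lift, rule fixed_in_point_field[OF x])
    fix i \<gamma> assume \<gamma>: "\<gamma> \<in> gal" "\<gamma> x = x"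
    interpret \<gamma>: fhom \<gamma> by (rule gal_fhom[OF \<gamma>(1)])
    have "map_poly \<gamma> (P A) = P A"
      unfolding P_def using \<gamma>.map_poly_prod_linear[of A] finite_subset[OF A(1) fF] A(2)[OF \<gamma>] by simp
    thus "\<gamma> (coeff (P A) i) = coeff (P A) i" by (metis \<gamma>.coeff_map)
  qed
  have stabF: "\<gamma> ` F = F" if "\<gamma> \<in> gal" for \<gamma>
    by (rule endo_inj_surj[OF fF]) (use gal_fibre[OF that] inj_on_subset[OF bij_is_inj[OF gal_bij[OF that]]] in \<open>auto simp: F_def\<close>)
  have stab': "\<gamma> ` (F - B) = F - B" if "\<gamma> \<in> gal" "\<gamma> x = x" for \<gamma>
    using image_set_diff[OF bij_is_inj[OF gal_bij[OF that(1)]], of F B] stabF[OF that(1)] stab[OF that] by simp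
  obtain p where p: "map_poly (rf_eval cst x) p = P B" using lift[of B] B stab F_def by blast
  obtain r where r: "map_poly (rf_eval cst x) r = P (F - B)" using lift[of "F - B"] stab' by blast
  define l where "l = lead_coeff f"
  have l0: "l \<noteq> 0" using f by (auto simp: l_def)
  have PF: "smult (cst l) (P F) = map_poly cst f - [:tt:]"
  proof (rule poly_eqI_degree_lead_coeff[where A = F and n = n])
    have "coeff (P F) n = 1" using lead_coeff_prod_linear[of F] degree_prod_linear[OF fF] cF by (simp add: P_def)
    thus "coeff (smult (cst l) (P F)) n = coeff (map_poly cst f - [:tt:]) n"
      using n0 by (simp add: cst.coeff_map l_def n_def coeff_pCons split: nat.split)
    show "degree (smult (cst l) (P F)) \<le> n" using degree_prod_linear[OF fF] cF by (simp add: P_def degree_smult_le)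
    show "degree (map_poly cst f - [:tt:]) \<le> n" by (rule degree_diff_le) (simp_all add: cst.degree_map_hom n_def)
    show "poly (smult (cst l) (P F)) z = poly (map_poly cst f - [:tt:]) z" if "z \<in> F" for z
      using that fF by (auto simp: P_def poly_prod F_def fibre_to_fract intro!: prod_zero)
  qed (simp add: cF)
  have fx: "rf_eval cst x (to_fract f) = tt" by (rule fibre_eval[OF x])
  \<comment> \<open>A polynomial in \<open>X\<close> over \<open>k[T]\<close>. Evaluating
    \<open>T\<close> at \<open>x\<close> sends the coefficient \<open>f\<close> to
    \<open>f(x) = t\<close>.\<close>
  define q where "q = smult [:inverse l:] (map_poly (\<lambda>c. [:c:]) f - [:f:])"
  have "P F = P (F - B) * P B" unfolding P_def by (rule prod.subset_diff) (use B fF F_def in auto)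
  hence "map_poly (rf_eval cst x) (r * p) = P F" by (simp add: x.ev.map_poly_hom_mult p r)
  also have "P F = smult (cst (inverse l)) (smult (cst l) (P F))" using l0 by (simp flip: cst.hom_mult) (simp add: cst.hom_one)
  also have "\<dots> = map_poly (rf_eval cst x) (fract_poly q)"
  proof -
    have "map_poly (rf_eval cst x) (fract_poly (map_poly (\<lambda>c. [:c:]) f)) = map_poly cst f"
      by (simp add: poly_eq_iff x.ev.coeff_map coeff_map_poly cst.coeff_map x.rf_eval_const[unfolded rf_const_def])
    moreover have "map_poly (rf_eval cst x) (fract_poly [:f:]) = [:tt:]"
      by (simp add: map_poly_pCons x.ev.map_poly_hom_pCons fx)
    moreover have "rf_eval cst x (to_fract [:inverse l:]) = cst (inverse l)" using x.rf_eval_const by (simp add: rf_const_def)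
    ultimately show ?thesis unfolding PF q_def
      by (simp only: fract_poly_smult fract_poly_diff x.ev.map_poly_hom_smult x.ev.map_poly_hom_diff)
  qed
  finally have pr: "p * r = fract_poly q" by (simp only: x.ev.map_poly_hom_eq mult.commute[of r])
  have monic: "lead_coeff s = 1" if "map_poly (rf_eval cst x) s = P A" for s A
  proof -
    have "rf_eval cst x (lead_coeff s) = lead_coeff (P A)" unfolding that[symmetric] by (simp add: x.ev.coeff_map x.ev.degree_map_hom)
    hence "rf_eval cst x (lead_coeff s) = rf_eval cst x 1" by (simp add: P_def lead_coeff_prod_linear x.ev.hom_one)
    thus ?thesis by (simp only: x.ev.hom_eq)
  qed
  obtain p' where p': "p = fract_poly p'"
    using monic_factor_polynomial_coeffs[OF pr monic[OF p] monic[OF r]] by blast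
  define u where "u = coeff p' 0"
  have ux: "poly (map_poly cst u) x = (\<Prod>a\<in>B. - a)"
  proof -
    have "poly (map_poly cst u) x = rf_eval cst x (coeff p 0)" unfolding p' by (simp add: coeff_map_poly x.rf_eval_to_fract u_def)
    also have "\<dots> = coeff (P B) 0" unfolding p[symmetric] by (simp add: x.ev.coeff_map)
    also have "\<dots> = (\<Prod>a\<in>B. - a)" unfolding poly_0_coeff_0[symmetric] P_def by (simp add: poly_prod)
    finally show ?thesis .
  qed
  have BF: "a \<in> F" if "a \<in> B" for a using that B F_def by blast
  have wneg: "fls_subdegree (w x) < 0" using w(2)[of x] m0 x F_def by simp
  have w0: "w a \<noteq> 0" if "a \<in> F" for a using w(2)[OF that] m0 by auto
  have "\<iota> (poly (map_poly cst u) x) = to_ac (poly (map_poly fls_const (map_poly to_ac u)) (w x))"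
  proof -
    have c: "\<iota> (cst c) = eL c" for c
      using transc.rf_eval_const[OF transc_tL, of "fact n" c] by (simp add: cst_def \<iota>(2))
    have "map_poly \<iota> (map_poly cst u) = map_poly to_ac (map_poly fls_const (map_poly to_ac u))"
      unfolding map_eL[symmetric] by (simp add: poly_eq_iff \<iota>.coeff_map cst.coeff_map c transc_tL coeff_map_poly eL_def)
    thus ?thesis using \<iota>.poly_map_hom[of "map_poly cst u" x] w(1)[of x] x by (simp add: F_def ac.poly_map_hom)
  qed
  moreover have "\<iota> (\<Prod>a\<in>B. - a) = to_ac (\<Prod>a\<in>B. - w a)"
    unfolding \<iota>.hom_prod ac.hom_prod by (rule prod.cong) (simp_all add: \<iota>.hom_uminus w(1) BF)
  ultimately have eq: "poly (map_poly fls_const (map_poly to_ac u)) (w x) = (\<Prod>a\<in>B. - w a)" using ux by simp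
  have nz: "(\<Prod>a\<in>B. - w a) \<noteq> 0" using fO w0 BF by simp
  hence u0: "map_poly to_ac u \<noteq> 0" using eq by auto
  have "fls_subdegree (\<Prod>a\<in>B. - w a) = (\<Sum>a\<in>B. fls_subdegree (- w a))" by (rule fls_subdegree_prod) (use w0 BF in simp)
  also have "\<dots> = - (int (card B) * m)" using w(2) BF by simp
  finally have s: "fls_subdegree (\<Prod>a\<in>B. - w a) = - (int (card B) * m)" .
  \<comment> \<open>All roots have the same pole order \<open>m\<close> at infinity, so the product
    over \<open>B\<close> has pole order \<open>card B * m\<close>, while \<open>u(x)\<close> has
    pole order \<open>degree u * m\<close>.\<close>
  have "int (degree u) * fls_subdegree (w x) = fls_subdegree (\<Prod>a\<in>B. - w a)"
    using poly_fls_subdegree(2)[OF wneg u0] by (simp only: eq ac.degree_map_hom)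
  hence "int (degree u) * m = int (card B) * m" using w(2)[of x] x s by (simp only: F_def minus_mult_right[symmetric] neg_equal_iff_equal)
  hence "degree u = card B" using m0 by simp
  thus ?thesis using ux by blast
qed

text \<open>\<open>B\<close> is the orbit of \<open>x\<close> under \<open>M\<close>, so
  \<open>U = u(x)\<close> is invariant under \<open>M\<close> and equals \<open>u(a)\<close> for
  every \<open>a\<close> in \<open>B\<close>. As \<open>M\<close> contains the stabiliser of
  \<open>y\<close>, the element \<open>U\<close> is also a rational function of \<open>y\<close>,
  and this function is \<open>g1\<close>.\<close>

lemma decomposition_from_block:
  fixes f :: "'a :: field_char_0 poly" and g :: "'a poly fract"
  assumes f: "degree f > 0" and x: "x \<in> B" and B: "B \<subset> fibre (to_fract f)" and y: "y \<in> fibre g"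
    and card: "card (fibre (to_fract f)) = degree f"
    and M: "\<And>\<gamma>. \<gamma> \<in> M \<Longrightarrow> \<gamma> \<in> gal \<and> \<gamma> ` B = B" and Mx: "\<And>\<gamma>. \<gamma> \<in> gal \<Longrightarrow> \<gamma> x = x \<Longrightarrow> \<gamma> \<in> M"
    and My: "\<And>\<gamma>. \<gamma> \<in> gal \<Longrightarrow> \<gamma> y = y \<Longrightarrow> \<gamma> \<in> M" and trans: "\<And>a. a \<in> B \<Longrightarrow> \<exists>\<gamma>\<in>M. \<gamma> x = a"
  shows "\<exists>h f1 g1. degree h > 1 \<and> f = pcompose h f1 \<and> g = rf_comp h g1"
proof -
  have xF: "x \<in> fibre (to_fract f)" using x B by blast
  have "\<exists>u. degree u = card B \<and> poly (map_poly cst u) x = (\<Prod>a\<in>B. - a)"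
    by (rule block_polynomial[OF f _ xF]) (use B Mx M in blast)+
  then obtain u where du: "degree u = card B" and ux: "poly (map_poly cst u) x = (\<Prod>a\<in>B. - a)" by blast
  have fF: "finite (fibre (to_fract f))" using card f by (metis card_ge_0_finite)
  have fO: "finite B" using B fF finite_subset by blast
  have d0: "card B > 0" using fO x card_gt_0_iff by blast
  have dn: "card B < degree f" using psubset_card_mono[OF fF B] card by simp
  interpret x: transc cst x by (rule fibre_transc[OF xF])
  interpret y: transc cst y by (rule fibre_transc[OF y])
  define U where "U = poly (map_poly cst u) x"
  have MU: "\<gamma> U = U" if "\<gamma> \<in> M" for \<gamma>
  proof -
    interpret \<gamma>: fhom \<gamma> using M[OF that] gal_fhom by blast
    have "\<gamma> U = (\<Prod>a\<in>B. - \<gamma> a)" unfolding U_def ux \<gamma>.hom_prod by (simp add: \<gamma>.hom_uminus)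
    also have "\<dots> = (\<Prod>a\<in>\<gamma> ` B. - a)" by (subst prod.reindex) (auto intro: inj_on_subset[OF \<gamma>.inj])
    finally show ?thesis using M[OF that] by (simp add: U_def ux)
  qed
  have Ua: "poly (map_poly cst u) a = U" if "a \<in> B" for a
  proof -
    obtain \<gamma> where \<gamma>: "\<gamma> \<in> M" "\<gamma> x = a" using trans \<open>a \<in> B\<close> by blast
    have "\<gamma> U = poly (map_poly cst u) a" unfolding U_def using gal_poly[of \<gamma> u x] M[OF \<gamma>(1)] \<gamma>(2) by simp
    thus ?thesis using MU[OF \<gamma>(1)] by simp
  qed
  obtain r m where r: "\<And>i. degree (r i) < card B" "f = (\<Sum>i<m. r i * u ^ i)"
    using base_expansion[of u f] du d0 by auto
  have map_f: "poly (map_poly cst f) a = (\<Sum>i<m. poly (map_poly cst (r i)) a * poly (map_poly cst u) a ^ i)" for a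
  proof -
    have "poly (map_poly cst (\<Sum>i<k. r i * u ^ i)) a = (\<Sum>i<k. poly (map_poly cst (r i)) a * poly (map_poly cst u) a ^ i)" for k
    proof (induction k)
      case (Suc k)
      have "map_poly cst (u ^ k) = map_poly cst u ^ k" by (induction k) (simp_all add: cst.map_poly_hom_one cst.map_poly_hom_mult)
      thus ?case using Suc by (simp add: cst.map_poly_hom_add cst.map_poly_hom_mult)
    qed simp
    thus ?thesis by (subst r(2))
  qed
  \<comment> \<open>Replacing \<open>u(x)\<close> by its value \<open>U\<close>, which is constant on \<open>B\<close>, leaves a polynomial of degree less than \<open>card B\<close>
    that takes the value \<open>t\<close> on all of \<open>B\<close>.\<close>
  have W: "(\<Sum>i<m. smult (U ^ i) (map_poly cst (r i))) = [:tt:]"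
  proof (rule poly_eqI_degree[where A = B])
    fix a assume a: "a \<in> B"
    hence "poly (map_poly cst f) a = tt" using B fibre_to_fract by blast
    thus "poly (\<Sum>i<m. smult (U ^ i) (map_poly cst (r i))) a = poly [:tt:] a"
      using map_f[of a] Ua[OF a] by (simp add: poly_sum mult.commute)
  next
    have "degree (\<Sum>i<m. smult (U ^ i) (map_poly cst (r i))) \<le> card B - 1"
      by (rule degree_sum_le) (use r(1) in \<open>auto intro!: order.trans[OF degree_smult_le] simp: cst.degree_map_hom less_imp_le le_diff_conv2 Suc_le_eq d0\<close>)
    thus "degree (\<Sum>i<m. smult (U ^ i) (map_poly cst (r i))) < card B" using d0 by linarith
  qed (use d0 in simp)
  \<comment> \<open>The coefficient of \<open>X ^ j\<close> in the identity \<open>W\<close> is a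
    polynomial in \<open>U\<close> over \<open>k\<close>, and \<open>U\<close> is transcendental
    over \<open>k\<close>; for \<open>j > 0\<close> all the coefficients involved vanish.\<close>
  have const: "coeff (r i) j = 0" if "j > 0" "i < m" for i j
  proof -
    define s where "s = (\<Sum>i<m. monom (coeff (r i) j) i)"
    have "(\<Sum>i<m. U ^ i * cst (coeff (r i) j)) = 0"
      using arg_cong[OF W, of "\<lambda>p. coeff p j"] that by (simp add: coeff_sum cst.coeff_map coeff_pCons split: nat.splits)
    moreover have "poly (map_poly cst s) U = (\<Sum>i<m. U ^ i * cst (coeff (r i) j))"
    proof -
      have "map_poly cst s = (\<Sum>i<m. monom (cst (coeff (r i) j)) i)"
        by (simp add: poly_eq_iff s_def cst.coeff_map coeff_sum cst.hom_sum cst.hom_zero if_distrib[of cst])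
      thus ?thesis by (simp add: poly_sum poly_monom mult.commute)
    qed
    ultimately have "s = 0" using x.transc_poly[of u s] du d0 by (simp add: U_def)
    hence "coeff s i = 0" by simp
    thus ?thesis using that by (simp add: s_def coeff_sum)
  qed
  define h where "h = (\<Sum>i<m. monom (coeff (r i) 0) i)"
  have hu: "f = pcompose h u"
  proof -
    have "r i = [:coeff (r i) 0:]" if "i < m" for i using const that by (simp add: poly_eq_iff coeff_pCons split: nat.split)
    hence "f = (\<Sum>i<m. [:coeff (r i) 0:] * u ^ i)" by (subst r(2)) (intro sum.cong, auto)
    also have "\<dots> = pcompose h u"
      unfolding h_def pcompose_sum by (intro sum.cong) (simp_all add: monom_altdef pcompose_smult pcompose_power pcompose_pCons)
    finally show ?thesis .
  qed
  have "degree f = degree h * card B" by (subst hu) (simp add: degree_pcompose du)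
  \<comment> \<open>\<open>degree f\<close> is a positive multiple of \<open>card B\<close> and
    exceeds it, since \<open>B\<close> is a proper part of the fibre.\<close>
  hence dh: "degree h > 1" using dn by (cases "degree h") auto
  have "U \<in> range (rf_eval cst y)" by (rule fixed_in_point_field[OF y]) (use My MU in blast)
  then obtain g1 where g1: "U = rf_eval cst y g1" by blast
  have "rf_eval cst y (rf_comp h g1) = poly (map_poly cst h) U" unfolding y.rf_eval_comp g1 ..
  also have "\<dots> = poly (map_poly cst f) x" unfolding U_def by (subst hu) (simp add: cst.map_poly_hom_pcompose poly_pcompose)
  also have "\<dots> = rf_eval cst y g" using xF fibre_eval[OF y] by (simp add: fibre_to_fract)
  finally have "g = rf_comp h g1" by (simp only: y.ev.hom_eq)
  thus ?thesis using dh hu by blast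
qed

section \<open>Reducibility\<close>

lemma fibre_nonempty:
  fixes \<phi> :: "'a :: field_char_0 poly fract"
  assumes "rf_degree \<phi> > 0" shows "fibre \<phi> \<noteq> {}"
proof -
  let ?p = "map_poly cst (rf_num \<phi>) - smult tt (map_poly cst (rf_den \<phi>))"
  \<comment> \<open>\<open>j\<close> is the degree of \<open>\<phi>\<close>. There the coefficient
    of the fibre polynomial has the form \<open>a - b t\<close> with \<open>a\<close> or
    \<open>b\<close> nonzero, so it does not vanish.\<close>
  obtain j where j: "j > 0" "coeff (rf_num \<phi>) j \<noteq> 0 \<or> coeff (rf_den \<phi>) j \<noteq> 0"
  proof (rule that)
    show "rf_degree \<phi> > 0" by (rule assms)
    have "coeff p (degree p) \<noteq> 0" if "degree p > 0" for p :: "'a poly" using that by auto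
    thus "coeff (rf_num \<phi>) (rf_degree \<phi>) \<noteq> 0 \<or> coeff (rf_den \<phi>) (rf_degree \<phi>) \<noteq> 0"
      using assms unfolding rf_degree_def max_def by (simp split: if_splits)
  qed
  have "coeff ?p j = poly (map_poly cst [:coeff (rf_num \<phi>) j, - coeff (rf_den \<phi>) j:]) tt"
    by (simp add: cst.coeff_map cst.map_poly_hom_pCons cst.hom_uminus)
  hence "coeff ?p j \<noteq> 0" using tt.transc[of "[:coeff (rf_num \<phi>) j, - coeff (rf_den \<phi>) j:]"] j(2) by auto
  hence "degree ?p > 0" using j(1) le_degree[of ?p j] by simp
  then obtain y where "poly ?p y = 0" using alg_closed_imp_poly_has_root by blast
  thus ?thesis by (auto simp: fibre_iff)
qed

text \<open>\<open>\<psi>\<close> is a root of \<open>h(X) - t\<close>, which up to a constant is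
  monic over \<open>k[t]\<close>; so \<open>\<psi>\<close> is integral over the integrally closed
  ring \<open>k[t]\<close>. This is Gauss' lemma for the linear factor
  \<open>X - \<psi>\<close>.\<close>

lemma rational_root_polynomial:
  fixes h :: "'a :: field_char_0 poly"
  assumes h: "degree h > 0" and root: "poly (map_poly cst h) (to_ac \<psi>) = tt"
  shows "\<exists>A. \<psi> = to_fract A"
proof -
  define q where "q = smult [:inverse (lead_coeff h):] (map_poly (\<lambda>c. [:c:]) h - [:[:0, 1:]:])"
  have l0: "lead_coeff h \<noteq> 0" using h by auto
  have q: "fract_poly q = smult (rf_const (inverse (lead_coeff h))) (map_poly rf_const h - [:to_fract [:0, 1:]:])"
    by (simp add: q_def rf_const_def[abs_def] map_poly_pCons map_poly_map_poly comp_def)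
  have "to_ac (poly (map_poly rf_const h) \<psi>) = to_ac (to_fract [:0, 1:])"
    using root by (simp add: map_cst[symmetric] ac.poly_map_hom)
  hence "poly (fract_poly q) \<psi> = 0" unfolding q by simp
  then obtain R where R: "fract_poly q = [:- \<psi>, 1:] * R" by (metis poly_eq_0_iff_dvd dvdE)
  have "lead_coeff (fract_poly q) = 1"
  proof -
    have d: "degree (map_poly rf_const h - [:to_fract [:0, 1:]:]) = degree h"
      unfolding diff_conv_add_uminus by (subst degree_add_eq_left) (use h in \<open>simp_all add: rfc.degree_map_hom\<close>)
    have "lead_coeff (map_poly rf_const h - [:to_fract [:0, 1:]:]) = rf_const (lead_coeff h)"
      unfolding d using h by (simp add: rfc.coeff_map coeff_pCons split: nat.split)
    hence "lead_coeff (fract_poly q) = rf_const (inverse (lead_coeff h)) * rf_const (lead_coeff h)" unfolding q lead_coeff_smult by simp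
    also have "\<dots> = rf_const 1" unfolding rfc.hom_mult[symmetric] using l0 by simp
    finally show ?thesis by (simp only: rfc.hom_one)
  qed
  hence "lead_coeff R = 1" unfolding R lead_coeff_mult by simp
  from monic_factor_polynomial_coeffs[OF R[symmetric] _ this]
  obtain p where "[:- \<psi>, 1:] = fract_poly p" by auto
  hence "- \<psi> = to_fract (coeff p 0)" by (metis coeff_map_poly coeff_pCons_0 to_fract_0)
  hence "\<psi> = to_fract (- coeff p 0)" by (metis minus_equation_iff to_fract_uminus)
  thus ?thesis by blast
qed

text \<open>The roots are chosen such that \<open>v = f1(x) = g1(y)\<close> is a common element of
  \<open>k(x)\<close> and \<open>k(y)\<close>. It is not in \<open>k(t)\<close>: there it would be a
  polynomial \<open>A\<close> with \<open>h(A(t)) = t\<close>, impossible for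
  \<open>degree h > 1\<close>. So \<open>v\<close> and 1 are independent over \<open>k(t)\<close>
  but not over \<open>k(y)\<close>.\<close>

lemma decomposition_imp_reducible:
  fixes f h f1 :: "'a :: field_char_0 poly" and g g1 :: "'a poly fract"
  assumes f: "degree f > 0" and g: "rf_degree g > 0" and h: "degree h > 1"
    and dec: "f = pcompose h f1" "g = rf_comp h g1"
  shows "reducible_curve (to_fract f) g"
proof -
  obtain y where y: "y \<in> fibre g" using fibre_nonempty[OF g] by blast
  interpret y: transc cst y by (rule fibre_transc[OF y])
  define v where "v = rf_eval cst y g1"
  have hv: "poly (map_poly cst h) v = tt"
    using fibre_eval[OF y] unfolding dec(2) y.rf_eval_comp v_def .
  have "degree f1 > 0" using f unfolding dec(1) degree_pcompose by simp
  hence "degree (map_poly cst f1 - [:v:]) > 0"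
    unfolding diff_conv_add_uminus by (subst degree_add_eq_left) (simp_all add: cst.degree_map_hom)
  then obtain x where "poly (map_poly cst f1 - [:v:]) x = 0" using alg_closed_imp_poly_has_root by blast
  hence xv: "poly (map_poly cst f1) x = v" by simp
  have x: "x \<in> fibre (to_fract f)"
    unfolding fibre_to_fract dec(1) cst.map_poly_hom_pcompose poly_pcompose xv by (rule hv)
  interpret x: transc cst x by (rule fibre_transc[OF x])
  have vx: "v \<in> point_field x" unfolding point_field_eq[OF x.transc_axioms] xv[symmetric] x.rf_eval_to_fract[symmetric] by (rule rangeI)
  have sy: "subfield (point_field y) Omega" unfolding point_field_eq[OF y.transc_axioms] by (rule y.ev.subfield_range)
  have vy: "v \<in> point_field y" unfolding point_field_eq[OF y.transc_axioms] v_def by (rule rangeI)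
  have nb: "v \<notin> base_field"
  proof
    assume "v \<in> base_field"
    then obtain \<psi> where \<psi>: "v = to_ac \<psi>" by (auto simp: base_field_def)
    obtain A where A: "\<psi> = to_fract A" using rational_root_polynomial[of h \<psi>] h hv \<psi> by auto
    have "v = poly (map_poly cst A) tt" using rf_eval_tt[of "to_fract A"] tt.rf_eval_to_fract[of A] \<psi> A by simp
    hence "poly (map_poly cst (pcompose h A - [:0, 1:])) tt = 0"
      using hv by (simp add: cst.map_poly_hom_diff cst.map_poly_hom_pcompose poly_pcompose cst.map_poly_hom_pCons cst.hom_zero cst.hom_one)
    hence "pcompose h A - [:0, 1:] = 0" by (rule tt.transc)
    hence "degree (pcompose h A) = 1" by simp
    thus False using h by (simp add: degree_pcompose)
  qed
  have U: "set us \<subseteq> carrier Omega" for us :: "'a poly fract alg_closure list" by simp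
  have sb: "subfield (base_field :: 'a poly fract alg_closure set) Omega" unfolding base_field_def by (rule ac.subfield_range)
  have "\<not> Om.independent (point_field y) [v, 1]"
  proof
    assume "Om.independent (point_field y) [v, 1]"
    hence "v \<notin> Om.Span (point_field y) [1]" by (auto elim: Om.independent.cases)
    moreover have "v = Om.combine [v] [1]" by simp
    ultimately show False using vy unfolding Om.Span_eq_combine_set[OF sy U] by fastforce
  qed
  moreover have "Om.independent base_field [v, 1]"
  proof (intro Om.li_Cons Om.li_Nil)
    show "v \<notin> Om.Span base_field [1]"
    proof
      assume "v \<in> Om.Span base_field [1]"
      then obtain Ks where "v = Om.combine Ks [1]" "set Ks \<subseteq> base_field" 
        using Om.Span_eq_combine_set[OF sb U[of "[1]"]] by blast
      moreover have "0 \<in> base_field" unfolding base_field_def by (metis rangeI to_ac_0)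
      ultimately show False using nb by (cases Ks) auto
    qed
  qed simp_all
  moreover have "1 \<in> point_field x" unfolding point_field_eq[OF x.transc_axioms] using x.ev.hom_one by (metis rangeI)
  ultimately have "\<not> linearly_disjoint Omega base_field (point_field x) (point_field y)"
    unfolding linearly_disjoint_def using vx by (auto intro!: exI[of _ "[v, 1]"])
  thus ?thesis unfolding reducible_curve_def using x y by blast
qed

section \<open>From reducibility to a decomposition\<close>

lemma inertia_orbit:
  fixes \<iota> :: "'a :: field_char_0 poly fract alg_closure \<Rightarrow> 'a alg_closure fls alg_closure"
  assumes \<iota>: "fhom \<iota>" and \<Sigma>: "\<And>x w. \<iota> x = to_ac w \<Longrightarrow> \<iota> (\<Sigma> x) = to_ac (scl \<zeta> w)"
    and Y: "\<And>i. scl \<zeta> (Y i) = Y (Suc i)" "\<And>i. Y (i + e) = Y i" "e > 0"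
    and x: "\<iota> x = to_ac (Y k)" and y: "\<iota> y = to_ac (Y l)"
  shows "\<exists>i. (\<Sigma> ^^ i) x = y" "(\<Sigma> ^^ e) x = x"
proof -
  interpret \<iota>: fhom \<iota> by (rule \<iota>)
  have shift: "\<iota> ((\<Sigma> ^^ i) x) = to_ac (Y (k + i))" for i
    by (induction i) (use x \<Sigma> Y(1) in simp_all)
  have per: "Y (j + i * e) = Y j" for i j
  proof (induction i)
    case (Suc i)
    thus ?case using Y(2)[of "j + i * e"] by (simp add: add_ac)
  qed simp
  \<comment> \<open>The way from index \<open>k\<close> to index \<open>l\<close> modulo the period
    \<open>e\<close>, arranged so that nothing is subtracted from \<open>l\<close>.\<close>
  have "k + (l + k * (e - 1)) = l + k * e" using Y(3) by (cases e) simp_all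
  hence "\<iota> ((\<Sigma> ^^ (l + k * (e - 1))) x) = \<iota> y" unfolding shift y by (simp only: per)
  thus "\<exists>i. (\<Sigma> ^^ i) x = y" using \<iota>.hom_eq by blast
  show "(\<Sigma> ^^ e) x = x" using shift[of e] unfolding Y(2) x[symmetric] \<iota>.hom_eq .
qed

text \<open>The group theorem is applied to the images of the stabilisers of \<open>x\<close> and
  \<open>y\<close>. A conjugate of the second is the stabiliser of another root
  \<open>\<tau> y\<close> of the same fibre, so the overgroup it provides fits the block argument
  for \<open>x\<close> and \<open>\<tau> y\<close>; the block is the orbit of
  \<open>x\<close>.\<close>

lemma reducible_imp_decomposition:
  fixes f :: "'a :: field_char_0 poly" and g :: "'a poly fract"
  assumes f: "degree f > 0" "odd (degree f)" and solv: "solvable (Mon (to_fract f))" and siegel: "siegel_function g"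
    and x: "x \<in> fibre (to_fract f)" and y: "y \<in> fibre g"
    and nld: "\<not> linearly_disjoint Omega base_field (point_field x) (point_field y)"
  shows "\<exists>h f1 g1. degree h > 1 \<and> f = pcompose h f1 \<and> g = rf_comp h g1"
proof -
  define n where "n = degree f"
  \<comment> \<open>The ramification indices of \<open>f\<close> and \<open>g\<close> over infinity
    are at most the degrees, so all of them divide this factorial.\<close>
  define N :: nat where "N = fact (n + rf_degree g)"
  have N: "N > 0" "\<And>e. 0 < e \<Longrightarrow> e \<le> n \<Longrightarrow> e dvd N" "\<And>e. 0 < e \<Longrightarrow> e \<le> rf_degree g \<Longrightarrow> e dvd N"
    by (auto simp: N_def intro!: dvd_fact)
  obtain \<zeta> :: "'a alg_closure" where \<zeta>: "\<And>i. \<zeta> ^ i = 1 \<longleftrightarrow> N dvd i" using primitive_root_exists[OF N(1)] by auto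
  obtain \<iota> :: "'a poly fract alg_closure \<Rightarrow> 'a alg_closure fls alg_closure"
    where \<iota>: "fhom \<iota>" "\<And>\<phi>. \<iota> (to_ac \<phi>) = rf_eval eL (tL N) \<phi>" using exists_Laurent_embedding[OF N(1)] by auto
  have \<zeta>1: "\<zeta> ^ N = 1" using \<zeta>[of N] by simp
  have \<zeta>0: "\<zeta> \<noteq> 0" using \<zeta>1 N(1) by (auto simp: power_0_left)
  obtain \<Sigma> where \<Sigma>: "fhom \<Sigma>" "\<And>\<phi>. \<Sigma> (to_ac \<phi>) = to_ac \<phi>" "\<And>x w. \<iota> x = to_ac w \<Longrightarrow> \<iota> (\<Sigma> x) = to_ac (scl \<zeta> w)"
    using exists_inertia[OF N(1) \<iota> \<zeta>0 \<zeta>1] by auto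
  have \<Sigma>g: "\<Sigma> \<in> gal" using \<Sigma> by (simp add: gal_def)
  define F where "F = fibre (to_fract f)"
  have "\<exists>Y. (\<forall>i. Y (i + n) = Y i \<and> scl \<zeta> (Y i) = Y (Suc i) \<and> fls_subdegree (Y i) = - int (N div n)) \<and>
    (\<forall>x\<in>F. \<exists>i. \<iota> x = to_ac (Y i)) \<and> card F = n"
    unfolding n_def F_def by (rule polynomial_branches[OF f(1) N(1) N(2)[unfolded n_def] \<zeta> \<iota>]) assumption+
  then obtain Y where Yall: "(\<forall>i. Y (i + n) = Y i \<and> scl \<zeta> (Y i) = Y (Suc i) \<and> fls_subdegree (Y i) = - int (N div n)) \<and>
    (\<forall>x\<in>F. \<exists>i. \<iota> x = to_ac (Y i)) \<and> card F = n" by (rule exE)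
  have Y: "Y (i + n) = Y i" "scl \<zeta> (Y i) = Y (Suc i)" for i using Yall by blast+
  have YF: "\<exists>i. \<iota> x = to_ac (Y i)" if "x \<in> F" for x using Yall that by blast
  have cF: "card F = n" using Yall by blast
  have n0: "n > 0" using f(1) by (simp add: n_def)
  have fF: "finite F" using cF f(1) n_def by (metis card_ge_0_finite)
  have orbF: "\<exists>i. (\<Sigma> ^^ i) a = b" if "a \<in> F" "b \<in> F" for a b
  proof -
    obtain k where k: "\<iota> a = to_ac (Y k)" using YF[OF \<open>a \<in> F\<close>] by (rule exE)
    obtain l where l: "\<iota> b = to_ac (Y l)" using YF[OF \<open>b \<in> F\<close>] by (rule exE)
    show ?thesis by (rule inertia_orbit(1)[of \<iota> \<Sigma>, OF \<iota>(1) \<Sigma>(3) Y(2) Y(1) n0 k l])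
  qed
  have perF: "(\<Sigma> ^^ n) a = a" if "a \<in> F" for a
  proof -
    obtain k where k: "\<iota> a = to_ac (Y k)" using YF[OF \<open>a \<in> F\<close>] by (rule exE)
    show ?thesis by (rule inertia_orbit(2)[of \<iota> \<Sigma>, OF \<iota>(1) \<Sigma>(3) Y(2) Y(1) n0 k k])
  qed
  have "\<exists>Z e. (\<forall>pt. rf_map g pt = None \<longrightarrow> e pt > 0 \<and> (\<forall>i. Z pt (i + e pt) = Z pt i) \<and> (\<forall>i. scl \<zeta> (Z pt i) = Z pt (Suc i))) \<and>
    (\<forall>x\<in>fibre g. \<exists>pt i. rf_map g pt = None \<and> \<iota> x = to_ac (Z pt i)) \<and> card (fibre g) = rf_degree g \<and>
    (rf_map g None = None \<longrightarrow> (\<forall>i. fls_subdegree (Z None i) = - int (N div e None)) \<and> e None = degree (rf_num g) - degree (rf_den g))"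
    by (rule fibre_branches[OF N(1) N(3) \<zeta> \<iota>]) assumption+
  then obtain Z where "\<exists>e. (\<forall>pt. rf_map g pt = None \<longrightarrow> e pt > 0 \<and> (\<forall>i. Z pt (i + e pt) = Z pt i) \<and> (\<forall>i. scl \<zeta> (Z pt i) = Z pt (Suc i))) \<and>
    (\<forall>x\<in>fibre g. \<exists>pt i. rf_map g pt = None \<and> \<iota> x = to_ac (Z pt i)) \<and> card (fibre g) = rf_degree g \<and>
    (rf_map g None = None \<longrightarrow> (\<forall>i. fls_subdegree (Z None i) = - int (N div e None)) \<and> e None = degree (rf_num g) - degree (rf_den g))"
    by (rule exE)
  then obtain e where Zall: "(\<forall>pt. rf_map g pt = None \<longrightarrow> e pt > 0 \<and> (\<forall>i. Z pt (i + e pt) = Z pt i) \<and> (\<forall>i. scl \<zeta> (Z pt i) = Z pt (Suc i))) \<and>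
    (\<forall>x\<in>fibre g. \<exists>pt i. rf_map g pt = None \<and> \<iota> x = to_ac (Z pt i)) \<and> card (fibre g) = rf_degree g \<and>
    (rf_map g None = None \<longrightarrow> (\<forall>i. fls_subdegree (Z None i) = - int (N div e None)) \<and> e None = degree (rf_num g) - degree (rf_den g))"
    by (rule exE)
  \<comment> \<open>The conjugate \<open>\<gamma> y\<close> is expanded at the pole
    \<open>pt\<close>. Inertia is transitive on the conjugates at one pole, so its orbits are
    counted by the poles.\<close>
  define K where "K pt \<gamma> \<longleftrightarrow> rf_map g pt = None \<and> (\<exists>i. \<iota> (\<gamma> y) = to_ac (Z pt i))" for pt and \<gamma> :: "'a poly fract alg_closure \<Rightarrow> 'a poly fract alg_closure"
  have orbK: "\<exists>i. (\<Sigma> ^^ i) (\<alpha> y) = \<gamma> y" if K: "K pt \<alpha>" "K pt \<gamma>" for pt \<alpha> \<gamma>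
  proof -
    obtain i j where ij: "\<iota> (\<alpha> y) = to_ac (Z pt i)" "\<iota> (\<gamma> y) = to_ac (Z pt j)" using K unfolding K_def by (elim conjE exE)
    have Zp: "scl \<zeta> (Z pt i) = Z pt (Suc i)" "Z pt (i + e pt) = Z pt i" "e pt > 0" for i
      using Zall K unfolding K_def by (elim conjE, simp)+
    show ?thesis by (rule inertia_orbit(1)[of \<iota> \<Sigma>, OF \<iota>(1) \<Sigma>(3) Zp(1) Zp(2) Zp(3) ij])
  qed
  obtain p q where pq: "rf_map g -` {None} \<subseteq> {p, q}"
  proof -
    have fin: "finite (rf_map g -` {None})" and c: "card (rf_map g -` {None}) \<le> 2" using siegel by (auto simp: siegel_function_def)
    from c consider "card (rf_map g -` {None}) = 0" | "card (rf_map g -` {None}) = 1" | "card (rf_map g -` {None}) = 2" by linarith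
    thus ?thesis
    proof cases
      case 1 thus ?thesis using fin that by simp
    next
      case 2 thus ?thesis using that by (auto simp: card_1_singleton_iff)
    next
      case 3 thus ?thesis using that by (auto simp: card_2_iff)
    qed
  qed
  have Kpq: "K p \<gamma> \<or> K q \<gamma>" if "\<gamma> \<in> gal" for \<gamma>
  proof -
    obtain pt i where "rf_map g pt = None" "\<iota> (\<gamma> y) = to_ac (Z pt i)"
      using Zall gal_fibre[OF \<open>\<gamma> \<in> gal\<close> y] by (elim conjE) blast
    hence "K pt \<gamma>" "pt = p \<or> pt = q" using pq by (auto simp: K_def)
    thus ?thesis by blast
  qed
  \<comment> \<open>If no conjugate of \<open>y\<close> is expanded at \<open>pt\<close>, the
    implication is vacuous and the identity serves as representative.\<close>
  have rep: "\<exists>\<alpha>\<in>gal. \<forall>\<gamma>\<in>gal. K pt \<gamma> \<longrightarrow> K pt \<alpha>" for pt using gal_id by blast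
  obtain \<alpha> where \<alpha>: "\<alpha> \<in> gal" "\<And>\<gamma>. \<gamma> \<in> gal \<Longrightarrow> K p \<gamma> \<Longrightarrow> K p \<alpha>" using rep[of p] by blast
  obtain \<beta> where \<beta>: "\<beta> \<in> gal" "\<And>\<gamma>. \<gamma> \<in> gal \<Longrightarrow> K q \<gamma> \<Longrightarrow> K q \<beta>" using rep[of q] by blast
  define G where "G = Mon (to_fract f)"
  interpret G: group G unfolding G_def by (rule group_Mon)
  define r where "r \<gamma> = restrict \<gamma> F" for \<gamma> :: "'a poly fract alg_closure \<Rightarrow> 'a poly fract alg_closure"
  have rG: "r \<gamma> \<in> carrier G" if "\<gamma> \<in> gal" for \<gamma> unfolding r_def G_def F_def carrier_Mon using that by blast
  have Gr: "\<exists>\<gamma>\<in>gal. a = r \<gamma>" if "a \<in> carrier G" for a using that unfolding r_def G_def F_def carrier_Mon by blast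
  have rm: "r \<gamma> \<otimes>\<^bsub>G\<^esub> r \<delta> = r (\<lambda>x. \<gamma> (\<delta> x))" if "\<gamma> \<in> gal" "\<delta> \<in> gal" for \<gamma> \<delta>
    unfolding r_def G_def F_def by (rule mult_Mon[OF that])
  have rp: "r \<Sigma> [^]\<^bsub>G\<^esub> i = r (\<Sigma> ^^ i)" for i :: nat unfolding r_def G_def F_def by (rule pow_Mon[OF \<Sigma>g])
  have rinv: "inv\<^bsub>G\<^esub> (r \<gamma>) = r \<delta>" if "\<gamma> \<in> gal" "\<delta> \<in> gal" "\<And>x. \<delta> (\<gamma> x) = x" for \<gamma> \<delta>
    unfolding r_def G_def F_def by (rule inv_Mon[OF that])
  have rone: "\<one>\<^bsub>G\<^esub> = r (\<lambda>x. x)" unfolding r_def G_def F_def by (rule one_Mon)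
  note \<Sigma>i = gal_funpow[OF \<Sigma>g]
  have xF: "x \<in> F" using x by (simp add: F_def)
  have subg: "subgroup (r ` {\<gamma>. \<gamma> \<in> gal \<and> \<gamma> z = z}) G" for z
    unfolding r_def G_def F_def 
  proof (rule subgroup_Mon)
    show "\<delta> \<in> gal \<and> \<delta> z = z" if "\<gamma> \<in> gal \<and> \<gamma> z = z" "\<delta> \<in> gal" "\<And>x. \<delta> (\<gamma> x) = x" for \<gamma> \<delta> using that by metis
  qed (simp_all add: gal_id gal_comp)
  \<comment> \<open>Elements of \<open>gal\<close> that agree at \<open>z\<close> differ by a right
    factor fixing \<open>z\<close>. This turns statements about orbits of inertia into the
    factorisations that the group theorem asks for.\<close>
  have split: "\<exists>\<epsilon>\<in>gal. \<epsilon> z = z \<and> (\<forall>v. \<gamma> v = \<delta> (\<epsilon> v))" if g: "\<gamma> \<in> gal" "\<delta> \<in> gal" "\<gamma> z = \<delta> z" for \<gamma> \<delta> z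
  proof -
    obtain \<delta>' where \<delta>': "\<delta>' \<in> gal" "\<And>v. \<delta>' (\<delta> v) = v" "\<And>v. \<delta> (\<delta>' v) = v" using gal_inverse[OF g(2)] by blast
    show ?thesis by (rule bexI[OF _ gal_comp[OF \<delta>'(1) g(1)]]) (use \<delta>' g in simp)
  qed
  have "\<exists>M a. subgroup M G \<and> M \<noteq> carrier G \<and> r ` {\<gamma>. \<gamma> \<in> gal \<and> \<gamma> x = x} \<subseteq> M \<and> a \<in> carrier G \<and>
      (\<forall>b\<in>r ` {\<gamma>. \<gamma> \<in> gal \<and> \<gamma> y = y}. a \<otimes>\<^bsub>G\<^esub> b \<otimes>\<^bsub>G\<^esub> inv\<^bsub>G\<^esub> a \<in> M)"
  proof (rule G.solvable_factorization[OF _ _ subg subg rG[OF \<Sigma>g] _ _ rG[OF \<alpha>(1)] rG[OF \<beta>(1)]])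
    show "finite (carrier G)" unfolding G_def using fF by (intro finite_Mon) (simp add: F_def)
    show "solvable G" unfolding G_def by (rule solv)
    have "r \<Sigma> [^]\<^bsub>G\<^esub> n = \<one>\<^bsub>G\<^esub>" unfolding rp rone unfolding r_def by (rule restrict_ext) (rule perF)
    hence "G.ord (r \<Sigma>) dvd n" using G.pow_eq_id[OF rG[OF \<Sigma>g]] by blast
    thus "odd (G.ord (r \<Sigma>))" using f(2) n_def dvd_trans by blast
  next
    fix a assume "a \<in> carrier G"
    then obtain \<gamma> where \<gamma>: "\<gamma> \<in> gal" "a = r \<gamma>" using Gr by blast
    have "\<gamma> x \<in> F" unfolding F_def by (rule gal_fibre[OF \<gamma>(1) x])
    then obtain i where "(\<Sigma> ^^ i) x = \<gamma> x" using orbF[OF xF] by blast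
    then obtain \<epsilon> where \<epsilon>: "\<epsilon> \<in> gal" "\<epsilon> x = x" "\<forall>v. \<gamma> v = (\<Sigma> ^^ i) (\<epsilon> v)" using split[OF \<gamma>(1) \<Sigma>i] by metis
    have "\<gamma> = (\<lambda>v. (\<Sigma> ^^ i) (\<epsilon> v))" using \<epsilon>(3) by (simp add: fun_eq_iff)
    hence "a = r \<Sigma> [^]\<^bsub>G\<^esub> i \<otimes>\<^bsub>G\<^esub> r \<epsilon>" unfolding \<gamma>(2) rp rm[OF \<Sigma>i \<epsilon>(1)] by simp
    thus "\<exists>i::nat. \<exists>b\<in>r ` {\<gamma>. \<gamma> \<in> gal \<and> \<gamma> x = x}. a = r \<Sigma> [^]\<^bsub>G\<^esub> i \<otimes>\<^bsub>G\<^esub> b" using \<epsilon>(1,2) by blast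
  next
    fix a assume "a \<in> carrier G"
    then obtain \<gamma> where \<gamma>: "\<gamma> \<in> gal" "a = r \<gamma>" using Gr by blast
    have main: "\<exists>i. \<exists>\<epsilon>\<in>gal. \<epsilon> y = y \<and> a = r \<Sigma> [^]\<^bsub>G\<^esub> (i :: nat) \<otimes>\<^bsub>G\<^esub> r \<delta> \<otimes>\<^bsub>G\<^esub> r \<epsilon>" if \<delta>: "\<delta> \<in> gal" "K pt \<delta>" "K pt \<gamma>" for \<delta> pt
    proof -
      obtain i where "(\<Sigma> ^^ i) (\<delta> y) = \<gamma> y" using orbK[OF \<delta>(2,3)] by blast
      then obtain \<epsilon> where \<epsilon>: "\<epsilon> \<in> gal" "\<epsilon> y = y" "\<forall>v. \<gamma> v = (\<Sigma> ^^ i) (\<delta> (\<epsilon> v))"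
        using split[OF \<gamma>(1) gal_comp[OF \<Sigma>i \<delta>(1)]] by metis
      have "\<gamma> = (\<lambda>v. (\<Sigma> ^^ i) (\<delta> (\<epsilon> v)))" using \<epsilon>(3) by (simp add: fun_eq_iff)
      hence "a = r \<Sigma> [^]\<^bsub>G\<^esub> i \<otimes>\<^bsub>G\<^esub> r \<delta> \<otimes>\<^bsub>G\<^esub> r \<epsilon>"
        unfolding \<gamma>(2) rp rm[OF \<Sigma>i \<delta>(1)] rm[OF gal_comp[OF \<Sigma>i \<delta>(1)] \<epsilon>(1)] by simp
      thus ?thesis using \<epsilon>(1,2) by blast
    qed
    from Kpq[OF \<gamma>(1)] show "\<exists>i::nat. \<exists>b\<in>r ` {\<gamma>. \<gamma> \<in> gal \<and> \<gamma> y = y}. a = r \<Sigma> [^]\<^bsub>G\<^esub> i \<otimes>\<^bsub>G\<^esub> r \<alpha> \<otimes>\<^bsub>G\<^esub> b \<or> a = r \<Sigma> [^]\<^bsub>G\<^esub> i \<otimes>\<^bsub>G\<^esub> r \<beta> \<otimes>\<^bsub>G\<^esub> b"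
    proof
      assume "K p \<gamma>"
      from main[OF \<alpha>(1) \<alpha>(2)[OF \<gamma>(1) this] this] show ?thesis by blast
    next
      assume "K q \<gamma>"
      from main[OF \<beta>(1) \<beta>(2)[OF \<gamma>(1) this] this] show ?thesis by blast
    qed
  next
    show "r ` {\<gamma>. \<gamma> \<in> gal \<and> \<gamma> x = x} <#>\<^bsub>G\<^esub> r ` {\<gamma>. \<gamma> \<in> gal \<and> \<gamma> y = y} \<noteq> carrier G"
    proof
      assume eq: "r ` {\<gamma>. \<gamma> \<in> gal \<and> \<gamma> x = x} <#>\<^bsub>G\<^esub> r ` {\<gamma>. \<gamma> \<in> gal \<and> \<gamma> y = y} = carrier G"
      have "linearly_disjoint Omega base_field (point_field x) (point_field y)"
      proof (rule transitive_stabiliser_linearly_disjoint[OF x y])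
        fix x' assume "x' \<in> fibre (to_fract f)"
        hence x': "x' \<in> F" by (simp add: F_def)
        \<comment> \<open>This power of inertia acts on the fibre as \<open>\<kappa>\<close> after
          \<open>\<rho>\<close>, with \<open>\<kappa>\<close> fixing \<open>x\<close> and
          \<open>\<rho>\<close> fixing \<open>y\<close>; hence \<open>\<rho>\<close> already carries
          \<open>x'\<close> to \<open>x\<close>, and its inverse is the element sought.\<close>
        obtain i where i: "(\<Sigma> ^^ i) x' = x" using orbF[OF x' xF] by blast
        have "r (\<Sigma> ^^ i) \<in> r ` {\<gamma>. \<gamma> \<in> gal \<and> \<gamma> x = x} <#>\<^bsub>G\<^esub> r ` {\<gamma>. \<gamma> \<in> gal \<and> \<gamma> y = y}"
          unfolding eq by (rule rG[OF \<Sigma>i])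
        then obtain \<kappa> \<rho> where lr: "\<kappa> \<in> gal" "\<kappa> x = x" "\<rho> \<in> gal" "\<rho> y = y" "r (\<Sigma> ^^ i) = r \<kappa> \<otimes>\<^bsub>G\<^esub> r \<rho>"
          unfolding set_mult_def by blast
        have "r (\<Sigma> ^^ i) x' = r (\<lambda>x. \<kappa> (\<rho> x)) x'" unfolding lr(5) rm[OF lr(1,3)] ..
        hence "\<kappa> (\<rho> x') = \<kappa> x" using x' i lr(2) by (simp add: r_def)
        hence \<rho>: "\<rho> x' = x" using fhom.hom_eq[OF gal_fhom[OF lr(1)]] by blast
        obtain \<rho>' where "\<rho>' \<in> gal" "\<And>v. \<rho>' (\<rho> v) = v" using gal_inverse[OF lr(3)] by blast
        thus "\<exists>\<gamma>\<in>gal. \<gamma> y = y \<and> \<gamma> x = x'" using \<rho> lr(4) by metis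
      qed
      thus False using nld by blast
    qed
  qed
  then obtain M a where M: "subgroup M G" "M \<noteq> carrier G" "r ` {\<gamma>. \<gamma> \<in> gal \<and> \<gamma> x = x} \<subseteq> M" and a: "a \<in> carrier G"
    and aM: "\<And>b. b \<in> r ` {\<gamma>. \<gamma> \<in> gal \<and> \<gamma> y = y} \<Longrightarrow> a \<otimes>\<^bsub>G\<^esub> b \<otimes>\<^bsub>G\<^esub> inv\<^bsub>G\<^esub> a \<in> M" by blast
  obtain \<tau> where \<tau>: "\<tau> \<in> gal" "a = r \<tau>" using Gr[OF a] by blast
  obtain \<tau>' where \<tau>': "\<tau>' \<in> gal" "\<And>v. \<tau>' (\<tau> v) = v" "\<And>v. \<tau> (\<tau>' v) = v" using gal_inverse[OF \<tau>(1)] by blast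
  define H where "H = {\<gamma> \<in> gal. r \<gamma> \<in> M}"
  define B where "B = (\<lambda>\<gamma>. \<gamma> x) ` H"
  have Hx: "\<gamma> \<in> H" if "\<gamma> \<in> gal" "\<gamma> x = x" for \<gamma> using that M(3) by (auto simp: H_def)
  have Hm: "(\<lambda>v. \<gamma> (\<delta> v)) \<in> H" if "\<gamma> \<in> H" "\<delta> \<in> H" for \<gamma> \<delta>
    using that subgroup.m_closed[OF M(1), of "r \<gamma>" "r \<delta>"] gal_comp[of \<gamma> \<delta>] by (simp add: H_def rm)
  have BF: "B \<subseteq> F" unfolding B_def F_def H_def using gal_fibre x by blast
  have HB: "\<gamma> ` B = B" if "\<gamma> \<in> H" for \<gamma>
  proof (rule endo_inj_surj[OF finite_subset[OF BF fF]])
    show "\<gamma> ` B \<subseteq> B"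
    proof
      fix b assume "b \<in> \<gamma> ` B"
      then obtain \<delta> where \<delta>: "\<delta> \<in> H" "b = \<gamma> (\<delta> x)" unfolding B_def by blast
      show "b \<in> B" unfolding B_def \<delta>(2) by (rule image_eqI[OF _ Hm[OF that \<delta>(1)]]) (rule refl)
    qed
    show "inj_on \<gamma> B" using that by (auto simp: H_def intro: inj_on_subset[OF fhom.inj[OF gal_fhom]])
  qed
  \<comment> \<open>If the orbit of \<open>x\<close> under \<open>H\<close> were the whole fibre,
    every element of \<open>gal\<close> would be a product of an element of \<open>H\<close> and one
    fixing \<open>x\<close>, and \<open>M\<close> would be everything.\<close>
  have "B \<noteq> F"
  proof
    assume BeqF: "B = F"
    have "carrier G \<subseteq> M"
    proof
      fix b assume "b \<in> carrier G"
      then obtain \<gamma> where \<gamma>: "\<gamma> \<in> gal" "b = r \<gamma>" using Gr by blast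
      have "\<gamma> x \<in> B" unfolding BeqF F_def by (rule gal_fibre[OF \<gamma>(1) x])
      then obtain \<delta> where \<delta>: "\<delta> \<in> H" "\<gamma> x = \<delta> x" by (auto simp: B_def)
      have \<delta>g: "\<delta> \<in> gal" using \<delta>(1) by (simp add: H_def)
      obtain \<epsilon> where \<epsilon>: "\<epsilon> \<in> gal" "\<epsilon> x = x" "\<forall>v. \<gamma> v = \<delta> (\<epsilon> v)" using split[OF \<gamma>(1) \<delta>g \<delta>(2)] by blast
      have "\<gamma> = (\<lambda>v. \<delta> (\<epsilon> v))" using \<epsilon>(3) by (simp add: fun_eq_iff)
      thus "b \<in> M" using Hm[OF \<delta>(1) Hx[OF \<epsilon>(1,2)]] \<gamma>(2) by (simp add: H_def)
    qed
    thus False using M(2) subgroup.subset[OF M(1)] by blast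
  qed
  hence Bpsub: "B \<subset> fibre (to_fract f)" using BF F_def by blast
  have xB: "x \<in> B" unfolding B_def by (rule image_eqI[OF _ Hx[OF gal_id]]) simp_all
  show ?thesis
  proof (rule decomposition_from_block[OF f(1) xB Bpsub gal_fibre[OF \<tau>(1) y]])
    show "card (fibre (to_fract f)) = degree f" using cF by (simp add: F_def n_def)
    show "\<gamma> \<in> gal \<and> \<gamma> ` B = B" if "\<gamma> \<in> H" for \<gamma> using HB[OF that] that by (simp add: H_def)
    show "\<exists>\<gamma>\<in>H. \<gamma> x = b" if "b \<in> B" for b using that by (auto simp: B_def)
    \<comment> \<open>The stabilisers of \<open>y\<close> and \<open>\<tau> y\<close> are conjugate
      by \<open>\<tau>\<close>, whose restriction is the conjugating element \<open>a\<close>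
      supplied by the group theorem.\<close>
    show "\<gamma> \<in> H" if \<gamma>: "\<gamma> \<in> gal" "\<gamma> (\<tau> y) = \<tau> y" for \<gamma>
    proof -
      define \<delta> where "\<delta> = (\<lambda>v. \<tau>' (\<gamma> (\<tau> v)))"
      have \<delta>: "\<delta> \<in> gal" "\<delta> y = y" unfolding \<delta>_def using gal_comp[OF \<tau>'(1) gal_comp[OF \<gamma>(1) \<tau>(1)]] \<gamma>(2) \<tau>'(2) by simp_all
      have "a \<otimes>\<^bsub>G\<^esub> r \<delta> \<otimes>\<^bsub>G\<^esub> inv\<^bsub>G\<^esub> a = r (\<lambda>v. \<tau> (\<delta> (\<tau>' v)))"
        unfolding \<tau>(2) rinv[OF \<tau>(1) \<tau>'(1) \<tau>'(2)] rm[OF \<tau>(1) \<delta>(1)] rm[OF gal_comp[OF \<tau>(1) \<delta>(1)] \<tau>'(1)] ..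
      also have "\<dots> = r \<gamma>" unfolding \<delta>_def by (simp add: \<tau>'(3))
      finally have "r \<gamma> \<in> M" using aM[of "r \<delta>"] \<delta> by auto
      thus ?thesis using \<gamma>(1) by (simp add: H_def)
    qed
  qed (rule Hx)
qed

theorem theorem5p7:
  fixes f :: "'a :: field_char_0 poly" and g :: "'a poly fract"
  assumes "Polynomial.degree f > 0" and "odd (Polynomial.degree f)"
    and "solvable (Mon (to_fract f))"
    and "siegel_function g" and "rf_degree g \<ge> 2"
  shows "reducible_curve (to_fract f) g \<longleftrightarrow>
    (\<exists>(h :: 'a poly) (f1 :: 'a poly) (g1 :: 'a poly fract).
       Polynomial.degree h > 1 \<and> f = pcompose h f1 \<and> g = rf_comp h g1)"
proof
  assume "reducible_curve (to_fract f) g"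
  then obtain x y where "x \<in> fibre (to_fract f)" "y \<in> fibre g"
    "\<not> linearly_disjoint Omega base_field (point_field x) (point_field y)"
    unfolding reducible_curve_def by blast
  thus "\<exists>h f1 g1. degree h > 1 \<and> f = pcompose h f1 \<and> g = rf_comp h g1"
    by (rule reducible_imp_decomposition[OF assms(1-4)])
next
  assume "\<exists>h f1 g1. degree h > 1 \<and> f = pcompose h f1 \<and> g = rf_comp h g1"
  then obtain h f1 g1 where "degree h > 1" "f = pcompose h f1" "g = rf_comp h g1" by blast
  thus "reducible_curve (to_fract f) g"
    using assms(1,5) by (intro decomposition_imp_reducible) auto
qed

end
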